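(* Let $n\ge1$ be an integer. (1) Let $F:\mathbb R^2\to\mathbb C$ be real analytic on $\mathbb R^2$ with $F(0)=0$. Then $F(f)\in M^{1,1}(\mathbb R^n)$ for all $f\in M^{1,1}(\mathbb R^n)$. (2) Moreover, let $F$ be a real entire function given by $F(x,y)=\sum_{j,k=0}^\infty a_{jk}x^jy^k$ with $F(0)=0$, and let $X$ denote either $M^{p,1}_s(\mathbb R^n)$ with $1\le p\le\infty$, $s\ge0$, or $M^{p,q}_s(\mathbb R^n)$ with $1\le p,q\le\infty$, $s>n/q'$. Then $$\|F(f)\|_X\lesssim\tilde F\left(\|f_1\|_X,\|f_2\|_X\right),\qquad f=f_1+if_2,$$ for all $f\in X$, where $\tilde F$ is the real entire function $\tilde F(x,y)=\sum_{j,k=0}^\infty|a_{jk}|x^jy^k$.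
   Context: For a fixed nonzero window $g\in\mathcal S(\mathbb R^n)$ (Schwartz space), the short time Fourier transform of a tempered distribution $f$ on $\mathbb R^n$ is $V_gf(x,w)=\langle f, M_wT_xg\rangle=\int_{\mathbb R^n} f(t)\overline{g(t-x)}e^{-2\pi i w\cdot t}\,dt$, where $T_xg(t)=g(t-x)$, $M_wg(t)=e^{2\pi i w\cdot t}g(t)$. For $1\le p,q\le\infty$, $s\ge0$, the modulation space $M^{p,q}_s(\mathbb R^n)$ is the space of tempered distributions $f$ with $\|f\|_{M^{p,q}_s}=\left(\int_{\mathbb R^n}\left(\int_{\mathbb R^n}|V_gf(x,w)|^p\,dx\right)^{q/p}(1+|w|^2)^{sq/2}\,dw\right)^{1/q}<\infty$ (essential suprema replace integrals when $p$ or $q$ is $\infty$); different windows give the same space with equivalent norms. $M^{p,q}=M^{p,q}_0$. $q'$ is the conjugate exponent, $1/q+1/q'=1$. For the spaces occurring here, elements are identified with continuous functions. For $f=f_1+if_2$ with $f_1=\mathrm{Re}(f)$, $f_2=\mathrm{Im}(f)$, $F(f)$ denotes the function $x\mapsto F(f_1(x),f_2(x))$. $A\lesssim B$ stands for $A\le CB$ for some constant $C$. $F$ is real analytic on $\mathbb R^2$ if every $(s_0,t_0)\in\mathbb R^2$ has a neighbourhood on which $F(s,t)=\sum_{j,k=0}^\infty a_{jk}(s-s_0)^j(t-t_0)^k$ with absolute convergence, for some $a_{jk}\in\mathbb C$ depending on $(s_0,t_0)$. $F$ is real entire if $F(s,t)=\sum_{j,k=0}^\infty a_{jk}s^jt^k$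 with absolute convergence for all $(s,t)\in\mathbb R^2$.
   Formalization: In (2) the norm of X is taken with the window rg for all r ≥ r₀, where r₀ depends on g and X only; for an arbitrary fixed window the inequality fails with C independent of f (e.g. F = e^x − 1, X = M^{1,1}, small window). *)

theory Defs
  imports "HOL-Probability.Essential_Supremum"
begin

section \<open>Schwartz functions and tempered distributions\<close>

definition partial_derivative ::
    "'n \<Rightarrow> (real^'n \<Rightarrow> complex) \<Rightarrow> real^'n::finite \<Rightarrow> complex" where
  "partial_derivative i f x = vector_derivative (\<lambda>h. f (x + h *\<^sub>R axis i 1)) (at 0)"

text \<open>A multi-index is given as the list of the coordinates in which one differentiates.\<close>

fun iterated_derivative ::
    "'n list \<Rightarrow> (real^'n \<Rightarrow> complex) \<Rightarrow> real^'n::finite \<Rightarrow> complex" where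
  "iterated_derivative [] f = f"
| "iterated_derivative (i # \<alpha>) f = partial_derivative i (iterated_derivative \<alpha> f)"

text \<open>Total differentiability of all iterated partial derivatives is the same as their existence
  and continuity.\<close>

definition smooth :: "(real^'n::finite \<Rightarrow> complex) \<Rightarrow> bool" where
  "smooth f \<longleftrightarrow> (\<forall>\<alpha> x. iterated_derivative \<alpha> f differentiable (at x))"

definition schwartz :: "(real^'n::finite \<Rightarrow> complex) set" where
  "schwartz = {\<phi>. smooth \<phi> \<and>
     (\<forall>k \<alpha>. bounded (range (\<lambda>x. norm x ^ k *\<^sub>R iterated_derivative \<alpha> \<phi> x)))}"

definition schwartz_seminorm :: "nat \<Rightarrow> 'n list \<Rightarrow> (real^'n::finite \<Rightarrow> complex) \<Rightarrow> real" where
  "schwartz_seminorm k \<alpha> \<phi> = (SUP x. norm x ^ k * norm (iterated_derivative \<alpha> \<phi> x))"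

text \<open>Only the values of \<open>u\<close> on \<^const>\<open>schwartz\<close> matter.\<close>

definition tempered_distribution :: "((real^'n::finite \<Rightarrow> complex) \<Rightarrow> complex) \<Rightarrow> bool" where
  "tempered_distribution u \<longleftrightarrow>
     (\<forall>\<phi>\<in>schwartz. \<forall>\<psi>\<in>schwartz. u (\<lambda>t. \<phi> t + \<psi> t) = u \<phi> + u \<psi>) \<and>
     (\<forall>c. \<forall>\<phi>\<in>schwartz. u (\<lambda>t. c * \<phi> t) = c * u \<phi>) \<and>
     (\<exists>C N. \<forall>\<phi>\<in>schwartz.
        norm (u \<phi>) \<le> C * (\<Sum>k\<le>N. \<Sum>\<alpha> | length \<alpha> \<le> N. schwartz_seminorm k \<alpha> \<phi>))"

section \<open>Short time Fourier transform and modulation spaces\<close>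

definition time_shift :: "real^'n \<Rightarrow> (real^'n::finite \<Rightarrow> complex) \<Rightarrow> real^'n \<Rightarrow> complex" where
  "time_shift x g = (\<lambda>t. g (t - x))"

definition freq_shift :: "real^'n \<Rightarrow> (real^'n::finite \<Rightarrow> complex) \<Rightarrow> real^'n \<Rightarrow> complex" where
  "freq_shift w g = (\<lambda>t. cis (2 * pi * (w \<bullet> t)) * g t)"

text \<open>The pairing \<open>\<langle>f, M\<^sub>w T\<^sub>x g\<rangle>\<close> is conjugate linear in its second argument, whereas
  distributions are linear functionals here; hence the conjugate.\<close>

definition stft ::
    "(real^'n::finite \<Rightarrow> complex) \<Rightarrow> ((real^'n \<Rightarrow> complex) \<Rightarrow> complex) \<Rightarrow>
       real^'n \<Rightarrow> real^'n \<Rightarrow> complex" where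
  "stft g u x w = u (\<lambda>t. cnj (freq_shift w (time_shift x g) t))"

definition ennreal_powr :: "ennreal \<Rightarrow> real \<Rightarrow> ennreal" where
  "ennreal_powr x a = (if x = \<infinity> then \<infinity> else ennreal (enn2real x powr a))"

text \<open>The \<open>L\<^sup>p\<close> norm of a nonnegative function, for \<open>1 \<le> p \<le> \<infinity>\<close>.\<close>

definition Lp_norm :: "ennreal \<Rightarrow> (real^'n::finite \<Rightarrow> ennreal) \<Rightarrow> ennreal" where
  "Lp_norm p h =
     (if p = \<infinity> then esssup lborel h
      else ennreal_powr (\<integral>\<^sup>+x. ennreal_powr (h x) (enn2real p) \<partial>lborel) (1 / enn2real p))"

definition modulation_enorm ::
    "(real^'n::finite \<Rightarrow> complex) \<Rightarrow> ennreal \<Rightarrow> ennreal \<Rightarrow> real \<Rightarrow>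
       ((real^'n \<Rightarrow> complex) \<Rightarrow> complex) \<Rightarrow> ennreal" where
  "modulation_enorm g p q s u =
     Lp_norm q (\<lambda>w. Lp_norm p (\<lambda>x. ennreal (norm (stft g u x w)))
                   * ennreal ((1 + (norm w)\<^sup>2) powr (s / 2)))"

definition modulation_space ::
    "(real^'n::finite \<Rightarrow> complex) \<Rightarrow> ennreal \<Rightarrow> ennreal \<Rightarrow> real \<Rightarrow>
       ((real^'n \<Rightarrow> complex) \<Rightarrow> complex) set" where
  "modulation_space g p q s =
     {u. tempered_distribution u \<and> modulation_enorm g p q s u < \<infinity>}"

section \<open>Identification with continuous functions\<close>

definition distribution_of :: "(real^'n::finite \<Rightarrow> complex) \<Rightarrow> (real^'n \<Rightarrow> complex) \<Rightarrow> complex" where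
  "distribution_of f \<phi> = (LINT t|lborel. f t * \<phi> t)"

text \<open>The continuous functions that represent an element of the modulation space. For the spaces
  considered here every element has exactly one such representative.\<close>

definition modulation_functions ::
    "(real^'n::finite \<Rightarrow> complex) \<Rightarrow> ennreal \<Rightarrow> ennreal \<Rightarrow> real \<Rightarrow> (real^'n \<Rightarrow> complex) set" where
  "modulation_functions g p q s =
     {f. continuous_on UNIV f \<and> (\<forall>\<phi>\<in>schwartz. integrable lborel (\<lambda>t. f t * \<phi> t)) \<and>
         distribution_of f \<in> modulation_space g p q s}"

definition modulation_norm ::
    "(real^'n::finite \<Rightarrow> complex) \<Rightarrow> ennreal \<Rightarrow> ennreal \<Rightarrow> real \<Rightarrow> (real^'n \<Rightarrow> complex) \<Rightarrow> real" where
  "modulation_norm g p q s f = enn2real (modulation_enorm g p q s (distribution_of f))"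

section \<open>Real analytic and real entire functions of two variables\<close>

definition real_analytic2 :: "(real \<Rightarrow> real \<Rightarrow> complex) \<Rightarrow> bool" where
  "real_analytic2 F \<longleftrightarrow>
     (\<forall>s\<^sub>0 t\<^sub>0. \<exists>U a. open U \<and> (s\<^sub>0, t\<^sub>0) \<in> U \<and>
        (\<forall>(s, t)\<in>U.
           (\<lambda>(j, k). norm (a j k * of_real (s - s\<^sub>0) ^ j * of_real (t - t\<^sub>0) ^ k))
             summable_on (UNIV :: (nat \<times> nat) set) \<and>
           F s t = (\<Sum>\<^sub>\<infinity>(j, k). a j k * of_real (s - s\<^sub>0) ^ j * of_real (t - t\<^sub>0) ^ k)))"

definition real_entire2 :: "(real \<Rightarrow> real \<Rightarrow> complex) \<Rightarrow> (nat \<Rightarrow> nat \<Rightarrow> complex) \<Rightarrow> bool" where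
  "real_entire2 F a \<longleftrightarrow>
     (\<forall>s t.
        (\<lambda>(j, k). norm (a j k * of_real s ^ j * of_real t ^ k))
          summable_on (UNIV :: (nat \<times> nat) set) \<and>
        F s t = (\<Sum>\<^sub>\<infinity>(j, k). a j k * of_real s ^ j * of_real t ^ k))"

definition majorant :: "(nat \<Rightarrow> nat \<Rightarrow> complex) \<Rightarrow> real \<Rightarrow> real \<Rightarrow> real" where
  "majorant a x y = (\<Sum>\<^sub>\<infinity>(j, k). norm (a j k) * x ^ j * y ^ k)"

definition Re_part :: "(real^'n::finite \<Rightarrow> complex) \<Rightarrow> real^'n \<Rightarrow> complex" where
  "Re_part f = (\<lambda>x. of_real (Re (f x)))"

definition Im_part :: "(real^'n::finite \<Rightarrow> complex) \<Rightarrow> real^'n \<Rightarrow> complex" where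
  "Im_part f = (\<lambda>x. of_real (Im (f x)))"

definition operate :: "(real \<Rightarrow> real \<Rightarrow> complex) \<Rightarrow> (real^'n::finite \<Rightarrow> complex) \<Rightarrow> real^'n \<Rightarrow> complex" where
  "operate F f = (\<lambda>x. F (Re (f x)) (Im (f x)))"

text \<open>The norm of a modulation space depends on the window, and rescaling the window rescales the
  norm. An estimate that is not homogeneous in the norm refers to a window whose scaling has been
  fixed suitably, for instance so that the norm is submultiplicative.\<close>

definition scaled_window :: "real \<Rightarrow> (real^'n::finite \<Rightarrow> complex) \<Rightarrow> real^'n \<Rightarrow> complex" where
  "scaled_window r g = (\<lambda>t. of_real r * g t)"

end

theory Submission
  imports Defs "HOL-Probability.Probability"
begin

text \<open>
  Everything rests on two facts. First, Fourier inversion gives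
  \<open>|FT (F \<cdot> \<Phi>)| \<le> |FT F| * |FT \<Phi>|\<close>. Since transforms of Schwartz functions decay rapidly, one
  can therefore change the window at the cost of convolving with a rapidly decreasing function; this yields \<open>M\<^sup>p\<^sup>,\<^sup>1 \<subseteq> M\<^sup>\<infinity>\<^sup>,\<^sup>1\<close>.
  Second, with window \<open>g\<^sup>2\<close> the transform of \<open>f h\<close> at position \<open>x\<close> is dominated by the convolution of
  those of \<open>f\<close> and \<open>h\<close> with window \<open>g\<close>. Together with the weighted Young inequality (and
  \<open>L\<^sup>q\<^sub>s \<subseteq> L\<^sup>1\<close> for \<open>s > n/q'\<close>) the spaces become algebras under pointwise multiplication; enlarging the
  window makes the norm submultiplicative, and Minkowski's inequality sums the power series.

  For a real analytic \<open>F\<close> the proof is of Wiener--Levy type: \<open>M\<^sup>1\<^sup>,\<^sup>1\<close> is described by the function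
  \<open>x \<mapsto> \<parallel>FT (f \<cdot> T\<^sub>x \<gamma>)\<parallel>\<^sub>1\<close>, which is integrable and vanishes at infinity. For a window \<open>\<gamma>\<close> with small
  support \<open>F(f) \<cdot> T\<^sub>x \<gamma>\<close> only involves the power series of \<open>F\<close> at one point, evaluated at a cut off
  \<open>f - f(x\<^sub>0)\<close> whose transform has small \<open>L\<^sup>1\<close> norm. Compactness treats bounded \<open>x\<close>, and the expansion
  at \<open>0\<close> treats large \<open>x\<close>.
\<close>

section \<open>Powers and \<open>L\<^sup>p\<close> norms of extended nonnegative functions\<close>

text \<open>Transforms are compared only through their absolute values, in \<open>ennreal\<close>:
  convolutions of nonnegative functions always exist, and Tonelli's theorem applies without
  integrability conditions.

  For \<open>p < \<infinity>\<close> the constant function 1 lies in none of the spaces, so a power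
  series can be summed in norm only without constant term; this is where \<open>F 0 0 = 0\<close>
  enters. In the analytic case the same fact returns in a sharper form: for large \<open>x\<close> a
  merely bounded local norm of \<open>F(f)\<close> would not be integrable in \<open>x\<close>, but
  a series without constant term is dominated linearly by the local norm of \<open>f\<close>, which
  is integrable.

  The scaling of the window exploits a mismatch of degrees: multiplying the window by
  \<open>r\<close> multiplies the norm by \<open>r\<close>, so a product estimate with constant
  \<open>C\<close> becomes one with constant \<open>C / r\<close>.

  The order of quantifiers shapes the analytic part. The radius on which an expansion of
  \<open>F\<close> helps depends on the base point, so the local estimates hold for all windows of
  small support at once; the window is chosen only after finitely many base points have been
  selected.\<close>

lemma ennreal_powr_ennreal: "0 \<le> x \<Longrightarrow> ennreal_powr (ennreal x) a = ennreal (x powr a)"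
  by (simp add: ennreal_powr_def)

lemma ennreal_powr_top [simp]: "ennreal_powr top a = top"
  by (simp add: ennreal_powr_def)

lemma ennreal_powr_0 [simp]: "ennreal_powr 0 a = 0"
  by (simp add: ennreal_powr_def)

lemma ennreal_powr_1 [simp]: "ennreal_powr x 1 = x"
  by (cases x) (auto simp: ennreal_powr_ennreal)

lemma ennreal_powr_eq_0_iff [simp]: "ennreal_powr x a = 0 \<longleftrightarrow> x = 0"
  by (cases x) (auto simp: ennreal_powr_ennreal ennreal_eq_0_iff)

lemma ennreal_powr_eq_top_iff [simp]: "ennreal_powr x a = top \<longleftrightarrow> x = top"
  by (cases x) (auto simp: ennreal_powr_ennreal)

lemma measurable_ennreal_powr [measurable (raw)]:
  assumes [measurable]: "f \<in> borel_measurable M"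
  shows "(\<lambda>x. ennreal_powr (f x) a) \<in> borel_measurable M"
  unfolding ennreal_powr_def by measurable

lemma ennreal_powr_mono: "0 \<le> a \<Longrightarrow> x \<le> y \<Longrightarrow> ennreal_powr x a \<le> ennreal_powr y a"
  by (cases x; cases y)
    (auto simp: ennreal_powr_ennreal top_unique intro!: ennreal_leI powr_mono2)

lemma ennreal_powr_mult: "ennreal_powr (x * y) a = ennreal_powr x a * ennreal_powr y a"
proof (cases "x = 0 \<or> y = 0")
  case False
  then show ?thesis
    by (cases x; cases y)
      (auto simp: ennreal_powr_ennreal ennreal_mult[symmetric] powr_mult ennreal_mult_top
        ennreal_top_mult ennreal_eq_0_iff)
qed auto

lemma ennreal_powr_powr: "ennreal_powr (ennreal_powr x a) b = ennreal_powr x (a * b)"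
  by (cases x) (auto simp: ennreal_powr_ennreal powr_powr)

lemma ennreal_powr_add: "ennreal_powr x a * ennreal_powr x b = ennreal_powr x (a + b)"
  by (cases x) (auto simp: ennreal_powr_ennreal ennreal_mult[symmetric] powr_add)

lemma ennreal_powr_add_1: "ennreal_powr x a * x = ennreal_powr x (a + 1)"
  using ennreal_powr_add[of x a 1] by simp

lemma ennreal_inverse_mult_self: "0 < x \<Longrightarrow> x < top \<Longrightarrow> x * inverse x = (1::ennreal)"
  by (cases x) (auto simp: inverse_ennreal ennreal_mult[symmetric])

text \<open>Up to the factor \<open>p\<close> this is the tangent inequality
  \<open>h powr p >= c powr p + p * c powr (p - 1) * (h - c)\<close> of a convex function,
  rearranged so that nothing depending on \<open>h\<close> is subtracted and it can be integrated in
  \<open>ennreal\<close>.\<close>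

lemma young_tangent:
  fixes h c p :: real
  assumes "1 \<le> p" "0 \<le> h" "0 \<le> c"
  shows "h * c powr (p - 1) \<le> h powr p / p + (1 - 1 / p) * c powr p"
proof (cases "p = 1")
  case True
  then show ?thesis using assms by auto
next
  case False
  define q where "q = p / (p - 1)"
  have p: "p > 1" using False assms by simp
  have q: "q > 1" "1 / p + 1 / q = 1" "(p - 1) * q = p" "1 / q = 1 - 1 / p"
    using p by (auto simp: q_def field_simps)
  have "h * c powr (p - 1) \<le> h powr p / p + (c powr (p - 1)) powr q / q"
    by (rule Youngs_inequality[OF p q(1,2)]) (use assms in auto)
  also have "(c powr (p - 1)) powr q / q = (1 - 1 / p) * c powr p"
    unfolding powr_powr q(3) q(4)[symmetric] by simp
  finally show ?thesis .
qed

text \<open>Jensen's inequality for the measure with density \<open>k\<close>, whose mass need not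
  be 1: the tangent inequality at the mean of \<open>h\<close> is integrated. It replaces duality:
  Minkowski's and Hoelder's inequalities below are derived from it.\<close>

lemma nn_integral_Jensen_powr:
  fixes h k :: "'a \<Rightarrow> ennreal" and p :: real
  assumes [measurable]: "h \<in> borel_measurable M" "k \<in> borel_measurable M"
    and p: "1 \<le> p" and fin: "(\<integral>\<^sup>+x. k x \<partial>M) < top"
  shows "ennreal_powr (\<integral>\<^sup>+x. h x * k x \<partial>M) p
    \<le> ennreal_powr (\<integral>\<^sup>+x. k x \<partial>M) (p - 1) * (\<integral>\<^sup>+x. ennreal_powr (h x) p * k x \<partial>M)"
proof -
  define S where "S = (\<integral>\<^sup>+x. k x \<partial>M)"
  define I where "I = (\<integral>\<^sup>+x. ennreal_powr (h x) p * k x \<partial>M)"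
  define m where "m = (\<integral>\<^sup>+x. h x * k x \<partial>M)"
  consider "S = 0" | "S \<noteq> 0" "I = top" | "S \<noteq> 0" "I \<noteq> top" by blast
  then have "ennreal_powr m p \<le> ennreal_powr S (p - 1) * I"
  proof cases
    case 1
    then have "AE x in M. k x = 0" by (simp add: S_def nn_integral_0_iff_AE)
    then have "m = (\<integral>\<^sup>+x. 0 \<partial>M)" unfolding m_def by (intro nn_integral_cong_AE) auto
    then show ?thesis by simp
  next
    case 2
    then show ?thesis by (simp add: ennreal_mult_top)
  next
    case 3
    \<comment> \<open>This gives finiteness of \<open>m\<close>; otherwise the mean would not be a
      real number and the cancellation below would fail.\<close>
    have "h x * k x \<le> k x + ennreal_powr (h x) p * k x" for x
    proof -
      have "h x \<le> 1 + ennreal_powr (h x) p"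
      proof (cases "h x")
        case (real r)
        have "r \<le> 1 + r powr p"
        proof (cases "r \<le> 1")
          case True
          then show ?thesis by (smt (verit) powr_ge_zero)
        next
          case False
          then show ?thesis using p powr_mono[of 1 p r] by auto
        qed
        then show ?thesis using real
          by (simp add: ennreal_powr_ennreal flip: ennreal_1 ennreal_plus)
      qed simp
      then have "h x * k x \<le> (1 + ennreal_powr (h x) p) * k x" by (rule mult_right_mono) simp
      then show ?thesis by (simp add: distrib_right)
    qed
    then have "m \<le> (\<integral>\<^sup>+x. k x + ennreal_powr (h x) p * k x \<partial>M)"
      unfolding m_def by (intro nn_integral_mono) auto
    also have "\<dots> = S + I" unfolding S_def I_def by (intro nn_integral_add) auto
    finally have "m < top" using 3 fin by (metis S_def ennreal_add_eq_top less_top neq_top_trans)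
    then obtain m' where m': "m = ennreal m'" "0 \<le> m'" by (cases m) auto
    obtain S' where S': "S = ennreal S'" "0 < S'"
      using 3 fin by (cases S) (auto simp: S_def less_le)
    obtain I' where I': "I = ennreal I'" "0 \<le> I'" using 3 by (cases I) auto
    \<comment> \<open>The mean of \<open>h\<close>. With this point of tangency both sides contain a
      multiple of \<open>c powr p * S'\<close>, and what remains after cancelling is
      \<open>c powr p * S' <= I'\<close>.\<close>
    define c where "c = m' / S'"
    have c: "0 \<le> c" "m' = c * S'" using S' m' by (auto simp: c_def)
    have pt: "h x * ennreal (c powr (p - 1)) * k x
        \<le> ennreal (1 / p) * (ennreal_powr (h x) p * k x) + ennreal ((1 - 1 / p) * c powr p) * k x" for x
    proof -
      have "h x * ennreal (c powr (p - 1))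
        \<le> ennreal (1 / p) * ennreal_powr (h x) p + ennreal ((1 - 1 / p) * c powr p)"
      proof (cases "h x")
        case (real r)
        then show ?thesis using young_tangent[OF p, of r c] c p
          by (simp add: ennreal_powr_ennreal ennreal_mult[symmetric] ennreal_plus[symmetric]
              del: ennreal_plus)
      qed (use p in \<open>simp add: ennreal_mult_top\<close>)
      then have "h x * ennreal (c powr (p - 1)) * k x
        \<le> (ennreal (1 / p) * ennreal_powr (h x) p + ennreal ((1 - 1 / p) * c powr p)) * k x"
        by (rule mult_right_mono) simp
      then show ?thesis unfolding distrib_right by (simp only: ac_simps)
    qed
    have "m * ennreal (c powr (p - 1)) = (\<integral>\<^sup>+x. h x * ennreal (c powr (p - 1)) * k x \<partial>M)"
      unfolding m_def by (subst nn_integral_multc[symmetric]) (auto simp: ac_simps)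
    also have "\<dots> \<le> (\<integral>\<^sup>+x. ennreal (1 / p) * (ennreal_powr (h x) p * k x)
        + ennreal ((1 - 1 / p) * c powr p) * k x \<partial>M)"
      by (intro nn_integral_mono pt)
    also have "\<dots> = ennreal (1 / p) * I + ennreal ((1 - 1 / p) * c powr p) * S"
      unfolding S_def I_def by (subst nn_integral_add) (auto simp: nn_integral_cmult)
    finally have "ennreal (m' * c powr (p - 1)) \<le> ennreal (I' / p + (1 - 1 / p) * c powr p * S')"
      using p m' S' I' by (simp add: ennreal_mult[symmetric] ennreal_plus[symmetric] del: ennreal_plus)
    then have "m' * c powr (p - 1) \<le> I' / p + (1 - 1 / p) * c powr p * S'"
      using p I' S' by (subst (asm) ennreal_le_iff) auto
    moreover have "m' * c powr (p - 1) = c powr p * S'"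
      using c powr_add[of c "p - 1" 1] by (cases "c = 0") auto
    ultimately have "c powr p * S' \<le> I'" using p by (simp add: field_simps)
    then have "c powr p * S' * S' powr (p - 1) \<le> S' powr (p - 1) * I'"
      using mult_left_mono[of _ _ "S' powr (p - 1)"] by (simp add: mult.commute)
    moreover have "m' powr p = c powr p * S' * S' powr (p - 1)"
      using c S' powr_add[of S' "p - 1" 1] by (simp add: powr_mult)
    ultimately show ?thesis using m' S' I'
      by (simp add: ennreal_powr_ennreal ennreal_mult[symmetric] ennreal_leI)
  qed
  then show ?thesis unfolding S_def I_def m_def .
qed

section \<open>\<open>L\<^sup>p\<close> norms in \<open>ennreal\<close> and Minkowski's integral
  inequality\<close>

lemma Lp_norm_ennreal:
  "1 \<le> r \<Longrightarrow> Lp_norm (ennreal r) h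
     = ennreal_powr (\<integral>\<^sup>+x. ennreal_powr (h x) r \<partial>lborel) (1 / r)"
  by (simp add: Lp_norm_def)

lemma Lp_norm_top: "Lp_norm top h = esssup lborel h"
  by (simp add: Lp_norm_def)

lemma Lp_norm_1: "Lp_norm 1 h = (\<integral>\<^sup>+x. h x \<partial>lborel)"
  using Lp_norm_ennreal[of 1 h] by simp

lemma ennreal_ge_1_cases:
  assumes "1 \<le> (p::ennreal)"
  obtains r where "p = ennreal r" "1 \<le> r" | "p = top"
  using assms by (cases p) (auto simp flip: ennreal_1)

text \<open>The right side is the measure of a section, hence measurable in a parameter; this
  carries measurability over to the essential supremum.\<close>

lemma less_esssup_iff:
  fixes f :: "'a \<Rightarrow> ennreal"
  assumes [measurable]: "f \<in> borel_measurable M"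
  shows "c < esssup M f \<longleftrightarrow> 0 < emeasure M {x \<in> space M. c < f x}"
proof
  assume "0 < emeasure M {x \<in> space M. c < f x}"
  then have "\<not> (AE x in M. f x \<le> c)"
    by (subst AE_iff_measurable[OF _ refl]) (auto simp: not_le)
  moreover have "AE x in M. f x \<le> c" if "esssup M f \<le> c"
    using esssup_AE[of f M] by eventually_elim (use that in auto)
  ultimately show "c < esssup M f" by (auto simp: not_le[symmetric])
qed (rule esssup_pos_measure[OF assms])

lemma measurable_Lp_norm [measurable (raw)]:
  fixes F :: "'a \<Rightarrow> real^'n::finite \<Rightarrow> ennreal"
  assumes p: "1 \<le> p"
    and F[measurable]: "(\<lambda>(w, x). F w x) \<in> borel_measurable (M \<Otimes>\<^sub>M lborel)"
  shows "(\<lambda>w. Lp_norm p (F w)) \<in> borel_measurable M"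
proof -
  interpret sigma_finite_measure "lborel :: (real^'n) measure" by (rule sigma_finite_lborel)
  show ?thesis using p
  proof (cases p rule: ennreal_ge_1_cases)
    case (1 r)
    show ?thesis unfolding 1 Lp_norm_ennreal[OF 1(2)] by measurable
  next
    case 2
    have "(\<lambda>w. esssup lborel (F w)) \<in> borel_measurable M"
    proof (rule borel_measurableI_greater)
      fix c
      have *: "{w \<in> space M. c < esssup lborel (F w)}
        = {w \<in> space M. 0 < emeasure lborel {x \<in> space lborel. c < F w x}}"
        by (intro Collect_cong conj_cong refl less_esssup_iff) measurable
      show "{w \<in> space M. c < esssup lborel (F w)} \<in> sets M"
        unfolding * by measurable
    qed
    then show ?thesis unfolding 2 Lp_norm_top[abs_def] .
  qed
qed

lemma Lp_norm_mono_AE: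
  assumes "1 \<le> p" and [measurable]: "h \<in> borel_measurable lborel" and "AE x in lborel. h x \<le> k x"
  shows "Lp_norm p h \<le> Lp_norm p k"
  using assms(1)
proof (cases p rule: ennreal_ge_1_cases)
  case (1 r)
  show ?thesis unfolding 1 Lp_norm_ennreal[OF 1(2)]
    using assms(3) 1
    by (intro ennreal_powr_mono nn_integral_mono_AE) (auto elim!: eventually_mono intro!: ennreal_powr_mono)
next
  case 2
  show ?thesis unfolding 2 Lp_norm_top by (intro esssup_AE_mono assms)
qed

lemma Lp_norm_mono:
  assumes "1 \<le> p" "h \<in> borel_measurable lborel" "\<And>x. h x \<le> k x"
  shows "Lp_norm p h \<le> Lp_norm p k"
  using assms by (intro Lp_norm_mono_AE) auto

text \<open>Minkowski's integral inequality, proved without duality. With \<open>A y\<close> the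
  norm of the slice at \<open>y\<close>, Jensen's inequality is applied to
  \<open>F x y / A y\<close> against the density \<open>A\<close>; integration over \<open>x\<close>
  then leaves at most 1 for every normalised slice.\<close>

lemma Lp_norm_nn_integral:
  fixes F :: "real^'n::finite \<Rightarrow> 'b \<Rightarrow> ennreal"
  assumes p: "1 \<le> p" and N: "sigma_finite_measure N"
    and F[measurable]: "(\<lambda>(x, y). F x y) \<in> borel_measurable (lborel \<Otimes>\<^sub>M N)"
  shows "Lp_norm p (\<lambda>x. \<integral>\<^sup>+y. F x y \<partial>N) \<le> (\<integral>\<^sup>+y. Lp_norm p (\<lambda>x. F x y) \<partial>N)"
proof -
  interpret N: sigma_finite_measure N by fact
  interpret L: sigma_finite_measure "lborel :: (real^'n) measure" by (rule sigma_finite_lborel)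
  interpret P: pair_sigma_finite "lborel :: (real^'n) measure" N ..
  have F'[measurable]: "(\<lambda>(y, x). F x y) \<in> borel_measurable (N \<Otimes>\<^sub>M lborel)"
    using measurable_compose[OF measurable_pair_swap' F] by (simp add: case_prod_beta)
  define A where "A y = Lp_norm p (\<lambda>x. F x y)" for y
  have [measurable]: "A \<in> borel_measurable N"
    unfolding A_def by (intro measurable_Lp_norm p F')
  define S where "S = (\<integral>\<^sup>+y. A y \<partial>N)"
  have "Lp_norm p (\<lambda>x. \<integral>\<^sup>+y. F x y \<partial>N) \<le> S" using p
  proof (cases p rule: ennreal_ge_1_cases)
    case (1 r)
    have A: "ennreal_powr (A y) r = (\<integral>\<^sup>+x. ennreal_powr (F x y) r \<partial>lborel)" for y
      unfolding A_def 1(1) Lp_norm_ennreal[OF 1(2)] using 1(2) by (simp add: ennreal_powr_powr)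
    show ?thesis
    proof (cases "S = top")
      case False
      \<comment> \<open>Only slices of finite positive norm can be normalised. Infinite norms form a
        null set because \<open>S\<close> is finite; slices of norm 0 contribute nothing for almost
        every \<open>x\<close> by Tonelli's theorem, which is shown next.\<close>
      define D where "D = {y. 0 < A y \<and> A y < top}"
      have [measurable]: "Measurable.pred N (\<lambda>y. y \<in> D)" unfolding D_def by simp
      define A' where "A' y = A y * indicator D y" for y
      have [measurable]: "A' \<in> borel_measurable N" unfolding A'_def by measurable
      have fin: "AE y in N. A y \<noteq> top"
        using False unfolding S_def by (intro nn_integral_PInf_AE[unfolded infinity_ennreal_def]) auto
      have "(\<integral>\<^sup>+x. \<integral>\<^sup>+y. F x y * indicator {y. A y = 0} y \<partial>N \<partial>lborel)
        = (\<integral>\<^sup>+y. \<integral>\<^sup>+x. F x y * indicator {y. A y = 0} y \<partial>lborel \<partial>N)"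
        by (rule P.Fubini'[symmetric]) measurable
      also have "\<dots> = (\<integral>\<^sup>+y. 0 \<partial>N)"
      proof (rule nn_integral_cong)
        fix y assume [measurable]: "y \<in> space N"
        show "(\<integral>\<^sup>+x. F x y * indicator {y. A y = 0} y \<partial>lborel) = 0"
        proof (cases "A y = 0")
          case True
          then have "(\<integral>\<^sup>+x. ennreal_powr (F x y) r \<partial>lborel) = 0" using A[of y] by simp
          then have "AE x in lborel. F x y = 0"
            by (subst (asm) nn_integral_0_iff_AE) auto
          then show ?thesis by (subst nn_integral_0_iff_AE) auto
        qed simp
      qed
      finally have "(\<integral>\<^sup>+x. \<integral>\<^sup>+y. F x y * indicator {y. A y = 0} y \<partial>N \<partial>lborel) = 0"
        by simp
      then have "AE x in lborel. (\<integral>\<^sup>+y. F x y * indicator {y. A y = 0} y \<partial>N) = 0"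
        by (subst (asm) nn_integral_0_iff_AE) auto
      then have le: "AE x in lborel. (\<integral>\<^sup>+y. F x y \<partial>N) \<le> (\<integral>\<^sup>+y. F x y * inverse (A y) * A' y \<partial>N)"
      proof eventually_elim
        case (elim x)
        have [measurable]: "x \<in> space lborel" by simp
        have "(\<integral>\<^sup>+y. F x y \<partial>N)
          \<le> (\<integral>\<^sup>+y. F x y * indicator {y. A y = 0} y + F x y * inverse (A y) * A' y \<partial>N)"
        proof (rule nn_integral_mono_AE)
          show "AE y in N. F x y \<le> F x y * indicator {y. A y = 0} y + F x y * inverse (A y) * A' y"
            using fin
          proof eventually_elim
            case (elim y)
            show ?case
            proof (cases "A y = 0")
              case False
              then have y: "0 < A y" "A y < top" using elim by (auto simp: less_top zero_less_iff_neq_zero)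
              then have "F x y * inverse (A y) * A' y = F x y * (A y * inverse (A y))"
                by (simp add: A'_def D_def mult.commute mult.left_commute)
              then show ?thesis using ennreal_inverse_mult_self[OF y] False by simp
            qed simp
          qed
        qed
        also have "\<dots> = (\<integral>\<^sup>+y. F x y * inverse (A y) * A' y \<partial>N)"
          by (subst nn_integral_add) (auto simp: elim)
        finally show ?case .
      qed
      have A'S: "(\<integral>\<^sup>+y. A' y \<partial>N) \<le> S"
        unfolding S_def A'_def by (intro nn_integral_mono) (auto split: split_indicator)
      have "(\<integral>\<^sup>+x. ennreal_powr (\<integral>\<^sup>+y. F x y \<partial>N) r \<partial>lborel)
        \<le> (\<integral>\<^sup>+x. ennreal_powr (\<integral>\<^sup>+y. F x y * inverse (A y) * A' y \<partial>N) r \<partial>lborel)"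
        using le 1(2) by (intro nn_integral_mono_AE) (auto elim!: eventually_mono intro!: ennreal_powr_mono)
      also have "\<dots> \<le> (\<integral>\<^sup>+x. ennreal_powr S (r - 1)
          * (\<integral>\<^sup>+y. ennreal_powr (F x y * inverse (A y)) r * A' y \<partial>N) \<partial>lborel)"
      proof (rule nn_integral_mono)
        fix x :: "real^'n"
        have [measurable]: "x \<in> space lborel" by simp
        have "ennreal_powr (\<integral>\<^sup>+y. F x y * inverse (A y) * A' y \<partial>N) r
          \<le> ennreal_powr (\<integral>\<^sup>+y. A' y \<partial>N) (r - 1)
            * (\<integral>\<^sup>+y. ennreal_powr (F x y * inverse (A y)) r * A' y \<partial>N)"
          using A'S False 1(2)
          by (intro nn_integral_Jensen_powr) (auto simp: less_top[symmetric] top_unique)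
        also have "\<dots> \<le> ennreal_powr S (r - 1)
            * (\<integral>\<^sup>+y. ennreal_powr (F x y * inverse (A y)) r * A' y \<partial>N)"
          using A'S 1(2) by (intro mult_right_mono ennreal_powr_mono) auto
        finally show "ennreal_powr (\<integral>\<^sup>+y. F x y * inverse (A y) * A' y \<partial>N) r
          \<le> ennreal_powr S (r - 1) * (\<integral>\<^sup>+y. ennreal_powr (F x y * inverse (A y)) r * A' y \<partial>N)" .
      qed
      also have "\<dots> = ennreal_powr S (r - 1)
          * (\<integral>\<^sup>+x. \<integral>\<^sup>+y. ennreal_powr (F x y * inverse (A y)) r * A' y \<partial>N \<partial>lborel)"
        by (rule nn_integral_cmult) measurable
      also have "(\<integral>\<^sup>+x. \<integral>\<^sup>+y. ennreal_powr (F x y * inverse (A y)) r * A' y \<partial>N \<partial>lborel)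
          = (\<integral>\<^sup>+y. \<integral>\<^sup>+x. ennreal_powr (F x y * inverse (A y)) r * A' y \<partial>lborel \<partial>N)"
        by (rule P.Fubini'[symmetric]) measurable
      also have "\<dots> \<le> (\<integral>\<^sup>+y. A y \<partial>N)"
      proof (rule nn_integral_mono)
        fix y assume [measurable]: "y \<in> space N"
        have "(\<integral>\<^sup>+x. ennreal_powr (F x y * inverse (A y)) r * A' y \<partial>lborel)
          = (\<integral>\<^sup>+x. ennreal_powr (F x y) r \<partial>lborel) * (ennreal_powr (inverse (A y)) r * A' y)"
          by (subst nn_integral_multc[symmetric]) (auto simp: ennreal_powr_mult ac_simps)
        also have "\<dots> = ennreal_powr (A y * inverse (A y)) r * A' y"
          by (simp add: A[symmetric] ennreal_powr_mult ac_simps)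
        also have "\<dots> \<le> A y"
          using ennreal_inverse_mult_self[of "A y"] ennreal_powr_ennreal[of 1 r]
          by (cases "y \<in> D") (auto simp: A'_def D_def)
        finally show "(\<integral>\<^sup>+x. ennreal_powr (F x y * inverse (A y)) r * A' y \<partial>lborel) \<le> A y" .
      qed
      finally have "(\<integral>\<^sup>+x. ennreal_powr (\<integral>\<^sup>+y. F x y \<partial>N) r \<partial>lborel) \<le> ennreal_powr S (r - 1) * S"
        by (simp add: S_def mult_left_mono)
      also have "\<dots> = ennreal_powr S r" by (simp add: ennreal_powr_add_1)
      finally have "ennreal_powr (\<integral>\<^sup>+x. ennreal_powr (\<integral>\<^sup>+y. F x y \<partial>N) r \<partial>lborel) (1 / r)
        \<le> ennreal_powr (ennreal_powr S r) (1 / r)"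
        using 1(2) by (intro ennreal_powr_mono) auto
      then show ?thesis unfolding 1(1) Lp_norm_ennreal[OF 1(2)]
        using 1(2) by (simp add: ennreal_powr_powr)
    qed simp
  next
    case 2
    \<comment> \<open>The essential supremum gives the estimate for almost every \<open>x\<close> at
      fixed \<open>y\<close>; the exceptional set is null in the product, so the quantifiers may be
      exchanged.\<close>
    have "AE x in lborel. AE y in N. F x y \<le> A y"
    proof (subst P.AE_commute)
      show "{x \<in> space (lborel \<Otimes>\<^sub>M N). F (fst x) (snd x) \<le> A (snd x)} \<in> sets (lborel \<Otimes>\<^sub>M N)"
        by measurable
      show "AE y in N. AE x in lborel. F x y \<le> A y"
        unfolding A_def 2 Lp_norm_top by (intro AE_I2 esssup_AE)
    qed
    then have "AE x in lborel. (\<integral>\<^sup>+y. F x y \<partial>N) \<le> S"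
      unfolding S_def by eventually_elim (rule nn_integral_mono_AE)
    then show ?thesis unfolding 2 Lp_norm_top by (intro esssup_I) auto
  qed
  then show ?thesis unfolding S_def A_def .
qed

lemma Lp_norm_cmult_le:
  fixes h :: "real^'n::finite \<Rightarrow> ennreal"
  assumes "1 \<le> p" and [measurable]: "h \<in> borel_measurable lborel"
  shows "Lp_norm p (\<lambda>x. c * h x) \<le> c * Lp_norm p h"
  using assms(1)
proof (cases p rule: ennreal_ge_1_cases)
  case (1 r)
  have "(\<integral>\<^sup>+x. ennreal_powr (c * h x) r \<partial>lborel) = ennreal_powr c r * (\<integral>\<^sup>+x. ennreal_powr (h x) r \<partial>lborel)"
    unfolding ennreal_powr_mult by (intro nn_integral_cmult) measurable
  then show ?thesis unfolding 1 Lp_norm_ennreal[OF 1(2)]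
    using 1(2) by (simp add: ennreal_powr_mult ennreal_powr_powr)
next
  case 2
  show ?thesis unfolding 2 Lp_norm_top
  proof (rule esssup_I)
    show "AE x in lborel. c * h x \<le> c * esssup lborel h"
      using esssup_AE[of h lborel] by eventually_elim (rule mult_left_mono, auto)
  qed measurable
qed

lemma Lp_norm_cmult:
  fixes h :: "real^'n::finite \<Rightarrow> ennreal"
  assumes "1 \<le> p" and [measurable]: "h \<in> borel_measurable lborel" and "0 < c" "c < top"
  shows "Lp_norm p (\<lambda>x. c * h x) = c * Lp_norm p h"
proof (rule antisym)
  have c: "inverse c * c = 1" using ennreal_inverse_mult_self[OF assms(3,4)] by (simp add: mult.commute)
  have "Lp_norm p h = Lp_norm p (\<lambda>x. inverse c * (c * h x))"
    using c by (simp add: mult.assoc[symmetric])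
  also have "\<dots> \<le> inverse c * Lp_norm p (\<lambda>x. c * h x)"
    by (rule Lp_norm_cmult_le) (use assms in measurable)
  finally have "c * Lp_norm p h \<le> c * (inverse c * Lp_norm p (\<lambda>x. c * h x))"
    by (rule mult_left_mono) simp
  then show "c * Lp_norm p h \<le> Lp_norm p (\<lambda>x. c * h x)"
    using c by (simp add: mult.assoc[symmetric] mult.commute[of c])
qed (rule Lp_norm_cmult_le[OF assms(1,2)])

text \<open>Minkowski's inequality for counting measure; countability of the index type supplies
  sigma-finiteness and joint measurability.\<close>

lemma Lp_norm_count_sum:
  fixes F :: "'i::countable \<Rightarrow> real^'n::finite \<Rightarrow> ennreal"
  assumes "1 \<le> p" and [measurable]: "\<And>i. F i \<in> borel_measurable lborel"
  shows "Lp_norm p (\<lambda>x. \<integral>\<^sup>+i. F i x \<partial>count_space UNIV) \<le> (\<integral>\<^sup>+i. Lp_norm p (F i) \<partial>count_space UNIV)"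
proof -
  have "(\<lambda>(i, x). F i x) \<in> borel_measurable (count_space UNIV \<Otimes>\<^sub>M lborel)"
    by (rule measurable_pair_measure_countable1) auto
  from measurable_compose[OF measurable_pair_swap' this]
  have "(\<lambda>(x, i). F i x) \<in> borel_measurable (lborel \<Otimes>\<^sub>M count_space UNIV)"
    by (simp add: case_prod_beta)
  then show ?thesis
    by (intro Lp_norm_nn_integral assms sigma_finite_measure_count_space)
qed

text \<open>Obtained from the countable sum with the two-element index type
  \<open>bool\<close>.\<close>

lemma Lp_norm_add:
  fixes h k :: "real^'n::finite \<Rightarrow> ennreal"
  assumes "1 \<le> p" and [measurable]: "h \<in> borel_measurable lborel" "k \<in> borel_measurable lborel"
  shows "Lp_norm p (\<lambda>x. h x + k x) \<le> Lp_norm p h + Lp_norm p k"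
proof -
  have *: "(\<integral>\<^sup>+i. (f i::ennreal) \<partial>count_space UNIV) = f True + f False" for f
    by (subst nn_integral_count_space_finite) (auto simp: UNIV_bool)
  have m: "(\<lambda>x. (if i then h else k) x) \<in> borel_measurable lborel" for i :: bool by (cases i) auto
  show ?thesis
    using Lp_norm_count_sum[OF assms(1), of "\<lambda>i x. (if i then h else k) x", OF m]
    unfolding * by (simp cong: if_cong)
qed

section \<open>Translations, reflections and Hoelder's inequality\<close>

lemma lborel_distr_isometry:
  assumes "\<bar>c\<bar> = 1"
  shows "distr lborel borel (\<lambda>x. t + c *\<^sub>R x) = (lborel :: 'a::euclidean_space measure)"
  using lborel_affine[of c t] assms by (auto simp: density_1)

lemma nn_integral_lborel_isometry:
  fixes h :: "'a::euclidean_space \<Rightarrow> ennreal"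
  assumes "\<bar>c\<bar> = 1" and [measurable]: "h \<in> borel_measurable borel"
  shows "(\<integral>\<^sup>+x. h (t + c *\<^sub>R x) \<partial>lborel) = (\<integral>\<^sup>+x. h x \<partial>lborel)"
  by (subst (2) lborel_distr_isometry[OF assms(1), of t, symmetric]) (simp add: nn_integral_distr)

lemma nn_integral_lborel_translate:
  fixes h :: "'a::euclidean_space \<Rightarrow> ennreal"
  assumes [measurable]: "h \<in> borel_measurable borel"
  shows "(\<integral>\<^sup>+x. h (x - t) \<partial>lborel) = (\<integral>\<^sup>+x. h x \<partial>lborel)"
  using nn_integral_lborel_isometry[of 1 h "-t"] by simp

lemma nn_integral_lborel_reflect:
  fixes h :: "'a::euclidean_space \<Rightarrow> ennreal"
  assumes [measurable]: "h \<in> borel_measurable borel"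
  shows "(\<integral>\<^sup>+x. h (t - x) \<partial>lborel) = (\<integral>\<^sup>+x. h x \<partial>lborel)"
  using nn_integral_lborel_isometry[of "-1" h t] by simp

lemma Lp_norm_isometry:
  fixes h :: "real^'n::finite \<Rightarrow> ennreal"
  assumes p: "1 \<le> p" and c: "\<bar>c\<bar> = 1" and [measurable]: "h \<in> borel_measurable borel"
  shows "Lp_norm p (\<lambda>x. h (t + c *\<^sub>R x)) = Lp_norm p h"
  using p
proof (cases p rule: ennreal_ge_1_cases)
  case (1 r)
  show ?thesis unfolding 1 Lp_norm_ennreal[OF 1(2)]
    by (subst nn_integral_lborel_isometry[OF c]) auto
next
  case 2
  have *: "(AE x in lborel. h (t + c *\<^sub>R x) \<le> z) \<longleftrightarrow> (AE x in lborel. h x \<le> z)" for z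
    by (subst (2) lborel_distr_isometry[OF c, of t, symmetric]) (simp add: AE_distr_iff)
  show ?thesis unfolding 2 Lp_norm_top by (simp add: esssup_eq_AE *)
qed

lemma Lp_norm_translate:
  fixes h :: "real^'n::finite \<Rightarrow> ennreal"
  assumes "1 \<le> p" "h \<in> borel_measurable borel"
  shows "Lp_norm p (\<lambda>x. h (x - t)) = Lp_norm p h"
  using Lp_norm_isometry[OF assms(1) _ assms(2), of 1 "-t"] by simp

text \<open>Removes exponents such as \<open>1 / r\<close> from constants, so that later bounds have
  the same form for every \<open>p\<close>.\<close>

lemma ennreal_powr_le_1_plus: "0 \<le> a \<Longrightarrow> a \<le> 1 \<Longrightarrow> ennreal_powr x a \<le> 1 + x"
proof (cases x)
  case (real r)
  assume a: "0 \<le> a" "a \<le> 1"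
  have "r powr a \<le> 1 + r"
  proof (cases "r \<le> 1")
    case True
    then show ?thesis using a real powr_mono2[of a r 1] by simp
  next
    case False
    then show ?thesis using powr_mono[of a 1 r] a by simp
  qed
  then show ?thesis using real
    by (simp add: ennreal_powr_ennreal flip: ennreal_1 ennreal_plus)
qed simp

text \<open>Hoelder's inequality for a kernel that is integrable and bounded, hence in every dual
  space. For finite exponent \<open>r\<close> Jensen's inequality yields the constant
  \<open>S powr (1 - 1 / r) * c powr (1 / r)\<close>; the cruder product form also covers
  \<open>p = \<infinity>\<close>.\<close>

lemma nn_integral_mult_le_Lp_norm:
  fixes h k :: "real^'n::finite \<Rightarrow> ennreal"
  assumes p: "1 \<le> p" and [measurable]: "h \<in> borel_measurable lborel" "k \<in> borel_measurable lborel"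
    and k: "\<And>x. k x \<le> c" and fin: "(\<integral>\<^sup>+x. k x \<partial>lborel) < top"
  shows "(\<integral>\<^sup>+x. h x * k x \<partial>lborel) \<le> (1 + (\<integral>\<^sup>+x. k x \<partial>lborel)) * (1 + c) * Lp_norm p h"
  using p
proof (cases p rule: ennreal_ge_1_cases)
  case (1 r)
  define S where "S = (\<integral>\<^sup>+x. k x \<partial>lborel)"
  have "ennreal_powr (\<integral>\<^sup>+x. h x * k x \<partial>lborel) r
    \<le> ennreal_powr S (r - 1) * (\<integral>\<^sup>+x. ennreal_powr (h x) r * k x \<partial>lborel)"
    unfolding S_def using 1 fin by (intro nn_integral_Jensen_powr) auto
  also have "\<dots> \<le> ennreal_powr S (r - 1) * (\<integral>\<^sup>+x. c * ennreal_powr (h x) r \<partial>lborel)"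
    using k by (intro mult_left_mono nn_integral_mono) (auto simp: mult.commute[of c] mult_left_mono)
  also have "\<dots> = ennreal_powr S (r - 1) * (c * (\<integral>\<^sup>+x. ennreal_powr (h x) r \<partial>lborel))"
    by (subst nn_integral_cmult) auto
  finally have "ennreal_powr (ennreal_powr (\<integral>\<^sup>+x. h x * k x \<partial>lborel) r) (1 / r)
    \<le> ennreal_powr (ennreal_powr S (r - 1) * (c * (\<integral>\<^sup>+x. ennreal_powr (h x) r \<partial>lborel))) (1 / r)"
    using 1 by (intro ennreal_powr_mono) auto
  then have "(\<integral>\<^sup>+x. h x * k x \<partial>lborel)
      \<le> ennreal_powr S ((r - 1) / r) * (ennreal_powr c (1 / r) * Lp_norm p h)"
    unfolding 1(1) Lp_norm_ennreal[OF 1(2)] using 1(2)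
    by (simp add: ennreal_powr_mult ennreal_powr_powr)
  also have "\<dots> \<le> (1 + S) * ((1 + c) * Lp_norm p h)"
    using 1(2) by (intro mult_mono ennreal_powr_le_1_plus) (auto simp: field_simps)
  finally show ?thesis by (simp add: S_def mult.assoc)
next
  case 2
  have "(\<integral>\<^sup>+x. h x * k x \<partial>lborel) \<le> (\<integral>\<^sup>+x. esssup lborel h * k x \<partial>lborel)"
    using esssup_AE[of h lborel]
    by (intro nn_integral_mono_AE) (auto elim!: eventually_mono intro!: mult_right_mono)
  also have "\<dots> = (\<integral>\<^sup>+x. k x \<partial>lborel) * 1 * esssup lborel h"
    by (subst nn_integral_cmult) (auto simp: mult.commute)
  also have "\<dots> \<le> (1 + (\<integral>\<^sup>+x. k x \<partial>lborel)) * (1 + c) * esssup lborel h"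
    by (intro mult_mono) (auto simp: add_increasing)
  finally show ?thesis unfolding 2 Lp_norm_top .
qed

section \<open>Polynomial weights\<close>

text \<open>The name stands for the Japanese bracket; note that it is the squared bracket that is raised to
  the power \<open>a\<close>.\<close>

definition jb :: "real \<Rightarrow> 'a::euclidean_space \<Rightarrow> real" where
  "jb a x = (1 + (norm x)\<^sup>2) powr a"

lemma one_plus_norm_pos [simp]: "0 < 1 + (norm x)\<^sup>2"
  by (simp add: add_pos_nonneg)

lemma jb_pos [simp]: "0 < jb a x"
  using one_plus_norm_pos[of x] by (simp add: jb_def del: one_plus_norm_pos)

lemma jb_nonneg [simp]: "0 \<le> jb a x"
  by (simp add: jb_def)

lemma jb_0 [simp]: "jb 0 x = 1"
  using one_plus_norm_pos[of x] by (simp add: jb_def del: one_plus_norm_pos)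

lemma jb_add: "jb a x * jb b x = jb (a + b) x"
  by (simp add: jb_def powr_add)

lemma jb_mono: "a \<le> b \<Longrightarrow> jb a x \<le> jb b x"
  unfolding jb_def by (rule powr_mono) auto

lemma jb_ge_1: "0 \<le> a \<Longrightarrow> 1 \<le> jb a x"
  using jb_mono[of 0 a x] by simp

lemma jb_le_1: "a \<le> 0 \<Longrightarrow> jb a x \<le> 1"
  using jb_mono[of a 0 x] by simp

lemma jb_minus [simp]: "jb a (- x) = jb a x"
  by (simp add: jb_def)

lemma jb_minus_commute: "jb a (x - y) = jb a (y - x)"
  by (simp add: jb_def norm_minus_commute)

lemma jb_measurable [measurable]: "jb a \<in> borel_measurable borel"
  unfolding jb_def[abs_def] by measurable

text \<open>Peetre's inequality: it lets a weight pass from a sum to its summands.\<close>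

lemma one_plus_norm_add: "1 + (norm (x + y))\<^sup>2 \<le> 2 * ((1 + (norm x)\<^sup>2) * (1 + (norm y)\<^sup>2))"
proof -
  have "(norm (x + y))\<^sup>2 \<le> (norm x + norm y)\<^sup>2"
    by (rule power_mono[OF norm_triangle_ineq]) simp
  also have "\<dots> \<le> 2 * (norm x)\<^sup>2 + 2 * (norm y)\<^sup>2"
    using zero_le_power2[of "norm x - norm y"] by (simp add: power2_eq_square algebra_simps)
  finally have "1 + (norm (x + y))\<^sup>2 \<le> 2 * (1 + (norm x)\<^sup>2 + (norm y)\<^sup>2)"
    by simp
  also have "\<dots> \<le> 2 * ((1 + (norm x)\<^sup>2) * (1 + (norm y)\<^sup>2))"
    by (simp add: algebra_simps)
  finally show ?thesis .
qed

lemma jb_submult: "0 \<le> a \<Longrightarrow> jb a (x + y) \<le> 2 powr a * jb a x * jb a y"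
  using powr_mono2[OF _ _ one_plus_norm_add[of x y], of a]
  by (simp add: jb_def powr_mult add_nonneg_nonneg)

text \<open>Peetre's inequality for decaying weights. Applied to \<open>x - t\<close> and
  \<open>t - y\<close> it turns decay about two points into decay in their distance.\<close>

lemma jb_negative_submult:
  assumes "0 \<le> a"
  shows "jb (- a) x * jb (- a) y \<le> 2 powr a * jb (- a) (x + y)"
proof -
  have "jb (- a) x * jb (- a) y = jb (- a) x * jb (- a) y * (jb a (x + y) * jb (- a) (x + y))"
    by (simp add: jb_add)
  also have "\<dots> \<le> jb (- a) x * jb (- a) y * (2 powr a * jb a x * jb a y * jb (- a) (x + y))"
    by (intro mult_left_mono mult_right_mono jb_submult assms) auto
  also have "\<dots> = 2 powr a * ((jb a x * jb (- a) x) * (jb a y * jb (- a) y)) * jb (- a) (x + y)"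
    by simp
  finally show ?thesis unfolding jb_add by simp
qed

text \<open>Additive counterpart of \<open>jb_submult\<close>: one summand carries at least half of
  the norm, so in each term the weight can be placed on a single factor of a convolution.\<close>

lemma jb_subadd:
  assumes "0 \<le> a"
  shows "jb a (x + y) \<le> 4 powr a * (jb a x + jb a y)"
proof -
  have "(norm (x + y))\<^sup>2 \<le> (norm x + norm y)\<^sup>2"
    by (rule power_mono[OF norm_triangle_ineq]) simp
  also have "\<dots> \<le> 2 * (norm x)\<^sup>2 + 2 * (norm y)\<^sup>2"
    using zero_le_power2[of "norm x - norm y"] by (simp add: power2_eq_square algebra_simps)
  finally have "(norm (x + y))\<^sup>2 \<le> 2 * (norm x)\<^sup>2 + 2 * (norm y)\<^sup>2" .
  then have le: "1 + (norm (x + y))\<^sup>2 \<le> 4 * max (1 + (norm x)\<^sup>2) (1 + (norm y)\<^sup>2)"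
  proof -
    define M where "M = max (1 + (norm x)\<^sup>2) (1 + (norm y)\<^sup>2)"
    have "1 + (norm x)\<^sup>2 \<le> M" "1 + (norm y)\<^sup>2 \<le> M" by (auto simp: M_def)
    with \<open>(norm (x + y))\<^sup>2 \<le> 2 * (norm x)\<^sup>2 + 2 * (norm y)\<^sup>2\<close> have "1 + (norm (x + y))\<^sup>2 \<le> 4 * M"
      by linarith
    then show ?thesis by (simp add: M_def)
  qed
  have "jb a (x + y) \<le> 4 powr a * (max (1 + (norm x)\<^sup>2) (1 + (norm y)\<^sup>2)) powr a"
    using powr_mono2[OF assms _ le] by (simp add: jb_def powr_mult add_nonneg_nonneg)
  also have "(max (1 + (norm x)\<^sup>2) (1 + (norm y)\<^sup>2)) powr a \<le> jb a x + jb a y"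
    by (auto simp: max_def jb_def)
  finally show ?thesis by simp
qed

text \<open>Summation over dyadic shells. The factor 2 in the hypothesis reflects that
  \<open>jb\<close> raises the squared bracket to the power \<open>a\<close>.\<close>

lemma nn_integral_jb_finite:
  assumes a: "2 * a < - real DIM('a)"
  shows "(\<integral>\<^sup>+x. ennreal (jb a (x::'a::euclidean_space)) \<partial>lborel) < top"
proof -
  define d where "d = DIM('a)"
  define c where "c = 2 powr (2 * a)"
  have c: "0 < c" "0 \<le> c" by (auto simp: c_def)
  define B :: "nat \<Rightarrow> 'a set" where "B k = cball 0 (2 ^ k)" for k
  have em: "emeasure lborel (B k) = ennreal (unit_ball_vol d * (2 ^ k) ^ d)" for k
    unfolding B_def d_def by (subst emeasure_cball) auto
  have [measurable]: "B k \<in> sets borel" for k unfolding B_def by simp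
  \<comment> \<open>Between the radii \<open>2 ^ k\<close> and \<open>2 ^ Suc k\<close> the weight
    is at most \<open>c ^ k\<close>, and the shell is enlarged to the whole ball; together with the
    volumes this gives a geometric series of ratio \<open>r = c * 2 ^ d < 1\<close>.\<close>
  have pt: "ennreal (jb a x) \<le> indicator (B 0) x + (\<Sum>k. ennreal (c ^ k) * indicator (B (Suc k)) x)" for x :: 'a
  proof (cases "norm x \<le> 1")
    case True
    then show ?thesis using jb_le_1[of a x] a by (simp add: B_def add_increasing2)
  next
    case False
    define k where "k = nat \<lfloor>log 2 (norm x)\<rfloor>"
    have "0 \<le> log 2 (norm x)" using False by (subst zero_le_log_cancel_iff) auto
    then have "real k = of_int \<lfloor>log 2 (norm x)\<rfloor>" by (simp add: k_def)
    then have k: "real k \<le> log 2 (norm x)" "log 2 (norm x) \<le> real (Suc k)"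
      using floor_correct[of "log 2 (norm x)"] by linarith+
    have "2 powr real k \<le> norm x" using k(1) False by (subst le_log_iff[symmetric]) auto
    then have k1: "2 ^ k \<le> norm x" by (simp add: powr_realpow)
    have "norm x \<le> 2 powr real (Suc k)" using k(2) False by (subst log_le_iff[symmetric]) auto
    then have k2: "norm x \<le> 2 ^ Suc k" by (simp only: powr_realpow)
    have "(2::real) ^ (2 * k) = (2 ^ k)\<^sup>2" by (simp add: power_mult mult.commute)
    also have "\<dots> \<le> (norm x)\<^sup>2" by (rule power_mono[OF k1]) simp
    also have "\<dots> \<le> 1 + (norm x)\<^sup>2" by simp
    finally have "jb a x \<le> (2 ^ (2 * k)) powr a"
      unfolding jb_def using a by (intro powr_mono2') auto
    also have "\<dots> = c ^ k"
      unfolding c_def by (simp add: powr_powr mult.commute mult.left_commute flip: powr_realpow)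
    finally have "ennreal (jb a x) \<le> ennreal (c ^ k) * indicator (B (Suc k)) x"
      using k2 by (simp add: B_def ennreal_leI)
    also have "\<dots> \<le> (\<Sum>k. ennreal (c ^ k) * indicator (B (Suc k)) x)"
    proof -
      have "f k \<le> (\<Sum>k. f k)" for f :: "nat \<Rightarrow> ennreal"
        using sum_le_suminf[of f "{k}"] by simp
      then show ?thesis .
    qed
    finally show ?thesis by (simp add: add_increasing)
  qed
  define r where "r = c * 2 ^ d"
  have "r = 2 powr (2 * a + d)" by (simp add: r_def c_def powr_add powr_realpow)
  also have "\<dots> < 2 powr 0" using a by (intro powr_less_mono) (auto simp: d_def)
  finally have r: "0 \<le> r" "r < 1" using c by (auto simp: r_def)
  have u: "0 \<le> unit_ball_vol (real d)" by (simp add: unit_ball_vol_nonneg)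
  have "(\<integral>\<^sup>+x. ennreal (jb a (x::'a)) \<partial>lborel)
    \<le> (\<integral>\<^sup>+x. indicator (B 0) x + (\<Sum>k. ennreal (c ^ k) * indicator (B (Suc k)) x) \<partial>lborel)"
    by (intro nn_integral_mono pt)
  also have "\<dots> = emeasure lborel (B 0) + (\<Sum>k. ennreal (c ^ k) * emeasure lborel (B (Suc k)))"
    by (subst nn_integral_add) (auto simp: nn_integral_suminf nn_integral_cmult)
  also have "(\<lambda>k. ennreal (c ^ k) * emeasure lborel (B (Suc k)))
    = (\<lambda>k. ennreal (unit_ball_vol d * 2 ^ d * r ^ k))"
    unfolding em r_def using c u
    by (auto simp: fun_eq_iff ennreal_mult[symmetric] power_mult_distrib ac_simps power_commutes
        simp flip: power_mult intro!: arg_cong[where f=ennreal])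
  also have "(\<Sum>k. ennreal (unit_ball_vol d * 2 ^ d * r ^ k)) < top"
  proof -
    have "summable (\<lambda>k. unit_ball_vol d * 2 ^ d * r ^ k)"
      using r by (intro summable_mult summable_geometric) auto
    then show ?thesis
      using r u by (subst suminf_ennreal2) auto
  qed
  then have "emeasure lborel (B 0) + (\<Sum>k. ennreal (unit_ball_vol d * 2 ^ d * r ^ k)) < top"
    by (simp add: em)
  finally show ?thesis .
qed

section \<open>Convolution and weighted norms\<close>

definition nn_conv :: "('a::euclidean_space \<Rightarrow> ennreal) \<Rightarrow> ('a \<Rightarrow> ennreal) \<Rightarrow> 'a \<Rightarrow> ennreal" where
  "nn_conv a b w = (\<integral>\<^sup>+\<eta>. a (w - \<eta>) * b \<eta> \<partial>lborel)"

definition wnorm :: "ennreal \<Rightarrow> real \<Rightarrow> (real^'n::finite \<Rightarrow> ennreal) \<Rightarrow> ennreal" where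
  "wnorm q s a = Lp_norm q (\<lambda>w. a w * ennreal (jb (s / 2) w))"

lemma nn_conv_measurable [measurable]:
  assumes [measurable]: "a \<in> borel_measurable borel" "b \<in> borel_measurable borel"
  shows "nn_conv a b \<in> borel_measurable borel"
proof -
  have "(\<lambda>(w, \<eta>). a (w - \<eta>) * b \<eta>) \<in> borel_measurable (borel \<Otimes>\<^sub>M lborel)"
    by measurable
  then show ?thesis
    unfolding nn_conv_def[abs_def] using lborel.borel_measurable_nn_integral by fastforce
qed

lemma nn_conv_mono: "(\<And>w. a w \<le> a' w) \<Longrightarrow> (\<And>w. b w \<le> b' w) \<Longrightarrow> nn_conv a b w \<le> nn_conv a' b' w"
  unfolding nn_conv_def by (intro nn_integral_mono mult_mono) auto

lemma nn_conv_commute: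
  assumes [measurable]: "a \<in> borel_measurable borel" "b \<in> borel_measurable borel"
  shows "nn_conv a b w = nn_conv b a w"
  using nn_integral_lborel_reflect[of "\<lambda>\<eta>. a (w - \<eta>) * b \<eta>" w]
  unfolding nn_conv_def by (simp add: mult.commute)

lemma nn_conv_cmult_right:
  assumes [measurable]: "a \<in> borel_measurable borel" "b \<in> borel_measurable borel"
  shows "nn_conv a (\<lambda>w. c * b w) w = c * nn_conv a b w"
  unfolding nn_conv_def by (subst nn_integral_cmult[symmetric]) (auto simp: ac_simps)

lemma nn_integral_nn_conv:
  fixes a b :: "'a::euclidean_space \<Rightarrow> ennreal"
  assumes [measurable]: "a \<in> borel_measurable borel" "b \<in> borel_measurable borel"
  shows "(\<integral>\<^sup>+w. nn_conv a b w \<partial>lborel) = (\<integral>\<^sup>+w. a w \<partial>lborel) * (\<integral>\<^sup>+w. b w \<partial>lborel)"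
proof -
  have "(\<integral>\<^sup>+w. nn_conv a b w \<partial>lborel) = (\<integral>\<^sup>+\<eta>. \<integral>\<^sup>+w. a (w - \<eta>) * b \<eta> \<partial>lborel \<partial>lborel)"
    unfolding nn_conv_def by (rule lborel_pair.Fubini'[symmetric]) measurable
  also have "\<dots> = (\<integral>\<^sup>+\<eta>. (\<integral>\<^sup>+w. a w \<partial>lborel) * b \<eta> \<partial>lborel)"
    by (intro nn_integral_cong) (simp add: nn_integral_multc nn_integral_lborel_translate)
  finally show ?thesis by (simp add: nn_integral_cmult)
qed

text \<open>Young's inequality with one factor in \<open>L\<^sup>1\<close>: Minkowski's inequality
  applied to the translates of \<open>a\<close>.\<close>

lemma Lp_norm_nn_conv:
  fixes a b :: "real^'n::finite \<Rightarrow> ennreal"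
  assumes q: "1 \<le> q" and [measurable]: "a \<in> borel_measurable borel" "b \<in> borel_measurable borel"
  shows "Lp_norm q (nn_conv a b) \<le> Lp_norm q a * (\<integral>\<^sup>+w. b w \<partial>lborel)"
proof -
  have "Lp_norm q (nn_conv a b) \<le> (\<integral>\<^sup>+\<eta>. Lp_norm q (\<lambda>w. a (w - \<eta>) * b \<eta>) \<partial>lborel)"
    unfolding nn_conv_def[abs_def] by (intro Lp_norm_nn_integral q sigma_finite_lborel) measurable
  also have "\<dots> \<le> (\<integral>\<^sup>+\<eta>. Lp_norm q a * b \<eta> \<partial>lborel)"
  proof (rule nn_integral_mono)
    fix \<eta> :: "real^'n"
    show "Lp_norm q (\<lambda>w. a (w - \<eta>) * b \<eta>) \<le> Lp_norm q a * b \<eta>"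
      using Lp_norm_cmult_le[OF q, of "\<lambda>w. a (w - \<eta>)" "b \<eta>"] Lp_norm_translate[OF q, of a \<eta>]
      by (simp add: mult.commute)
  qed
  finally show ?thesis by (simp add: nn_integral_cmult)
qed

lemma wnorm_mono:
  assumes "1 \<le> q" and [measurable]: "a \<in> borel_measurable borel" and "\<And>w. a w \<le> b w"
  shows "wnorm q s a \<le> wnorm q s b"
  unfolding wnorm_def by (intro Lp_norm_mono assms mult_right_mono) auto

lemma wnorm_cmult_le:
  assumes q: "1 \<le> q" and [measurable]: "a \<in> borel_measurable borel"
  shows "wnorm q s (\<lambda>w. c * a w) \<le> c * wnorm q s a"
  unfolding wnorm_def using Lp_norm_cmult_le[OF q, of "\<lambda>w. a w * ennreal (jb (s / 2) w)" c]
  by (simp add: mult.assoc)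

lemma wnorm_cmult:
  assumes q: "1 \<le> q" and [measurable]: "a \<in> borel_measurable borel" and "0 < c" "c < top"
  shows "wnorm q s (\<lambda>w. c * a w) = c * wnorm q s a"
  unfolding wnorm_def using Lp_norm_cmult[OF q, of "\<lambda>w. a w * ennreal (jb (s / 2) w)" c] assms
  by (simp add: mult.assoc)

lemma wnorm_add:
  assumes q: "1 \<le> q" and [measurable]: "a \<in> borel_measurable borel" "b \<in> borel_measurable borel"
  shows "wnorm q s (\<lambda>w. a w + b w) \<le> wnorm q s a + wnorm q s b"
  unfolding wnorm_def distrib_right by (intro Lp_norm_add q) measurable

lemma wnorm_count_sum:
  fixes F :: "'i::countable \<Rightarrow> real^'n::finite \<Rightarrow> ennreal"
  assumes "1 \<le> q" and [measurable]: "\<And>i. F i \<in> borel_measurable borel"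
  shows "wnorm q s (\<lambda>x. \<integral>\<^sup>+i. F i x \<partial>count_space UNIV) \<le> (\<integral>\<^sup>+i. wnorm q s (F i) \<partial>count_space UNIV)"
proof -
  have "(\<lambda>w. (\<integral>\<^sup>+i. F i w \<partial>count_space UNIV) * ennreal (jb (s / 2) w))
    = (\<lambda>w. \<integral>\<^sup>+i. F i w * ennreal (jb (s / 2) w) \<partial>count_space UNIV)"
    by (simp add: nn_integral_multc)
  then show ?thesis unfolding wnorm_def
    using Lp_norm_count_sum[OF assms(1), of "\<lambda>i w. F i w * ennreal (jb (s / 2) w)"] by simp
qed

lemma wnorm_reflect:
  fixes a :: "real^'n::finite \<Rightarrow> ennreal"
  assumes q: "1 \<le> q" and [measurable]: "a \<in> borel_measurable borel"
  shows "wnorm q s (\<lambda>w. a (- w)) = wnorm q s a"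
  using Lp_norm_isometry[OF q, of "-1" "\<lambda>w. a w * ennreal (jb (s / 2) w)" 0]
  by (simp add: wnorm_def)

text \<open>Splitting the weight multiplicatively leaves a weight on both factors. This suits a
  rapidly decreasing \<open>b\<close>, whose weighted integral is finite.\<close>

lemma wnorm_nn_conv_le:
  fixes a b :: "real^'n::finite \<Rightarrow> ennreal"
  assumes q: "1 \<le> q" and s: "0 \<le> s"
    and [measurable]: "a \<in> borel_measurable borel" "b \<in> borel_measurable borel"
  shows "wnorm q s (nn_conv a b) \<le> ennreal (2 powr (s / 2)) * (\<integral>\<^sup>+w. b w * ennreal (jb (s / 2) w) \<partial>lborel) * wnorm q s a"
proof -
  let ?a = "\<lambda>w. a w * ennreal (jb (s / 2) w)" and ?b = "\<lambda>w. b w * ennreal (jb (s / 2) w)"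
  have "nn_conv a b w * ennreal (jb (s / 2) w) \<le> ennreal (2 powr (s / 2)) * nn_conv ?a ?b w" for w
  proof -
    have "nn_conv a b w * ennreal (jb (s / 2) w)
      = (\<integral>\<^sup>+\<eta>. a (w - \<eta>) * b \<eta> * ennreal (jb (s / 2) w) \<partial>lborel)"
      unfolding nn_conv_def by (simp add: nn_integral_multc)
    also have "\<dots> \<le> (\<integral>\<^sup>+\<eta>. ennreal (2 powr (s / 2)) * (?a (w - \<eta>) * ?b \<eta>) \<partial>lborel)"
    proof (rule nn_integral_mono)
      fix \<eta> :: "real^'n"
      have "ennreal (jb (s / 2) w) \<le> ennreal (2 powr (s / 2) * jb (s / 2) (w - \<eta>) * jb (s / 2) \<eta>)"
        using jb_submult[of "s / 2" "w - \<eta>" \<eta>] s by (intro ennreal_leI) auto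
      then have "a (w - \<eta>) * b \<eta> * ennreal (jb (s / 2) w)
        \<le> a (w - \<eta>) * b \<eta> * ennreal (2 powr (s / 2) * jb (s / 2) (w - \<eta>) * jb (s / 2) \<eta>)"
        by (rule mult_left_mono) simp
      then show "a (w - \<eta>) * b \<eta> * ennreal (jb (s / 2) w)
        \<le> ennreal (2 powr (s / 2)) * (?a (w - \<eta>) * ?b \<eta>)"
        by (simp add: ennreal_mult ac_simps)
    qed
    also have "\<dots> = ennreal (2 powr (s / 2)) * nn_conv ?a ?b w"
      unfolding nn_conv_def by (rule nn_integral_cmult) measurable
    finally show ?thesis .
  qed
  then have "wnorm q s (nn_conv a b) \<le> Lp_norm q (\<lambda>w. ennreal (2 powr (s / 2)) * nn_conv ?a ?b w)"
    unfolding wnorm_def by (intro Lp_norm_mono q) auto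
  also have "\<dots> \<le> ennreal (2 powr (s / 2)) * Lp_norm q (nn_conv ?a ?b)"
    by (intro Lp_norm_cmult_le q) measurable
  also have "\<dots> \<le> ennreal (2 powr (s / 2)) * (Lp_norm q ?a * (\<integral>\<^sup>+w. ?b w \<partial>lborel))"
    by (intro mult_left_mono Lp_norm_nn_conv q) auto
  finally show ?thesis by (simp add: wnorm_def ac_simps)
qed

text \<open>Here neither factor decays rapidly. Splitting the weight additively leaves one factor
  unweighted in each term, and \<open>emb\<close> bounds the integral of that factor; the 2 in the
  constant counts the two terms.\<close>

lemma wnorm_nn_conv_algebra:
  fixes a b :: "real^'n::finite \<Rightarrow> ennreal"
  assumes q: "1 \<le> q" and s: "0 \<le> s"
    and emb: "\<And>b :: real^'n \<Rightarrow> ennreal. b \<in> borel_measurable borel \<Longrightarrow> (\<integral>\<^sup>+w. b w \<partial>lborel) \<le> C * wnorm q s b"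
    and [measurable]: "a \<in> borel_measurable borel" "b \<in> borel_measurable borel"
  shows "wnorm q s (nn_conv a b) \<le> ennreal (2 * 4 powr (s / 2)) * C * (wnorm q s a * wnorm q s b)"
proof -
  let ?a = "\<lambda>w. a w * ennreal (jb (s / 2) w)" and ?b = "\<lambda>w. b w * ennreal (jb (s / 2) w)"
  let ?c = "ennreal (4 powr (s / 2))"
  have "nn_conv a b w * ennreal (jb (s / 2) w) \<le> ?c * (nn_conv ?a b w + nn_conv ?b a w)" for w
  proof -
    have "nn_conv a b w * ennreal (jb (s / 2) w)
      = (\<integral>\<^sup>+\<eta>. a (w - \<eta>) * b \<eta> * ennreal (jb (s / 2) w) \<partial>lborel)"
      unfolding nn_conv_def by (simp add: nn_integral_multc)
    also have "\<dots> \<le> (\<integral>\<^sup>+\<eta>. ?c * (?a (w - \<eta>) * b \<eta> + a (w - \<eta>) * ?b \<eta>) \<partial>lborel)"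
    proof (rule nn_integral_mono)
      fix \<eta> :: "real^'n"
      have "ennreal (jb (s / 2) w) \<le> ennreal (4 powr (s / 2) * (jb (s / 2) (w - \<eta>) + jb (s / 2) \<eta>))"
        using jb_subadd[of "s / 2" "w - \<eta>" \<eta>] s by (intro ennreal_leI) auto
      then have "a (w - \<eta>) * b \<eta> * ennreal (jb (s / 2) w)
        \<le> a (w - \<eta>) * b \<eta> * ennreal (4 powr (s / 2) * (jb (s / 2) (w - \<eta>) + jb (s / 2) \<eta>))"
        by (rule mult_left_mono) simp
      then show "a (w - \<eta>) * b \<eta> * ennreal (jb (s / 2) w)
        \<le> ?c * (?a (w - \<eta>) * b \<eta> + a (w - \<eta>) * ?b \<eta>)"
        by (simp add: ennreal_mult distrib_left ac_simps)
    qed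
    also have "\<dots> = ?c * (nn_conv ?a b w + nn_conv a ?b w)"
      unfolding nn_conv_def by (subst nn_integral_cmult) (auto simp: nn_integral_add)
    \<comment> \<open>The weighted factor moves to the first place, the one measured in the
      \<open>q\<close>-norm by Young's inequality.\<close>
    also have "nn_conv a ?b w = nn_conv ?b a w" by (rule nn_conv_commute) measurable
    finally show ?thesis .
  qed
  then have "wnorm q s (nn_conv a b) \<le> Lp_norm q (\<lambda>w. ?c * (nn_conv ?a b w + nn_conv ?b a w))"
    unfolding wnorm_def by (intro Lp_norm_mono q) auto
  also have "\<dots> \<le> ?c * Lp_norm q (\<lambda>w. nn_conv ?a b w + nn_conv ?b a w)"
    by (intro Lp_norm_cmult_le q) measurable
  also have "\<dots> \<le> ?c * (Lp_norm q (nn_conv ?a b) + Lp_norm q (nn_conv ?b a))"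
    by (intro mult_left_mono Lp_norm_add q) auto
  also have "\<dots> \<le> ?c * (wnorm q s a * (\<integral>\<^sup>+w. b w \<partial>lborel) + wnorm q s b * (\<integral>\<^sup>+w. a w \<partial>lborel))"
    unfolding wnorm_def by (intro mult_left_mono add_mono Lp_norm_nn_conv q) auto
  also have "\<dots> \<le> ?c * (wnorm q s a * (C * wnorm q s b) + wnorm q s b * (C * wnorm q s a))"
    by (intro mult_left_mono add_mono emb) auto
  also have "\<dots> = (2 * ?c) * C * (wnorm q s a * wnorm q s b)"
    by (simp only: mult_2 distrib_right distrib_left mult.commute mult.left_commute)
  also have "2 * ?c = ennreal (2 * 4 powr (s / 2))"
    by (simp only: ennreal_mult' ennreal_numeral powr_ge_zero)
  finally show ?thesis .
qed

text \<open>For \<open>q = 1\<close> the weight is at least 1. Otherwise Hoelder's inequality pairs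
  the weighted function with the weight of order \<open>- s\<close>, whose \<open>q'\<close>-th
  power is integrable because \<open>s * q' > n\<close>.\<close>

lemma wnorm_l1_embedding:
  assumes q: "1 \<le> q"
    and cond: "q = 1 \<and> 0 \<le> s \<or>
         (\<exists>q'. 1 / q + 1 / q' = 1 \<and> ennreal s > of_nat CARD('n) / q')"
  obtains C where "C < top" "0 \<le> s"
    "\<And>b :: real^'n::finite \<Rightarrow> ennreal. b \<in> borel_measurable borel \<Longrightarrow>
       (\<integral>\<^sup>+w. b w \<partial>lborel) \<le> C * wnorm q s b"
proof -
  have s: "0 \<le> s"
  proof (rule ccontr)
    assume "\<not> 0 \<le> s"
    \<comment> \<open>\<open>ennreal\<close> truncates negative numbers to 0 and nothing lies
      strictly below 0, so the second alternative excludes negative \<open>s\<close>.\<close>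
    then have "ennreal s = 0" by (simp add: ennreal_neg)
    then show False using cond \<open>\<not> 0 \<le> s\<close> by auto
  qed
  show thesis
  proof (cases "q = 1")
    case True
    have "(\<integral>\<^sup>+w. b w \<partial>lborel) \<le> 1 * wnorm q s b" for b :: "real^'n \<Rightarrow> ennreal"
    proof -
      have "b w \<le> b w * ennreal (jb (s / 2) w)" for w
        using mult_left_mono[of 1 "ennreal (jb (s / 2) w)" "b w"] ennreal_leI[OF jb_ge_1[of "s / 2" w]] s
        by simp
      then show ?thesis unfolding wnorm_def True Lp_norm_1 by (simp add: nn_integral_mono)
    qed
    then show thesis using s by (intro that[of 1]) auto
  next
    case q1: False
    then obtain q' where q': "1 / q + 1 / q' = 1" "ennreal s > of_nat CARD('n) / q'"
      using cond by auto
    show thesis using q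
    proof (cases q rule: ennreal_ge_1_cases)
      case 2
      have "1 / q' = 1" using q'(1) 2 by simp
      then have "q' = 1"
        by (cases "q' = 0"; cases q') (auto simp: ennreal_1[symmetric] divide_ennreal simp del: ennreal_1)
      then have "of_nat CARD('n) / q' = ennreal (real CARD('n)) / ennreal 1"
        by (simp add: ennreal_of_nat_eq_real_of_nat)
      also have "\<dots> = ennreal (real CARD('n))" by (subst divide_ennreal) auto
      finally have n: "real CARD('n) < s"
        using q'(2) s by (simp add: ennreal_less_iff)
      have "(\<integral>\<^sup>+w. b w \<partial>lborel) \<le> (\<integral>\<^sup>+w. ennreal (jb (- s / 2) (w::real^'n)) \<partial>lborel) * wnorm q s b"
        if [measurable]: "b \<in> borel_measurable borel" for b :: "real^'n \<Rightarrow> ennreal"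
      proof -
        have "(\<integral>\<^sup>+w. b w \<partial>lborel) \<le> (\<integral>\<^sup>+w. ennreal (jb (- s / 2) (w::real^'n)) * wnorm q s b \<partial>lborel)"
        proof (rule nn_integral_mono_AE)
          show "AE w in lborel. b w \<le> ennreal (jb (- s / 2) w) * wnorm q s b"
            using esssup_AE[of "\<lambda>w. b w * ennreal (jb (s / 2) w)" lborel]
          proof eventually_elim
            case (elim w)
            have "b w = ennreal (jb (- s / 2) w) * (b w * ennreal (jb (s / 2) w))"
              by (simp add: ac_simps jb_add flip: ennreal_mult)
            also have "\<dots> \<le> ennreal (jb (- s / 2) w) * wnorm q s b"
              using elim unfolding wnorm_def 2 Lp_norm_top by (intro mult_left_mono) auto
            finally show ?case .
          qed
        qed
        then show ?thesis by (simp add: nn_integral_multc)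
      qed
      moreover have "(\<integral>\<^sup>+w. ennreal (jb (- s / 2) (w::real^'n)) \<partial>lborel) < top"
        using n by (intro nn_integral_jb_finite) simp
      ultimately show thesis using s by (intro that)
    next
      case (1 r)
      have r: "1 < r" using 1 q1 by (cases "r = 1") auto
      define r' where "r' = r / (r - 1)"
      have r': "0 < r'" "1 / r + 1 / r' = 1" "r' * (r - 1) = r"
        using r by (auto simp: r'_def field_simps)
      have "1 / q = ennreal 1 / ennreal r" by (simp add: 1)
      also have "\<dots> = ennreal (1 / r)" using r by (intro divide_ennreal) auto
      finally have "ennreal (1 / r) + 1 / q' = ennreal (1 / r + 1 / r')"
        using q'(1) unfolding r'(2) by simp
      also have "\<dots> = ennreal (1 / r) + ennreal (1 / r')"
        using r r'(1) by (intro ennreal_plus) auto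
      finally have iq': "1 / q' = ennreal (1 / r')" by (simp add: ennreal_add_left_cancel)
      have "of_nat CARD('n) / q' = ennreal (real CARD('n)) * ennreal (1 / r')"
        using iq' by (simp add: divide_ennreal_def ennreal_of_nat_eq_real_of_nat)
      then have "real CARD('n) / r' < s"
        using q'(2) s r'(1) by (simp add: ennreal_mult[symmetric] ennreal_less_iff)
      then have n: "real CARD('n) < s * r'" using r'(1) by (simp add: field_simps)
      \<comment> \<open>Hoelder's inequality as Jensen's with density \<open>k\<close> applied to
        \<open>h = b / k\<close>: since \<open>r' * (r - 1) = r\<close>, the integrand
        \<open>h powr r * k\<close> is the \<open>r\<close>-th power of the weighted
        \<open>b\<close>.\<close>
      define k where "k w = ennreal (jb (- s * r' / 2) w)" for w :: "real^'n"
      have [measurable]: "k \<in> borel_measurable borel" unfolding k_def by measurable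
      define S where "S = (\<integral>\<^sup>+w. k w \<partial>lborel)"
      have S: "S < top" unfolding S_def k_def using n by (intro nn_integral_jb_finite) simp
      have "(\<integral>\<^sup>+w. b w \<partial>lborel) \<le> ennreal_powr S ((r - 1) / r) * wnorm q s b"
        if [measurable]: "b \<in> borel_measurable borel" for b :: "real^'n \<Rightarrow> ennreal"
      proof -
        define h where "h w = b w * ennreal (jb (s * r' / 2) w)" for w
        have [measurable]: "h \<in> borel_measurable borel" unfolding h_def by measurable
        have hk: "h w * k w = b w" for w
          by (simp add: h_def k_def mult.assoc jb_add flip: ennreal_mult)
        have hr: "ennreal_powr (h w) r * k w = ennreal_powr (b w * ennreal (jb (s / 2) w)) r" for w
        proof -
          have "jb (s * r' / 2) w powr r * jb (- s * r' / 2) w = jb (s * r' / 2 * r - s * r' / 2) w"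
            by (simp add: jb_def powr_powr powr_add[symmetric])
          also have "s * r' / 2 * r - s * r' / 2 = s / 2 * (r' * (r - 1))" by (simp add: field_simps)
          also have "jb (s / 2 * (r' * (r - 1))) w = jb (s / 2) w powr r"
            unfolding r'(3) by (simp add: jb_def powr_powr)
          finally show ?thesis
            by (simp add: h_def k_def ennreal_powr_mult ennreal_powr_ennreal mult.assoc flip: ennreal_mult)
        qed
        have "ennreal_powr (\<integral>\<^sup>+w. b w \<partial>lborel) r
          \<le> ennreal_powr S (r - 1) * (\<integral>\<^sup>+w. ennreal_powr (b w * ennreal (jb (s / 2) w)) r \<partial>lborel)"
          using nn_integral_Jensen_powr[of h lborel k r] 1(2) S unfolding hk hr S_def by simp
        then have "ennreal_powr (ennreal_powr (\<integral>\<^sup>+w. b w \<partial>lborel) r) (1 / r)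
          \<le> ennreal_powr (ennreal_powr S (r - 1)
             * (\<integral>\<^sup>+w. ennreal_powr (b w * ennreal (jb (s / 2) w)) r \<partial>lborel)) (1 / r)"
          using r by (intro ennreal_powr_mono) auto
        then show ?thesis using r unfolding wnorm_def 1(1) Lp_norm_ennreal[OF 1(2)]
          by (simp add: ennreal_powr_mult ennreal_powr_powr)
      qed
      moreover have "ennreal_powr S ((r - 1) / r) < top" using S by (simp add: less_top[symmetric])
      ultimately show thesis using s by (intro that)
    qed
  qed
qed

section \<open>Schwartz functions\<close>

text \<open>The definition differentiates at parameter 0 only. Re-basing the line at its point of
  parameter \<open>h\<close> gives the derivative along the whole line, as the mean value bound
  needs it.\<close>

lemma partial_derivative_works:
  assumes "f differentiable (at (x + h *\<^sub>R axis i 1))"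
  shows "((\<lambda>h. f (x + h *\<^sub>R axis i 1)) has_vector_derivative
    partial_derivative i f (x + h *\<^sub>R axis i 1)) (at h)"
proof -
  have *: "(\<lambda>k. f (x + h *\<^sub>R axis i 1 + k *\<^sub>R axis i 1)) differentiable (at 0)"
    by (rule differentiable_chain_at[of "\<lambda>k. x + h *\<^sub>R axis i 1 + k *\<^sub>R axis i 1" 0 f, unfolded o_def])
      (use assms in \<open>auto intro!: derivative_intros\<close>)
  have "((\<lambda>k. f (x + h *\<^sub>R axis i 1 + k *\<^sub>R axis i 1)) has_vector_derivative
     partial_derivative i f (x + h *\<^sub>R axis i 1)) (at (h - h))"
    unfolding partial_derivative_def using * by (simp add: vector_derivative_works)
  moreover have "((\<lambda>k. k - h) has_derivative (\<lambda>k. k)) (at h)"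
    by (auto intro!: derivative_eq_intros)
  ultimately have
    "((\<lambda>k. f (x + h *\<^sub>R axis i 1 + (k - h) *\<^sub>R axis i 1)) has_vector_derivative
     partial_derivative i f (x + h *\<^sub>R axis i 1)) (at h)"
    unfolding has_vector_derivative_def by (rule has_derivative_compose[rotated])
  moreover have "x + h *\<^sub>R axis i 1 + (k - h) *\<^sub>R axis i 1 = x + k *\<^sub>R axis i 1" for k
    by (simp add: scaleR_left_diff_distrib)
  ultimately show ?thesis by simp
qed

lemma partial_derivative_works_0:
  assumes "f differentiable (at x)"
  shows "((\<lambda>h. f (x + h *\<^sub>R axis i 1)) has_vector_derivative partial_derivative i f x) (at 0)"
  using partial_derivative_works[of f x 0 i] assms by simp

lemma partial_derivative_eqI:
  "((\<lambda>h. f (x + h *\<^sub>R axis i 1)) has_vector_derivative d) (at 0) \<Longrightarrow> partial_derivative i f x = d"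
  unfolding partial_derivative_def by (rule vector_derivative_at)

lemma partial_derivative_mult:
  assumes "f differentiable (at x)" "g differentiable (at x)"
  shows "partial_derivative i (\<lambda>x. f x * g x) x
    = partial_derivative i f x * g x + f x * partial_derivative i g x"
  by (rule partial_derivative_eqI)
    (use has_vector_derivative_mult[OF partial_derivative_works_0[OF assms(1), of i]
        partial_derivative_works_0[OF assms(2), of i]] in \<open>simp add: add.commute\<close>)

lemma partial_derivative_sum_list:
  assumes "\<And>p. p \<in> set L \<Longrightarrow> h p differentiable (at x)"
  shows "partial_derivative i (\<lambda>x. \<Sum>p\<leftarrow>L. h p x) x = (\<Sum>p\<leftarrow>L. partial_derivative i (h p) x)"
proof (rule partial_derivative_eqI)
  show "((\<lambda>k. \<Sum>p\<leftarrow>L. h p (x + k *\<^sub>R axis i 1)) has_vector_derivative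
      (\<Sum>p\<leftarrow>L. partial_derivative i (h p) x)) (at 0)"
    using assms by (induction L)
      (auto intro!: has_vector_derivative_add partial_derivative_works_0)
qed

lemma partial_derivative_cnj:
  assumes "f differentiable (at x)"
  shows "partial_derivative i (\<lambda>x. cnj (f x)) x = cnj (partial_derivative i f x)"
  by (rule partial_derivative_eqI)
    (rule bounded_linear.has_vector_derivative[OF bounded_linear_cnj partial_derivative_works_0[OF assms]])

lemma partial_derivative_translate:
  "partial_derivative i (\<lambda>x. f (x - a)) x = partial_derivative i f (x - a)"
  by (simp add: partial_derivative_def algebra_simps)

lemma partial_derivative_dilate:
  assumes "f differentiable (at (c *\<^sub>R x))"
  shows "partial_derivative i (\<lambda>x. f (c *\<^sub>R x)) x = c *\<^sub>R partial_derivative i f (c *\<^sub>R x)"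
proof (rule partial_derivative_eqI)
  have "((\<lambda>h. c * h) has_vector_derivative c) (at 0)"
    by (auto intro!: derivative_eq_intros simp: has_real_derivative_iff_has_vector_derivative[symmetric])
  from vector_diff_chain_at[OF this, of "\<lambda>h. f (c *\<^sub>R x + h *\<^sub>R axis i 1)" "partial_derivative i f (c *\<^sub>R x)"]
  show "((\<lambda>h. f (c *\<^sub>R (x + h *\<^sub>R axis i 1))) has_vector_derivative
      c *\<^sub>R partial_derivative i f (c *\<^sub>R x)) (at 0)"
    using partial_derivative_works_0[OF assms, of i] by (simp add: o_def algebra_simps)
qed

lemma smooth_differentiable: "smooth f \<Longrightarrow> iterated_derivative \<alpha> f differentiable (at x)"
  by (simp add: smooth_def)

text \<open>All splittings of the list into two sublists, with repetition; the multiplicity of a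
  pair plays the role of the binomial coefficient.\<close>

fun leibniz :: "'n list \<Rightarrow> ('n list \<times> 'n list) list" where
  "leibniz [] = [([], [])]"
| "leibniz (i # \<alpha>) = map (\<lambda>p. (i # fst p, snd p)) (leibniz \<alpha>) @ map (\<lambda>p. (fst p, i # snd p)) (leibniz \<alpha>)"

lemma differentiable_sum_list:
  "(\<And>p. p \<in> set L \<Longrightarrow> h p differentiable (at x)) \<Longrightarrow> (\<lambda>x. \<Sum>p\<leftarrow>L. h p x) differentiable (at x)"
  by (induction L) auto

lemma iterated_derivative_mult:
  assumes "smooth f" "smooth g"
  shows "iterated_derivative \<alpha> (\<lambda>x. f x * g x)
    = (\<lambda>x. \<Sum>p\<leftarrow>leibniz \<alpha>. iterated_derivative (fst p) f x * iterated_derivative (snd p) g x)"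
proof (induction \<alpha>)
  case (Cons i \<alpha>)
  have "partial_derivative i (\<lambda>x. \<Sum>p\<leftarrow>leibniz \<alpha>. iterated_derivative (fst p) f x * iterated_derivative (snd p) g x) x
    = (\<Sum>p\<leftarrow>leibniz \<alpha>. partial_derivative i (\<lambda>x. iterated_derivative (fst p) f x * iterated_derivative (snd p) g x) x)" for x
    using assms by (intro partial_derivative_sum_list differentiable_mult smooth_differentiable)
  moreover have "partial_derivative i (\<lambda>x. iterated_derivative (fst p) f x * iterated_derivative (snd p) g x) x
    = iterated_derivative (i # fst p) f x * iterated_derivative (snd p) g x
      + iterated_derivative (fst p) f x * iterated_derivative (i # snd p) g x" for p x
    by (subst partial_derivative_mult) (auto intro!: smooth_differentiable assms)
  ultimately show ?case
    unfolding iterated_derivative.simps(2) Cons by (simp add: sum_list_addf o_def)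
qed simp

lemma smooth_mult:
  assumes "smooth f" "smooth g"
  shows "smooth (\<lambda>x. f x * g x)"
  unfolding smooth_def iterated_derivative_mult[OF assms]
  using assms by (auto intro!: differentiable_sum_list differentiable_mult smooth_differentiable simp: case_prod_beta)

lemma iterated_derivative_cnj:
  "smooth f \<Longrightarrow> iterated_derivative \<alpha> (\<lambda>x. cnj (f x)) = (\<lambda>x. cnj (iterated_derivative \<alpha> f x))"
proof (induction \<alpha>)
  case (Cons i \<alpha>)
  then show ?case
    unfolding iterated_derivative.simps(2) by (simp add: partial_derivative_cnj smooth_differentiable)
qed simp

lemma iterated_derivative_translate:
  "iterated_derivative \<alpha> (\<lambda>x. f (x - a)) = (\<lambda>x. iterated_derivative \<alpha> f (x - a))"
proof (induction \<alpha>)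
  case (Cons i \<alpha>)
  then show ?case unfolding iterated_derivative.simps(2) by (simp add: partial_derivative_translate)
qed simp

lemma smooth_translate:
  assumes "smooth f"
  shows "smooth (\<lambda>t. f (t - x))"
  unfolding smooth_def iterated_derivative_translate
proof (intro allI)
  fix \<alpha> t
  have "(\<lambda>t. t - x) differentiable (at t)" by (intro derivative_intros)
  then show "(\<lambda>t. iterated_derivative \<alpha> f (t - x)) differentiable (at t)"
    using differentiable_chain_at[of "\<lambda>t. t - x" t "iterated_derivative \<alpha> f"]
      smooth_differentiable[OF assms] by (simp add: o_def)
qed

lemma partial_derivative_scaleR:
  assumes "f differentiable (at x)"
  shows "partial_derivative i (\<lambda>x. c *\<^sub>R f x) x = c *\<^sub>R partial_derivative i f x"
  by (rule partial_derivative_eqI)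
    (rule bounded_linear.has_vector_derivative[OF bounded_linear_scaleR_right partial_derivative_works_0[OF assms]])

lemma differentiable_dilate:
  assumes "\<And>x. (f :: real^'n::finite \<Rightarrow> complex) differentiable (at x)"
  shows "(\<lambda>x. f (c *\<^sub>R x)) differentiable (at x)"
  by (rule differentiable_chain_at[of "\<lambda>x. c *\<^sub>R x" x f, unfolded o_def])
    (auto intro: assms)

lemma iterated_derivative_dilate:
  assumes "smooth f"
  shows "iterated_derivative \<alpha> (\<lambda>x. f (c *\<^sub>R x)) = (\<lambda>x. c ^ length \<alpha> *\<^sub>R iterated_derivative \<alpha> f (c *\<^sub>R x))"
proof (induction \<alpha>)
  case (Cons i \<alpha>)
  have "partial_derivative i (\<lambda>x. c ^ length \<alpha> *\<^sub>R iterated_derivative \<alpha> f (c *\<^sub>R x)) x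
    = c ^ length \<alpha> *\<^sub>R partial_derivative i (\<lambda>x. iterated_derivative \<alpha> f (c *\<^sub>R x)) x" for x
    using assms by (intro partial_derivative_scaleR differentiable_dilate smooth_differentiable)
  then show ?case using assms
    by (simp add: Cons fun_eq_iff partial_derivative_dilate smooth_differentiable mult.commute)
qed simp

lemma iterated_derivative_append:
  "iterated_derivative \<alpha> (iterated_derivative \<beta> f) = iterated_derivative (\<alpha> @ \<beta>) f"
  by (induction \<alpha>) auto

section \<open>Decay estimates and closure properties of the Schwartz class\<close>

lemma schwartz_smooth: "f \<in> schwartz \<Longrightarrow> smooth f"
  by (simp add: schwartz_def)

lemma norm_power_le_jb: "norm x ^ k \<le> jb (real k) x"
proof -
  have "2 * norm x \<le> 1 + (norm x)\<^sup>2"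
    using zero_le_power2[of "norm x - 1"] by (simp add: power2_eq_square algebra_simps)
  then have "norm x \<le> 1 + (norm x)\<^sup>2"
    using norm_ge_zero[of x] by linarith
  then have "norm x ^ k \<le> (1 + (norm x)\<^sup>2) ^ k" by (intro power_mono) auto
  then show ?thesis by (simp add: jb_def powr_realpow)
qed

lemma jb_le_norm_power: "jb (real k) x \<le> 2 ^ k * (1 + norm x ^ (2 * k))"
proof -
  have "jb (real k) x = (1 + (norm x)\<^sup>2) ^ k" by (simp add: jb_def powr_realpow)
  also have "\<dots> \<le> (2 * max 1 ((norm x)\<^sup>2)) ^ k" by (intro power_mono) auto
  also have "\<dots> = 2 ^ k * max 1 ((norm x)\<^sup>2) ^ k" by (simp add: power_mult_distrib)
  also have "max 1 ((norm x)\<^sup>2) ^ k \<le> 1 + norm x ^ (2 * k)"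
    by (auto simp: max_def power_mult)
  finally show ?thesis by simp
qed

lemma jb_mult_leD:
  assumes "jb a x * u \<le> v"
  shows "u \<le> v * jb (- a) x"
proof -
  have "u = jb (- a) x * (jb a x * u)" by (simp add: mult.assoc[symmetric] jb_add)
  also have "\<dots> \<le> jb (- a) x * v" using assms by (rule mult_left_mono) simp
  finally show ?thesis by (simp add: mult.commute)
qed

text \<open>Turns polynomially weighted seminorms into decay of bracket type, the form compatible
  with Peetre's inequality; \<open>schwartzI\<close> is the way back.\<close>

lemma schwartz_bound:
  assumes "f \<in> schwartz"
  obtains C where "0 \<le> C" "\<And>x. norm (iterated_derivative \<alpha> f x) \<le> C * jb (- a) x"
proof -
  define k where "k = nat \<lceil>a\<rceil>"
  have k: "a \<le> real k" unfolding k_def by linarith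
  have bd: "\<exists>B. \<forall>x. norm x ^ j * norm (iterated_derivative \<alpha> f x) \<le> B" for j
    using assms unfolding schwartz_def bounded_iff by (auto simp: norm_power)
  obtain B0 where B0: "\<And>x. norm x ^ 0 * norm (iterated_derivative \<alpha> f x) \<le> B0" using bd by meson
  obtain B1 where B1: "\<And>x. norm x ^ (2 * k) * norm (iterated_derivative \<alpha> f x) \<le> B1" using bd by meson
  have "0 \<le> B0" "0 \<le> B1"
    using order_trans[OF _ B0[of 0]] order_trans[OF _ B1[of 0]] by auto
  show thesis
  proof
    show "0 \<le> 2 ^ k * (B0 + B1)" using \<open>0 \<le> B0\<close> \<open>0 \<le> B1\<close> by simp
    fix x
    have "jb (real k) x * norm (iterated_derivative \<alpha> f x)
      \<le> 2 ^ k * (1 + norm x ^ (2 * k)) * norm (iterated_derivative \<alpha> f x)"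
      by (intro mult_right_mono jb_le_norm_power) auto
    also have "\<dots> \<le> 2 ^ k * (B0 + B1)"
      unfolding mult.assoc using B0[of x] B1[of x] by (intro mult_left_mono) (auto simp: distrib_right)
    finally have "norm (iterated_derivative \<alpha> f x) \<le> 2 ^ k * (B0 + B1) * jb (- real k) x"
      by (rule jb_mult_leD)
    also have "\<dots> \<le> 2 ^ k * (B0 + B1) * jb (- a) x"
      using k \<open>0 \<le> B0\<close> \<open>0 \<le> B1\<close> by (intro mult_left_mono jb_mono) auto
    finally show "norm (iterated_derivative \<alpha> f x) \<le> 2 ^ k * (B0 + B1) * jb (- a) x" .
  qed
qed

lemma schwartzI:
  assumes "smooth f" and bd: "\<And>\<alpha> a. 0 \<le> a \<Longrightarrow> \<exists>C. \<forall>x. norm (iterated_derivative \<alpha> f x) \<le> C * jb (- a) x"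
  shows "f \<in> schwartz"
proof -
  have "bounded (range (\<lambda>x. norm x ^ k *\<^sub>R iterated_derivative \<alpha> f x))" for k \<alpha>
  proof -
    obtain C where C: "\<And>x. norm (iterated_derivative \<alpha> f x) \<le> C * jb (- real k) x"
      using bd[of "real k" \<alpha>] by auto
    have "norm (norm x ^ k *\<^sub>R iterated_derivative \<alpha> f x) \<le> C" for x
    proof -
      have "norm x ^ k * norm (iterated_derivative \<alpha> f x) \<le> jb (real k) x * (C * jb (- real k) x)"
        by (intro mult_mono norm_power_le_jb C) auto
      also have "\<dots> = C * (jb (real k) x * jb (- real k) x)" by simp
      finally show ?thesis unfolding jb_add by (simp add: norm_power)
    qed
    then show ?thesis unfolding bounded_iff by auto
  qed
  then show ?thesis using assms(1) by (simp add: schwartz_def)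
qed

text \<open>The bound is uniform in the translations, which yields the decay of short time Fourier
  transforms of Schwartz functions in the position variable.\<close>

lemma schwartz_product_bound:
  assumes f: "f \<in> schwartz" and g: "g \<in> schwartz" and a: "0 \<le> a" and b: "0 \<le> b"
  obtains C where "0 \<le> C"
    "\<And>x y t. norm (iterated_derivative \<alpha> (\<lambda>t. f (t - x) * g (t - y)) t)
       \<le> C * (jb (- a) (x - y) * jb (- b) (t - x))"
proof -
  have sm: "smooth (\<lambda>t. f (t - x))" "smooth (\<lambda>t. g (t - x))" for x
    by (intro smooth_translate schwartz_smooth f g)+
  have "\<exists>C\<ge>0. \<forall>x y t. norm (\<Sum>p\<leftarrow>L. iterated_derivative (fst p) f (t - x) * iterated_derivative (snd p) g (t - y))
    \<le> C * (jb (- a) (x - y) * jb (- b) (t - x))" for L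
  proof (induction L)
    case Nil
    show ?case by (intro exI[of _ 0]) auto
  next
    case (Cons p L)
    then obtain C where C: "0 \<le> C" "\<And>x y t. norm (\<Sum>p\<leftarrow>L. iterated_derivative (fst p) f (t - x) * iterated_derivative (snd p) g (t - y))
      \<le> C * (jb (- a) (x - y) * jb (- b) (t - x))" by auto
    obtain \<beta> \<gamma> where p: "p = (\<beta>, \<gamma>)" by (cases p)
    \<comment> \<open>The factor \<open>f\<close> is given decay \<open>a + b\<close>: the part
      \<open>a\<close> combines with the decay of \<open>g\<close> about \<open>y\<close> into decay
      in \<open>x - y\<close>, the part \<open>b\<close> remains for the integration in
      \<open>t\<close>.\<close>
    obtain C1 where C1: "0 \<le> C1" "\<And>x. norm (iterated_derivative \<beta> f x) \<le> C1 * jb (- (a + b)) x"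
      using schwartz_bound[OF f] by blast
    obtain C2 where C2: "0 \<le> C2" "\<And>x. norm (iterated_derivative \<gamma> g x) \<le> C2 * jb (- a) x"
      using schwartz_bound[OF g] by blast
    have "norm (iterated_derivative \<beta> f (t - x) * iterated_derivative \<gamma> g (t - y))
      \<le> C1 * C2 * 2 powr a * (jb (- a) (x - y) * jb (- b) (t - x))" for x y t
    proof -
      have "norm (iterated_derivative \<beta> f (t - x) * iterated_derivative \<gamma> g (t - y))
        \<le> (C1 * jb (- (a + b)) (t - x)) * (C2 * jb (- a) (t - y))"
        unfolding norm_mult using C1 C2 by (intro mult_mono) auto
      also have "jb (- (a + b)) (t - x) = jb (- a) (t - x) * jb (- b) (t - x)" by (simp add: jb_add)
      also have "(C1 * (jb (- a) (t - x) * jb (- b) (t - x))) * (C2 * jb (- a) (t - y))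
        = C1 * C2 * (jb (- a) (x - t) * jb (- a) (t - y)) * jb (- b) (t - x)"
        by (simp add: jb_minus_commute[of "- a" t x])
      also have "\<dots> \<le> C1 * C2 * (2 powr a * jb (- a) ((x - t) + (t - y))) * jb (- b) (t - x)"
        using C1 C2 by (intro mult_left_mono mult_right_mono jb_negative_submult a) auto
      finally show ?thesis by (simp add: ac_simps)
    qed
    then have "norm (\<Sum>p\<leftarrow>p # L. iterated_derivative (fst p) f (t - x) * iterated_derivative (snd p) g (t - y))
      \<le> C1 * C2 * 2 powr a * (jb (- a) (x - y) * jb (- b) (t - x)) + C * (jb (- a) (x - y) * jb (- b) (t - x))" for x y t
      using C(2)[where x = x and y = y and t = t] by (auto simp: p intro!: norm_triangle_le add_mono)
    then show ?case using C1 C2 C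
      by (intro exI[of _ "C1 * C2 * 2 powr a + C"]) (auto simp: distrib_right)
  qed
  from this[of "leibniz \<alpha>"] obtain C where C: "0 \<le> C"
    "\<And>x y t. norm (\<Sum>p\<leftarrow>leibniz \<alpha>. iterated_derivative (fst p) f (t - x) * iterated_derivative (snd p) g (t - y))
    \<le> C * (jb (- a) (x - y) * jb (- b) (t - x))" by blast
  show thesis
    by (rule that[OF C(1)]) (use C(2) in \<open>simp add: iterated_derivative_mult[OF sm] iterated_derivative_translate\<close>)
qed

lemma schwartz_mult:
  assumes "f \<in> schwartz" "g \<in> schwartz"
  shows "(\<lambda>x. f x * g x) \<in> schwartz"
proof (rule schwartzI)
  show "smooth (\<lambda>x. f x * g x)" by (intro smooth_mult schwartz_smooth assms)
  fix \<alpha> :: "'a list" and a :: real assume a: "0 \<le> a"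
  obtain C where "0 \<le> C" and C: "\<And>x y t. norm (iterated_derivative \<alpha> (\<lambda>t. f (t - x) * g (t - y)) t)
       \<le> C * (jb (- 0) (x - y) * jb (- a) (t - x))"
    by (rule schwartz_product_bound[OF assms order.refl a, where \<alpha> = \<alpha>]) (rule that)
  show "\<exists>C. \<forall>x. norm (iterated_derivative \<alpha> (\<lambda>x. f x * g x) x) \<le> C * jb (- a) x"
    using C[where x = 0 and y = 0] by (intro exI[of _ C]) simp
qed

lemma schwartz_cnj:
  assumes "f \<in> schwartz"
  shows "(\<lambda>x. cnj (f x)) \<in> schwartz"
proof (rule schwartzI)
  have sm: "smooth f" by (intro schwartz_smooth assms)
  show "smooth (\<lambda>x. cnj (f x))"
    unfolding smooth_def iterated_derivative_cnj[OF sm]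
  proof (intro allI)
    fix \<alpha> x
    have "cnj differentiable (at y)" for y
      by (intro bounded_linear_imp_differentiable bounded_linear_cnj)
    then show "(\<lambda>x. cnj (iterated_derivative \<alpha> f x)) differentiable (at x)"
      using differentiable_chain_at[of "iterated_derivative \<alpha> f" x cnj]
        smooth_differentiable[OF sm] by (simp add: o_def)
  qed
  show "\<exists>C. \<forall>x. norm (iterated_derivative \<alpha> (\<lambda>x. cnj (f x)) x) \<le> C * jb (- a) x" for \<alpha> a
    using schwartz_bound[OF assms, of \<alpha> a] unfolding iterated_derivative_cnj[OF sm] by (auto simp: )
qed

lemma schwartz_translate:
  assumes "f \<in> schwartz"
  shows "(\<lambda>x. f (x - y)) \<in> schwartz"
proof (rule schwartzI)
  show "smooth (\<lambda>x. f (x - y))"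
    by (intro smooth_translate schwartz_smooth assms)
  fix \<alpha> :: "'a list" and a :: real assume a: "0 \<le> a"
  obtain C where C: "0 \<le> C" "\<And>x. norm (iterated_derivative \<alpha> f x) \<le> C * jb (- a) x"
    using schwartz_bound[OF assms] by blast
  have "C * jb (- a) (x - y) \<le> C * 2 powr a * jb a y * jb (- a) x" for x
  proof -
    have "C * jb (- a) (x - y) = C * (jb (- a) (x - y) * jb (- a) y) * jb a y" by (simp add: jb_add)
    also have "\<dots> \<le> C * (2 powr a * jb (- a) ((x - y) + y)) * jb a y"
      using C by (intro mult_left_mono mult_right_mono jb_negative_submult a) auto
    finally show ?thesis by (simp add: ac_simps)
  qed
  then have "norm (iterated_derivative \<alpha> f (x - y)) \<le> C * 2 powr a * jb a y * jb (- a) x" for x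
    using C(2)[of "x - y"] by (rule order_trans[rotated])
  then show "\<exists>C. \<forall>x. norm (iterated_derivative \<alpha> (\<lambda>x. f (x - y)) x) \<le> C * jb (- a) x"
    unfolding iterated_derivative_translate by (intro exI allI)
qed

lemma schwartz_dilate:
  assumes "f \<in> schwartz" "1 \<le> c"
  shows "(\<lambda>x. f (c *\<^sub>R x)) \<in> schwartz"
proof (rule schwartzI)
  have sm: "smooth f" by (intro schwartz_smooth assms)
  show "smooth (\<lambda>x. f (c *\<^sub>R x))"
    unfolding smooth_def iterated_derivative_dilate[OF sm]
    using smooth_differentiable[OF sm] by (auto intro!: differentiable_scaleR differentiable_dilate)
  fix \<alpha> :: "'a list" and a :: real assume a: "0 \<le> a"
  obtain C where C: "0 \<le> C" "\<And>x. norm (iterated_derivative \<alpha> f x) \<le> C * jb (- a) x"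
    using schwartz_bound[OF assms(1)] by blast
  have "norm (c ^ length \<alpha> *\<^sub>R iterated_derivative \<alpha> f (c *\<^sub>R x)) \<le> c ^ length \<alpha> * C * jb (- a) x" for x
  proof -
    have "jb (- a) (c *\<^sub>R x) \<le> jb (- a) x"
    proof -
      have "norm x \<le> norm (c *\<^sub>R x)"
        using mult_right_mono[OF assms(2) norm_ge_zero[of x]] assms(2) by simp
      then have "1 + (norm x)\<^sup>2 \<le> 1 + (norm (c *\<^sub>R x))\<^sup>2"
        by (intro add_left_mono power_mono) auto
      then show ?thesis unfolding jb_def using a by (intro powr_mono2') auto
    qed
    then have "norm (iterated_derivative \<alpha> f (c *\<^sub>R x)) \<le> C * jb (- a) x"
      using C by (meson mult_left_mono order_trans)
    then show ?thesis using assms(2) by (simp add: norm_power mult.assoc mult_left_mono)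
  qed
  then show "\<exists>C. \<forall>x. norm (iterated_derivative \<alpha> (\<lambda>x. f (c *\<^sub>R x)) x) \<le> C * jb (- a) x"
    unfolding iterated_derivative_dilate[OF sm] by blast
qed

lemma schwartz_iterated_derivative:
  assumes "f \<in> schwartz"
  shows "iterated_derivative \<beta> f \<in> schwartz"
proof (rule schwartzI)
  show "smooth (iterated_derivative \<beta> f)"
    using schwartz_smooth[OF assms] by (simp add: smooth_def iterated_derivative_append)
  show "\<exists>C. \<forall>x. norm (iterated_derivative \<alpha> (iterated_derivative \<beta> f) x) \<le> C * jb (- a) x" for \<alpha> a
    unfolding iterated_derivative_append using schwartz_bound[OF assms] by metis
qed

lemma schwartz_scale:
  assumes "f \<in> schwartz"
  shows "(\<lambda>x. of_real r * f x) \<in> schwartz"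
proof (rule schwartzI)
  have sm: "smooth f" by (intro schwartz_smooth assms)
  have *: "iterated_derivative \<alpha> (\<lambda>x. r *\<^sub>R f x) = (\<lambda>x. r *\<^sub>R iterated_derivative \<alpha> f x)" for \<alpha>
  proof (induction \<alpha>)
    case (Cons i \<alpha>)
    then show ?case unfolding iterated_derivative.simps(2)
      by (simp add: partial_derivative_scaleR smooth_differentiable[OF sm])
  qed simp
  show "smooth (\<lambda>x. of_real r * f x)"
    unfolding smooth_def scaleR_conv_of_real[symmetric] *
    using smooth_differentiable[OF sm] by (auto intro!: differentiable_scaleR)
  fix \<alpha> :: "'a list" and a :: real
  obtain C where C: "0 \<le> C" "\<And>x. norm (iterated_derivative \<alpha> f x) \<le> C * jb (- a) x"
    using schwartz_bound[OF assms(1)] by blast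
  show "\<exists>C. \<forall>x. norm (iterated_derivative \<alpha> (\<lambda>x. of_real r * f x) x) \<le> C * jb (- a) x"
    unfolding scaleR_conv_of_real[symmetric] *
    using C(2) by (intro exI[of _ "\<bar>r\<bar> * C"]) (auto simp: mult.assoc mult_left_mono)
qed

lemma schwartz_continuous: "f \<in> schwartz \<Longrightarrow> continuous_on UNIV f"
  using smooth_differentiable[OF schwartz_smooth, of f "[]"]
  by (auto simp: continuous_on_eq_continuous_at intro: differentiable_imp_continuous_within)

lemma schwartz_measurable [measurable_dest]: "f \<in> schwartz \<Longrightarrow> f \<in> borel_measurable borel"
  by (intro borel_measurable_continuous_onI schwartz_continuous)

lemma integrable_jb:
  assumes "2 * a < - real DIM('a)"
  shows "integrable lborel (jb a :: 'a::euclidean_space \<Rightarrow> real)"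
  using nn_integral_jb_finite[OF assms] by (intro integrableI_nonneg) auto

lemma schwartz_integrable:
  fixes f :: "real^'n::finite \<Rightarrow> complex"
  assumes "f \<in> schwartz"
  shows "integrable lborel f"
proof -
  define a where "a = real CARD('n)"
  obtain C where C: "0 \<le> C" "\<And>x. norm (iterated_derivative [] f x) \<le> C * jb (- a) x"
    using schwartz_bound[OF assms(1)] by blast
  show ?thesis
  proof (rule Bochner_Integration.integrable_bound)
    show "integrable lborel (\<lambda>x::real^'n. C * jb (- a) x)"
      by (intro integrable_mult_right integrable_jb) (simp add: a_def)
    show "f \<in> borel_measurable lborel" using schwartz_measurable[OF assms] by simp
    show "AE x in lborel. norm (f x) \<le> norm (C * jb (- a) x)"
      using C by auto
  qed
qed

text \<open>The pairing is at most \<open>B\<close> times the integral of the absolute value of the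
  test function, and two seminorms control that integral.\<close>

lemma tempered_distribution_of_bounded:
  fixes f :: "real^'n::finite \<Rightarrow> complex"
  assumes [measurable]: "f \<in> borel_measurable borel" and bd: "\<And>x. norm (f x) \<le> B"
  shows "\<And>\<phi>. \<phi> \<in> schwartz \<Longrightarrow> integrable lborel (\<lambda>t. f t * \<phi> t)"
    and "tempered_distribution (distribution_of f)"
proof -
  have B: "0 \<le> B" using order_trans[OF norm_ge_zero bd] .
  show int: "integrable lborel (\<lambda>t. f t * \<phi> t)" if \<phi>: "\<phi> \<in> schwartz" for \<phi>
  proof (rule Bochner_Integration.integrable_bound)
    note [measurable] = schwartz_measurable[OF \<phi>]
    show "integrable lborel (\<lambda>x. B * norm (\<phi> x))"
      using schwartz_integrable[OF \<phi>] by simp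
    show "AE x in lborel. norm (f x * \<phi> x) \<le> norm (B * norm (\<phi> x))"
      using bd B by (auto simp: norm_mult intro!: mult_right_mono)
    show "(\<lambda>t. f t * \<phi> t) \<in> borel_measurable lborel" by measurable
  qed
  \<comment> \<open>The bracket of exponent \<open>- n\<close> is integrable since
    \<open>2 * n > n\<close>, and \<open>jb_le_norm_power\<close> bounds its inverse by the powers 0
    and \<open>2 * n\<close> of the norm; hence \<open>N = 2 * k\<close>.\<close>
  define k where "k = CARD('n)"
  define N where "N = 2 * k"
  define I where "I = (LINT x|lborel. jb (- real k) (x::real^'n))"
  have I: "integrable lborel (jb (- real k) :: real^'n \<Rightarrow> real)"
    by (intro integrable_jb) (simp add: k_def)
  have bound: "norm (distribution_of f \<phi>) \<le> B * 2 ^ k * I * (\<Sum>k\<le>N. \<Sum>\<alpha> | length \<alpha> \<le> N. schwartz_seminorm k \<alpha> \<phi>)"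
    if \<phi>: "\<phi> \<in> schwartz" for \<phi>
  proof -
    note [measurable] = schwartz_measurable[OF \<phi>]
    have bdd: "bdd_above (range (\<lambda>x. norm x ^ j * norm (iterated_derivative \<alpha> \<phi> x)))" for j \<alpha>
    proof -
      have "bounded (range (\<lambda>x. norm x ^ j *\<^sub>R iterated_derivative \<alpha> \<phi> x))"
        using \<phi> by (simp add: schwartz_def)
      then show ?thesis unfolding bounded_iff bdd_above_def by (auto simp: norm_power)
    qed
    have le: "norm x ^ j * norm (iterated_derivative \<alpha> \<phi> x) \<le> schwartz_seminorm j \<alpha> \<phi>" for j \<alpha> x
      unfolding schwartz_seminorm_def by (rule cSUP_upper[OF _ bdd]) simp
    have nn: "0 \<le> schwartz_seminorm j \<alpha> \<phi>" for j \<alpha>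
      by (rule order_trans[OF _ le[of 0 j \<alpha>]]) simp
    have fin: "finite {\<alpha> :: 'n list. length \<alpha> \<le> N}"
      using finite_lists_length_le[of "UNIV :: 'n set" N] by simp
    have "(\<Sum>\<alpha> | length \<alpha> \<le> N. schwartz_seminorm j \<alpha> \<phi>) \<ge> schwartz_seminorm j [] \<phi>" for j
      using nn fin by (intro member_le_sum) auto
    then have "(\<Sum>j\<in>{0, 2 * k}. schwartz_seminorm j [] \<phi>) \<le> (\<Sum>j\<in>{0, 2 * k}. \<Sum>\<alpha> | length \<alpha> \<le> N. schwartz_seminorm j \<alpha> \<phi>)"
      by (intro sum_mono)
    also have "\<dots> \<le> (\<Sum>k\<le>N. \<Sum>\<alpha> | length \<alpha> \<le> N. schwartz_seminorm k \<alpha> \<phi>)"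
      by (intro sum_mono2) (auto simp: N_def intro!: sum_nonneg nn)
    finally have S: "schwartz_seminorm 0 [] \<phi> + schwartz_seminorm (2 * k) [] \<phi>
        \<le> (\<Sum>k\<le>N. \<Sum>\<alpha> | length \<alpha> \<le> N. schwartz_seminorm k \<alpha> \<phi>)" (is "_ \<le> ?S")
      by (simp add: k_def)
    have pt: "norm (\<phi> x) \<le> 2 ^ k * ?S * jb (- real k) x" for x
    proof -
      have "jb (real k) x * norm (\<phi> x) \<le> 2 ^ k * (1 + norm x ^ (2 * k)) * norm (\<phi> x)"
        by (intro mult_right_mono jb_le_norm_power) auto
      also have "\<dots> \<le> 2 ^ k * ?S"
        unfolding mult.assoc using le[of x 0 "[]"] le[of x "2 * k" "[]"] S
        by (intro mult_left_mono) (auto simp: distrib_right)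
      finally show ?thesis by (rule jb_mult_leD)
    qed
    have "norm (distribution_of f \<phi>) \<le> (LINT x|lborel. norm (f x * \<phi> x))"
      unfolding distribution_of_def by (rule integral_norm_bound)
    also have "\<dots> \<le> (LINT x|lborel. B * (2 ^ k * ?S) * jb (- real k) (x::real^'n))"
    proof (rule integral_mono)
      show "integrable lborel (\<lambda>x. norm (f x * \<phi> x))" using int[OF \<phi>] by simp
      show "integrable lborel (\<lambda>x::real^'n. B * (2 ^ k * ?S) * jb (- real k) x)"
        by (intro integrable_mult_right I)
      show "norm (f x * \<phi> x) \<le> B * (2 ^ k * ?S) * jb (- real k) x" for x
        unfolding norm_mult mult.assoc[of B] using pt B by (intro mult_mono bd) auto
    qed
    finally show ?thesis by (simp add: I_def ac_simps)
  qed
  show "tempered_distribution (distribution_of f)"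
    unfolding tempered_distribution_def
  proof (intro conjI ballI allI)
    show "distribution_of f (\<lambda>t. \<phi> t + \<psi> t) = distribution_of f \<phi> + distribution_of f \<psi>"
      if "\<phi> \<in> schwartz" "\<psi> \<in> schwartz" for \<phi> \<psi>
      using int[OF that(1)] int[OF that(2)] by (simp add: distribution_of_def distrib_left)
    show "distribution_of f (\<lambda>t. c * \<phi> t) = c * distribution_of f \<phi>" if "\<phi> \<in> schwartz" for c \<phi>
      unfolding distribution_of_def by (simp add: mult.left_commute[of _ c])
  qed (use bound in blast)
qed

section \<open>The Fourier transform\<close>

definition fourier :: "(real^'n::finite \<Rightarrow> complex) \<Rightarrow> real^'n \<Rightarrow> complex" where
  "fourier h w = (LINT t|lborel. h t * cis (- (2 * pi * (w \<bullet> t))))"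

lemma cis_measurable [measurable (raw)]:
  "f \<in> borel_measurable M \<Longrightarrow> (\<lambda>x. cis (f x)) \<in> borel_measurable M"
  unfolding cis_conv_exp by measurable

lemma fourier_measurable [measurable]:
  assumes [measurable]: "h \<in> borel_measurable borel"
  shows "fourier h \<in> borel_measurable borel"
proof -
  have "(\<lambda>w. LINT t|lborel. h t * cis (- (2 * pi * (w \<bullet> t)))) \<in> borel_measurable borel"
    by (intro lborel.borel_measurable_lebesgue_integral) measurable
  then show ?thesis unfolding fourier_def[abs_def] .
qed

text \<open>Covers non-integrable \<open>f\<close> as well, because the Bochner integral is then 0
  by convention.\<close>

lemma norm_integral_le_nn_integral:
  fixes f :: "'a \<Rightarrow> 'b::{banach, second_countable_topology}"
  shows "ennreal (norm (integral\<^sup>L M f)) \<le> (\<integral>\<^sup>+x. ennreal (norm (f x)) \<partial>M)"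
  by (cases "integrable M f") (auto simp: integral_norm_bound_ennreal not_integrable_integral_eq)

lemma integrable_pair_mult:
  fixes f g :: "'a::euclidean_space \<Rightarrow> complex"
  assumes f: "integrable lborel f" and g: "integrable lborel g"
    and [measurable]: "(\<lambda>(x, y). u x y) \<in> borel_measurable (lborel \<Otimes>\<^sub>M lborel)"
    and u: "\<And>x y. norm (u x y) \<le> 1"
  shows "integrable (lborel \<Otimes>\<^sub>M lborel) (\<lambda>(x, y). f x * g y * u x y)"
proof -
  have [measurable]: "f \<in> borel_measurable borel" "g \<in> borel_measurable borel"
    using f g by (auto dest: borel_measurable_integrable)
  have "integrable (lborel \<Otimes>\<^sub>M lborel) (\<lambda>(x, y). f x * g y)"
  proof (rule lborel_pair.Fubini_integrable)
    show "integrable lborel (\<lambda>x. LINT y|lborel. norm (case (x, y) of (x, y) \<Rightarrow> f x * g y))"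
      using f by (simp add: norm_mult)
    show "AE x in lborel. integrable lborel (\<lambda>y. case (x, y) of (x, y) \<Rightarrow> f x * g y)"
      using g by simp
  qed measurable
  then show ?thesis
  proof (rule Bochner_Integration.integrable_bound)
    show "AE z in lborel \<Otimes>\<^sub>M lborel. norm (case z of (x, y) \<Rightarrow> f x * g y * u x y)
        \<le> norm (case z of (x, y) \<Rightarrow> f x * g y)"
      using u by (intro AE_I2) (auto simp: norm_mult intro!: mult_left_le)
  qed measurable
qed

lemma lborel_affine_nz:
  assumes "c \<noteq> 0"
  shows "lborel = density (distr lborel borel (\<lambda>x. t + c *\<^sub>R x :: 'a::euclidean_space)) (\<lambda>_. ennreal (\<bar>c\<bar> ^ DIM('a)))"
  using lborel_affine[OF assms, of t] by simp

lemma integral_lborel_affine: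
  fixes h :: "'a::euclidean_space \<Rightarrow> complex"
  assumes c: "c \<noteq> 0" and [measurable]: "h \<in> borel_measurable borel"
  shows "(LINT x|lborel. h x) = \<bar>c\<bar> ^ DIM('a) *\<^sub>R (LINT x|lborel. h (t + c *\<^sub>R x))"
  by (subst lborel_affine_nz[OF c, of t]) (simp add: integral_density integral_distr)

lemma integrable_lborel_affine:
  fixes h :: "'a::euclidean_space \<Rightarrow> complex"
  assumes c: "c \<noteq> 0" and h: "integrable lborel h"
  shows "integrable lborel (\<lambda>x. h (t + c *\<^sub>R x))"
proof -
  have [measurable]: "h \<in> borel_measurable borel" using h by (auto dest: borel_measurable_integrable)
  show ?thesis
  proof -
    have "integrable lborel (\<lambda>x. \<bar>c\<bar> ^ DIM('a) *\<^sub>R h (t + c *\<^sub>R x))"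
      using h by (subst (asm) lborel_affine_nz[OF c, of t]) (simp add: integrable_density integrable_distr_eq)
    from integrable_scaleR_right[OF this, of "inverse (\<bar>c\<bar> ^ DIM('a))"] show ?thesis
      using c by simp
  qed
qed

lemma integral_lborel_translate:
  fixes h :: "'a::euclidean_space \<Rightarrow> complex"
  assumes [measurable]: "h \<in> borel_measurable borel"
  shows "(LINT x|lborel. h (x + t)) = (LINT x|lborel. h x)"
  using integral_lborel_affine[of 1 h t] by (simp add: add.commute)

subsection \<open>The Gaussian\<close>

definition gauss :: "'a::euclidean_space \<Rightarrow> real" where
  "gauss x = (\<Prod>b\<in>Basis. std_normal_density (x \<bullet> b))"

lemma gauss_eq: "gauss (x::'a::euclidean_space) = (1 / sqrt (2 * pi)) ^ DIM('a) * exp (- (norm x)\<^sup>2 / 2)"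
proof -
  have "gauss x = (1 / sqrt (2 * pi)) ^ DIM('a) * exp (\<Sum>b\<in>Basis. - (x \<bullet> b)\<^sup>2 / 2)"
    by (simp add: gauss_def std_normal_density_def prod_dividef exp_sum power_one_over del: real_sqrt_mult)
  also have "(\<Sum>b\<in>Basis. - (x \<bullet> b)\<^sup>2 / 2) = - (norm x)\<^sup>2 / 2"
    unfolding power2_norm_eq_inner euclidean_inner[of x x]
    by (simp add: sum_negf sum_divide_distrib power2_eq_square)
  finally show ?thesis .
qed

lemma gauss_nonneg [simp]: "0 \<le> gauss x"
  by (simp add: gauss_def prod_nonneg)

lemma gauss_measurable [measurable]: "gauss \<in> borel_measurable borel"
  unfolding gauss_def[abs_def] by measurable

lemma integral_lborel_prod_Basis:
  fixes k :: "'a::euclidean_space \<Rightarrow> real \<Rightarrow> complex"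
  assumes k: "\<And>b. b \<in> Basis \<Longrightarrow> integrable lborel (k b)"
  shows "integrable lborel (\<lambda>x. \<Prod>b\<in>Basis. k b (x \<bullet> b))"
    and "(LINT x|lborel. (\<Prod>b\<in>Basis. k b (x \<bullet> b))) = (\<Prod>b\<in>Basis. LINT r|lborel. k b r)"
proof -
  interpret product_sigma_finite "\<lambda>b::'a. lborel :: real measure" ..
  have m: "\<And>b. b \<in> Basis \<Longrightarrow> k b \<in> borel_measurable borel"
    using k by (auto dest: borel_measurable_integrable)
  have [measurable]: "(\<lambda>x. \<Prod>b\<in>Basis. k b (x \<bullet> b)) \<in> borel_measurable borel"
    by (intro borel_measurable_prod measurable_compose[OF _ m]) auto
  have [measurable]: "(\<lambda>f. \<Sum>b\<in>Basis. f b *\<^sub>R b) \<in> (\<Pi>\<^sub>M b\<in>(Basis :: 'a set). lborel :: real measure) \<rightarrow>\<^sub>M borel"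
    by measurable
  have eq: "(\<Prod>b\<in>Basis. k b ((\<Sum>b\<in>Basis. f b *\<^sub>R b) \<bullet> b)) = (\<Prod>b\<in>Basis. k b (f b))" for f
    by (intro prod.cong) (auto simp: inner_sum_left inner_Basis if_distrib cong: if_cong)
  show "integrable lborel (\<lambda>x. \<Prod>b\<in>Basis. k b (x \<bullet> b))"
    by (subst lborel_eq) (simp add: integrable_distr_eq eq product_integrable_prod k)
  show "(LINT x|lborel. (\<Prod>b\<in>Basis. k b (x \<bullet> b))) = (\<Prod>b\<in>Basis. LINT r|lborel. k b r)"
    by (subst lborel_eq) (simp add: integral_distr eq product_integral_prod k)
qed

lemma cis_inner_eq: "cis (x \<bullet> y) = (\<Prod>b\<in>Basis. cis ((x \<bullet> b) * (y \<bullet> b)))"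
  unfolding cis_conv_exp euclidean_inner[of x y] by (simp add: sum_distrib_left exp_sum)

text \<open>In each coordinate the integral is the characteristic function of the standard normal
  distribution, and the product measure separates the coordinates.\<close>

lemma gauss_fourier:
  shows "integrable lborel (\<lambda>x::'a::euclidean_space. of_real (gauss x) * cis (x \<bullet> y))"
    and "(LINT x|lborel. of_real (gauss (x::'a::euclidean_space)) * cis (x \<bullet> y)) = of_real (exp (- (norm y)\<^sup>2 / 2))"
proof -
  define k where "k b r = of_real (std_normal_density r) * cis (r * (y \<bullet> b))" for b r
  have k: "integrable lborel (k b)" for b
  proof (rule Bochner_Integration.integrable_bound)
    show "integrable lborel std_normal_density" by simp
    show "AE x in lborel. norm (k b x) \<le> norm (std_normal_density x)"
      by (simp add: k_def norm_mult)
    show "k b \<in> borel_measurable lborel" unfolding k_def by measurable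
  qed
  have "(LINT r|lborel. k b r) = of_real (exp (- (y \<bullet> b)\<^sup>2 / 2))" for b
  proof -
    have "char std_normal_distribution (y \<bullet> b) = (LINT r|lborel. k b r)"
      unfolding char_def k_def
      by (subst integral_density)
        (auto simp: cis_conv_exp scaleR_conv_of_real mult.commute)
    then show ?thesis by (simp add: char_std_normal_distribution)
  qed
  moreover have eq: "of_real (gauss x) * cis (x \<bullet> y) = (\<Prod>b\<in>Basis. k b (x \<bullet> b))" for x
    by (simp add: gauss_def k_def cis_inner_eq prod.distrib)
  moreover have "(\<Prod>b\<in>Basis. exp (- (y \<bullet> b)\<^sup>2 / 2)) = exp (- (norm y)\<^sup>2 / 2)"
    unfolding power2_norm_eq_inner euclidean_inner[of y y]
    by (simp add: exp_sum[symmetric] sum_negf sum_divide_distrib power2_eq_square)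
  ultimately show "integrable lborel (\<lambda>x. of_real (gauss x) * cis (x \<bullet> y))"
    "(LINT x|lborel. of_real (gauss x) * cis (x \<bullet> y)) = of_real (exp (- (norm y)\<^sup>2 / 2))"
    using integral_lborel_prod_Basis[of k, OF k] by (simp_all flip: of_real_prod)
qed

lemma gauss_integrable: "integrable lborel (\<lambda>x::'a::euclidean_space. complex_of_real (gauss x))"
  and gauss_integral: "(LINT x|lborel. complex_of_real (gauss (x::'a::euclidean_space))) = 1"
  using gauss_fourier[of "0::'a"] by simp_all

subsection \<open>Fourier inversion\<close>

text \<open>An approximate identity. \<open>F\<close> need not be bounded, so the integral is split
  at the unit ball: inside, local boundedness gives a dominating function after rescaling; outside,
  the kernel is uniformly small and \<open>F\<close> is integrable.\<close>

lemma gauss_approximation: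
  fixes F :: "'a::euclidean_space \<Rightarrow> complex"
  assumes cont: "continuous_on UNIV F" and F: "integrable lborel F"
    and M: "filterlim M at_top sequentially" and Mpos: "\<And>m. 0 < M m"
  shows "(\<lambda>m. LINT u|lborel. F (t - u) * of_real (M m ^ DIM('a) * gauss (M m *\<^sub>R u))) \<longlonglongrightarrow> F t"
proof -
  have [measurable]: "F \<in> borel_measurable borel" using F by (auto dest: borel_measurable_integrable)
  define \<delta> :: real where "\<delta> = 1"
  define B where "B = cball (0::'a) \<delta>"
  have [measurable]: "B \<in> sets borel" by (simp add: B_def)
  have cF: "isCont F x" for x using cont by (simp add: continuous_on_eq_continuous_at)
  have "compact (F ` cball t \<delta>)"
    by (intro compact_continuous_image continuous_on_subset[OF cont]) auto
  then have "bounded (F ` cball t \<delta>)" by (rule compact_imp_bounded)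
  then obtain S where S: "\<And>y. y \<in> cball t \<delta> \<Longrightarrow> norm (F y) \<le> S"
    unfolding bounded_iff by (metis imageI)
  have fourier: "integrable lborel (\<lambda>u. F (t - u))"
    using integrable_lborel_affine[OF _ F, of "-1" t] by simp
  define K :: "nat \<Rightarrow> 'a \<Rightarrow> real" where "K m u = M m ^ DIM('a) * gauss (M m *\<^sub>R u)" for m u
  have [measurable]: "K m \<in> borel_measurable borel" for m unfolding K_def by measurable
  have K: "0 \<le> K m u" for m u using Mpos[of m] by (simp add: K_def)
  \<comment> \<open>Used twice: with \<open>d = 0\<close> it shows that the kernel is bounded, with
    \<open>d = \<delta>\<close> that it is small outside the ball.\<close>
  have Kb: "K m u \<le> M m ^ DIM('a) * exp (- (M m)\<^sup>2 * d\<^sup>2 / 2)" if "d \<le> norm u" "0 \<le> d" for m u d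
  proof -
    have "(1 / sqrt (2 * pi)) \<le> 1" using pi_gt3 by (simp add: real_le_rsqrt)
    then have c: "(1 / sqrt (2 * pi)) ^ DIM('a) \<le> 1" by (intro power_le_one) auto
    have "(M m)\<^sup>2 * d\<^sup>2 \<le> (norm (M m *\<^sub>R u))\<^sup>2"
      using that Mpos[of m] by (simp add: power_mult_distrib[symmetric] power_mono mult_left_mono)
    then have "exp (- (norm (M m *\<^sub>R u))\<^sup>2 / 2) \<le> exp (- (M m)\<^sup>2 * d\<^sup>2 / 2)" by simp
    then have "gauss (M m *\<^sub>R u) \<le> 1 * exp (- (M m)\<^sup>2 * d\<^sup>2 / 2)"
      unfolding gauss_eq by (intro mult_mono c) auto
    then show ?thesis unfolding K_def using Mpos[of m] by (intro mult_left_mono) auto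
  qed
  have int: "integrable lborel (\<lambda>u. F (t - u) * of_real (K m u))" for m
  proof (rule Bochner_Integration.integrable_bound)
    show "integrable lborel (\<lambda>u. F (t - u) * of_real (M m ^ DIM('a)))" using fourier by simp
    show "AE u in lborel. norm (F (t - u) * of_real (K m u)) \<le> norm (F (t - u) * of_real (M m ^ DIM('a)))"
      using K Kb[of 0] Mpos by (intro AE_I2) (auto simp: norm_mult norm_power abs_of_pos intro!: mult_left_mono)
  qed measurable
  have near: "(\<lambda>m. LINT u|lborel. F (t - u) * of_real (K m u) * indicator B u) \<longlonglongrightarrow> F t"
  proof -
    have "(LINT u|lborel. F (t - u) * of_real (K m u) * indicator B u)
      = (LINT v|lborel. F (t - v /\<^sub>R M m) * of_real (gauss v) * indicator B (v /\<^sub>R M m))" for m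
    proof -
      have "(LINT v|lborel. F (t - v /\<^sub>R M m) * of_real (gauss v) * indicator B (v /\<^sub>R M m))
        = M m ^ DIM('a) *\<^sub>R (LINT u|lborel. F (t - u) * of_real (gauss (M m *\<^sub>R u)) * indicator B u)"
        using Mpos[of m] by (subst integral_lborel_affine[where c = "M m" and t = 0]) auto
      also have "\<dots> = (LINT u|lborel. F (t - u) * of_real (K m u) * indicator B u)"
        unfolding K_def by (simp add: scaleR_conv_of_real ac_simps flip: integral_mult_right_zero)
      finally show ?thesis by simp
    qed
    moreover have "(\<lambda>m. LINT v|lborel. F (t - v /\<^sub>R M m) * of_real (gauss v) * indicator B (v /\<^sub>R M m))
      \<longlonglongrightarrow> (LINT v|lborel. F t * of_real (gauss (v::'a)))"
    proof (rule integral_dominated_convergence)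
      show "integrable lborel (\<lambda>v::'a. S * gauss v)"
        using integrable_norm[OF gauss_integrable] by (intro integrable_mult_right) simp
      show "AE v in lborel. norm (F (t - v /\<^sub>R M m) * of_real (gauss v) * indicator B (v /\<^sub>R M m)) \<le> S * gauss v" for m
      proof (intro AE_I2)
        fix v
        show "norm (F (t - v /\<^sub>R M m) * of_real (gauss v) * indicator B (v /\<^sub>R M m)) \<le> S * gauss v"
        proof (cases "v /\<^sub>R M m \<in> B")
          case True
          then have "t - v /\<^sub>R M m \<in> cball t \<delta>" by (simp add: B_def dist_norm)
          then show ?thesis using S True by (auto simp: norm_mult intro!: mult_right_mono)
        next
          case False
          have "0 \<le> S" using order_trans[OF norm_ge_zero S[of t]] by (simp add: \<delta>_def)
          then show ?thesis using False by simp
        qed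
      qed
      show "AE v in lborel. (\<lambda>m. F (t - v /\<^sub>R M m) * of_real (gauss v) * indicator B (v /\<^sub>R M m))
          \<longlonglongrightarrow> F t * of_real (gauss v)"
      proof (intro AE_I2)
        fix v :: 'a
        have "(\<lambda>m. inverse (M m)) \<longlonglongrightarrow> 0" using M by (rule tendsto_inverse_0_at_top)
        then have lim: "(\<lambda>m. v /\<^sub>R M m) \<longlonglongrightarrow> 0" using tendsto_scaleR[OF _ tendsto_const, of _ 0 _ v] by auto
        then have "(\<lambda>m. F (t - v /\<^sub>R M m)) \<longlonglongrightarrow> F (t - 0)"
          by (intro isCont_tendsto_compose[OF cF] tendsto_diff tendsto_const)
        then have "(\<lambda>m. F (t - v /\<^sub>R M m) * of_real (gauss v)) \<longlonglongrightarrow> F t * of_real (gauss v)"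
          by (intro tendsto_mult) auto
        moreover have "\<forall>\<^sub>F m in sequentially. v /\<^sub>R M m \<in> ball 0 \<delta>"
          by (rule topological_tendstoD[OF lim]) (auto simp: \<delta>_def)
        then have "\<forall>\<^sub>F m in sequentially. F (t - v /\<^sub>R M m) * of_real (gauss v)
          = F (t - v /\<^sub>R M m) * of_real (gauss v) * indicator B (v /\<^sub>R M m)"
          by eventually_elim (auto simp: B_def indicator_def)
        ultimately show "(\<lambda>m. F (t - v /\<^sub>R M m) * of_real (gauss v) * indicator B (v /\<^sub>R M m))
          \<longlonglongrightarrow> F t * of_real (gauss v)"
          by (rule Lim_transform_eventually)
      qed
    qed measurable
    ultimately show ?thesis using gauss_integral[where 'a = 'a] by simp
  qed
  have far: "(\<lambda>m. LINT u|lborel. F (t - u) * of_real (K m u) * indicator (- B) u) \<longlonglongrightarrow> 0"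
  proof (rule Lim_null_comparison)
    define I where "I = (LINT u|lborel. norm (F (t - u)))"
    show "\<forall>\<^sub>F m in sequentially. norm (LINT u|lborel. F (t - u) * of_real (K m u) * indicator (- B) u)
        \<le> I * (M m ^ DIM('a) * exp (- (M m)\<^sup>2 * \<delta>\<^sup>2 / 2))"
    proof (intro always_eventually allI)
      fix m
      have "norm (LINT u|lborel. F (t - u) * of_real (K m u) * indicator (- B) u)
        \<le> (LINT u|lborel. norm (F (t - u) * of_real (K m u) * indicator (- B) u))"
        by (rule integral_norm_bound)
      also have "\<dots> \<le> (LINT u|lborel. norm (F (t - u)) * (M m ^ DIM('a) * exp (- (M m)\<^sup>2 * \<delta>\<^sup>2 / 2)))"
      proof (rule integral_mono)
        show "integrable lborel (\<lambda>u. norm (F (t - u) * of_real (K m u) * indicator (- B) u))"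
          by (intro integrable_norm, rule Bochner_Integration.integrable_bound[OF int[of m]])
            (auto simp: norm_mult indicator_def)
        show "integrable lborel (\<lambda>u. norm (F (t - u)) * (M m ^ DIM('a) * exp (- (M m)\<^sup>2 * \<delta>\<^sup>2 / 2)))"
          using fourier by (intro integrable_mult_left integrable_norm)
        show "norm (F (t - u) * of_real (K m u) * indicator (- B) u)
           \<le> norm (F (t - u)) * (M m ^ DIM('a) * exp (- (M m)\<^sup>2 * \<delta>\<^sup>2 / 2))" for u
        proof (cases "u \<in> B")
          case True
          then show ?thesis using Mpos[of m] by simp
        next
          case False
          then have "\<delta> \<le> norm u" by (simp add: B_def)
          then have "K m u \<le> M m ^ DIM('a) * exp (- (M m)\<^sup>2 * \<delta>\<^sup>2 / 2)" by (rule Kb) (simp add: \<delta>_def)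
          then show ?thesis using False K[of m u] by (auto simp: norm_mult intro!: mult_left_mono)
        qed
      qed
      finally show "norm (LINT u|lborel. F (t - u) * of_real (K m u) * indicator (- B) u)
        \<le> I * (M m ^ DIM('a) * exp (- (M m)\<^sup>2 * \<delta>\<^sup>2 / 2))" by (simp add: I_def)
    qed
    have "((\<lambda>x::real. x ^ DIM('a) * exp (- x\<^sup>2 * \<delta>\<^sup>2 / 2)) \<longlongrightarrow> 0) at_top"
    proof (rule Lim_null_comparison)
      show "\<forall>\<^sub>F x in at_top. norm (x ^ DIM('a) * exp (- x\<^sup>2 * \<delta>\<^sup>2 / 2)) \<le> x ^ DIM('a) / exp (x::real)"
        using eventually_ge_at_top[of 2]
      proof eventually_elim
        case (elim x)
        then have "2 * x \<le> x\<^sup>2" by (simp add: power2_eq_square)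
        then have "exp (- x\<^sup>2 * \<delta>\<^sup>2 / 2) \<le> exp (- x)" by (simp add: \<delta>_def)
        then show ?case using elim
          by (simp add: abs_mult exp_minus field_simps del: exp_le_cancel_iff)
      qed
    qed (rule tendsto_power_div_exp_0)
    from filterlim_compose[OF this M]
    show "(\<lambda>m. I * (M m ^ DIM('a) * exp (- (M m)\<^sup>2 * \<delta>\<^sup>2 / 2))) \<longlonglongrightarrow> 0"
      by (rule tendsto_mult_right_zero)
  qed
  have "(LINT u|lborel. F (t - u) * of_real (K m u))
    = (LINT u|lborel. F (t - u) * of_real (K m u) * indicator B u) + (LINT u|lborel. F (t - u) * of_real (K m u) * indicator (- B) u)" for m
  proof (subst Bochner_Integration.integral_add[symmetric])
    show "integrable lborel (\<lambda>u. F (t - u) * of_real (K m u) * indicator B u)"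
      by (rule Bochner_Integration.integrable_bound[OF int[of m]]) (auto simp: norm_mult indicator_def)
    show "integrable lborel (\<lambda>u. F (t - u) * of_real (K m u) * indicator (- B) u)"
      by (rule Bochner_Integration.integrable_bound[OF int[of m]]) (auto simp: norm_mult indicator_def)
  qed (auto intro!: Bochner_Integration.integral_cong simp: indicator_def)
  then show ?thesis using tendsto_add[OF near far] by (simp add: K_def)
qed

text \<open>Makes the inverse transform of the damping factor an approximate identity of scale
  \<open>2 * pi * m\<close>; the normalisation comes out exactly because
  \<open>c * c = (2 * pi) ^ n\<close>.\<close>

lemma gauss_kernel:
  fixes y :: "'a::euclidean_space"
  assumes m: "0 < (m::real)"
  shows "integrable lborel (\<lambda>w::'a. complex_of_real (exp (- (norm w)\<^sup>2 / (2 * m\<^sup>2))))"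
    and "(LINT w|lborel. complex_of_real (exp (- (norm w)\<^sup>2 / (2 * m\<^sup>2))) * cis (2 * pi * (w \<bullet> y)))
      = of_real ((2 * pi * m) ^ DIM('a) * gauss ((2 * pi * m) *\<^sub>R y))"
proof -
  define c where "c = sqrt (2 * pi) ^ DIM('a)"
  have c: "0 < c" by (simp add: c_def)
  have g: "gauss x = exp (- (norm x)\<^sup>2 / 2) / c" for x :: 'a
    unfolding gauss_eq c_def by (simp add: power_one_over)
  have eq: "exp (- (norm w)\<^sup>2 / (2 * m\<^sup>2)) = c * gauss ((1 / m) *\<^sub>R w)" for w :: 'a
    unfolding g using c m by (simp add: power_divide power_mult_distrib field_simps)
  show "integrable lborel (\<lambda>w::'a. complex_of_real (exp (- (norm w)\<^sup>2 / (2 * m\<^sup>2))))"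
    unfolding eq of_real_mult
    using integrable_lborel_affine[OF _ gauss_integrable, of "1 / m" 0] m by (intro integrable_mult_right) simp
  have "(LINT w|lborel. complex_of_real (exp (- (norm w)\<^sup>2 / (2 * m\<^sup>2))) * cis (2 * pi * (w \<bullet> y)))
    = m ^ DIM('a) *\<^sub>R (LINT w|lborel. of_real c * (of_real (gauss (w::'a)) * cis (w \<bullet> ((2 * pi * m) *\<^sub>R y))))"
    unfolding eq using m by (subst integral_lborel_affine[where c = m and t = 0]) (auto simp: ac_simps)
  also have "\<dots> = of_real (m ^ DIM('a) * c * exp (- (norm ((2 * pi * m) *\<^sub>R y))\<^sup>2 / 2))"
    by (subst integral_mult_right_zero, subst gauss_fourier(2)) (simp add: scaleR_conv_of_real)
  also have "m ^ DIM('a) * c * exp (- (norm ((2 * pi * m) *\<^sub>R y))\<^sup>2 / 2)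
    = m ^ DIM('a) * (c * c) * gauss ((2 * pi * m) *\<^sub>R y)"
    unfolding g using c by simp
  also have "c * c = (2 * pi) ^ DIM('a)"
    unfolding c_def power_mult_distrib[symmetric] by simp
  also have "m ^ DIM('a) * (2 * pi) ^ DIM('a) = (2 * pi * m) ^ DIM('a)"
    by (simp add: power_mult_distrib)
  finally show "(LINT w|lborel. complex_of_real (exp (- (norm w)\<^sup>2 / (2 * m\<^sup>2))) * cis (2 * pi * (w \<bullet> y)))
      = of_real ((2 * pi * m) ^ DIM('a) * gauss ((2 * pi * m) *\<^sub>R y))" .
qed

text \<open>A Gaussian damping factor makes Fubini's theorem applicable and turns the damped
  integral into a Gaussian mean of \<open>F\<close> about \<open>t\<close>. As the damping is
  removed, this one sequence tends to both sides of the identity.\<close>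

theorem Fourier_inversion:
  fixes F :: "real^'n::finite \<Rightarrow> complex"
  assumes cont: "continuous_on UNIV F" and F: "integrable lborel F" and FF: "integrable lborel (fourier F)"
  shows "F t = (LINT w|lborel. fourier F w * cis (2 * pi * (w \<bullet> t)))"
proof -
  have [measurable]: "F \<in> borel_measurable borel" using F by (auto dest: borel_measurable_integrable)
  define K :: "nat \<Rightarrow> real^'n \<Rightarrow> real" where "K m w = exp (- (norm w)\<^sup>2 / (2 * (real (Suc m))\<^sup>2))" for m w
  have [measurable]: "K m \<in> borel_measurable borel" for m unfolding K_def by measurable
  have K: "0 \<le> K m w" "K m w \<le> 1" for m w by (auto simp: K_def)
  have Ki: "integrable lborel (\<lambda>w. complex_of_real (K m w))" for m
    unfolding K_def by (rule gauss_kernel) simp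
  define M where "M m = 2 * pi * real (Suc m)" for m
  have M0: "0 < M m" for m by (simp add: M_def)
  have Minf: "filterlim M at_top sequentially"
    unfolding M_def
    by (intro filterlim_tendsto_pos_mult_at_top[OF tendsto_const]
        filterlim_compose[OF filterlim_real_sequentially filterlim_Suc]) auto
  have eq: "(LINT w|lborel. fourier F w * cis (2 * pi * (w \<bullet> t)) * of_real (K m w))
    = (LINT u|lborel. F (t - u) * of_real (M m ^ DIM(real^'n) * gauss (M m *\<^sub>R u)))" for m
  proof -
    have "(LINT w|lborel. fourier F w * cis (2 * pi * (w \<bullet> t)) * of_real (K m w))
      = (LINT w|lborel. LINT s|lborel. F s * of_real (K m w) * cis (2 * pi * (w \<bullet> (t - s))))"
    proof (rule Bochner_Integration.integral_cong)
      fix w :: "real^'n"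
      have "fourier F w * (cis (2 * pi * (w \<bullet> t)) * of_real (K m w))
        = (LINT s|lborel. F s * cis (- (2 * pi * (w \<bullet> s))) * (cis (2 * pi * (w \<bullet> t)) * of_real (K m w)))"
        unfolding fourier_def by (rule integral_mult_left_zero[symmetric])
      also have "\<dots> = (LINT s|lborel. F s * of_real (K m w) * cis (2 * pi * (w \<bullet> (t - s))))"
      proof (rule Bochner_Integration.integral_cong)
        fix s :: "real^'n"
        have "cis (2 * pi * (w \<bullet> (t - s))) = cis (- (2 * pi * (w \<bullet> s))) * cis (2 * pi * (w \<bullet> t))"
          by (simp add: cis_mult inner_diff_right algebra_simps)
        then show "F s * cis (- (2 * pi * (w \<bullet> s))) * (cis (2 * pi * (w \<bullet> t)) * of_real (K m w))
          = F s * of_real (K m w) * cis (2 * pi * (w \<bullet> (t - s)))" by simp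
      qed simp
      finally show "fourier F w * cis (2 * pi * (w \<bullet> t)) * of_real (K m w)
        = (LINT s|lborel. F s * of_real (K m w) * cis (2 * pi * (w \<bullet> (t - s))))"
        by (simp only: mult.assoc)
    qed simp
    also have "\<dots> = (LINT s|lborel. LINT w|lborel. F s * of_real (K m w) * cis (2 * pi * (w \<bullet> (t - s))))"
      by (rule lborel_pair.Fubini_integral, rule integrable_pair_mult[OF F Ki]) auto
    also have "\<dots> = (LINT s|lborel. F s * of_real (M m ^ DIM(real^'n) * gauss (M m *\<^sub>R (t - s))))"
    proof (rule Bochner_Integration.integral_cong)
      fix s :: "real^'n"
      have "(LINT w|lborel. F s * of_real (K m w) * cis (2 * pi * (w \<bullet> (t - s))))
        = F s * (LINT w|lborel. of_real (K m w) * cis (2 * pi * (w \<bullet> (t - s))))"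
        unfolding mult.assoc by (rule integral_mult_right_zero)
      then show "(LINT w|lborel. F s * of_real (K m w) * cis (2 * pi * (w \<bullet> (t - s))))
        = F s * of_real (M m ^ DIM(real^'n) * gauss (M m *\<^sub>R (t - s)))"
        unfolding K_def M_def by (subst (asm) gauss_kernel(2)) auto
    qed simp
    also have "\<dots> = (LINT u|lborel. F (t - u) * of_real (M m ^ DIM(real^'n) * gauss (M m *\<^sub>R u)))"
      by (subst integral_lborel_affine[where c = "-1" and t = t]) auto
    finally show ?thesis .
  qed
  have "(\<lambda>m. LINT w|lborel. fourier F w * cis (2 * pi * (w \<bullet> t)) * of_real (K m w))
    \<longlonglongrightarrow> (LINT w|lborel. fourier F w * cis (2 * pi * (w \<bullet> t)))"
  proof (rule integral_dominated_convergence)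
    show "integrable lborel (\<lambda>w. norm (fourier F w))" using FF by simp
    show "AE w in lborel. norm (fourier F w * cis (2 * pi * (w \<bullet> t)) * of_real (K m w)) \<le> norm (fourier F w)" for m
      using K[of m] by (auto simp: norm_mult intro!: mult_left_le)
    show "AE w in lborel. (\<lambda>m. fourier F w * cis (2 * pi * (w \<bullet> t)) * of_real (K m w))
        \<longlonglongrightarrow> fourier F w * cis (2 * pi * (w \<bullet> t))"
    proof (intro AE_I2)
      fix w :: "real^'n"
      have "(\<lambda>m. inverse (real (Suc m))) \<longlonglongrightarrow> 0" by (rule LIMSEQ_inverse_real_of_nat)
      then have "(\<lambda>m. - (norm w)\<^sup>2 / 2 * (inverse (real (Suc m)))\<^sup>2) \<longlonglongrightarrow> - (norm w)\<^sup>2 / 2 * 0\<^sup>2"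
        by (intro tendsto_intros)
      then have "(\<lambda>m. exp (- (norm w)\<^sup>2 / 2 * (inverse (real (Suc m)))\<^sup>2)) \<longlonglongrightarrow> exp (- (norm w)\<^sup>2 / 2 * 0\<^sup>2)"
        by (rule tendsto_exp)
      then have "(\<lambda>m. K m w) \<longlonglongrightarrow> 1" unfolding K_def by (simp add: field_simps)
      then have "(\<lambda>m. fourier F w * cis (2 * pi * (w \<bullet> t)) * of_real (K m w))
        \<longlonglongrightarrow> fourier F w * cis (2 * pi * (w \<bullet> t)) * of_real 1"
        by (intro tendsto_intros)
      then show "(\<lambda>m. fourier F w * cis (2 * pi * (w \<bullet> t)) * of_real (K m w))
        \<longlonglongrightarrow> fourier F w * cis (2 * pi * (w \<bullet> t))" by simp
    qed
  qed measurable
  then show ?thesis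
    unfolding eq using gauss_approximation[OF cont F Minf M0] by (rule LIMSEQ_unique[rotated])
qed

text \<open>The norm of the Fourier algebra. For non-integrable \<open>h\<close> the transform is 0
  by convention, so a bound by \<open>FL1\<close> is meaningful only together with
  integrability.\<close>

definition FL1 :: "(real^'n::finite \<Rightarrow> complex) \<Rightarrow> ennreal" where
  "FL1 h = (\<integral>\<^sup>+w. ennreal (norm (fourier h w)) \<partial>lborel)"

lemma integrable_fourier:
  assumes [measurable]: "h \<in> borel_measurable borel" and "FL1 h < top"
  shows "integrable lborel (fourier h)"
  by (rule integrableI_bounded) (use assms(2) in \<open>auto simp: FL1_def\<close>)

lemma Fourier_inversion_FL1:
  assumes "continuous_on UNIV F" "integrable lborel F" "FL1 F < top"
  shows "F t = (LINT w|lborel. fourier F w * cis (2 * pi * (w \<bullet> t)))"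
  using assms by (intro Fourier_inversion integrable_fourier) (auto dest: borel_measurable_integrable)

lemma norm_le_FL1:
  assumes "continuous_on UNIV F" "integrable lborel F"
  shows "ennreal (norm (F t)) \<le> FL1 F"
proof (cases "FL1 F < top")
  case True
  have "ennreal (norm (F t)) \<le> (\<integral>\<^sup>+w. ennreal (norm (fourier F w * cis (2 * pi * (w \<bullet> t)))) \<partial>lborel)"
    by (subst Fourier_inversion_FL1[OF assms True]) (rule norm_integral_le_nn_integral)
  then show ?thesis by (simp add: FL1_def norm_mult)
qed (simp add: less_top[symmetric])

text \<open>Inversion is applied to \<open>G\<close> alone, so \<open>F\<close> only has to be
  integrable. The asymmetry matters: in the change of window nothing is known yet about the
  integrability of the transform of \<open>F\<close>.\<close>

lemma fourier_mult_le:
  fixes F G :: "real^'n::finite \<Rightarrow> complex"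
  assumes F: "integrable lborel F"
    and G: "continuous_on UNIV G" "integrable lborel G" "FL1 G < top"
  shows "ennreal (norm (fourier (\<lambda>t. F t * G t) w)) \<le> nn_conv (\<lambda>w. ennreal (norm (fourier F w))) (\<lambda>w. ennreal (norm (fourier G w))) w"
proof -
  have [measurable]: "F \<in> borel_measurable borel" "G \<in> borel_measurable borel"
    using F G by (auto dest: borel_measurable_integrable)
  have FG: "integrable lborel (fourier G)" using G by (intro integrable_fourier) auto
  have "fourier (\<lambda>t. F t * G t) w = (LINT t|lborel. LINT \<eta>|lborel. F t * fourier G \<eta> * cis (- (2 * pi * ((w - \<eta>) \<bullet> t))))"
    unfolding fourier_def[of "\<lambda>t. F t * G t"]
  proof (rule Bochner_Integration.integral_cong)
    fix t :: "real^'n"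
    have "F t * G t * cis (- (2 * pi * (w \<bullet> t)))
      = F t * cis (- (2 * pi * (w \<bullet> t))) * (LINT \<eta>|lborel. fourier G \<eta> * cis (2 * pi * (\<eta> \<bullet> t)))"
      by (subst Fourier_inversion_FL1[OF G]) simp
    also have "\<dots> = (LINT \<eta>|lborel. F t * cis (- (2 * pi * (w \<bullet> t))) * (fourier G \<eta> * cis (2 * pi * (\<eta> \<bullet> t))))"
      by (rule integral_mult_right_zero[symmetric])
    also have "\<dots> = (LINT \<eta>|lborel. F t * fourier G \<eta> * cis (- (2 * pi * ((w - \<eta>) \<bullet> t))))"
    proof (rule Bochner_Integration.integral_cong)
      fix \<eta> :: "real^'n"
      have "cis (- (2 * pi * ((w - \<eta>) \<bullet> t))) = cis (- (2 * pi * (w \<bullet> t))) * cis (2 * pi * (\<eta> \<bullet> t))"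
        by (simp add: cis_mult inner_diff_left algebra_simps)
      then show "F t * cis (- (2 * pi * (w \<bullet> t))) * (fourier G \<eta> * cis (2 * pi * (\<eta> \<bullet> t)))
        = F t * fourier G \<eta> * cis (- (2 * pi * ((w - \<eta>) \<bullet> t)))" by simp
    qed simp
    finally show "F t * G t * cis (- (2 * pi * (w \<bullet> t)))
      = (LINT \<eta>|lborel. F t * fourier G \<eta> * cis (- (2 * pi * ((w - \<eta>) \<bullet> t))))" .
  qed simp
  also have "\<dots> = (LINT \<eta>|lborel. LINT t|lborel. F t * fourier G \<eta> * cis (- (2 * pi * ((w - \<eta>) \<bullet> t))))"
    by (rule lborel_pair.Fubini_integral[symmetric], rule integrable_pair_mult[OF F FG]) auto
  also have "\<dots> = (LINT \<eta>|lborel. fourier F (w - \<eta>) * fourier G \<eta>)"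
  proof (rule Bochner_Integration.integral_cong)
    fix \<eta> :: "real^'n"
    have "fourier F (w - \<eta>) * fourier G \<eta> = (LINT t|lborel. F t * cis (- (2 * pi * ((w - \<eta>) \<bullet> t))) * fourier G \<eta>)"
      unfolding fourier_def[of F] by (rule integral_mult_left_zero[symmetric])
    then show "(LINT t|lborel. F t * fourier G \<eta> * cis (- (2 * pi * ((w - \<eta>) \<bullet> t)))) = fourier F (w - \<eta>) * fourier G \<eta>"
      by (simp add: ac_simps)
  qed simp
  finally have "ennreal (norm (fourier (\<lambda>t. F t * G t) w)) \<le> (\<integral>\<^sup>+\<eta>. ennreal (norm (fourier F (w - \<eta>) * fourier G \<eta>)) \<partial>lborel)"
    by (simp add: norm_integral_le_nn_integral)
  then show ?thesis by (simp add: nn_conv_def norm_mult ennreal_mult)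
qed

lemma FL1_mult_le:
  fixes F G :: "real^'n::finite \<Rightarrow> complex"
  assumes "integrable lborel F" "continuous_on UNIV G" "integrable lborel G" "FL1 G < top"
  shows "FL1 (\<lambda>t. F t * G t) \<le> FL1 F * FL1 G"
proof -
  have [measurable]: "F \<in> borel_measurable borel" "G \<in> borel_measurable borel"
    using assms by (auto dest: borel_measurable_integrable)
  have "FL1 (\<lambda>t. F t * G t) \<le> (\<integral>\<^sup>+w. nn_conv (\<lambda>w. ennreal (norm (fourier F w))) (\<lambda>w. ennreal (norm (fourier G w))) w \<partial>lborel)"
    unfolding FL1_def by (intro nn_integral_mono fourier_mult_le assms)
  then show ?thesis by (subst (asm) nn_integral_nn_conv) (auto simp: FL1_def)
qed

subsection \<open>Decay of Fourier transforms\<close>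

text \<open>Steps of length \<open>1 / (m + 1)\<close> suit the dominated convergence theorem, which
  is about sequences.\<close>

lemma has_vector_derivative_sequentially:
  fixes f :: "real \<Rightarrow> 'a::real_normed_vector"
  assumes "(f has_vector_derivative d) (at 0)"
  shows "(\<lambda>m. real (Suc m) *\<^sub>R (f (inverse (real (Suc m))) - f 0)) \<longlonglongrightarrow> d"
proof -
  have "((\<lambda>h. norm (f (0 + h) - f 0 - h *\<^sub>R d) / norm h) \<longlongrightarrow> 0) (at 0)"
    using assms unfolding has_vector_derivative_def has_derivative_at by simp
  moreover have "norm (f (0 + h) - f 0 - h *\<^sub>R d) / norm h = norm ((f h - f 0) /\<^sub>R h - d)" if "h \<noteq> 0" for h
  proof -
    have "(f h - f 0) /\<^sub>R h - d = (f (0 + h) - f 0 - h *\<^sub>R d) /\<^sub>R h"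
      using that by (simp add: scaleR_diff_right)
    then show ?thesis by (simp add: divide_inverse_commute)
  qed
  then have "\<forall>\<^sub>F h in at 0. norm (f (0 + h) - f 0 - h *\<^sub>R d) / norm h = norm ((f h - f 0) /\<^sub>R h - d)"
    by (auto simp: eventually_at_filter)
  ultimately have "((\<lambda>h. norm ((f h - f 0) /\<^sub>R h - d)) \<longlongrightarrow> 0) (at 0)"
    by (rule Lim_transform_eventually)
  then have lim: "((\<lambda>h. (f h - f 0) /\<^sub>R h) \<longlongrightarrow> d) (at 0)"
    by (simp add: tendsto_norm_zero_iff LIM_zero_iff)
  have "filterlim (\<lambda>m. inverse (real (Suc m))) (at 0) sequentially"
    using LIMSEQ_inverse_real_of_nat by (auto simp: filterlim_at)
  from filterlim_compose[OF lim this] show ?thesis by simp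
qed

lemma mean_value_bound:
  fixes f :: "real \<Rightarrow> complex"
  assumes "\<And>h. h \<in> {0..e} \<Longrightarrow> (f has_vector_derivative f' h) (at h)" "\<And>h. h \<in> {0..e} \<Longrightarrow> norm (f' h) \<le> B" "0 \<le> e"
  shows "norm (f e - f 0) \<le> B * e"
proof -
  have "norm (f e - f 0) \<le> B * norm (e - 0)"
  proof (rule differentiable_bound[where S = "{0..e}" and f' = "\<lambda>h k. k *\<^sub>R f' h"])
    show "(f has_derivative (\<lambda>k. k *\<^sub>R f' x)) (at x within {0..e})" if "x \<in> {0..e}" for x
      using assms(1)[OF that] unfolding has_vector_derivative_def by (rule has_derivative_at_withinI)
    show "onorm (\<lambda>k. k *\<^sub>R f' x) \<le> B" if "x \<in> {0..e}" for x
      by (rule onorm_le) (use assms(2)[OF that] in \<open>auto simp: mult.commute[of B] intro: mult_left_mono\<close>)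
  qed (use assms in auto)
  then show ?thesis using assms(3) by simp
qed

text \<open>Difference quotients take the place of integration by parts: translating
  \<open>G\<close> multiplies its transform by a phase, so the quotient can be followed to its limit
  on both sides.\<close>

lemma fourier_partial_derivative:
  fixes G :: "real^'n::finite \<Rightarrow> complex"
  assumes G: "G \<in> schwartz"
  shows "fourier (partial_derivative i G) w = - (\<i> * of_real (- (2 * pi * w $ i))) * fourier G w"
proof -
  define a where "a = real CARD('n)"
  have a: "0 \<le> a" by (simp add: a_def)
  obtain C where C: "0 \<le> C" "\<And>x. norm (iterated_derivative [i] G x) \<le> C * jb (- a) x"
    using schwartz_bound[OF G, of "[i]" a] by blast
  let ?e = "axis i 1 :: real^'n"
  note [measurable] = schwartz_measurable[OF G]
  have [measurable]: "partial_derivative i G \<in> borel_measurable borel"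
    using schwartz_measurable[OF schwartz_iterated_derivative[OF G, of "[i]"]] by simp
  define h where "h m = inverse (real (Suc m))" for m
  have h: "0 \<le> h m" "h m \<le> 1" "real (Suc m) * h m = 1" for m by (auto simp: h_def divide_simps)
  have dG: "((\<lambda>h. G (x + h *\<^sub>R ?e)) has_vector_derivative partial_derivative i G (x + k *\<^sub>R ?e)) (at k)" for x k
    using smooth_differentiable[OF schwartz_smooth[OF G], of "[]"] by (intro partial_derivative_works) simp
  define D where "D m x = real (Suc m) *\<^sub>R (G (x + h m *\<^sub>R ?e) - G x)" for m x
  have [measurable]: "D m \<in> borel_measurable borel" for m unfolding D_def by measurable
  \<comment> \<open>A dominating function independent of \<open>m\<close>, from the mean value bound
    over a segment of length at most 1. One factor \<open>2 powr a\<close> comes from Peetre's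
    inequality, the other from the bound on \<open>jb a (k *\<^sub>R ?e)\<close>.\<close>
  have bd: "norm (D m x) \<le> C * 2 powr a * 2 powr a * jb (- a) x" for m x
  proof -
    have "norm (G (x + h m *\<^sub>R ?e) - G (x + 0 *\<^sub>R ?e)) \<le> C * 2 powr a * 2 powr a * jb (- a) x * h m"
    proof (rule mean_value_bound[OF dG])
      fix k assume k: "k \<in> {0..h m}"
      have "jb a (k *\<^sub>R ?e) \<le> 2 powr a"
      proof -
        have "k\<^sup>2 \<le> 1\<^sup>2" using k h(2)[of m] by (intro power_mono) auto
        then show ?thesis unfolding jb_def using a by (intro powr_mono2) auto
      qed
      have "norm (partial_derivative i G (x + k *\<^sub>R ?e)) \<le> C * jb (- a) (x + k *\<^sub>R ?e)" using C(2)[of "x + k *\<^sub>R ?e"] by simp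
      also have "\<dots> = C * (jb (- a) (x + k *\<^sub>R ?e) * jb (- a) (- (k *\<^sub>R ?e))) * jb a (k *\<^sub>R ?e)"
        by (simp add: jb_add)
      also have "\<dots> \<le> C * (2 powr a * jb (- a) (x + k *\<^sub>R ?e + - (k *\<^sub>R ?e))) * 2 powr a"
        using C a \<open>jb a (k *\<^sub>R ?e) \<le> 2 powr a\<close>
        by (intro mult_mono mult_left_mono jb_negative_submult) auto
      finally show "norm (partial_derivative i G (x + k *\<^sub>R ?e)) \<le> C * 2 powr a * 2 powr a * jb (- a) x"
        by (simp add: ac_simps)
    qed (rule h)
    then have "real (Suc m) * norm (G (x + h m *\<^sub>R ?e) - G x) \<le> real (Suc m) * (C * 2 powr a * 2 powr a * jb (- a) x * h m)"
      by (intro mult_left_mono) auto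
    also have "\<dots> = C * 2 powr a * 2 powr a * jb (- a) x * (real (Suc m) * h m)" by (simp only: ac_simps)
    finally show ?thesis unfolding D_def h(3) by simp
  qed
  have "(\<lambda>m. LINT x|lborel. D m x * cis (- (2 * pi * (w \<bullet> x)))) \<longlonglongrightarrow> fourier (partial_derivative i G) w"
    unfolding fourier_def
  proof (rule integral_dominated_convergence)
    show "integrable lborel (\<lambda>x::real^'n. C * 2 powr a * 2 powr a * jb (- a) x)"
      by (intro integrable_mult_right integrable_jb) (simp add: a_def)
    show "AE x in lborel. norm (D m x * cis (- (2 * pi * (w \<bullet> x)))) \<le> C * 2 powr a * 2 powr a * jb (- a) x" for m
      using bd[of m] by (simp add: norm_mult)
    show "AE x in lborel. (\<lambda>m. D m x * cis (- (2 * pi * (w \<bullet> x)))) \<longlonglongrightarrow> partial_derivative i G x * cis (- (2 * pi * (w \<bullet> x)))"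
    proof (intro AE_I2 tendsto_mult tendsto_const)
      fix x :: "real^'n"
      show "(\<lambda>m. D m x) \<longlonglongrightarrow> partial_derivative i G x"
        using has_vector_derivative_sequentially[OF dG[of x 0, simplified]] by (simp add: D_def h_def)
    qed
  qed measurable
  moreover have "(LINT x|lborel. D m x * cis (- (2 * pi * (w \<bullet> x))))
    = (real (Suc m) *\<^sub>R (cis (2 * pi * (w $ i) * h m) - cis (2 * pi * (w $ i) * 0))) * fourier G w" for m
  proof -
    have int: "integrable lborel (\<lambda>x. G x * cis (- (2 * pi * (w \<bullet> x))))"
      by (rule Bochner_Integration.integrable_bound[OF schwartz_integrable[OF G]]) (auto simp: norm_mult)
    have c: "cis (- (2 * pi * (w \<bullet> x))) = cis (- (2 * pi * (w \<bullet> (x + h m *\<^sub>R ?e)))) * cis (2 * pi * (w $ i) * h m)" for x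
      by (simp add: cis_mult inner_add_right inner_axis algebra_simps)
    have int2: "integrable lborel (\<lambda>x. G (x + h m *\<^sub>R ?e) * cis (- (2 * pi * (w \<bullet> (x + h m *\<^sub>R ?e)))))"
      using integrable_lborel_affine[OF _ int, of 1 "h m *\<^sub>R ?e"] by (simp add: add.commute)
    have "(LINT x|lborel. D m x * cis (- (2 * pi * (w \<bullet> x))))
      = (LINT x|lborel. real (Suc m) *\<^sub>R (G (x + h m *\<^sub>R ?e) * cis (- (2 * pi * (w \<bullet> (x + h m *\<^sub>R ?e)))) * cis (2 * pi * (w $ i) * h m)
          - G x * cis (- (2 * pi * (w \<bullet> x)))))"
    proof (rule Bochner_Integration.integral_cong)
      fix x :: "real^'n"
      show "D m x * cis (- (2 * pi * (w \<bullet> x))) = real (Suc m) *\<^sub>R (G (x + h m *\<^sub>R ?e) * cis (- (2 * pi * (w \<bullet> (x + h m *\<^sub>R ?e)))) * cis (2 * pi * (w $ i) * h m)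
          - G x * cis (- (2 * pi * (w \<bullet> x))))"
      proof -
        have "G (x + h m *\<^sub>R ?e) * cis (- (2 * pi * (w \<bullet> x)))
          = G (x + h m *\<^sub>R ?e) * cis (- (2 * pi * (w \<bullet> (x + h m *\<^sub>R ?e)))) * cis (2 * pi * (w $ i) * h m)"
          by (subst c[of x]) (rule mult.assoc[symmetric])
        then show ?thesis unfolding D_def by (simp add: left_diff_distrib)
      qed
    qed simp
    also have "\<dots> = real (Suc m) *\<^sub>R ((LINT x|lborel. G (x + h m *\<^sub>R ?e) * cis (- (2 * pi * (w \<bullet> (x + h m *\<^sub>R ?e))))) * cis (2 * pi * (w $ i) * h m) - fourier G w)"
      using int int2 unfolding fourier_def by simp
    also have "(LINT x|lborel. G (x + h m *\<^sub>R ?e) * cis (- (2 * pi * (w \<bullet> (x + h m *\<^sub>R ?e))))) = fourier G w"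
      unfolding fourier_def by (rule integral_lborel_translate[where h = "\<lambda>x. G x * cis (- (2 * pi * (w \<bullet> x)))"]) measurable
    finally show ?thesis by (simp add: algebra_simps)
  qed
  moreover have "(\<lambda>m. (real (Suc m) *\<^sub>R (cis (2 * pi * (w $ i) * h m) - cis (2 * pi * (w $ i) * 0))) * fourier G w)
    \<longlonglongrightarrow> (\<i> * of_real (2 * pi * w $ i)) * fourier G w"
    unfolding h_def
  proof (intro tendsto_mult tendsto_const has_vector_derivative_sequentially)
    show "((\<lambda>h. cis (2 * pi * w $ i * h)) has_vector_derivative \<i> * complex_of_real (2 * pi * w $ i)) (at 0)"
    proof -
      have "((\<lambda>z. exp (\<i> * of_real (2 * pi * w $ i) * z)) has_field_derivative \<i> * of_real (2 * pi * w $ i)) (at (of_real 0))"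
        by (auto intro!: derivative_eq_intros)
      from has_vector_derivative_real_field[OF this] show ?thesis
        by (simp add: cis_conv_exp mult.assoc)
    qed
  qed
  ultimately show ?thesis using LIMSEQ_unique by fastforce
qed

lemma norm_fourier_le: "ennreal (norm (fourier h w)) \<le> (\<integral>\<^sup>+t. ennreal (norm (h t)) \<partial>lborel)"
  using norm_integral_le_nn_integral[of lborel "\<lambda>t. h t * cis (- (2 * pi * (w \<bullet> t)))"]
  by (simp add: fourier_def norm_mult)

lemma fourier_iterated_derivative:
  fixes G :: "real^'n::finite \<Rightarrow> complex"
  assumes G: "G \<in> schwartz"
  shows "norm (fourier (iterated_derivative (replicate k i) G) w) = (2 * pi * \<bar>w $ i\<bar>) ^ k * norm (fourier G w)"
  by (induction k)
    (auto simp: fourier_partial_derivative[OF schwartz_iterated_derivative[OF G]] norm_mult abs_mult)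

text \<open>Reduces bracket weights to pure powers of single coordinates, so that only the
  derivatives \<open>replicate k i\<close> enter.\<close>

lemma jb_le_components:
  fixes w :: "real^'n::finite"
  shows "jb (real m) w \<le> (real CARD('n) + 1) ^ m * (1 + (\<Sum>i\<in>UNIV. \<bar>w $ i\<bar> ^ (2 * m)))"
proof -
  define A where "A = insert 1 (range (\<lambda>i. (w $ i)\<^sup>2))"
  \<comment> \<open>Comparison with the largest of 1 and the squared coordinates avoids a
    multinomial expansion: \<open>1 + (norm w)\<^sup>2\<close> is at most
    \<open>(n + 1) * T\<close>.\<close>
  define T where "T = Max A"
  have fin: "finite A" by (simp add: A_def)
  have T: "T \<in> A" unfolding T_def by (rule Max_in[OF fin]) (simp add: A_def)
  have le: "z \<le> T" if "z \<in> A" for z unfolding T_def using that fin by (rule Max_ge[rotated])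
  have "(norm w)\<^sup>2 = (\<Sum>i\<in>UNIV. (w $ i)\<^sup>2)"
    unfolding power2_norm_eq_inner inner_vec_def by (simp add: power2_eq_square)
  also have "\<dots> \<le> (\<Sum>i\<in>(UNIV :: 'n set). T)" by (intro sum_mono le) (simp add: A_def)
  finally have "1 + (norm w)\<^sup>2 \<le> (real CARD('n) + 1) * T"
    using le[of 1] by (simp add: A_def algebra_simps)
  then have "(1 + (norm w)\<^sup>2) ^ m \<le> ((real CARD('n) + 1) * T) ^ m" by (intro power_mono) auto
  also have "\<dots> = (real CARD('n) + 1) ^ m * T ^ m" by (rule power_mult_distrib)
  also have "T ^ m \<le> 1 + (\<Sum>i\<in>UNIV. \<bar>w $ i\<bar> ^ (2 * m))"
  proof -
    from T consider "T = 1" | i where "T = (w $ i)\<^sup>2" by (auto simp: A_def)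
    then show ?thesis
    proof cases
      case 1
      then show ?thesis by (simp add: sum_nonneg)
    next
      case 2
      then have "T ^ m = \<bar>w $ i\<bar> ^ (2 * m)" by (simp add: power_mult)
      also have "\<dots> \<le> (\<Sum>i\<in>UNIV. \<bar>w $ i\<bar> ^ (2 * m))" by (rule member_le_sum) auto
      finally show ?thesis by simp
    qed
  qed
  finally show ?thesis by (simp add: jb_def powr_realpow mult_left_mono)
qed

text \<open>The bound involves \<open>G\<close> only through the \<open>L\<^sup>1\<close> norms of
  derivatives of orders 0 and \<open>2 * m\<close>, hence is uniform over families such as products
  of translates.\<close>

lemma fourier_decay:
  fixes G :: "real^'n::finite \<Rightarrow> complex"
  assumes G: "G \<in> schwartz" and B: "0 \<le> B"
    and b: "\<And>i k. k \<in> {0, 2 * m} \<Longrightarrow> (\<integral>\<^sup>+t. ennreal (norm (iterated_derivative (replicate k i) G t)) \<partial>lborel) \<le> ennreal B"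
  shows "norm (fourier G w) \<le> (real CARD('n) + 1) ^ Suc m * B * jb (- real m) w"
proof -
  have *: "(2 * pi * \<bar>w $ i\<bar>) ^ k * norm (fourier G w) \<le> B" if "k \<in> {0, 2 * m}" for i k
    using order_trans[OF norm_fourier_le b[OF that, of i], of w] B
    by (simp add: fourier_iterated_derivative[OF G])
  have **: "\<bar>w $ i\<bar> ^ (2 * m) * norm (fourier G w) \<le> B" for i
  proof -
    have "1 * \<bar>w $ i\<bar> \<le> 2 * pi * \<bar>w $ i\<bar>" using pi_gt3 by (intro mult_right_mono) auto
    then have "\<bar>w $ i\<bar> ^ (2 * m) \<le> (2 * pi * \<bar>w $ i\<bar>) ^ (2 * m)" by (intro power_mono) auto
    then have "\<bar>w $ i\<bar> ^ (2 * m) * norm (fourier G w) \<le> (2 * pi * \<bar>w $ i\<bar>) ^ (2 * m) * norm (fourier G w)"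
      by (rule mult_right_mono) simp
    then show ?thesis using *[of "2 * m" i] by simp
  qed
  have "jb (real m) w * norm (fourier G w)
    \<le> (real CARD('n) + 1) ^ m * (1 + (\<Sum>i\<in>UNIV. \<bar>w $ i\<bar> ^ (2 * m))) * norm (fourier G w)"
    by (intro mult_right_mono jb_le_components) auto
  also have "\<dots> = (real CARD('n) + 1) ^ m * (norm (fourier G w) + (\<Sum>i\<in>UNIV. \<bar>w $ i\<bar> ^ (2 * m) * norm (fourier G w)))"
    by (simp add: distrib_right sum_distrib_right mult.assoc)
  also have "\<dots> \<le> (real CARD('n) + 1) ^ m * (B + (\<Sum>i\<in>(UNIV :: 'n set). B))"
    using *[of 0] by (intro mult_left_mono add_mono sum_mono **) auto
  also have "\<dots> = (real CARD('n) + 1) ^ Suc m * B" by (simp add: algebra_simps)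
  finally show ?thesis by (rule jb_mult_leD)
qed

lemma nn_integral_jb_translate:
  "(\<integral>\<^sup>+t. ennreal (jb a (t - x :: 'a)) \<partial>lborel) = (\<integral>\<^sup>+t. ennreal (jb a (t::'a::euclidean_space)) \<partial>lborel)"
  by (rule nn_integral_lborel_translate[where h = "\<lambda>t. ennreal (jb a t)"]) measurable

text \<open>Decay in \<open>x - y\<close> and in \<open>w\<close> at the same time, with one
  constant for all translates: this is the kernel estimate behind every change of window.\<close>

lemma schwartz_product_fourier:
  fixes f g :: "real^'n::finite \<Rightarrow> complex"
  assumes f: "f \<in> schwartz" and g: "g \<in> schwartz" and a: "0 \<le> a"
  obtains C where "0 \<le> C"
    "\<And>x y w. norm (fourier (\<lambda>t. f (t - x) * g (t - y)) w) \<le> C * (jb (- a) (x - y) * jb (- real m) w)"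
proof -
  define b where "b = real CARD('n)"
  have b: "0 \<le> b" by (simp add: b_def)
  define I where "I = enn2real (\<integral>\<^sup>+t. ennreal (jb (- b) (t::real^'n)) \<partial>lborel)"
  have I: "(\<integral>\<^sup>+t. ennreal (jb (- b) (t::real^'n)) \<partial>lborel) = ennreal I"
    unfolding I_def using nn_integral_jb_finite[of "- b", where 'a = "real^'n"] by (simp add: b_def)
  have I0: "0 \<le> I" by (simp add: I_def)
  have "\<forall>\<alpha>. \<exists>C\<ge>0. \<forall>x y t. norm (iterated_derivative \<alpha> (\<lambda>t. f (t - x) * g (t - y)) t)
       \<le> C * (jb (- a) (x - y) * jb (- b) (t - x))"
  proof
    fix \<alpha>
    obtain C where "0 \<le> C" "\<And>x y t. norm (iterated_derivative \<alpha> (\<lambda>t. f (t - x) * g (t - y)) t)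
       \<le> C * (jb (- a) (x - y) * jb (- b) (t - x))"
      by (rule schwartz_product_bound[OF f g a b, where \<alpha> = \<alpha>]) (rule that)
    then show "\<exists>C\<ge>0. \<forall>x y t. norm (iterated_derivative \<alpha> (\<lambda>t. f (t - x) * g (t - y)) t)
       \<le> C * (jb (- a) (x - y) * jb (- b) (t - x))" by blast
  qed
  from choice[OF this] obtain C where C': "\<forall>\<alpha>. 0 \<le> C \<alpha> \<and> (\<forall>x y t. norm (iterated_derivative \<alpha> (\<lambda>t. f (t - x) * g (t - y)) t)
       \<le> C \<alpha> * (jb (- a) (x - y) * jb (- b) (t - x)))"
    by (rule exE)
  have C: "0 \<le> C \<alpha>"
    "norm (iterated_derivative \<alpha> (\<lambda>t. f (t - x) * g (t - y)) t)
       \<le> C \<alpha> * (jb (- a) (x - y) * jb (- b) (t - x))" for \<alpha> x y t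
    using C' by (rule allE[of _ \<alpha>], simp)+
  \<comment> \<open>A common bound for the finitely many derivatives that
    \<open>fourier_decay\<close> asks for.\<close>
  define D where "D = (\<Sum>i\<in>(UNIV :: 'n set). \<Sum>k\<in>{0, 2 * m}. C (replicate k i))"
  have D: "C (replicate k i) \<le> D" if "k \<in> {0, 2 * m}" for k i
  proof -
    have "C (replicate k i) \<le> (\<Sum>k\<in>{0, 2 * m}. C (replicate k i))"
      using that C(1) by (intro member_le_sum) auto
    also have "\<dots> \<le> D" unfolding D_def
      using C(1) by (intro member_le_sum[where f = "\<lambda>i. \<Sum>k\<in>{0, 2 * m}. C (replicate k i)"] sum_nonneg) auto
    finally show ?thesis .
  qed
  have D0: "0 \<le> D" using order_trans[OF C(1) D[of 0]] by simp
  show thesis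
  proof
    show "0 \<le> (real CARD('n) + 1) ^ Suc m * (D * I)" using D0 I0 by simp
    fix x y w
    have "norm (fourier (\<lambda>t. f (t - x) * g (t - y)) w)
      \<le> (real CARD('n) + 1) ^ Suc m * (D * I * jb (- a) (x - y)) * jb (- real m) w"
    proof (rule fourier_decay)
      show "(\<lambda>t. f (t - x) * g (t - y)) \<in> schwartz" by (intro schwartz_mult schwartz_translate f g)
      show "0 \<le> D * I * jb (- a) (x - y)" using D0 I0 by simp
      fix i k assume k: "k \<in> {0, 2 * m}"
      have "(\<integral>\<^sup>+t. ennreal (norm (iterated_derivative (replicate k i) (\<lambda>t. f (t - x) * g (t - y)) t)) \<partial>lborel)
        \<le> (\<integral>\<^sup>+t. ennreal (D * jb (- a) (x - y)) * ennreal (jb (- b) (t - x)) \<partial>lborel)"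
      proof (rule nn_integral_mono)
        fix t
        have "norm (iterated_derivative (replicate k i) (\<lambda>t. f (t - x) * g (t - y)) t)
          \<le> D * (jb (- a) (x - y) * jb (- b) (t - x))"
          by (rule order_trans[OF C(2)]) (intro mult_right_mono D k, simp)
        then show "ennreal (norm (iterated_derivative (replicate k i) (\<lambda>t. f (t - x) * g (t - y)) t))
          \<le> ennreal (D * jb (- a) (x - y)) * ennreal (jb (- b) (t - x))"
          using D0 by (simp add: ennreal_mult[symmetric] mult.assoc)
      qed
      also have "\<dots> = ennreal (D * jb (- a) (x - y)) * ennreal I"
        by (subst nn_integral_cmult) (auto simp: nn_integral_jb_translate I)
      also have "\<dots> = ennreal (D * I * jb (- a) (x - y))"
        using D0 I0 by (simp add: ennreal_mult[symmetric] ac_simps)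
      finally show "(\<integral>\<^sup>+t. ennreal (norm (iterated_derivative (replicate k i) (\<lambda>t. f (t - x) * g (t - y)) t)) \<partial>lborel)
        \<le> ennreal (D * I * jb (- a) (x - y))" .
    qed
    then show "norm (fourier (\<lambda>t. f (t - x) * g (t - y)) w)
      \<le> (real CARD('n) + 1) ^ Suc m * (D * I) * (jb (- a) (x - y) * jb (- real m) w)"
      by (simp add: ac_simps)
  qed
qed

lemma schwartz_fourier:
  fixes f :: "real^'n::finite \<Rightarrow> complex"
  assumes f: "f \<in> schwartz"
  obtains C where "0 \<le> C" "\<And>w. norm (fourier f w) \<le> C * jb (- real m) w"
proof -
  define I where "I k i = (LINT t|lborel. norm (iterated_derivative (replicate k i) f t))" for k i
  have I: "(\<integral>\<^sup>+t. ennreal (norm (iterated_derivative (replicate k i) f t)) \<partial>lborel) = ennreal (I k i)" for k i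
    unfolding I_def
    by (intro nn_integral_eq_integral integrable_norm schwartz_integrable schwartz_iterated_derivative f) auto
  have I0: "0 \<le> I k i" for k i unfolding I_def by simp
  define D where "D = (\<Sum>i\<in>UNIV. \<Sum>k\<in>{0, 2 * m}. I k i)"
  have D: "I k i \<le> D" if "k \<in> {0, 2 * m}" for k i
  proof -
    have "I k i \<le> (\<Sum>k\<in>{0, 2 * m}. I k i)"
      using that I0 by (intro member_le_sum) auto
    also have "\<dots> \<le> D" unfolding D_def
      using I0 by (intro member_le_sum[where f = "\<lambda>i. \<Sum>k\<in>{0, 2 * m}. I k i"] sum_nonneg) auto
    finally show ?thesis .
  qed
  have D0: "0 \<le> D" using order_trans[OF I0 D[of 0]] by simp
  show thesis
  proof (rule that)
    show "norm (fourier f w) \<le> (real CARD('n) + 1) ^ Suc m * D * jb (- real m) w" for w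
      by (rule fourier_decay[OF f D0]) (use D in \<open>auto simp: I intro!: ennreal_leI\<close>)
  qed (use D0 in simp)
qed

lemma schwartz_FL1:
  fixes f :: "real^'n::finite \<Rightarrow> complex"
  assumes f: "f \<in> schwartz"
  shows "FL1 f < top"
proof -
  define m where "m = CARD('n)"
  obtain C where C: "0 \<le> C" "\<And>w. norm (fourier f w) \<le> C * jb (- real m) w"
    by (rule schwartz_fourier[OF f, where m = m]) (rule that)
  have "FL1 f \<le> (\<integral>\<^sup>+w. ennreal C * ennreal (jb (- real m) (w::real^'n)) \<partial>lborel)"
    unfolding FL1_def using C by (intro nn_integral_mono) (simp add: ennreal_mult[symmetric] ennreal_leI)
  also have "\<dots> < top"
    using nn_integral_jb_finite[of "- real m", where 'a = "real^'n"]
    by (simp add: nn_integral_cmult ennreal_mult_less_top m_def)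
  finally show ?thesis .
qed

section \<open>Short time Fourier transforms of continuous functions\<close>

text \<open>What makes every short time Fourier transform with a Schwartz window the transform of a
  continuous integrable function. Temperedness is recovered from boundedness in
  \<open>modulation_functionsI\<close>.\<close>

definition admissible :: "(real^'n::finite \<Rightarrow> complex) \<Rightarrow> bool" where
  "admissible f \<longleftrightarrow> continuous_on UNIV f \<and> (\<forall>\<phi>\<in>schwartz. integrable lborel (\<lambda>t. f t * \<phi> t))"

definition STFT :: "(real^'n::finite \<Rightarrow> complex) \<Rightarrow> (real^'n \<Rightarrow> complex) \<Rightarrow> real^'n \<Rightarrow> real^'n \<Rightarrow> complex" where
  "STFT g f x w = fourier (\<lambda>t. f t * cnj (g (t - x))) w"

definition STFT_abs :: "(real^'n::finite \<Rightarrow> complex) \<Rightarrow> (real^'n \<Rightarrow> complex) \<Rightarrow> real^'n \<Rightarrow> real^'n \<Rightarrow> ennreal" where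
  "STFT_abs g f x w = ennreal (norm (STFT g f x w))"

definition STFT_Lp :: "(real^'n::finite \<Rightarrow> complex) \<Rightarrow> ennreal \<Rightarrow> (real^'n \<Rightarrow> complex) \<Rightarrow> real^'n \<Rightarrow> ennreal" where
  "STFT_Lp g p f w = Lp_norm p (\<lambda>x. STFT_abs g f x w)"

lemma stft_distribution_of: "stft g (distribution_of f) x w = STFT g f x w"
  unfolding stft_def distribution_of_def STFT_def fourier_def freq_shift_def time_shift_def
  by (intro Bochner_Integration.integral_cong) (simp_all add: cis_cnj ac_simps)

lemma modulation_enorm_eq: "modulation_enorm g p q s (distribution_of f) = wnorm q s (STFT_Lp g p f)"
  unfolding modulation_enorm_def wnorm_def STFT_Lp_def STFT_abs_def stft_distribution_of jb_def ..

lemma cnj_measurable [measurable (raw)]: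
  "f \<in> borel_measurable M \<Longrightarrow> (\<lambda>x. cnj (f x)) \<in> borel_measurable M"
  by (intro borel_measurable_continuous_on[where f = cnj]) (auto intro: continuous_intros)

lemma STFT_abs_measurable:
  assumes [measurable]: "f \<in> borel_measurable borel" "g \<in> borel_measurable borel"
  shows "(\<lambda>(x, w). STFT_abs g f x w) \<in> borel_measurable (borel \<Otimes>\<^sub>M borel)"
proof -
  have "(\<lambda>p. LINT t|lborel. f t * cnj (g (t - fst p)) * cis (- (2 * pi * (snd p \<bullet> t)))) \<in> borel_measurable (borel \<Otimes>\<^sub>M borel)"
    by (intro lborel.borel_measurable_lebesgue_integral) measurable
  then show ?thesis unfolding STFT_abs_def STFT_def fourier_def case_prod_beta by measurable
qed

lemma admissible_measurable [measurable_dest]: "admissible f \<Longrightarrow> f \<in> borel_measurable borel"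
  unfolding admissible_def by (auto intro: borel_measurable_continuous_onI)

lemma admissible_window:
  assumes "admissible f" "g \<in> schwartz"
  shows "integrable lborel (\<lambda>t. f t * cnj (g (t - x)))"
    and "continuous_on UNIV (\<lambda>t. f t * cnj (g (t - x)))"
proof -
  have s: "(\<lambda>t. cnj (g (t - x))) \<in> schwartz" by (intro schwartz_cnj schwartz_translate assms)
  show "integrable lborel (\<lambda>t. f t * cnj (g (t - x)))" using assms(1) s by (simp add: admissible_def)
  show "continuous_on UNIV (\<lambda>t. f t * cnj (g (t - x)))"
    using assms(1) schwartz_continuous[OF s] by (auto simp: admissible_def intro: continuous_on_mult)
qed

lemma STFT_abs_measurable' [measurable (raw)]:
  assumes f: "admissible f" and g: "g \<in> schwartz"
    and [measurable]: "h \<in> M \<rightarrow>\<^sub>M borel" "k \<in> M \<rightarrow>\<^sub>M borel"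
  shows "(\<lambda>z. STFT_abs g f (h z) (k z)) \<in> borel_measurable M"
  using measurable_compose[OF _ STFT_abs_measurable[OF admissible_measurable[OF f] schwartz_measurable[OF g]], of "\<lambda>z. (h z, k z)" M]
  by simp

lemma STFT_Lp_measurable [measurable]:
  assumes "1 \<le> p" "admissible f" "g \<in> schwartz"
  shows "STFT_Lp g p f \<in> borel_measurable borel"
proof -
  have "(\<lambda>w. Lp_norm p (\<lambda>x. STFT_abs g f x w)) \<in> borel_measurable borel"
    using assms by (intro measurable_Lp_norm) (auto intro: STFT_abs_measurable')
  then show ?thesis unfolding STFT_Lp_def[abs_def] .
qed

section \<open>Change of window\<close>

lemma schwartz_L2_pos:
  fixes g :: "real^'n::finite \<Rightarrow> complex"
  assumes g: "g \<in> schwartz" and nz: "g \<noteq> (\<lambda>t. 0)"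
  obtains N where "0 < N" "(LINT t|lborel. g t * cnj (g t)) = complex_of_real N"
proof -
  define N where "N = (LINT t|lborel. (norm (g t))\<^sup>2)"
  note [measurable] = schwartz_measurable[OF g]
  have eq: "g t * cnj (g t) = complex_of_real ((norm (g t))\<^sup>2)" for t
    by (rule complex_norm_square[symmetric])
  have "integrable lborel (\<lambda>t. g t * cnj (g t))"
    by (intro schwartz_integrable schwartz_mult schwartz_cnj g)
  then have int: "integrable lborel (\<lambda>t. (norm (g t))\<^sup>2)"
    unfolding eq by (simp only: complex_of_real_integrable_eq)
  have "N \<noteq> 0"
  proof
    assume "N = 0"
    then have "AE t in lborel. (norm (g t))\<^sup>2 = 0"
      unfolding N_def using int by (subst (asm) integral_nonneg_eq_0_iff_AE) auto
    then have ae: "AE t in lborel. t \<notin> {t. g t \<noteq> 0}" by auto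
    have op: "open {t. g t \<noteq> 0}"
      using schwartz_continuous[OF g] by (intro open_Collect_neq) (auto intro: continuous_intros)
    then have "{t. g t \<noteq> 0} \<in> null_sets lborel"
      using ae by (subst AE_iff_null_sets) auto
    then have "negligible {t. g t \<noteq> 0}"
      using negligible_iff_null_sets null_sets_completionI by blast
    then show False using open_not_negligible[OF op] nz by auto
  qed
  moreover have "0 \<le> N" unfolding N_def by simp
  ultimately have "0 < N" by simp
  moreover have "(LINT t|lborel. g t * cnj (g t)) = complex_of_real N"
    unfolding eq N_def by (rule integral_complex_of_real)
  ultimately show thesis by (rule that)
qed

text \<open>Averaging \<open>f(t) cnj (\<gamma>(t - y))\<close> against \<open>|g(t - x)|\<^sup>2\<close> over \<open>x\<close> writes the transform
  with window \<open>\<gamma>\<close> as a superposition of products of \<open>f \<cdot> T\<^sub>x cnj g\<close> with Schwartz functions.\<close>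

lemma window_change_pointwise:
  fixes g \<gamma> :: "real^'n::finite \<Rightarrow> complex"
  assumes g: "g \<in> schwartz" and \<gamma>: "\<gamma> \<in> schwartz" and nz: "g \<noteq> (\<lambda>t. 0)" and a: "0 \<le> a"
  obtains C where "0 \<le> C"
    "\<And>f y v. admissible f \<Longrightarrow> STFT_abs \<gamma> f y v
       \<le> (\<integral>\<^sup>+\<eta>. ennreal C * ennreal (jb (- real m) \<eta>) * nn_conv (\<lambda>x. STFT_abs g f x (v - \<eta>)) (\<lambda>z. ennreal (jb (- a) z)) y \<partial>lborel)"
proof -
  obtain N where N: "0 < N" "(LINT t|lborel. g t * cnj (g t)) = complex_of_real N"
    using schwartz_L2_pos[OF g nz] .
  note [measurable] = schwartz_measurable[OF g] schwartz_measurable[OF \<gamma>]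
  have c\<gamma>: "(\<lambda>t. cnj (\<gamma> t)) \<in> schwartz" by (intro schwartz_cnj \<gamma>)
  obtain C where C: "0 \<le> C" "\<And>x y w. norm (fourier (\<lambda>t. g (t - x) * cnj (\<gamma> (t - y))) w)
      \<le> C * (jb (- a) (x - y) * jb (- real m) w)"
    by (rule schwartz_product_fourier[OF g c\<gamma> a, where m = m]) (rule that)
  show thesis
  proof (rule that[of "C / N"])
    show "0 \<le> C / N" using C N by simp
    fix f :: "real^'n \<Rightarrow> complex" and y v :: "real^'n"
    assume f: "admissible f"
    note [measurable] = admissible_measurable[OF f]
    define h where "h t = f t * cnj (\<gamma> (t - y)) * cis (- (2 * pi * (v \<bullet> t)))" for t
    have [measurable]: "h \<in> borel_measurable borel" unfolding h_def by measurable
    have h: "integrable lborel h"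
      by (rule Bochner_Integration.integrable_bound[OF admissible_window(1)[OF f \<gamma>, of y]]) (auto simp: h_def norm_mult)
    have gg: "integrable lborel (\<lambda>t. g t * cnj (g t))"
      by (intro schwartz_integrable schwartz_mult schwartz_cnj g)
    have ggt: "integrable lborel (\<lambda>x. g (t - x) * cnj (g (t - x)))" for t
      using integrable_lborel_affine[OF _ gg, of "-1" t] by simp
    have ggN: "(LINT x|lborel. g (t - x) * cnj (g (t - x))) = of_real N" for t
      using integral_lborel_affine[of "-1" "\<lambda>t. g t * cnj (g t)" t] N by simp
    have ggN': "(LINT x|lborel. norm (g (t - x) * cnj (g (t - x)))) = N" for t
    proof -
      have "g x * cnj (g x) = complex_of_real (norm (g x * cnj (g x)))" for x
        by (simp add: complex_norm_square[symmetric] norm_mult power2_eq_square)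
      then have "complex_of_real N = (LINT x|lborel. complex_of_real (norm (g (t - x) * cnj (g (t - x)))))"
        using ggN[of t] by simp
      then show ?thesis by (metis integral_complex_of_real of_real_eq_iff)
    qed
    have int: "integrable (lborel \<Otimes>\<^sub>M lborel) (\<lambda>(t, x). h t * (g (t - x) * cnj (g (t - x))))"
    proof (rule lborel_pair.Fubini_integrable)
      show "integrable lborel (\<lambda>t. LINT x|lborel. norm (case (t, x) of (t, x) \<Rightarrow> h t * (g (t - x) * cnj (g (t - x)))))"
        using h by (simp add: norm_mult[of "h _"] ggN')
      show "AE t in lborel. integrable lborel (\<lambda>x. case (t, x) of (t, x) \<Rightarrow> h t * (g (t - x) * cnj (g (t - x))))"
        using ggt by simp
    qed measurable
    \<comment> \<open>One of the two factors of modulus \<open>|g(t - x)|\<close> stays with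
      \<open>f\<close> as its window; the other forms with \<open>\<gamma>\<close> a Schwartz
      product whose transform decays in \<open>x - y\<close> and in frequency.\<close>
    define P where "P x = (\<lambda>t. (f t * cnj (g (t - x))) * (g (t - x) * cnj (\<gamma> (t - y))))" for x
    have "of_real N * STFT \<gamma> f y v = (LINT t|lborel. h t * (LINT x|lborel. g (t - x) * cnj (g (t - x))))"
      unfolding STFT_def fourier_def h_def[symmetric] ggN by (simp add: mult.commute)
    also have "\<dots> = (LINT t|lborel. LINT x|lborel. h t * (g (t - x) * cnj (g (t - x))))"
      by simp
    also have "\<dots> = (LINT x|lborel. LINT t|lborel. h t * (g (t - x) * cnj (g (t - x))))"
      by (rule lborel_pair.Fubini_integral[OF int, symmetric])
    also have "\<dots> = (LINT x|lborel. fourier (P x) v)"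
      unfolding fourier_def h_def P_def by (intro Bochner_Integration.integral_cong) (simp_all add: ac_simps)
    finally have eq: "of_real N * STFT \<gamma> f y v = (LINT x|lborel. fourier (P x) v)" .
    have Pbd: "ennreal (norm (fourier (P x) v))
      \<le> ennreal (C * jb (- a) (y - x)) * nn_conv (\<lambda>w. STFT_abs g f x w) (\<lambda>w. ennreal (jb (- real m) w)) v" for x
    proof -
      have s: "(\<lambda>t. g (t - x) * cnj (\<gamma> (t - y))) \<in> schwartz"
        by (intro schwartz_mult schwartz_translate[OF g] schwartz_translate[OF c\<gamma>])
      have "ennreal (norm (fourier (P x) v))
        \<le> nn_conv (\<lambda>w. ennreal (norm (fourier (\<lambda>t. f t * cnj (g (t - x))) w)))
            (\<lambda>w. ennreal (norm (fourier (\<lambda>t. g (t - x) * cnj (\<gamma> (t - y))) w))) v"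
        unfolding P_def
        by (intro fourier_mult_le admissible_window(1) f g schwartz_continuous schwartz_integrable schwartz_FL1 s)
      also have "\<dots> \<le> nn_conv (\<lambda>w. STFT_abs g f x w) (\<lambda>w. ennreal (C * jb (- a) (y - x)) * ennreal (jb (- real m) w)) v"
        using C by (intro nn_conv_mono)
          (auto simp: STFT_abs_def STFT_def ennreal_mult[symmetric] mult.assoc jb_minus_commute[of "- a" y x] intro!: ennreal_leI)
      also have "\<dots> = ennreal (C * jb (- a) (y - x)) * nn_conv (\<lambda>w. STFT_abs g f x w) (\<lambda>w. ennreal (jb (- real m) w)) v"
        by (intro nn_conv_cmult_right) (use f g in measurable)
      finally show ?thesis .
    qed
    note STFT_abs_measurable'[OF f g, measurable]
    have "ennreal N * STFT_abs \<gamma> f y v = ennreal (norm (LINT x|lborel. fourier (P x) v))"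
      unfolding eq[symmetric] STFT_abs_def using N by (simp add: norm_mult ennreal_mult)
    also have "\<dots> \<le> (\<integral>\<^sup>+x. ennreal (norm (fourier (P x) v)) \<partial>lborel)"
      by (rule norm_integral_le_nn_integral)
    also have "\<dots> \<le> (\<integral>\<^sup>+x. ennreal (C * jb (- a) (y - x)) * nn_conv (\<lambda>w. STFT_abs g f x w) (\<lambda>w. ennreal (jb (- real m) w)) v \<partial>lborel)"
      by (intro nn_integral_mono Pbd)
    also have "\<dots> = (\<integral>\<^sup>+x. \<integral>\<^sup>+\<eta>. ennreal (C * jb (- a) (y - x)) * (STFT_abs g f x (v - \<eta>) * ennreal (jb (- real m) \<eta>)) \<partial>lborel \<partial>lborel)"
      unfolding nn_conv_def by (intro nn_integral_cong nn_integral_cmult[symmetric]) measurable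
    also have "\<dots> = (\<integral>\<^sup>+\<eta>. \<integral>\<^sup>+x. ennreal (C * jb (- a) (y - x)) * (STFT_abs g f x (v - \<eta>) * ennreal (jb (- real m) \<eta>)) \<partial>lborel \<partial>lborel)"
      by (rule lborel_pair.Fubini'[symmetric]) measurable
    also have "\<dots> = (\<integral>\<^sup>+\<eta>. ennreal C * ennreal (jb (- real m) \<eta>) * nn_conv (\<lambda>x. STFT_abs g f x (v - \<eta>)) (\<lambda>z. ennreal (jb (- a) z)) y \<partial>lborel)"
    proof (rule nn_integral_cong)
      fix \<eta> :: "real^'n"
      have "nn_conv (\<lambda>x. STFT_abs g f x (v - \<eta>)) (\<lambda>z. ennreal (jb (- a) z)) y = nn_conv (\<lambda>z. ennreal (jb (- a) z)) (\<lambda>x. STFT_abs g f x (v - \<eta>)) y"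
        by (rule nn_conv_commute) measurable
      moreover have "(\<integral>\<^sup>+x. ennreal (C * jb (- a) (y - x)) * (STFT_abs g f x (v - \<eta>) * ennreal (jb (- real m) \<eta>)) \<partial>lborel)
        = (\<integral>\<^sup>+x. (ennreal C * ennreal (jb (- real m) \<eta>)) * (ennreal (jb (- a) (y - x)) * STFT_abs g f x (v - \<eta>)) \<partial>lborel)"
        using C(1) by (intro nn_integral_cong) (simp add: ennreal_mult ac_simps)
      moreover have "\<dots> = ennreal C * ennreal (jb (- real m) \<eta>) * nn_conv (\<lambda>z. ennreal (jb (- a) z)) (\<lambda>x. STFT_abs g f x (v - \<eta>)) y"
        unfolding nn_conv_def by (rule nn_integral_cmult) measurable
      ultimately show "(\<integral>\<^sup>+x. ennreal (C * jb (- a) (y - x)) * (STFT_abs g f x (v - \<eta>) * ennreal (jb (- real m) \<eta>)) \<partial>lborel)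
        = ennreal C * ennreal (jb (- real m) \<eta>) * nn_conv (\<lambda>x. STFT_abs g f x (v - \<eta>)) (\<lambda>z. ennreal (jb (- a) z)) y"
        by simp
    qed
    finally have le: "ennreal N * STFT_abs \<gamma> f y v \<le> (\<integral>\<^sup>+\<eta>. ennreal C * ennreal (jb (- real m) \<eta>) * nn_conv (\<lambda>x. STFT_abs g f x (v - \<eta>)) (\<lambda>z. ennreal (jb (- a) z)) y \<partial>lborel)" .
    have "STFT_abs \<gamma> f y v = ennreal (1 / N) * (ennreal N * STFT_abs \<gamma> f y v)"
      using N by (simp add: mult.assoc[symmetric] ennreal_mult[symmetric])
    also have "\<dots> \<le> ennreal (1 / N) * (\<integral>\<^sup>+\<eta>. ennreal C * ennreal (jb (- real m) \<eta>) * nn_conv (\<lambda>x. STFT_abs g f x (v - \<eta>)) (\<lambda>z. ennreal (jb (- a) z)) y \<partial>lborel)"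
      by (rule mult_left_mono[OF le]) simp
    also have "\<dots> = (\<integral>\<^sup>+\<eta>. ennreal (C / N) * ennreal (jb (- real m) \<eta>) * nn_conv (\<lambda>x. STFT_abs g f x (v - \<eta>)) (\<lambda>z. ennreal (jb (- a) z)) y \<partial>lborel)"
    proof (subst nn_integral_cmult[symmetric])
      show "(\<lambda>\<eta>. ennreal C * ennreal (jb (- real m) \<eta>) * nn_conv (\<lambda>x. STFT_abs g f x (v - \<eta>)) (\<lambda>z. ennreal (jb (- a) z)) y) \<in> borel_measurable lborel"
        unfolding nn_conv_def by measurable
      have "ennreal (C / N) = ennreal (1 / N) * ennreal C" using C N by (simp add: ennreal_mult[symmetric])
      then show "(\<integral>\<^sup>+\<eta>. ennreal (1 / N) * (ennreal C * ennreal (jb (- real m) \<eta>) * nn_conv (\<lambda>x. STFT_abs g f x (v - \<eta>)) (\<lambda>z. ennreal (jb (- a) z)) y) \<partial>lborel)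
        = (\<integral>\<^sup>+\<eta>. ennreal (C / N) * ennreal (jb (- real m) \<eta>) * nn_conv (\<lambda>x. STFT_abs g f x (v - \<eta>)) (\<lambda>z. ennreal (jb (- a) z)) y \<partial>lborel)"
        by (simp add: mult.assoc)
    qed
    finally show "STFT_abs \<gamma> f y v
       \<le> (\<integral>\<^sup>+\<eta>. ennreal (C / N) * ennreal (jb (- real m) \<eta>) * nn_conv (\<lambda>x. STFT_abs g f x (v - \<eta>)) (\<lambda>z. ennreal (jb (- a) z)) y \<partial>lborel)" .
  qed
qed

text \<open>In the position variable the kernel \<open>J\<close> is integrable and bounded. Young's
  inequality gives the bound for the \<open>p\<close>-norm, Hoelder's inequality the one uniform in
  \<open>y\<close>; the second is the passage from \<open>p\<close> to
  \<open>\<infinity>\<close>.\<close>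

lemma window_change:
  fixes g \<gamma> :: "real^'n::finite \<Rightarrow> complex"
  assumes g: "g \<in> schwartz" and \<gamma>: "\<gamma> \<in> schwartz" and nz: "g \<noteq> (\<lambda>t. 0)" and p: "1 \<le> p"
  obtains C where "C < top"
    "\<And>f v. admissible f \<Longrightarrow> STFT_Lp \<gamma> p f v \<le> C * nn_conv (STFT_Lp g p f) (\<lambda>\<eta>. ennreal (jb (- real m) \<eta>)) v"
    "\<And>f y v. admissible f \<Longrightarrow> STFT_abs \<gamma> f y v \<le> C * nn_conv (STFT_Lp g p f) (\<lambda>\<eta>. ennreal (jb (- real m) \<eta>)) v"
proof -
  define a where "a = real CARD('n)"
  define J where "J = (\<lambda>z :: real^'n. ennreal (jb (- a) z))"
  define Jm where "Jm = (\<lambda>\<eta> :: real^'n. ennreal (jb (- real m) \<eta>))"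
  have [measurable]: "J \<in> borel_measurable borel" "Jm \<in> borel_measurable borel"
    unfolding J_def Jm_def by measurable
  define S where "S = (\<integral>\<^sup>+z. J z \<partial>lborel)"
  have S: "S < top" unfolding S_def J_def by (rule nn_integral_jb_finite) (simp add: a_def)
  have a: "0 \<le> a" by (simp add: a_def)
  have J1: "J z \<le> 1" for z using ennreal_leI[OF jb_le_1[of "- a" z]] a by (simp add: J_def)
  obtain C where C0: "0 \<le> C"
    "\<And>f y v. admissible f \<Longrightarrow> STFT_abs \<gamma> f y v \<le> (\<integral>\<^sup>+\<eta>. ennreal C * ennreal (jb (- real m) \<eta>)
        * nn_conv (\<lambda>x. STFT_abs g f x (v - \<eta>)) (\<lambda>z. ennreal (jb (- a) z)) y \<partial>lborel)"
    by (rule window_change_pointwise[OF g \<gamma> nz a, where m = m]) (rule that)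
  have C: "STFT_abs \<gamma> f y v \<le> (\<integral>\<^sup>+\<eta>. ennreal C * Jm \<eta> * nn_conv (\<lambda>x. STFT_abs g f x (v - \<eta>)) J y \<partial>lborel)"
    if "admissible f" for f y v
    using C0(2)[OF that] by (simp add: J_def Jm_def)
  \<comment> \<open>The constant of Hoelder's inequality for a kernel with integral \<open>S\<close>
    and bound 1; it also dominates the constant \<open>S\<close> of Young's inequality.\<close>
  define D where "D = ennreal C * ((1 + S) * (1 + 1))"
  have SD: "S \<le> (1 + S) * (1 + 1)"
    using mult_mono[of S "1 + S" 1 "1 + 1 :: ennreal"] by (simp add: add_increasing)
  have cvle: "nn_conv h J y \<le> (1 + S) * (1 + 1) * Lp_norm p h" if [measurable]: "h \<in> borel_measurable borel" for h y
  proof -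
    have "nn_conv h J y = (\<integral>\<^sup>+z. h (y + (-1) *\<^sub>R z) * J z \<partial>lborel)" by (simp add: nn_conv_def)
    also have "\<dots> \<le> (1 + S) * (1 + 1) * Lp_norm p (\<lambda>z. h (y + (-1) *\<^sub>R z))"
      unfolding S_def by (intro nn_integral_mult_le_Lp_norm p J1 S[unfolded S_def]) measurable
    also have "Lp_norm p (\<lambda>z. h (y + (-1) *\<^sub>R z)) = Lp_norm p h"
      by (rule Lp_norm_isometry[OF p]) auto
    finally show ?thesis .
  qed
  show thesis
  proof (rule that[of D])
    show "D < top" using S by (simp add: D_def ennreal_mult_less_top)
    fix f :: "real^'n \<Rightarrow> complex" and v :: "real^'n"
    assume f: "admissible f"
    note STFT_abs_measurable'[OF f g, measurable] STFT_abs_measurable'[OF f \<gamma>, measurable]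
    have [measurable]: "STFT_Lp g p f \<in> borel_measurable borel" by (rule STFT_Lp_measurable[OF p f g])
    have eqD: "(\<integral>\<^sup>+\<eta>. ennreal C * Jm \<eta> * ((1 + S) * (1 + 1) * STFT_Lp g p f (v - \<eta>)) \<partial>lborel) = D * nn_conv (STFT_Lp g p f) Jm v" for v
      unfolding nn_conv_def D_def by (subst nn_integral_cmult[symmetric]) (auto simp: ac_simps)
    show "STFT_abs \<gamma> f y v \<le> D * nn_conv (STFT_Lp g p f) (\<lambda>\<eta>. ennreal (jb (- real m) \<eta>)) v" for y
    proof -
      have "STFT_abs \<gamma> f y v \<le> (\<integral>\<^sup>+\<eta>. ennreal C * Jm \<eta> * nn_conv (\<lambda>x. STFT_abs g f x (v - \<eta>)) J y \<partial>lborel)" by (rule C[OF f])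
      also have "\<dots> \<le> (\<integral>\<^sup>+\<eta>. ennreal C * Jm \<eta> * ((1 + S) * (1 + 1) * STFT_Lp g p f (v - \<eta>)) \<partial>lborel)"
        unfolding STFT_Lp_def by (intro nn_integral_mono mult_left_mono cvle) auto
      finally have "STFT_abs \<gamma> f y v \<le> D * nn_conv (STFT_Lp g p f) Jm v" unfolding eqD .
      then show ?thesis unfolding Jm_def .
    qed
    have "STFT_Lp \<gamma> p f v \<le> Lp_norm p (\<lambda>y. \<integral>\<^sup>+\<eta>. ennreal C * Jm \<eta> * nn_conv (\<lambda>x. STFT_abs g f x (v - \<eta>)) J y \<partial>lborel)"
      unfolding STFT_Lp_def by (intro Lp_norm_mono p C f) measurable
    also have "\<dots> \<le> (\<integral>\<^sup>+\<eta>. Lp_norm p (\<lambda>y. ennreal C * Jm \<eta> * nn_conv (\<lambda>x. STFT_abs g f x (v - \<eta>)) J y) \<partial>lborel)"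
      by (intro Lp_norm_nn_integral p sigma_finite_lborel) (unfold nn_conv_def, measurable)
    also have "\<dots> \<le> (\<integral>\<^sup>+\<eta>. ennreal C * Jm \<eta> * ((1 + S) * (1 + 1) * STFT_Lp g p f (v - \<eta>)) \<partial>lborel)"
    proof (rule nn_integral_mono)
      fix \<eta> :: "real^'n"
      have "Lp_norm p (\<lambda>y. ennreal C * Jm \<eta> * nn_conv (\<lambda>x. STFT_abs g f x (v - \<eta>)) J y)
        \<le> ennreal C * Jm \<eta> * Lp_norm p (nn_conv (\<lambda>x. STFT_abs g f x (v - \<eta>)) J)"
        by (intro Lp_norm_cmult_le p) measurable
      also have "\<dots> \<le> ennreal C * Jm \<eta> * (STFT_Lp g p f (v - \<eta>) * ((1 + S) * (1 + 1)))"
      proof (rule mult_left_mono)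
        have "Lp_norm p (nn_conv (\<lambda>x. STFT_abs g f x (v - \<eta>)) J) \<le> STFT_Lp g p f (v - \<eta>) * S"
          unfolding STFT_Lp_def S_def by (intro Lp_norm_nn_conv p) measurable
        also have "\<dots> \<le> STFT_Lp g p f (v - \<eta>) * ((1 + S) * (1 + 1))"
          by (intro mult_left_mono SD) auto
        finally show "Lp_norm p (nn_conv (\<lambda>x. STFT_abs g f x (v - \<eta>)) J) \<le> STFT_Lp g p f (v - \<eta>) * ((1 + S) * (1 + 1))" .
      qed simp
      finally show "Lp_norm p (\<lambda>y. ennreal C * Jm \<eta> * nn_conv (\<lambda>x. STFT_abs g f x (v - \<eta>)) J y)
        \<le> ennreal C * Jm \<eta> * ((1 + S) * (1 + 1) * STFT_Lp g p f (v - \<eta>))"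
        by (simp only: mult.commute[of "STFT_Lp g p f (v - \<eta>)"])
    qed
    finally have "STFT_Lp \<gamma> p f v \<le> D * nn_conv (STFT_Lp g p f) Jm v" unfolding eqD .
    then show "STFT_Lp \<gamma> p f v \<le> D * nn_conv (STFT_Lp g p f) (\<lambda>\<eta>. ennreal (jb (- real m) \<eta>)) v"
      unfolding Jm_def .
  qed
qed

lemma jb_weighted_finite:
  assumes "0 \<le> s"
  obtains m where "(\<integral>\<^sup>+w. ennreal (jb (- real m) (w::'a::euclidean_space)) * ennreal (jb (s / 2) w) \<partial>lborel) < top"
proof -
  define m where "m = nat \<lceil>s\<rceil> + DIM('a)"
  define d where "d = real DIM('a)"
  have "s \<le> real (nat \<lceil>s\<rceil>)" by linarith
  then have "0 < d" "s + d \<le> real m" by (simp_all add: m_def d_def)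
  then have "s - 2 * real m < - d" using assms by linarith
  then have "2 * (- real m + s / 2) < - real DIM('a)" by (simp add: d_def)
  from nn_integral_jb_finite[OF this] show thesis
    by (intro that[of m]) (simp add: ennreal_mult[symmetric] jb_add)
qed

text \<open>The kernel of \<open>window_change\<close> can be made to decay faster than the weight
  grows, so the weighted Young inequality applies. For two nonzero windows this gives equivalent
  norms by exchanging their roles.\<close>

lemma wnorm_window_change:
  fixes g \<gamma> :: "real^'n::finite \<Rightarrow> complex"
  assumes g: "g \<in> schwartz" and \<gamma>: "\<gamma> \<in> schwartz" and nz: "g \<noteq> (\<lambda>t. 0)"
    and p: "1 \<le> p" and q: "1 \<le> q" and s: "0 \<le> s"
  obtains C where "C < top" "\<And>f. admissible f \<Longrightarrow> wnorm q s (STFT_Lp \<gamma> p f) \<le> C * wnorm q s (STFT_Lp g p f)"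
proof -
  obtain m where m: "(\<integral>\<^sup>+w. ennreal (jb (- real m) (w::real^'n)) * ennreal (jb (s / 2) w) \<partial>lborel) < top"
    by (rule jb_weighted_finite[OF s]) (rule that)
  define J where "J = (\<lambda>\<eta> :: real^'n. ennreal (jb (- real m) \<eta>))"
  have [measurable]: "J \<in> borel_measurable borel" unfolding J_def by measurable
  define K where "K = (\<integral>\<^sup>+w. J w * ennreal (jb (s / 2) w) \<partial>lborel)"
  have K: "K < top" using m by (simp add: K_def J_def)
  obtain C where C': "C < top" "\<And>f v. admissible f \<Longrightarrow> STFT_Lp \<gamma> p f v \<le> C * nn_conv (STFT_Lp g p f) (\<lambda>\<eta>. ennreal (jb (- real m) \<eta>)) v"
    by (rule window_change[OF g \<gamma> nz p, where m = m]) (rule that)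
  note C = C'[folded J_def]
  show thesis
  proof (rule that[of "C * (ennreal (2 powr (s / 2)) * K)"])
    show "C * (ennreal (2 powr (s / 2)) * K) < top" using C(1) K by (simp add: ennreal_mult_less_top)
    fix f :: "real^'n \<Rightarrow> complex" assume f: "admissible f"
    have [measurable]: "STFT_Lp g p f \<in> borel_measurable borel" "STFT_Lp \<gamma> p f \<in> borel_measurable borel"
      by (intro STFT_Lp_measurable p f g \<gamma>)+
    have "wnorm q s (STFT_Lp \<gamma> p f) \<le> wnorm q s (\<lambda>v. C * nn_conv (STFT_Lp g p f) J v)"
      by (intro wnorm_mono q C f) measurable
    also have "\<dots> \<le> C * wnorm q s (nn_conv (STFT_Lp g p f) J)" by (intro wnorm_cmult_le q) measurable
    also have "\<dots> \<le> C * (ennreal (2 powr (s / 2)) * K * wnorm q s (STFT_Lp g p f))"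
      unfolding K_def by (intro mult_left_mono wnorm_nn_conv_le q s) auto
    finally show "wnorm q s (STFT_Lp \<gamma> p f) \<le> C * (ennreal (2 powr (s / 2)) * K) * wnorm q s (STFT_Lp g p f)"
      by (simp add: mult.assoc)
  qed
qed

text \<open>The pointwise bound of \<open>window_change\<close> does not depend on the position, so
  integrating it over the frequency gives a Fourier algebra bound uniform in
  \<open>x\<close>.\<close>

lemma FL1_window_le:
  fixes g \<gamma> :: "real^'n::finite \<Rightarrow> complex"
  assumes g: "g \<in> schwartz" and \<gamma>: "\<gamma> \<in> schwartz" and nz: "g \<noteq> (\<lambda>t. 0)"
    and p: "1 \<le> p"
    and C0: "C0 < top"
    and emb: "\<And>b :: real^'n \<Rightarrow> ennreal. b \<in> borel_measurable borel \<Longrightarrow> (\<integral>\<^sup>+w. b w \<partial>lborel) \<le> C0 * wnorm q s b"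
  obtains C where "C < top"
    "\<And>f x. admissible f \<Longrightarrow> FL1 (\<lambda>t. f t * cnj (\<gamma> (t - x))) \<le> C * wnorm q s (STFT_Lp g p f)"
proof -
  define m where "m = CARD('n)"
  define J where "J = (\<lambda>\<eta> :: real^'n. ennreal (jb (- real m) \<eta>))"
  have [measurable]: "J \<in> borel_measurable borel" unfolding J_def by measurable
  define K where "K = (\<integral>\<^sup>+w. J w \<partial>lborel)"
  have K: "K < top" unfolding K_def J_def by (intro nn_integral_jb_finite) (simp add: m_def)
  obtain C where C': "C < top" "\<And>f y v. admissible f \<Longrightarrow> STFT_abs \<gamma> f y v \<le> C * nn_conv (STFT_Lp g p f) (\<lambda>\<eta>. ennreal (jb (- real m) \<eta>)) v"
    by (rule window_change[OF g \<gamma> nz p, where m = m]) (rule that)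
  note C = C'[folded J_def]
  show thesis
  proof (rule that[of "C * (C0 * K)"])
    show "C * (C0 * K) < top" using C(1) K C0 by (simp add: ennreal_mult_less_top)
    fix f :: "real^'n \<Rightarrow> complex" and x assume f: "admissible f"
    have [measurable]: "STFT_Lp g p f \<in> borel_measurable borel"
      by (intro STFT_Lp_measurable p f g)
    have "FL1 (\<lambda>t. f t * cnj (\<gamma> (t - x))) = (\<integral>\<^sup>+v. STFT_abs \<gamma> f x v \<partial>lborel)"
      by (simp add: FL1_def STFT_abs_def STFT_def)
    also have "\<dots> \<le> (\<integral>\<^sup>+v. C * nn_conv (STFT_Lp g p f) J v \<partial>lborel)"
      by (intro nn_integral_mono C f)
    also have "\<dots> = C * ((\<integral>\<^sup>+v. STFT_Lp g p f v \<partial>lborel) * K)"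
      unfolding K_def by (subst nn_integral_cmult) (auto simp: nn_integral_nn_conv)
    also have "\<dots> \<le> C * (C0 * wnorm q s (STFT_Lp g p f) * K)"
      by (intro mult_left_mono mult_right_mono emb) auto
    finally show "FL1 (\<lambda>t. f t * cnj (\<gamma> (t - x))) \<le> C * (C0 * K) * wnorm q s (STFT_Lp g p f)"
      by (simp add: ac_simps)
  qed
qed

text \<open>The window is translated so that a point where \<open>g\<close> does not vanish lies
  over \<open>t\<close>; dividing by that value turns the Fourier algebra bound into a pointwise
  one.\<close>

lemma norm_le_wnorm:
  fixes g :: "real^'n::finite \<Rightarrow> complex"
  assumes g: "g \<in> schwartz" and nz: "g \<noteq> (\<lambda>t. 0)"
    and p: "1 \<le> p" and C0: "C0 < top"
    and emb: "\<And>b :: real^'n \<Rightarrow> ennreal. b \<in> borel_measurable borel \<Longrightarrow> (\<integral>\<^sup>+w. b w \<partial>lborel) \<le> C0 * wnorm q s b"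
  obtains C where "C < top"
    "\<And>f t. admissible f \<Longrightarrow> ennreal (norm (f t)) \<le> C * wnorm q s (STFT_Lp g p f)"
proof -
  obtain t0 where t0: "g t0 \<noteq> 0" using nz by (auto simp: fun_eq_iff)
  obtain C where C: "C < top" "\<And>f x. admissible f \<Longrightarrow> FL1 (\<lambda>t. f t * cnj (g (t - x))) \<le> C * wnorm q s (STFT_Lp g p f)"
    by (rule FL1_window_le[OF g g nz p C0 emb]) (assumption, rule that)
  show thesis
  proof (rule that[of "ennreal (1 / norm (g t0)) * C"])
    show "ennreal (1 / norm (g t0)) * C < top" using C(1) by (simp add: ennreal_mult_less_top)
    fix f :: "real^'n \<Rightarrow> complex" and t assume f: "admissible f"
    have "ennreal (norm (f t)) = ennreal (1 / norm (g t0)) * ennreal (norm (f t * cnj (g (t - (t - t0)))))"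
      using t0 by (simp add: norm_mult ennreal_mult[symmetric])
    also have "\<dots> \<le> ennreal (1 / norm (g t0)) * FL1 (\<lambda>t'. f t' * cnj (g (t' - (t - t0))))"
      by (intro mult_left_mono norm_le_FL1[of "\<lambda>t'. f t' * cnj (g (t' - (t - t0)))" t] admissible_window f g) auto
    also have "\<dots> \<le> ennreal (1 / norm (g t0)) * (C * wnorm q s (STFT_Lp g p f))"
      by (intro mult_left_mono C f) auto
    finally show "ennreal (norm (f t)) \<le> ennreal (1 / norm (g t0)) * C * wnorm q s (STFT_Lp g p f)"
      by (simp add: mult.assoc)
  qed
qed

section \<open>Products in modulation spaces\<close>

lemma admissible_bounded:
  fixes f :: "real^'n::finite \<Rightarrow> complex"
  assumes "continuous_on UNIV f" "\<And>t. norm (f t) \<le> B"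
  shows "admissible f"
  using assms tempered_distribution_of_bounded(1)[of f B]
  by (auto simp: admissible_def intro: borel_measurable_continuous_onI)

lemma modulation_functions_iff:
  "f \<in> modulation_functions g p q s \<longleftrightarrow>
     admissible f \<and> tempered_distribution (distribution_of f) \<and> wnorm q s (STFT_Lp g p f) < top"
  by (auto simp: modulation_functions_def modulation_space_def admissible_def modulation_enorm_eq)

lemma modulation_functionsI:
  fixes f :: "real^'n::finite \<Rightarrow> complex"
  assumes "continuous_on UNIV f" "\<And>t. norm (f t) \<le> B" "wnorm q s (STFT_Lp g p f) < top"
  shows "f \<in> modulation_functions g p q s"
  using assms admissible_bounded[OF assms(1,2)] tempered_distribution_of_bounded(2)[of f B]
  by (auto simp: modulation_functions_iff intro: borel_measurable_continuous_onI)

lemma modulation_mult: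
  fixes g :: "real^'n::finite \<Rightarrow> complex"
  assumes g: "g \<in> schwartz" and nz: "g \<noteq> (\<lambda>t. 0)"
    and p: "1 \<le> p" and q: "1 \<le> q" and s: "0 \<le> s" and C0: "C0 < top"
    and emb: "\<And>b :: real^'n \<Rightarrow> ennreal. b \<in> borel_measurable borel \<Longrightarrow> (\<integral>\<^sup>+w. b w \<partial>lborel) \<le> C0 * wnorm q s b"
  obtains C where "C < top"
    "\<And>f h. admissible f \<Longrightarrow> admissible h \<Longrightarrow> wnorm q s (STFT_Lp g p f) < top \<Longrightarrow> wnorm q s (STFT_Lp g p h) < top \<Longrightarrow>
       admissible (\<lambda>t. f t * h t) \<and> wnorm q s (STFT_Lp g p (\<lambda>t. f t * h t)) \<le> C * (wnorm q s (STFT_Lp g p f) * wnorm q s (STFT_Lp g p h))"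
proof -
  define G where "G = (\<lambda>t. g t * g t)"
  have G: "G \<in> schwartz" unfolding G_def by (intro schwartz_mult g)
  have Gnz: "G \<noteq> (\<lambda>t. 0)" using nz by (auto simp: G_def fun_eq_iff)
  obtain m where m: "(\<integral>\<^sup>+w. ennreal (jb (- real m) (w::real^'n)) * ennreal (jb (s / 2) w) \<partial>lborel) < top"
    by (rule jb_weighted_finite[OF s]) (rule that)
  define J where "J = (\<lambda>\<eta> :: real^'n. ennreal (jb (- real m) \<eta>))"
  have [measurable]: "J \<in> borel_measurable borel" unfolding J_def by measurable
  define K where "K = (\<integral>\<^sup>+w. J w * ennreal (jb (s / 2) w) \<partial>lborel)"
  have K: "K < top" using m by (simp add: K_def J_def)
  obtain C1 where C1': "C1 < top" "\<And>f y v. admissible f \<Longrightarrow> STFT_abs g f y v \<le> C1 * nn_conv (STFT_Lp g p f) (\<lambda>\<eta>. ennreal (jb (- real m) \<eta>)) v"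
    by (rule window_change[OF g g nz p, where m = m]) (rule that)
  note C1 = C1'[folded J_def]
  obtain C2 where C2: "C2 < top" "\<And>f. admissible f \<Longrightarrow> wnorm q s (STFT_Lp g p f) \<le> C2 * wnorm q s (STFT_Lp G p f)"
    by (rule wnorm_window_change[OF G g Gnz p q s]) (rule that)
  obtain C3 where C3: "C3 < top" "\<And>f t. admissible f \<Longrightarrow> ennreal (norm (f t)) \<le> C3 * wnorm q s (STFT_Lp g p f)"
    by (rule norm_le_wnorm[OF g nz p C0 emb]) (assumption, rule that)
  obtain C4 where C4: "C4 < top"
    "\<And>f x. admissible f \<Longrightarrow> FL1 (\<lambda>t. f t * cnj (g (t - x))) \<le> C4 * wnorm q s (STFT_Lp g p f)"
    by (rule FL1_window_le[OF g g nz p C0 emb]) (assumption, rule that)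
  define B where "B = ennreal (2 * 4 powr (s / 2)) * C0"
  define C where "C = C2 * B * (C1 * (ennreal (2 powr (s / 2)) * K))"
  show thesis
  proof (rule that[of C])
    show "C < top" using C0 C1 C2 K by (simp add: C_def B_def ennreal_mult_less_top)
    fix f h :: "real^'n \<Rightarrow> complex"
    assume f: "admissible f" and h: "admissible h" and ff: "wnorm q s (STFT_Lp g p f) < top" and hf: "wnorm q s (STFT_Lp g p h) < top"
    have bd: "norm (u t) \<le> enn2real (C3 * wnorm q s (STFT_Lp g p u))" if "admissible u" "wnorm q s (STFT_Lp g p u) < top" for u t
    proof -
      have "C3 * wnorm q s (STFT_Lp g p u) < top" using C3(1) that(2) by (simp add: ennreal_mult_less_top)
      then have "ennreal (norm (u t)) \<le> ennreal (enn2real (C3 * wnorm q s (STFT_Lp g p u)))"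
        using C3(2)[OF that(1), of t] by simp
      then show ?thesis by (subst (asm) ennreal_le_iff) auto
    qed
    \<comment> \<open>Admissibility alone is not closed under products; boundedness, available from
      the finite norms, supplies it.\<close>
    have fh: "admissible (\<lambda>t. f t * h t)"
    proof (rule admissible_bounded)
      show "continuous_on UNIV (\<lambda>t. f t * h t)" using f h by (auto simp: admissible_def intro: continuous_on_mult)
      show "norm (f t * h t) \<le> enn2real (C3 * wnorm q s (STFT_Lp g p f)) * enn2real (C3 * wnorm q s (STFT_Lp g p h))" for t
        unfolding norm_mult by (intro mult_mono bd f h ff hf) auto
    qed
    note [measurable] = STFT_Lp_measurable[OF p f g] STFT_Lp_measurable[OF p h g] STFT_abs_measurable'[OF f g] STFT_abs_measurable'[OF fh G]
      STFT_Lp_measurable[OF p fh G]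
    \<comment> \<open>A majorant of the transform of \<open>h\<close> that does not depend on the
      position. Minkowski's inequality in \<open>x\<close> therefore charges the
      \<open>p\<close>-norm to \<open>f\<close> alone, and no relation between exponents is
      needed.\<close>
    define S where "S = (\<lambda>v. C1 * nn_conv (STFT_Lp g p h) J v)"
    have [measurable]: "S \<in> borel_measurable borel" unfolding S_def by measurable
    have pt: "STFT_abs G (\<lambda>t. f t * h t) x v \<le> nn_conv (\<lambda>v. STFT_abs g f x v) S v" for x v
    proof -
      have FL1: "FL1 (\<lambda>t. h t * cnj (g (t - x))) < top"
        using le_less_trans[OF C4(2)[OF h, of x]] C4(1) hf by (simp add: ennreal_mult_less_top)
      have "STFT_abs G (\<lambda>t. f t * h t) x v
        = ennreal (norm (fourier (\<lambda>t. (f t * cnj (g (t - x))) * (h t * cnj (g (t - x)))) v))"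
        by (simp add: STFT_abs_def STFT_def G_def ac_simps)
      also have "\<dots> \<le> nn_conv (\<lambda>v. STFT_abs g f x v) (\<lambda>v. STFT_abs g h x v) v"
        unfolding STFT_abs_def STFT_def by (intro fourier_mult_le admissible_window f h g FL1)
      also have "\<dots> \<le> nn_conv (\<lambda>v. STFT_abs g f x v) S v"
        unfolding S_def by (intro nn_conv_mono C1 h) simp
      finally show ?thesis .
    qed
    have le: "STFT_Lp G p (\<lambda>t. f t * h t) v \<le> nn_conv (STFT_Lp g p f) S v" for v
    proof -
      have "STFT_Lp G p (\<lambda>t. f t * h t) v \<le> Lp_norm p (\<lambda>x. nn_conv (\<lambda>v. STFT_abs g f x v) S v)"
        unfolding STFT_Lp_def by (intro Lp_norm_mono p pt) measurable
      also have "\<dots> \<le> (\<integral>\<^sup>+\<eta>. Lp_norm p (\<lambda>x. STFT_abs g f x (v - \<eta>) * S \<eta>) \<partial>lborel)"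
        unfolding nn_conv_def by (intro Lp_norm_nn_integral p sigma_finite_lborel) measurable
      also have "\<dots> \<le> (\<integral>\<^sup>+\<eta>. STFT_Lp g p f (v - \<eta>) * S \<eta> \<partial>lborel)"
      proof (rule nn_integral_mono)
        fix \<eta>
        show "Lp_norm p (\<lambda>x. STFT_abs g f x (v - \<eta>) * S \<eta>) \<le> STFT_Lp g p f (v - \<eta>) * S \<eta>"
          using Lp_norm_cmult_le[OF p, of "\<lambda>x. STFT_abs g f x (v - \<eta>)" "S \<eta>"] by (simp add: STFT_Lp_def mult.commute)
      qed
      finally show ?thesis by (simp add: nn_conv_def)
    qed
    have "wnorm q s S \<le> C1 * wnorm q s (nn_conv (STFT_Lp g p h) J)" unfolding S_def by (intro wnorm_cmult_le q) measurable
    also have "\<dots> \<le> C1 * (ennreal (2 powr (s / 2)) * K * wnorm q s (STFT_Lp g p h))"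
      unfolding K_def by (intro mult_left_mono wnorm_nn_conv_le q s) auto
    finally have S: "wnorm q s S \<le> C1 * (ennreal (2 powr (s / 2)) * K) * wnorm q s (STFT_Lp g p h)" by (simp add: mult.assoc)
    have "wnorm q s (STFT_Lp g p (\<lambda>t. f t * h t)) \<le> C2 * wnorm q s (STFT_Lp G p (\<lambda>t. f t * h t))" by (rule C2(2)[OF fh])
    also have "\<dots> \<le> C2 * wnorm q s (nn_conv (STFT_Lp g p f) S)"
      by (intro mult_left_mono wnorm_mono q le) auto
    also have "\<dots> \<le> C2 * (B * (wnorm q s (STFT_Lp g p f) * wnorm q s S))"
      unfolding B_def by (intro mult_left_mono wnorm_nn_conv_algebra q s emb) auto
    also have "\<dots> \<le> C2 * (B * (wnorm q s (STFT_Lp g p f) * (C1 * (ennreal (2 powr (s / 2)) * K) * wnorm q s (STFT_Lp g p h))))"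
      by (intro mult_left_mono S) auto
    also have "\<dots> = C * (wnorm q s (STFT_Lp g p f) * wnorm q s (STFT_Lp g p h))" by (simp add: C_def ac_simps)
    finally show "admissible (\<lambda>t. f t * h t) \<and> wnorm q s (STFT_Lp g p (\<lambda>t. f t * h t)) \<le> C * (wnorm q s (STFT_Lp g p f) * wnorm q s (STFT_Lp g p h))"
      using fh by blast
  qed
qed

subsection \<open>Real and imaginary parts\<close>

lemma fourier_add_cmult:
  assumes "integrable lborel u" "integrable lborel v"
  shows "fourier (\<lambda>t. a * u t + b * v t) w = a * fourier u w + b * fourier v w"
proof -
  have i: "integrable lborel (\<lambda>t. h t * cis (- (2 * pi * (w \<bullet> t))))" if h: "integrable lborel h" for h
    by (rule Bochner_Integration.integrable_bound[OF h])
      (use h in \<open>auto simp: norm_mult dest: borel_measurable_integrable\<close>)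
  have "fourier (\<lambda>t. a * u t + b * v t) w
    = (LINT t|lborel. a * (u t * cis (- (2 * pi * (w \<bullet> t)))) + b * (v t * cis (- (2 * pi * (w \<bullet> t)))))"
    unfolding fourier_def by (simp add: distrib_right mult.assoc)
  then show ?thesis
    unfolding fourier_def using i[OF assms(1)] i[OF assms(2)] by simp
qed

lemma fourier_cnj: "fourier (\<lambda>t. cnj (h t)) w = cnj (fourier h (- w))"
proof -
  have "(LINT t|lborel. cnj (h t * cis (- (2 * pi * (- w \<bullet> t))))) = cnj (LINT t|lborel. h t * cis (- (2 * pi * (- w \<bullet> t))))"
    by (rule Bochner_Integration.integral_cnj)
  then show ?thesis by (simp add: fourier_def cis_cnj)
qed

lemma admissible_cnj:
  assumes "admissible f"
  shows "admissible (\<lambda>t. cnj (f t))"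
  unfolding admissible_def
proof (intro conjI ballI)
  show "continuous_on UNIV (\<lambda>t. cnj (f t))" using assms by (auto simp: admissible_def intro: continuous_intros)
  fix \<phi> :: "real^'a \<Rightarrow> complex" assume "\<phi> \<in> schwartz"
  from schwartz_cnj[OF this] have "integrable lborel (\<lambda>t. f t * cnj (\<phi> t))" using assms by (auto simp: admissible_def)
  then have "integrable lborel (\<lambda>t. cnj (f t * cnj (\<phi> t)))" by (simp only: complex_integrable_cnj)
  then show "integrable lborel (\<lambda>t. cnj (f t) * \<phi> t)" by simp
qed

lemma admissible_add_cmult:
  assumes "admissible f" "admissible h"
  shows "admissible (\<lambda>t. a * f t + b * h t)"
  using assms unfolding admissible_def
  by (auto intro!: continuous_intros simp: distrib_right mult.assoc)

lemma STFT_abs_cnj: "STFT_abs g (\<lambda>t. cnj (f t)) x w = STFT_abs (\<lambda>t. cnj (g t)) f x (- w)"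
  unfolding STFT_abs_def STFT_def using fourier_cnj[of "\<lambda>t. f t * g (t - x)" w] by simp

lemma STFT_Lp_add_cmult:
  assumes p: "1 \<le> p" and f: "admissible f" and h: "admissible h" and g: "g \<in> schwartz"
  shows "STFT_Lp g p (\<lambda>t. a * f t + b * h t) w \<le> ennreal (norm a) * STFT_Lp g p f w + ennreal (norm b) * STFT_Lp g p h w"
proof -
  note [measurable] = STFT_abs_measurable'[OF f g] STFT_abs_measurable'[OF h g] STFT_abs_measurable'[OF admissible_add_cmult[OF f h] g]
  have "STFT_abs g (\<lambda>t. a * f t + b * h t) x w \<le> ennreal (norm a) * STFT_abs g f x w + ennreal (norm b) * STFT_abs g h x w" for x
  proof -
    have "STFT g (\<lambda>t. a * f t + b * h t) x w = a * STFT g f x w + b * STFT g h x w"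
      unfolding STFT_def
      by (subst fourier_add_cmult[symmetric]) (auto intro: admissible_window[OF f g] admissible_window[OF h g] simp: distrib_right mult.assoc)
    then have "norm (STFT g (\<lambda>t. a * f t + b * h t) x w) \<le> norm a * norm (STFT g f x w) + norm b * norm (STFT g h x w)"
      by (metis norm_mult norm_triangle_ineq)
    then show ?thesis unfolding STFT_abs_def
      by (simp add: ennreal_mult[symmetric] ennreal_plus[symmetric] ennreal_leI del: ennreal_plus)
  qed
  then have "STFT_Lp g p (\<lambda>t. a * f t + b * h t) w \<le> Lp_norm p (\<lambda>x. ennreal (norm a) * STFT_abs g f x w + ennreal (norm b) * STFT_abs g h x w)"
    unfolding STFT_Lp_def by (intro Lp_norm_mono p) measurable
  also have "\<dots> \<le> Lp_norm p (\<lambda>x. ennreal (norm a) * STFT_abs g f x w) + Lp_norm p (\<lambda>x. ennreal (norm b) * STFT_abs g h x w)"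
    by (intro Lp_norm_add p) measurable
  also have "\<dots> \<le> ennreal (norm a) * STFT_Lp g p f w + ennreal (norm b) * STFT_Lp g p h w"
    unfolding STFT_Lp_def by (intro add_mono Lp_norm_cmult_le p) measurable
  finally show ?thesis .
qed

lemma Re_Im_part_eq:
  "Re_part f = (\<lambda>t. (1 / 2) * f t + (1 / 2) * cnj (f t))"
  "Im_part f = (\<lambda>t. (- \<i> / 2) * f t + (\<i> / 2) * cnj (f t))"
  by (auto simp: Re_part_def Im_part_def fun_eq_iff complex_eq_iff)

text \<open>Conjugating \<open>f\<close> conjugates the window and reflects the frequency. The
  weight is even, but the window need not be real, so a change of window has to relate
  \<open>cnj g\<close> to \<open>g\<close>.\<close>

lemma wnorm_Re_Im_part:
  fixes g :: "real^'n::finite \<Rightarrow> complex"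
  assumes g: "g \<in> schwartz" and nz: "g \<noteq> (\<lambda>t. 0)"
    and p: "1 \<le> p" and q: "1 \<le> q" and s: "0 \<le> s" and f: "admissible f" and fin: "wnorm q s (STFT_Lp g p f) < top"
  shows "admissible (Re_part f)" "admissible (Im_part f)" "wnorm q s (STFT_Lp g p (Re_part f)) < top" "wnorm q s (STFT_Lp g p (Im_part f)) < top"
proof -
  have cg: "(\<lambda>t. cnj (g t)) \<in> schwartz" by (rule schwartz_cnj[OF g])
  have cf: "admissible (\<lambda>t. cnj (f t))" by (rule admissible_cnj[OF f])
  obtain C where C: "C < top" "\<And>f. admissible f \<Longrightarrow> wnorm q s (STFT_Lp (\<lambda>t. cnj (g t)) p f) \<le> C * wnorm q s (STFT_Lp g p f)"
    by (rule wnorm_window_change[OF g cg nz p q s]) (rule that)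
  note [measurable] = STFT_Lp_measurable[OF p f g] STFT_Lp_measurable[OF p cf g] STFT_Lp_measurable[OF p f cg]
  have "STFT_Lp g p (\<lambda>t. cnj (f t)) = (\<lambda>w. STFT_Lp (\<lambda>t. cnj (g t)) p f (- w))"
    by (simp add: STFT_Lp_def STFT_abs_cnj fun_eq_iff)
  then have "wnorm q s (STFT_Lp g p (\<lambda>t. cnj (f t))) = wnorm q s (STFT_Lp (\<lambda>t. cnj (g t)) p f)"
    by (simp add: wnorm_reflect q)
  also have "\<dots> < top" using le_less_trans[OF C(2)[OF f]] C(1) fin by (simp add: ennreal_mult_less_top)
  finally have cfin: "wnorm q s (STFT_Lp g p (\<lambda>t. cnj (f t))) < top" .
  have *: "wnorm q s (STFT_Lp g p (\<lambda>t. a * f t + b * cnj (f t))) < top" for a b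
  proof -
    have [measurable]: "STFT_Lp g p (\<lambda>t. a * f t + b * cnj (f t)) \<in> borel_measurable borel"
      by (intro STFT_Lp_measurable p g admissible_add_cmult f cf)
    have "wnorm q s (STFT_Lp g p (\<lambda>t. a * f t + b * cnj (f t)))
      \<le> wnorm q s (\<lambda>w. ennreal (norm a) * STFT_Lp g p f w + ennreal (norm b) * STFT_Lp g p (\<lambda>t. cnj (f t)) w)"
      by (intro wnorm_mono q STFT_Lp_add_cmult p f cf g) measurable
    also have "\<dots> \<le> wnorm q s (\<lambda>w. ennreal (norm a) * STFT_Lp g p f w) + wnorm q s (\<lambda>w. ennreal (norm b) * STFT_Lp g p (\<lambda>t. cnj (f t)) w)"
      by (intro wnorm_add q) measurable
    also have "\<dots> \<le> ennreal (norm a) * wnorm q s (STFT_Lp g p f) + ennreal (norm b) * wnorm q s (STFT_Lp g p (\<lambda>t. cnj (f t)))"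
      by (intro add_mono wnorm_cmult_le q) measurable
    also have "\<dots> < top" using fin cfin by (simp add: ennreal_mult_less_top)
    finally show ?thesis .
  qed
  show "admissible (Re_part f)" "admissible (Im_part f)" unfolding Re_Im_part_eq by (intro admissible_add_cmult f cf)+
  show "wnorm q s (STFT_Lp g p (Re_part f)) < top" "wnorm q s (STFT_Lp g p (Im_part f)) < top"
    unfolding Re_Im_part_eq by (rule *)+
qed

subsection \<open>Countable sums\<close>

text \<open>The bridge between \<open>infsum\<close>, in which the series are stated, and
  integration against counting measure, for which Fubini's and Minkowski's theorems are
  available.\<close>

lemma nn_integral_count_space_infsum:
  fixes f :: "'i \<Rightarrow> real"
  assumes "f summable_on UNIV" "\<And>i. 0 \<le> f i"
  shows "(\<integral>\<^sup>+i. ennreal (f i) \<partial>count_space UNIV) = ennreal (infsum f UNIV)"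
proof -
  have "(\<lambda>i. norm (f i)) summable_on UNIV" using assms by simp
  then have s: "Infinite_Set_Sum.abs_summable_on f UNIV" by (rule abs_summable_equivalent[THEN iffD1])
  then have "(\<integral>\<^sup>+i. ennreal (f i) \<partial>count_space UNIV) = ennreal (infsetsum f UNIV)"
    using assms(2) by (intro nn_integral_conv_infsetsum)
  then show ?thesis using infsetsum_infsum[OF s] by simp
qed

lemma measurable_pair_count_space:
  fixes u :: "'i::countable \<Rightarrow> 'a \<Rightarrow> 'b::topological_space"
  assumes "\<And>i. u i \<in> borel_measurable M"
  shows "(\<lambda>(t, i). u i t) \<in> borel_measurable (M \<Otimes>\<^sub>M count_space UNIV)"
proof -
  have "(\<lambda>(i, t). u i t) \<in> borel_measurable (count_space UNIV \<Otimes>\<^sub>M M)"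
    by (rule measurable_pair_measure_countable1) (use assms in auto)
  from measurable_compose[OF measurable_pair_swap' this] show ?thesis by (simp add: case_prod_beta)
qed

text \<open>Fubini's theorem for the product of Lebesgue and counting measure.\<close>

lemma fourier_infsum_le:
  fixes u :: "'i::countable \<Rightarrow> real^'n::finite \<Rightarrow> complex"
  assumes u: "\<And>i. u i \<in> borel_measurable borel"
    and fin: "(\<integral>\<^sup>+t. \<integral>\<^sup>+i. ennreal (norm (u i t)) \<partial>count_space UNIV \<partial>lborel) < top"
    and sm: "\<And>t. (\<lambda>i. norm (u i t)) summable_on UNIV"
  shows "ennreal (norm (fourier (\<lambda>t. infsum (\<lambda>i. u i t) UNIV) w)) \<le> (\<integral>\<^sup>+i. ennreal (norm (fourier (u i) w)) \<partial>count_space UNIV)"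
proof -
  interpret C: sigma_finite_measure "count_space UNIV :: 'i measure" by (rule sigma_finite_measure_count_space)
  interpret P: pair_sigma_finite "lborel :: (real^'n) measure" "count_space UNIV :: 'i measure" ..
  have uc: "(\<lambda>t. u i t * cis (- (2 * pi * (w \<bullet> t)))) \<in> borel_measurable lborel" for i
    using u[of i] by measurable
  have um[measurable]: "(\<lambda>(t, i). u i t * cis (- (2 * pi * (w \<bullet> t)))) \<in> borel_measurable (lborel \<Otimes>\<^sub>M count_space UNIV)"
    by (rule measurable_pair_count_space[OF uc])
  have int: "integrable (lborel \<Otimes>\<^sub>M count_space UNIV) (\<lambda>(t, i). u i t * cis (- (2 * pi * (w \<bullet> t))))"
  proof (rule integrableI_bounded[OF um])
    have "(\<integral>\<^sup>+z. ennreal (norm (case z of (t, i) \<Rightarrow> u i t * cis (- (2 * pi * (w \<bullet> t))))) \<partial>(lborel \<Otimes>\<^sub>M count_space UNIV))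
      = (\<integral>\<^sup>+t. \<integral>\<^sup>+i. ennreal (norm (u i t * cis (- (2 * pi * (w \<bullet> t))))) \<partial>count_space UNIV \<partial>lborel)"
      by (subst C.nn_integral_fst[symmetric]) auto
    also have "\<dots> < \<infinity>" using fin by (simp add: norm_mult)
    finally show "(\<integral>\<^sup>+z. ennreal (norm (case z of (t, i) \<Rightarrow> u i t * cis (- (2 * pi * (w \<bullet> t))))) \<partial>(lborel \<Otimes>\<^sub>M count_space UNIV)) < \<infinity>" .
  qed
  have "fourier (\<lambda>t. infsum (\<lambda>i. u i t) UNIV) w
    = (LINT t|lborel. LINT i|count_space UNIV. u i t * cis (- (2 * pi * (w \<bullet> t))))"
    unfolding fourier_def
  proof (rule Bochner_Integration.integral_cong)
    fix t
    have "Infinite_Set_Sum.abs_summable_on (\<lambda>i. u i t) UNIV" using sm[of t] by (rule abs_summable_equivalent[THEN iffD1])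
    then have "infsum (\<lambda>i. u i t) UNIV = (LINT i|count_space UNIV. u i t)"
      by (simp add: infsetsum_infsum[symmetric] infsetsum_def)
    then show "infsum (\<lambda>i. u i t) UNIV * cis (- (2 * pi * (w \<bullet> t)))
      = (LINT i|count_space UNIV. u i t * cis (- (2 * pi * (w \<bullet> t))))" by simp
  qed simp
  also have "\<dots> = (LINT i|count_space UNIV. fourier (u i) w)"
    unfolding fourier_def by (rule P.Fubini_integral[OF int, symmetric])
  finally show ?thesis by (simp add: norm_integral_le_nn_integral)
qed

section \<open>Power series\<close>

text \<open>Complex arguments allow the complex valued \<open>Re_part f\<close> and
  \<open>Im_part f\<close> to be inserted; projections instead of a case distinction on pairs keep
  the terms easy to rewrite.\<close>

definition pseries :: "(nat \<Rightarrow> nat \<Rightarrow> complex) \<Rightarrow> complex \<Rightarrow> complex \<Rightarrow> complex" where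
  "pseries a x y = (\<Sum>\<^sub>\<infinity>i. a (fst i) (snd i) * x ^ fst i * y ^ snd i)"

lemma pseries_bound:
  assumes sm: "(\<lambda>i. norm (a (fst i) (snd i)) * B ^ fst i * B ^ snd i) summable_on UNIV"
    and x: "norm x \<le> B" and y: "norm y \<le> B"
  shows "norm (a (fst i) (snd i) * x ^ fst i * y ^ snd i) \<le> norm (a (fst i) (snd i)) * B ^ fst i * B ^ snd i"
    and "(\<lambda>i. norm (a (fst i) (snd i) * x ^ fst i * y ^ snd i)) summable_on UNIV"
    and "norm (pseries a x y) \<le> (\<Sum>\<^sub>\<infinity>i. norm (a (fst i) (snd i)) * B ^ fst i * B ^ snd i)"
proof -
  have B: "0 \<le> B" using order_trans[OF norm_ge_zero x] .
  show le: "norm (a (fst i) (snd i) * x ^ fst i * y ^ snd i) \<le> norm (a (fst i) (snd i)) * B ^ fst i * B ^ snd i" for i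
    unfolding norm_mult norm_power using x y B by (intro mult_mono power_mono) auto
  show s: "(\<lambda>i. norm (a (fst i) (snd i) * x ^ fst i * y ^ snd i)) summable_on UNIV"
    by (rule summable_on_comparison_test[OF sm]) (use le in auto)
  have "norm (pseries a x y) \<le> (\<Sum>\<^sub>\<infinity>i. norm (a (fst i) (snd i) * x ^ fst i * y ^ snd i))"
    unfolding pseries_def by (rule norm_infsum_bound[OF s])
  also have "\<dots> \<le> (\<Sum>\<^sub>\<infinity>i. norm (a (fst i) (snd i)) * B ^ fst i * B ^ snd i)"
    by (rule infsum_mono[OF s sm le])
  finally show "norm (pseries a x y) \<le> (\<Sum>\<^sub>\<infinity>i. norm (a (fst i) (snd i)) * B ^ fst i * B ^ snd i)" .
qed

text \<open>The Weierstrass M-test along the finite subsets of the index set.\<close>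

lemma pseries_continuous:
  assumes sm: "(\<lambda>i. norm (a (fst i) (snd i)) * B ^ fst i * B ^ snd i) summable_on UNIV"
    and u: "continuous_on S u" "\<And>t. t \<in> S \<Longrightarrow> norm (u t) \<le> B"
    and v: "continuous_on S v" "\<And>t. t \<in> S \<Longrightarrow> norm (v t) \<le> B"
  shows "continuous_on S (\<lambda>t. pseries a (u t) (v t))"
proof -
  have "uniform_limit S (\<lambda>X t. \<Sum>i\<in>X. a (fst i) (snd i) * u t ^ fst i * v t ^ snd i)
     (\<lambda>t. pseries a (u t) (v t)) (finite_subsets_at_top UNIV)"
    unfolding pseries_def
    by (rule Weierstrass_m_test_general[OF _ sm]) (intro pseries_bound(1)[OF sm] u(2) v(2))
  then show ?thesis
    by (rule uniform_limit_theorem[rotated])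
      (use u v in \<open>auto intro!: always_eventually continuous_intros\<close>)
qed

lemma fourier_pseries_le:
  fixes u v K :: "real^'n::finite \<Rightarrow> complex"
  assumes sm: "(\<lambda>i. norm (a (fst i) (snd i)) * B ^ fst i * B ^ snd i) summable_on UNIV"
    and [measurable]: "u \<in> borel_measurable borel" "v \<in> borel_measurable borel"
    and u: "\<And>t. norm (u t) \<le> B" and v: "\<And>t. norm (v t) \<le> B"
    and K: "integrable lborel K"
  shows "ennreal (norm (fourier (\<lambda>t. pseries a (u t) (v t) * K t) w))
    \<le> (\<integral>\<^sup>+i. ennreal (norm (a (fst i) (snd i))) * ennreal (norm (fourier (\<lambda>t. u t ^ fst i * v t ^ snd i * K t) w)) \<partial>count_space UNIV)"
proof -
  have [measurable]: "K \<in> borel_measurable borel" using K by (auto dest: borel_measurable_integrable)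
  define M where "M i = norm (a (fst i) (snd i)) * B ^ fst i * B ^ snd i" for i
  have smM: "M summable_on UNIV" using sm by (simp add: M_def[abs_def])
  have B: "0 \<le> B" using order_trans[OF norm_ge_zero u] .
  have M: "0 \<le> M i" for i using B by (simp add: M_def)
  define U where "U i t = a (fst i) (snd i) * u t ^ fst i * v t ^ snd i * K t" for i t
  have eq: "pseries a (u t) (v t) * K t = infsum (\<lambda>i. U i t) UNIV" for t
    unfolding pseries_def U_def by (rule infsum_cmult_left'[symmetric])
  have nU: "norm (U i t) \<le> M i * norm (K t)" for i t
    unfolding U_def norm_mult[of _ "K t"] M_def
    by (intro mult_right_mono pseries_bound(1)[OF sm u v]) auto
  have le: "ennreal (norm (fourier (\<lambda>t. infsum (\<lambda>i. U i t) UNIV) w)) \<le> (\<integral>\<^sup>+i. ennreal (norm (fourier (U i) w)) \<partial>count_space UNIV)"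
  proof (rule fourier_infsum_le)
    show "U i \<in> borel_measurable borel" for i unfolding U_def by measurable
    show "(\<lambda>i. norm (U i t)) summable_on UNIV" for t
      by (rule summable_on_comparison_test[OF summable_on_cmult_left[OF smM, of "norm (K t)"]]) (use nU in auto)
    have "(\<integral>\<^sup>+t. \<integral>\<^sup>+i. ennreal (norm (U i t)) \<partial>count_space UNIV \<partial>lborel)
      \<le> (\<integral>\<^sup>+t. \<integral>\<^sup>+i. ennreal (M i) * ennreal (norm (K t)) \<partial>count_space UNIV \<partial>lborel)"
      using nU M by (intro nn_integral_mono) (auto simp: ennreal_mult[symmetric] intro!: ennreal_leI)
    also have "\<dots> = (\<integral>\<^sup>+t. ennreal (infsum M UNIV) * ennreal (norm (K t)) \<partial>lborel)"
      by (subst nn_integral_multc) (auto simp: nn_integral_count_space_infsum[OF smM M])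
    also have "\<dots> = ennreal (infsum M UNIV) * (\<integral>\<^sup>+t. ennreal (norm (K t)) \<partial>lborel)"
      by (rule nn_integral_cmult) measurable
    also have "\<dots> < top" using K by (simp add: ennreal_mult_less_top integrable_iff_bounded)
    finally show "(\<integral>\<^sup>+t. \<integral>\<^sup>+i. ennreal (norm (U i t)) \<partial>count_space UNIV \<partial>lborel) < top" .
  qed
  have "ennreal (norm (fourier (U i) w)) = ennreal (norm (a (fst i) (snd i))) * ennreal (norm (fourier (\<lambda>t. u t ^ fst i * v t ^ snd i * K t) w))" for i
  proof -
    have "fourier (U i) w = (LINT t|lborel. a (fst i) (snd i) * (u t ^ fst i * v t ^ snd i * K t * cis (- (2 * pi * (w \<bullet> t)))))"
      unfolding fourier_def U_def by (simp add: mult.assoc)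
    also have "\<dots> = a (fst i) (snd i) * fourier (\<lambda>t. u t ^ fst i * v t ^ snd i * K t) w"
      unfolding fourier_def by (rule integral_mult_right_zero)
    finally show ?thesis by (simp add: norm_mult ennreal_mult)
  qed
  then show ?thesis using le by (simp add: eq)
qed

lemma real_entire2_pseries:
  assumes "real_entire2 F a"
  shows "F s t = pseries a (of_real s) (of_real t)"
    and "0 \<le> x \<Longrightarrow> 0 \<le> y \<Longrightarrow> (\<lambda>i. norm (a (fst i) (snd i)) * x ^ fst i * y ^ snd i) summable_on UNIV"
proof -
  have *: "(\<lambda>i. norm (a (fst i) (snd i) * of_real s ^ fst i * of_real t ^ snd i)) summable_on UNIV"
     "F s t = pseries a (of_real s) (of_real t)" for s t
    using assms unfolding real_entire2_def pseries_def by (simp_all add: case_prod_unfold)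
  show "F s t = pseries a (of_real s) (of_real t)" by (rule *)
  show "(\<lambda>i. norm (a (fst i) (snd i)) * x ^ fst i * y ^ snd i) summable_on UNIV" if "0 \<le> x" "0 \<le> y"
    using *(1)[of x y] that by (simp add: norm_mult norm_power)
qed

lemma pseries_0: "pseries a 0 0 = a 0 0"
proof -
  have "pseries a 0 0 = infsum (\<lambda>i. a (fst i) (snd i) * 0 ^ fst i * 0 ^ snd i) {(0, 0)}"
    unfolding pseries_def by (rule infsum_cong_neutral) (auto simp: power_0_left)
  then show ?thesis by simp
qed

lemma modulation_entire:
  fixes g :: "real^'n::finite \<Rightarrow> complex"
  assumes g: "g \<in> schwartz" and nz: "g \<noteq> (\<lambda>t. 0)"
    and p: "1 \<le> p" and q: "1 \<le> q" and s: "0 \<le> s" and C0: "C0 < top"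
    and emb: "\<And>b :: real^'n \<Rightarrow> ennreal. b \<in> borel_measurable borel \<Longrightarrow> (\<integral>\<^sup>+w. b w \<partial>lborel) \<le> C0 * wnorm q s b"
    and sub: "\<And>f h. admissible f \<Longrightarrow> admissible h \<Longrightarrow> wnorm q s (STFT_Lp g p f) < top \<Longrightarrow> wnorm q s (STFT_Lp g p h) < top \<Longrightarrow>
       admissible (\<lambda>t. f t * h t) \<and> wnorm q s (STFT_Lp g p (\<lambda>t. f t * h t)) \<le> wnorm q s (STFT_Lp g p f) * wnorm q s (STFT_Lp g p h)"
    and F: "real_entire2 F a" "F 0 0 = 0" and f: "f \<in> modulation_functions g p q s"
  shows "operate F f \<in> modulation_functions g p q s"
    and "modulation_norm g p q s (operate F f)
      \<le> majorant a (modulation_norm g p q s (Re_part f)) (modulation_norm g p q s (Im_part f))"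
proof -
  define Nr where "Nr h = wnorm q s (STFT_Lp g p h)" for h
  define good where "good h \<longleftrightarrow> admissible h \<and> Nr h < top" for h
  have f': "admissible f" "wnorm q s (STFT_Lp g p f) < top" using f by (auto simp: modulation_functions_iff)
  define u where "u = Re_part f"
  define v where "v = Im_part f"
  have uv: "good u" "good v"
    using wnorm_Re_Im_part[OF g nz p q s f'] by (auto simp: good_def Nr_def u_def v_def)
  have mult: "good (\<lambda>t. f t * h t) \<and> Nr (\<lambda>t. f t * h t) \<le> Nr f * Nr h" if "good f" "good h" for f h
  proof -
    have "admissible (\<lambda>t. f t * h t)" "Nr (\<lambda>t. f t * h t) \<le> Nr f * Nr h"
      using sub[of f h] that by (auto simp: good_def Nr_def)
    moreover have "Nr f * Nr h < top" using that by (simp add: good_def ennreal_mult_less_top)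
    ultimately show ?thesis by (auto simp: good_def)
  qed
  \<comment> \<open>Exponents start at 1, since the power 0 is the constant 1, which has infinite
    norm for finite \<open>p\<close>.\<close>
  have pow: "good (\<lambda>t. h t ^ Suc j) \<and> Nr (\<lambda>t. h t ^ Suc j) \<le> Nr h ^ Suc j" if h: "good h" for h j
  proof (induction j)
    case (Suc j)
    then have IH: "good (\<lambda>t. h t ^ Suc j)" "Nr (\<lambda>t. h t ^ Suc j) \<le> Nr h ^ Suc j" by auto
    from mult[OF h IH(1)] have "good (\<lambda>t. h t ^ Suc (Suc j))" "Nr (\<lambda>t. h t ^ Suc (Suc j)) \<le> Nr h * Nr (\<lambda>t. h t ^ Suc j)"
      by simp_all
    moreover have "Nr h * Nr (\<lambda>t. h t ^ Suc j) \<le> Nr h * Nr h ^ Suc j" by (intro mult_left_mono IH) simp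
    ultimately show ?case by (auto intro: order_trans)
  qed (use h in simp)
  have powers: "Nr (\<lambda>t. u t ^ j * v t ^ k) \<le> Nr u ^ j * Nr v ^ k" if "(j, k) \<noteq> (0, 0)" for j k
  proof (cases j)
    case 0
    then obtain k' where "k = Suc k'" using \<open>(j, k) \<noteq> (0, 0)\<close> by (cases k) auto
    then show ?thesis using pow[OF uv(2), of k'] 0 by simp
  next
    case j: (Suc j')
    show ?thesis
    proof (cases k)
      case 0
      then show ?thesis using pow[OF uv(1), of j'] j by simp
    next
      case (Suc k')
      have "Nr (\<lambda>t. u t ^ Suc j' * v t ^ Suc k') \<le> Nr (\<lambda>t. u t ^ Suc j') * Nr (\<lambda>t. v t ^ Suc k')"
        using mult pow[OF uv(1), of j'] pow[OF uv(2), of k'] by blast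
      also have "\<dots> \<le> Nr u ^ Suc j' * Nr v ^ Suc k'"
        using pow[OF uv(1), of j'] pow[OF uv(2), of k'] by (intro mult_mono) auto
      finally show ?thesis using j Suc by simp
    qed
  qed
  obtain C where C: "C < top" "\<And>f t. admissible f \<Longrightarrow> ennreal (norm (f t)) \<le> C * wnorm q s (STFT_Lp g p f)"
    by (rule norm_le_wnorm[OF g nz p C0 emb]) (assumption, rule that)
  \<comment> \<open>A common supremum bound for the real and imaginary parts. It serves convergence
    and continuity of the composed series, whereas the final estimate inserts the norms
    themselves.\<close>
  define B where "B = enn2real (C * (Nr u + Nr v))"
  have B: "ennreal B = C * (Nr u + Nr v)"
    using C(1) uv by (simp add: B_def good_def ennreal_mult_less_top)
  have B0: "0 \<le> B" by (simp add: B_def)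
  have bd: "norm (u t) \<le> B" "norm (v t) \<le> B" for t
  proof -
    have "ennreal (norm (u t)) \<le> C * Nr u" "ennreal (norm (v t)) \<le> C * Nr v"
      using C(2) uv by (auto simp: good_def Nr_def)
    moreover have "C * Nr u \<le> ennreal B" "C * Nr v \<le> ennreal B"
      unfolding B by (intro mult_left_mono; simp)+
    ultimately have "ennreal (norm (u t)) \<le> ennreal B" "ennreal (norm (v t)) \<le> ennreal B"
      by (auto intro: order_trans)
    then show "norm (u t) \<le> B" "norm (v t) \<le> B" using B0 by (simp_all add: ennreal_le_iff)
  qed
  have cont: "continuous_on UNIV u" "continuous_on UNIV v" using uv by (auto simp: good_def admissible_def)
  have [measurable]: "u \<in> borel_measurable borel" "v \<in> borel_measurable borel"
    using cont by (auto intro: borel_measurable_continuous_onI)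
  have sm: "(\<lambda>i. norm (a (fst i) (snd i)) * B ^ fst i * B ^ snd i) summable_on UNIV"
    by (rule real_entire2_pseries(2)[OF F(1) B0 B0])
  have op: "operate F f = (\<lambda>t. pseries a (u t) (v t))"
    unfolding operate_def u_def v_def Re_part_def Im_part_def
    using real_entire2_pseries(1)[OF F(1)] by simp
  \<comment> \<open>This disposes of the one term to which \<open>powers\<close> does not
    apply.\<close>
  have a0: "a 0 0 = 0" using F(2) real_entire2_pseries(1)[OF F(1), of 0 0] by (simp add: pseries_0)
  have opc: "continuous_on UNIV (operate F f)" unfolding op by (rule pseries_continuous[OF sm cont(1) bd(1) cont(2) bd(2)])
  have opb: "norm (operate F f t) \<le> (\<Sum>\<^sub>\<infinity>i. norm (a (fst i) (snd i)) * B ^ fst i * B ^ snd i)" for t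
    unfolding op by (rule pseries_bound(3)[OF sm bd])
  have opadm: "admissible (operate F f)" by (rule admissible_bounded[OF opc opb])
  have padm: "admissible (\<lambda>t. u t ^ j * v t ^ k)" for j k
  proof (rule admissible_bounded)
    show "continuous_on UNIV (\<lambda>t. u t ^ j * v t ^ k)" by (intro continuous_intros cont)
    show "norm (u t ^ j * v t ^ k) \<le> B ^ j * B ^ k" for t
      unfolding norm_mult norm_power using bd B0 by (intro mult_mono power_mono) auto
  qed
  define c where "c i = ennreal (norm (a (fst i) (snd i)))" for i
  define P where "P i = (\<lambda>t. u t ^ fst i * v t ^ snd i)" for i
  have P: "admissible (P i)" for i unfolding P_def by (rule padm)
  note [measurable] = STFT_abs_measurable'[OF P g] STFT_abs_measurable'[OF opadm g] STFT_Lp_measurable[OF p P g] STFT_Lp_measurable[OF p opadm g]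
  have Vle: "STFT_abs g (operate F f) x w \<le> (\<integral>\<^sup>+i. c i * STFT_abs g (P i) x w \<partial>count_space UNIV)" for x w
  proof -
    have "integrable lborel (\<lambda>t. cnj (g (t - x)))"
      by (intro schwartz_integrable schwartz_cnj schwartz_translate g)
    from fourier_pseries_le[OF sm _ _ bd this, where w = w]
    show ?thesis unfolding STFT_abs_def STFT_def op c_def P_def by simp
  qed
  have Ale: "STFT_Lp g p (operate F f) w \<le> (\<integral>\<^sup>+i. c i * STFT_Lp g p (P i) w \<partial>count_space UNIV)" for w
  proof -
    have "STFT_Lp g p (operate F f) w \<le> Lp_norm p (\<lambda>x. \<integral>\<^sup>+i. c i * STFT_abs g (P i) x w \<partial>count_space UNIV)"
      unfolding STFT_Lp_def by (intro Lp_norm_mono p Vle) measurable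
    also have "\<dots> \<le> (\<integral>\<^sup>+i. Lp_norm p (\<lambda>x. c i * STFT_abs g (P i) x w) \<partial>count_space UNIV)"
      by (intro Lp_norm_count_sum p) measurable
    also have "\<dots> \<le> (\<integral>\<^sup>+i. c i * STFT_Lp g p (P i) w \<partial>count_space UNIV)"
      unfolding STFT_Lp_def by (intro nn_integral_mono Lp_norm_cmult_le p) measurable
    finally show ?thesis .
  qed
  define x where "x = enn2real (Nr u)"
  define y where "y = enn2real (Nr v)"
  have xy: "Nr u = ennreal x" "Nr v = ennreal y" "0 \<le> x" "0 \<le> y" using uv by (auto simp: good_def x_def y_def)
  have smxy: "(\<lambda>i. norm (a (fst i) (snd i)) * x ^ fst i * y ^ snd i) summable_on UNIV"
    by (rule real_entire2_pseries(2)[OF F(1) xy(3,4)])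
  have maj: "majorant a x y = (\<Sum>\<^sub>\<infinity>i. norm (a (fst i) (snd i)) * x ^ fst i * y ^ snd i)"
    by (simp add: majorant_def case_prod_unfold)
  have "Nr (operate F f) \<le> wnorm q s (\<lambda>w. \<integral>\<^sup>+i. c i * STFT_Lp g p (P i) w \<partial>count_space UNIV)"
    unfolding Nr_def by (intro wnorm_mono q Ale) measurable
  also have "\<dots> \<le> (\<integral>\<^sup>+i. wnorm q s (\<lambda>w. c i * STFT_Lp g p (P i) w) \<partial>count_space UNIV)"
    by (intro wnorm_count_sum q) measurable
  also have "\<dots> \<le> (\<integral>\<^sup>+i. c i * Nr (P i) \<partial>count_space UNIV)"
    unfolding Nr_def by (intro nn_integral_mono wnorm_cmult_le q) measurable
  also have "\<dots> \<le> (\<integral>\<^sup>+i. ennreal (norm (a (fst i) (snd i)) * x ^ fst i * y ^ snd i) \<partial>count_space UNIV)"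
  proof (rule nn_integral_mono)
    fix i :: "nat \<times> nat"
    show "c i * Nr (P i) \<le> ennreal (norm (a (fst i) (snd i)) * x ^ fst i * y ^ snd i)"
    proof (cases "i = (0, 0)")
      case True
      then show ?thesis by (simp add: c_def a0)
    next
      case False
      then have "Nr (P i) \<le> Nr u ^ fst i * Nr v ^ snd i"
        unfolding P_def by (intro powers) (auto simp: prod_eq_iff)
      also have "\<dots> = ennreal (x ^ fst i * y ^ snd i)"
        unfolding xy(1,2) using xy by (simp add: ennreal_power ennreal_mult)
      finally have "c i * Nr (P i) \<le> c i * ennreal (x ^ fst i * y ^ snd i)" by (rule mult_left_mono) simp
      then show ?thesis using xy by (simp add: c_def ennreal_mult[symmetric] mult.assoc)
    qed
  qed
  also have "\<dots> = ennreal (majorant a x y)"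
    unfolding maj using xy by (intro nn_integral_count_space_infsum smxy) auto
  finally have le: "Nr (operate F f) \<le> ennreal (majorant a x y)" .
  then have fin: "wnorm q s (STFT_Lp g p (operate F f)) < top"
    unfolding Nr_def using le_less_trans ennreal_less_top by blast
  show "operate F f \<in> modulation_functions g p q s"
    by (rule modulation_functionsI[OF opc opb fin])
  have "0 \<le> majorant a x y" unfolding maj using xy by (intro infsum_nonneg) auto
  then have "enn2real (Nr (operate F f)) \<le> majorant a x y" using le by (metis enn2real_leI)
  then show "modulation_norm g p q s (operate F f)
      \<le> majorant a (modulation_norm g p q s (Re_part f)) (modulation_norm g p q s (Im_part f))"
    unfolding modulation_norm_def modulation_enorm_eq Nr_def x_def y_def u_def v_def by simp
qed

section \<open>Rescaled windows and the estimate for entire functions\<close>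

lemma STFT_Lp_scaled_window:
  fixes g :: "real^'n::finite \<Rightarrow> complex"
  assumes p: "1 \<le> p" and g: "g \<in> schwartz" and f: "admissible f" and r: "0 < r"
  shows "STFT_Lp (scaled_window r g) p f w = ennreal r * STFT_Lp g p f w"
proof -
  have "STFT (scaled_window r g) f x w = of_real r * STFT g f x w" for x
  proof -
    have "STFT (scaled_window r g) f x w = (LINT t|lborel. of_real r * (f t * cnj (g (t - x)) * cis (- (2 * pi * (w \<bullet> t)))))"
      unfolding STFT_def fourier_def scaled_window_def by (simp add: ac_simps)
    also have "\<dots> = of_real r * STFT g f x w" unfolding STFT_def fourier_def by (rule integral_mult_right_zero)
    finally show ?thesis .
  qed
  then have "STFT_abs (scaled_window r g) f x w = ennreal r * STFT_abs g f x w" for x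
    using r by (simp add: STFT_abs_def norm_mult ennreal_mult)
  moreover have "(\<lambda>x. STFT_abs g f x w) \<in> borel_measurable lborel" by (rule STFT_abs_measurable'[OF f g]) auto
  ultimately show ?thesis
    unfolding STFT_Lp_def using r by (simp add: Lp_norm_cmult[OF p])
qed

lemma wnorm_scaled_window:
  fixes g :: "real^'n::finite \<Rightarrow> complex"
  assumes "1 \<le> p" "1 \<le> q" "g \<in> schwartz" "admissible f" "0 < r"
  shows "wnorm q s (STFT_Lp (scaled_window r g) p f) = ennreal r * wnorm q s (STFT_Lp g p f)"
proof -
  have "STFT_Lp (scaled_window r g) p f = (\<lambda>w. ennreal r * STFT_Lp g p f w)"
    using STFT_Lp_scaled_window[OF assms(1,3-5)] by (simp add: fun_eq_iff)
  then show ?thesis using assms by (simp add: wnorm_cmult STFT_Lp_measurable)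
qed

theorem entire_on_modulation_spaces:
  fixes g :: "real^'n::finite \<Rightarrow> complex"
  assumes g: "g \<in> schwartz" and nz: "g \<noteq> (\<lambda>t. 0)" and p: "1 \<le> p" and q: "1 \<le> q"
    and cond: "q = 1 \<and> 0 \<le> s \<or> (\<exists>q'. 1 / q + 1 / q' = 1 \<and> ennreal s > of_nat CARD('n) / q')"
  obtains r\<^sub>0 where "0 < r\<^sub>0" "\<And>r F a f. r\<^sub>0 \<le> r \<Longrightarrow> real_entire2 F a \<Longrightarrow> F 0 0 = 0 \<Longrightarrow>
     f \<in> modulation_functions (scaled_window r g) p q s \<Longrightarrow>
     operate F f \<in> modulation_functions (scaled_window r g) p q s \<and>
     modulation_norm (scaled_window r g) p q s (operate F f)
       \<le> majorant a (modulation_norm (scaled_window r g) p q s (Re_part f))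
            (modulation_norm (scaled_window r g) p q s (Im_part f))"
proof -
  obtain C0 where C0: "C0 < top" "0 \<le> s"
    "\<And>b :: real^'n \<Rightarrow> ennreal. b \<in> borel_measurable borel \<Longrightarrow> (\<integral>\<^sup>+w. b w \<partial>lborel) \<le> C0 * wnorm q s b"
    by (rule wnorm_l1_embedding[OF q cond]) (rule that)
  obtain C where C: "C < top"
    "\<And>f h. admissible f \<Longrightarrow> admissible h \<Longrightarrow> wnorm q s (STFT_Lp g p f) < top \<Longrightarrow> wnorm q s (STFT_Lp g p h) < top \<Longrightarrow>
       admissible (\<lambda>t. f t * h t) \<and> wnorm q s (STFT_Lp g p (\<lambda>t. f t * h t)) \<le> C * (wnorm q s (STFT_Lp g p f) * wnorm q s (STFT_Lp g p h))"
    by (rule modulation_mult[OF g nz p q C0(2,1,3)]) (assumption, rule that)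
  \<comment> \<open>With the window \<open>scaled_window r g\<close> the product constant is
    \<open>C / r\<close>, which is at most 1 once \<open>r >= C\<close>; the summand 1 keeps
    \<open>r\<^sub>0\<close> positive.\<close>
  define r\<^sub>0 where "r\<^sub>0 = 1 + enn2real C"
  have r0: "0 < r\<^sub>0" "C \<le> ennreal r\<^sub>0"
  proof -
    show "0 < r\<^sub>0" by (simp add: r\<^sub>0_def add_pos_nonneg)
    show "C \<le> ennreal r\<^sub>0" using C(1) by (cases C) (auto simp: r\<^sub>0_def intro!: ennreal_leI)
  qed
  show thesis
  proof (rule that[OF r0(1)])
    fix r F a and f :: "real^'n \<Rightarrow> complex"
    assume r: "r\<^sub>0 \<le> r" and F: "real_entire2 F a" "F 0 0 = 0" and f: "f \<in> modulation_functions (scaled_window r g) p q s"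
    have rpos: "0 < r" using r r0 by simp
    define \<gamma> where "\<gamma> = scaled_window r g"
    have \<gamma>: "\<gamma> \<in> schwartz" unfolding \<gamma>_def scaled_window_def by (rule schwartz_scale[OF g])
    have \<gamma>nz: "\<gamma> \<noteq> (\<lambda>t. 0)" using nz rpos by (auto simp: \<gamma>_def scaled_window_def fun_eq_iff)
    note wr = wnorm_scaled_window[OF p q g _ rpos, folded \<gamma>_def]
    have sub: "admissible (\<lambda>t. f t * h t) \<and> wnorm q s (STFT_Lp \<gamma> p (\<lambda>t. f t * h t)) \<le> wnorm q s (STFT_Lp \<gamma> p f) * wnorm q s (STFT_Lp \<gamma> p h)"
      if "admissible f" "admissible h" "wnorm q s (STFT_Lp \<gamma> p f) < top" "wnorm q s (STFT_Lp \<gamma> p h) < top" for f h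
    proof -
      have "wnorm q s (STFT_Lp g p f) < top" "wnorm q s (STFT_Lp g p h) < top"
        using that(3,4) rpos unfolding wr[OF that(1)] wr[OF that(2)] by (auto simp: ennreal_mult_less_top)
      from C(2)[OF that(1,2) this] have fh: "admissible (\<lambda>t. f t * h t)"
        and le: "wnorm q s (STFT_Lp g p (\<lambda>t. f t * h t)) \<le> C * (wnorm q s (STFT_Lp g p f) * wnorm q s (STFT_Lp g p h))" by auto
      have "C \<le> ennreal r" using r0(2) r by (meson ennreal_leI order_trans)
      have "wnorm q s (STFT_Lp \<gamma> p (\<lambda>t. f t * h t)) \<le> ennreal r * (ennreal r * (wnorm q s (STFT_Lp g p f) * wnorm q s (STFT_Lp g p h)))"
        unfolding wr[OF fh]
        by (intro mult_left_mono order_trans[OF le] mult_right_mono \<open>C \<le> ennreal r\<close>) auto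
      then show ?thesis using fh unfolding wr[OF that(1)] wr[OF that(2)] by (simp add: ac_simps)
    qed
    show "operate F f \<in> modulation_functions (scaled_window r g) p q s \<and>
     modulation_norm (scaled_window r g) p q s (operate F f)
       \<le> majorant a (modulation_norm (scaled_window r g) p q s (Re_part f))
            (modulation_norm (scaled_window r g) p q s (Im_part f))"
      using modulation_entire[OF \<gamma> \<gamma>nz p q C0(2,1,3) sub F f[folded \<gamma>_def]] unfolding \<gamma>_def by blast
  qed
qed

section \<open>A compactly supported Schwartz function\<close>

text \<open>The factor \<open>inverse x ^ k\<close> is built in because these functions are closed
  under differentiation up to linear combinations, so all derivatives of
  \<open>exp (- inverse x)\<close> are treated at once.\<close>

definition flat :: "nat \<Rightarrow> real \<Rightarrow> real" where
  "flat k x = (if 0 < x then inverse x ^ k * exp (- inverse x) else 0)"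

text \<open>To the right of 0 the quotient is \<open>flat (k + 1)\<close>, where the exponential
  beats every power; so the function glued at 0 has derivative 0 there.\<close>

lemma flat_tendsto_0: "((\<lambda>h. flat k h / h) \<longlongrightarrow> 0) (at 0)"
proof (rule filterlim_split_at_real)
  show "((\<lambda>h. flat k h / h) \<longlongrightarrow> 0) (at_left 0)"
    by (rule tendsto_eventually) (auto simp: flat_def eventually_at_filter)
  have "filterlim inverse at_top (at_right (0::real))" by (rule filterlim_inverse_at_top_right)
  from filterlim_compose[OF tendsto_power_div_exp_0[of "Suc k"] this]
  have "((\<lambda>h. inverse h ^ Suc k / exp (inverse h)) \<longlongrightarrow> 0) (at_right (0::real))" .
  then show "((\<lambda>h. flat k h / h) \<longlongrightarrow> 0) (at_right 0)"
  proof (rule Lim_transform_eventually)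
    show "\<forall>\<^sub>F h in at_right 0. inverse h ^ Suc k / exp (inverse h) = flat k h / (h::real)"
      by (auto simp: flat_def eventually_at_filter exp_minus field_simps)
  qed
qed

lemma flat_deriv: "(flat k has_real_derivative (flat (k + 2) x - real k * flat (k + 1) x)) (at x)"
proof -
  consider "x < 0" | "x = 0" | "0 < x" by linarith
  then show ?thesis
  proof cases
    case 1
    have "((\<lambda>_. 0) has_real_derivative 0) (at x)" by simp
    then have "(flat k has_real_derivative 0) (at x)"
      by (rule has_field_derivative_transform_within_open[where S = "{..<0}"]) (use 1 in \<open>auto simp: flat_def\<close>)
    then show ?thesis using 1 by (simp add: flat_def)
  next
    case 2
    show ?thesis using flat_tendsto_0[of k] 2
      by (simp add: has_field_derivative_iff flat_def[of _ 0])
  next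
    case 3
    have "((\<lambda>x. inverse x ^ k * exp (- inverse x)) has_real_derivative
      (inverse x ^ (k + 2) * exp (- inverse x) - real k * (inverse x ^ (k + 1) * exp (- inverse x)))) (at x)"
    proof -
      have "((\<lambda>x. inverse x ^ k) has_real_derivative real k * (- (inverse x ^ Suc (Suc 0)) * inverse x ^ (k - Suc 0))) (at x)"
        using 3 by (intro DERIV_power DERIV_inverse) auto
      moreover have "((\<lambda>x. exp (- inverse x)) has_real_derivative exp (- inverse x) * (- (- (inverse x ^ Suc (Suc 0))))) (at x)"
        using 3 by (intro DERIV_chain2[OF DERIV_exp] DERIV_minus DERIV_inverse) auto
      ultimately have "((\<lambda>x. inverse x ^ k * exp (- inverse x)) has_real_derivative
          real k * (- (inverse x ^ Suc (Suc 0)) * inverse x ^ (k - Suc 0)) * exp (- inverse x)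
          + exp (- inverse x) * (- (- (inverse x ^ Suc (Suc 0)))) * inverse x ^ k) (at x)"
        by (rule DERIV_mult)
      then show ?thesis
      proof (rule DERIV_cong)
        show "real k * (- (inverse x ^ Suc (Suc 0)) * inverse x ^ (k - Suc 0)) * exp (- inverse x)
          + exp (- inverse x) * (- (- (inverse x ^ Suc (Suc 0)))) * inverse x ^ k
        = inverse x ^ (k + 2) * exp (- inverse x) - real k * (inverse x ^ (k + 1) * exp (- inverse x))"
          by (cases k) (simp_all add: power_add power2_eq_square algebra_simps)
      qed
    qed
    then have "(flat k has_real_derivative
      (inverse x ^ (k + 2) * exp (- inverse x) - real k * (inverse x ^ (k + 1) * exp (- inverse x)))) (at x)"
      by (rule has_field_derivative_transform_within_open[where S = "{0<..}"]) (use 3 in \<open>auto simp: flat_def\<close>)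
    then show ?thesis using 3 by (simp add: flat_def)
  qed
qed

text \<open>A list of triples stands for a linear combination of the products
  \<open>flat k x * flat l (1 - x)\<close>; these combinations are closed under differentiation.\<close>

definition flat_comb :: "(real \<times> nat \<times> nat) list \<Rightarrow> real \<Rightarrow> real" where
  "flat_comb L x = (\<Sum>(c, k, l)\<leftarrow>L. c * (flat k x * flat l (1 - x)))"

definition flat_comb_deriv :: "(real \<times> nat \<times> nat) list \<Rightarrow> (real \<times> nat \<times> nat) list" where
  "flat_comb_deriv L = concat (map (\<lambda>(c, k, l).
     [(c, k + 2, l), (- c * real k, k + 1, l), (- c, k, l + 2), (c * real l, k, l + 1)]) L)"

lemma flat_comb_has_derivative:
  "(flat_comb L has_real_derivative flat_comb (flat_comb_deriv L) x) (at x)"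
proof (induction L)
  case Nil
  then show ?case by (simp add: flat_comb_def[abs_def] flat_comb_deriv_def)
next
  case (Cons p L)
  obtain c k l where p: "p = (c, k, l)" by (cases p)
  have r: "((\<lambda>x. flat l (1 - x)) has_real_derivative (flat (l + 2) (1 - x) - real l * flat (l + 1) (1 - x)) * (- 1)) (at x)"
    by (rule DERIV_chain2[OF flat_deriv]) (auto intro!: derivative_eq_intros)
  have "((\<lambda>x. c * (flat k x * flat l (1 - x))) has_real_derivative
     c * ((flat (k + 2) x - real k * flat (k + 1) x) * flat l (1 - x)
       + (flat (l + 2) (1 - x) - real l * flat (l + 1) (1 - x)) * (- 1) * flat k x)) (at x)"
    by (intro DERIV_cmult DERIV_mult flat_deriv r)
  from DERIV_add[OF this Cons]
  have "((\<lambda>x. c * (flat k x * flat l (1 - x)) + flat_comb L x) has_real_derivative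
     c * ((flat (k + 2) x - real k * flat (k + 1) x) * flat l (1 - x)
       + (flat (l + 2) (1 - x) - real l * flat (l + 1) (1 - x)) * (- 1) * flat k x) + flat_comb (flat_comb_deriv L) x) (at x)" .
  moreover have "(\<lambda>x. c * (flat k x * flat l (1 - x)) + flat_comb L x) = flat_comb (p # L)"
    by (simp add: flat_comb_def fun_eq_iff p)
  moreover have "c * ((flat (k + 2) x - real k * flat (k + 1) x) * flat l (1 - x)
       + (flat (l + 2) (1 - x) - real l * flat (l + 1) (1 - x)) * (- 1) * flat k x) + flat_comb (flat_comb_deriv L) x
    = flat_comb (flat_comb_deriv (p # L)) x"
    by (simp add: flat_comb_def flat_comb_deriv_def p algebra_simps)
  ultimately show ?case by simp
qed

lemma flat_comb_eq_0: "x \<le> 0 \<or> 1 \<le> x \<Longrightarrow> flat_comb L x = 0"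
  unfolding flat_comb_def by (induction L) (auto simp: flat_def)

text \<open>A bump vanishing outside the unit interval is integrated to a smooth step, and the
  difference of two shifted steps is the plateau. All derivatives are returned together as the
  sequence \<open>D\<close>.\<close>

lemma smooth_plateau:
  obtains D :: "nat \<Rightarrow> real \<Rightarrow> real" where
    "\<And>k x. (D k has_real_derivative D (Suc k) x) (at x)"
    "\<And>x. \<bar>x\<bar> \<le> 1 \<Longrightarrow> D 0 x = 1" "\<And>k x. 2 \<le> \<bar>x\<bar> \<Longrightarrow> D k x = 0"
proof -
  define b where "b k = flat_comb ((flat_comb_deriv ^^ k) [(1, 0, 0)])" for k
  have bd: "(b k has_real_derivative b (Suc k) x) (at x)" for k x
    unfolding b_def using flat_comb_has_derivative by simp
  have b0: "b k x = 0" if "x \<le> 0 \<or> 1 \<le> x" for k x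
    unfolding b_def using that by (rule flat_comb_eq_0)
  have bc: "continuous_on A (b k)" for k A
    using bd by (meson DERIV_isCont continuous_at_imp_continuous_on)
  \<comment> \<open>Starting at -1, left of the support, puts every \<open>x >= 0\<close> in the
    interior of the interval on which the fundamental theorem of calculus is used.\<close>
  define S where "S x = integral {-1..x} (b 0)" for x
  have S0: "S x = 0" if "x \<le> 0" for x
  proof -
    have "S x = integral {-1..x} (\<lambda>_. 0)"
      unfolding S_def by (rule integral_cong) (use that b0 in auto)
    then show ?thesis by simp
  qed
  have Sd: "(S has_real_derivative b 0 x) (at x)" for x
  proof (cases "x < 0")
    case True
    have "((\<lambda>_. 0) has_real_derivative 0) (at x)" by simp
    then have "(S has_real_derivative 0) (at x)"
      by (rule has_field_derivative_transform_within_open[where S = "{..<0}"]) (use True S0 in auto)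
    then show ?thesis using True b0 by simp
  next
    case False
    have "((\<lambda>u. integral {-1..u} (b 0)) has_vector_derivative b 0 x) (at x within {-1..x+1})"
      by (rule integral_has_vector_derivative[OF bc]) (use False in auto)
    then have "(S has_vector_derivative b 0 x) (at x within {-1<..<x+1})"
      unfolding S_def[abs_def] by (rule has_vector_derivative_within_subset) auto
    then have "(S has_vector_derivative b 0 x) (at x)"
      using False by (subst (asm) has_vector_derivative_within_open) auto
    then show ?thesis by (simp add: has_real_derivative_iff_has_vector_derivative)
  qed
  have b_nonneg: "0 \<le> b 0 x" for x by (simp add: b_def flat_comb_def flat_def)
  have S1: "S x = S 1" if "1 \<le> x" for x
  proof (cases "x = 1")
    case False
    then have "1 < x" using that by simp
    obtain z where z: "1 < z" "z < x" "S x - S 1 = (x - 1) * b 0 z"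
      using MVT2[OF \<open>1 < x\<close>, of S "b 0"] Sd by auto
    then show ?thesis using b0[of z 0] by simp
  qed simp
  \<comment> \<open>If \<open>S 1\<close> were 0, the nondecreasing \<open>S\<close> would be
    constant on the unit interval and its derivative \<open>b 0\<close> would vanish at
    \<open>1 / 2\<close>.\<close>
  have Spos: "0 < S 1"
  proof -
    have mono: "S x \<le> S y" if "x \<le> y" for x y
      by (rule DERIV_nonneg_imp_nondecreasing[OF that]) (use Sd b_nonneg in blast)
    have "S 1 \<noteq> 0"
    proof
      assume "S 1 = 0"
      then have "S x = 0" if "0 \<le> x" "x \<le> 1" for x
        using mono[OF that(1)] mono[OF that(2)] S0[of 0] by simp
      then have "(S has_real_derivative 0) (at (1/2))"
        by (intro has_field_derivative_transform_within_open[OF DERIV_const, where S = "{0<..<1}"]) auto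
      then have "b 0 (1/2) = 0" using Sd DERIV_unique by blast
      then show False by (simp add: b_def flat_comb_def flat_def)
    qed
    then show ?thesis using mono[of 0 1] S0[of 0] by simp
  qed
  \<comment> \<open>The shifts give \<open>x + 2 >= 1\<close> and \<open>x - 1 <= 0\<close> for
    \<open>|x| <= 1\<close>, while for \<open>|x| >= 2\<close> both points lie on the same flat part
    of \<open>S\<close>.\<close>
  define D where "D k x = (case k of 0 \<Rightarrow> (S (x + 2) - S (x - 1)) / S 1 | Suc j \<Rightarrow> (b j (x + 2) - b j (x - 1)) / S 1)" for k x
  have shift: "((\<lambda>x. h (x + c)) has_real_derivative h' (x + c)) (at x)"
    if "\<And>x. (h has_real_derivative h' x) (at x)" for h h' c x
  proof -
    have "((\<lambda>x. x + c) has_real_derivative 1) (at x)" by (auto intro!: derivative_eq_intros)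
    from DERIV_chain2[of h "h' (x + c)" "\<lambda>x. x + c" x, OF that this] show ?thesis by simp
  qed
  have lin: "((\<lambda>x. (h (x + 2) - h (x - 1)) / S 1) has_real_derivative (h' (x + 2) - h' (x - 1)) / S 1) (at x)"
    if "\<And>x. (h has_real_derivative h' x) (at x)" for h h' x
    using shift[OF that, of 2 x] shift[OF that, of "-1" x] by (intro DERIV_cdivide DERIV_diff) auto
  show thesis
  proof (rule that[of D])
    show "(D k has_real_derivative D (Suc k) x) (at x)" for k x
    proof (cases k)
      case 0
      then show ?thesis using lin[OF Sd] by (simp add: D_def[abs_def])
    next
      case (Suc j)
      then show ?thesis using lin[OF bd[of j]] by (simp add: D_def[abs_def])
    qed
    show "D 0 x = 1" if "\<bar>x\<bar> \<le> 1" for x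
      using that S1[of "x + 2"] S0[of "x - 1"] Spos by (simp add: D_def)
    show "D k x = 0" if x: "2 \<le> \<bar>x\<bar>" for k x
    proof (cases "0 \<le> x")
      case True
      then show ?thesis using x S1[of "x + 2"] S1[of "x - 1"] by (cases k) (auto simp: D_def b0)
    next
      case False
      then show ?thesis using x S0[of "x + 2"] S0[of "x - 1"] by (cases k) (auto simp: D_def b0)
    qed
  qed
qed

lemma schwartz_plateau:
  obtains \<tau> :: "real^'n::finite \<Rightarrow> complex" and R where
    "\<tau> \<in> schwartz" "\<And>t. cnj (\<tau> t) = \<tau> t" "\<And>t. norm t \<le> 1 \<Longrightarrow> \<tau> t = 1"
    "0 < R" "\<And>t. R \<le> norm t \<Longrightarrow> \<tau> t = 0"
proof -
  obtain D :: "nat \<Rightarrow> real \<Rightarrow> real" where D: "\<And>k x. (D k has_real_derivative D (Suc k) x) (at x)"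
    "\<And>x. \<bar>x\<bar> \<le> 1 \<Longrightarrow> D 0 x = 1" "\<And>k x. 2 \<le> \<bar>x\<bar> \<Longrightarrow> D k x = 0"
    by (rule smooth_plateau) (rule that)
  \<comment> \<open>\<open>c j\<close> counts the derivatives taken in coordinate \<open>j\<close>.
    The family is closed under partial differentiation, so one argument for decay covers all
    derivatives.\<close>
  define T where "T c = (\<lambda>x :: real^'n. \<Prod>j\<in>UNIV. complex_of_real (D (c j) (x $ j)))" for c :: "'n \<Rightarrow> nat"
  have dD: "D k differentiable (at x)" for k x
    using D(1)[of k x] real_differentiable_def by blast
  have Tdiff: "T c differentiable (at x)" for c x
  proof -
    have "(\<lambda>x :: real^'n. complex_of_real (D (c j) (x $ j))) differentiable (at x)" for j
    proof -
      have "(\<lambda>x :: real^'n. D (c j) (x $ j)) differentiable (at x)"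
        using differentiable_chain_at[of "\<lambda>x :: real^'n. x $ j" x "D (c j)"] dD
        by (simp add: o_def bounded_linear_imp_differentiable bounded_linear_vec_nth)
      moreover have "complex_of_real differentiable (at y)" for y
        by (intro bounded_linear_imp_differentiable bounded_linear_of_real)
      ultimately show ?thesis
        using differentiable_chain_at[of "\<lambda>x :: real^'n. D (c j) (x $ j)" x complex_of_real] by (simp add: o_def)
    qed
    note factor = this
    have "(\<lambda>x. \<Prod>j\<in>A. complex_of_real (D (c j) (x $ j))) differentiable (at x)" if "finite A" for A
      using that by (induction A rule: finite_induct) (auto intro!: differentiable_mult factor)
    then show ?thesis unfolding T_def by simp
  qed
  have Tpd: "partial_derivative i (T c) x = T (c(i := Suc (c i))) x" for i c x
  proof (rule partial_derivative_eqI)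
    let ?P = "\<Prod>j\<in>UNIV - {i}. complex_of_real (D (c j) (x $ j))"
    have eq: "T c (x + h *\<^sub>R axis i 1) = complex_of_real (D (c i) (x $ i + h)) * ?P" for h
    proof -
      have "T c (x + h *\<^sub>R axis i 1) = complex_of_real (D (c i) ((x + h *\<^sub>R axis i 1) $ i))
        * (\<Prod>j\<in>UNIV - {i}. complex_of_real (D (c j) ((x + h *\<^sub>R axis i 1) $ j)))"
        unfolding T_def by (rule prod.remove) auto
      also have "(\<Prod>j\<in>UNIV - {i}. complex_of_real (D (c j) ((x + h *\<^sub>R axis i 1) $ j))) = ?P"
        by (intro prod.cong) (auto simp: axis_def)
      finally show ?thesis by (simp add: axis_def)
    qed
    have eq2: "T (c(i := Suc (c i))) x = complex_of_real (D (Suc (c i)) (x $ i)) * ?P"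
    proof -
      have "T (c(i := Suc (c i))) x = complex_of_real (D ((c(i := Suc (c i))) i) (x $ i))
        * (\<Prod>j\<in>UNIV - {i}. complex_of_real (D ((c(i := Suc (c i))) j) (x $ j)))"
        unfolding T_def by (rule prod.remove) auto
      also have "(\<Prod>j\<in>UNIV - {i}. complex_of_real (D ((c(i := Suc (c i))) j) (x $ j))) = ?P"
        by (intro prod.cong) auto
      finally show ?thesis by (simp only: fun_upd_same)
    qed
    have "((\<lambda>h. x $ i + h) has_real_derivative 1) (at 0)" by (auto intro!: derivative_eq_intros)
    from DERIV_chain2[of "D (c i)" "D (Suc (c i)) (x $ i)" "\<lambda>h. x $ i + h" 0, OF _ this]
    have "((\<lambda>h. D (c i) (x $ i + h)) has_real_derivative D (Suc (c i)) (x $ i)) (at 0)"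
      using D(1)[of "c i" "x $ i"] by simp
    then have "((\<lambda>h. complex_of_real (D (c i) (x $ i + h)) * ?P) has_vector_derivative
        complex_of_real (D (Suc (c i)) (x $ i)) * ?P) (at 0)"
      by (intro has_vector_derivative_mult_left has_vector_derivative_of_real)
    then show "((\<lambda>h. T c (x + h *\<^sub>R axis i 1)) has_vector_derivative T (c(i := Suc (c i))) x) (at 0)"
      unfolding eq eq2 .
  qed
  have Titer: "\<exists>c'. iterated_derivative \<alpha> (T c) = T c'" for \<alpha> c
  proof (induction \<alpha>)
    case (Cons i \<alpha>)
    then obtain c' where "iterated_derivative \<alpha> (T c) = T c'" by auto
    then have "iterated_derivative (i # \<alpha>) (T c) = partial_derivative i (T c')" by simp
    also have "\<dots> = T (c'(i := Suc (c' i)))" by (rule ext) (rule Tpd)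
    finally have "iterated_derivative (i # \<alpha>) (T c) = T (c'(i := Suc (c' i)))" .
    then show ?case by blast
  qed auto
  \<comment> \<open>The norm is at most the sum of the absolute coordinates; if it is at least
    \<open>2 * n\<close>, some coordinate has absolute value at least 2 and its factor
    vanishes.\<close>
  define R where "R = 2 * real CARD('n)"
  have R: "0 < R" by (simp add: R_def)
  have T0: "T c x = 0" if "R \<le> norm x" for c x
  proof -
    have "\<exists>j. 2 \<le> \<bar>x $ j\<bar>"
    proof (rule ccontr)
      assume "\<nexists>j. 2 \<le> \<bar>x $ j\<bar>"
      then have "(\<Sum>j\<in>UNIV. \<bar>x $ j\<bar>) < (\<Sum>j\<in>(UNIV :: 'n set). 2)"
        by (intro sum_strict_mono) (auto simp: not_le)
      then show False using norm_le_l1_cart[of x] that by (simp add: R_def)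
    qed
    then show ?thesis unfolding T_def by (intro prod_zero) (use D(3) in auto)
  qed
  have bound: "\<exists>C. \<forall>x. norm (T c x) \<le> C * jb (- a) x" if a: "0 \<le> a" for c a
  proof -
    have "continuous_on (cball 0 R) (T c)"
      using Tdiff differentiable_imp_continuous_within continuous_at_imp_continuous_on by blast
    then have "bounded (T c ` cball 0 R)"
      by (intro compact_imp_bounded compact_continuous_image) auto
    then obtain B where "\<forall>y\<in>T c ` cball 0 R. norm y \<le> B" unfolding bounded_iff by blast
    then have B: "\<And>x. x \<in> cball 0 R \<Longrightarrow> norm (T c x) \<le> B" by blast
    have B0: "0 \<le> B" using order_trans[OF norm_ge_zero B[of 0]] R by simp
    \<comment> \<open>Outside radius \<open>R\<close> the function is 0; inside, the weight is at
      least \<open>(1 + R\<^sup>2) powr (- a)\<close>, which the constant compensates.\<close>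
    have "norm (T c x) \<le> B * (1 + R\<^sup>2) powr a * jb (- a) x" for x
    proof (cases "norm x < R")
      case True
      have "(1 + R\<^sup>2) powr (- a) \<le> jb (- a) x"
        unfolding jb_def using True a by (intro powr_mono2') (auto simp: power_mono)
      then have "1 \<le> (1 + R\<^sup>2) powr a * jb (- a) x"
        using mult_left_mono[of "(1 + R\<^sup>2) powr (- a)" "jb (- a) x" "(1 + R\<^sup>2) powr a"] one_plus_norm_pos[of R]
        by (simp add: powr_add[symmetric] del: one_plus_norm_pos)
      then have "B * 1 \<le> B * ((1 + R\<^sup>2) powr a * jb (- a) x)" using B0 by (rule mult_left_mono)
      then show ?thesis using B[of x] True by (simp add: mult.assoc)
    next
      case False
      then show ?thesis using T0[of x c] B0 by simp
    qed
    then show ?thesis by blast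
  qed
  show thesis
  proof (rule that[of "T (\<lambda>_. 0)" R])
    show "T (\<lambda>_. 0) \<in> schwartz"
    proof (rule schwartzI)
      show "smooth (T (\<lambda>_. 0))" unfolding smooth_def using Titer Tdiff by metis
      show "\<exists>C. \<forall>x. norm (iterated_derivative \<alpha> (T (\<lambda>_. 0)) x) \<le> C * jb (- a) x" if "0 \<le> a" for \<alpha> a
        using Titer[of \<alpha> "\<lambda>_. 0"] bound[OF that] by auto
    qed
    show "cnj (T (\<lambda>_. 0) t) = T (\<lambda>_. 0) t" for t by (simp add: T_def)
    show "T (\<lambda>_. 0) t = 1" if "norm t \<le> 1" for t
    proof -
      have "\<bar>t $ j\<bar> \<le> 1" for j using component_le_norm_cart[of t j] that by simp
      then show ?thesis unfolding T_def by (intro prod.neutral) (auto simp: D(2))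
    qed
  qed (use R T0 in auto)
qed

section \<open>Local estimates in the Fourier algebra\<close>

lemma FL1_cnj:
  assumes [measurable]: "h \<in> borel_measurable borel"
  shows "FL1 (\<lambda>t. cnj (h t)) = FL1 h"
proof -
  have "FL1 (\<lambda>t. cnj (h t)) = (\<integral>\<^sup>+w. ennreal (norm (fourier h (0 - w))) \<partial>lborel)"
    unfolding FL1_def fourier_cnj by simp
  also have "\<dots> = FL1 h" unfolding FL1_def by (rule nn_integral_lborel_reflect) measurable
  finally show ?thesis .
qed

lemma FL1_translate:
  assumes [measurable]: "h \<in> borel_measurable borel"
  shows "FL1 (\<lambda>t. h (t - x)) = FL1 h"
proof -
  have "norm (fourier (\<lambda>t. h (t - x)) w) = norm (fourier h w)" for w
  proof -
    have "fourier (\<lambda>t. h (t - x)) w = (LINT t|lborel. h (t + x - x) * cis (- (2 * pi * (w \<bullet> (t + x)))))"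
      unfolding fourier_def by (rule integral_lborel_translate[symmetric]) measurable
    also have "\<dots> = (LINT t|lborel. cis (- (2 * pi * (w \<bullet> x))) * (h t * cis (- (2 * pi * (w \<bullet> t)))))"
      by (intro Bochner_Integration.integral_cong) (simp_all add: cis_mult inner_add_right algebra_simps)
    also have "\<dots> = cis (- (2 * pi * (w \<bullet> x))) * fourier h w"
      unfolding fourier_def by (rule integral_mult_right_zero)
    finally show ?thesis by (simp add: norm_mult)
  qed
  then show ?thesis by (simp add: FL1_def)
qed

lemma FL1_add_cmult:
  fixes u v :: "real^'n::finite \<Rightarrow> complex"
  assumes "integrable lborel u" "integrable lborel v"
  shows "FL1 (\<lambda>t. a * u t + b * v t) \<le> ennreal (norm a) * FL1 u + ennreal (norm b) * FL1 v"
proof -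
  have [measurable]: "u \<in> borel_measurable borel" "v \<in> borel_measurable borel"
    using assms by (auto dest: borel_measurable_integrable)
  have "FL1 (\<lambda>t. a * u t + b * v t)
    \<le> (\<integral>\<^sup>+w. ennreal (norm a) * ennreal (norm (fourier u w)) + ennreal (norm b) * ennreal (norm (fourier v w)) \<partial>lborel)"
    unfolding FL1_def
  proof (rule nn_integral_mono)
    fix w :: "real^'n"
    have "norm (fourier (\<lambda>t. a * u t + b * v t) w) \<le> norm a * norm (fourier u w) + norm b * norm (fourier v w)"
      unfolding fourier_add_cmult[OF assms] by (metis norm_mult norm_triangle_ineq)
    then show "ennreal (norm (fourier (\<lambda>t. a * u t + b * v t) w))
      \<le> ennreal (norm a) * ennreal (norm (fourier u w)) + ennreal (norm b) * ennreal (norm (fourier v w))"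
      by (simp add: ennreal_mult[symmetric] ennreal_plus[symmetric] ennreal_leI del: ennreal_plus)
  qed
  also have "\<dots> = ennreal (norm a) * FL1 u + ennreal (norm b) * FL1 v"
    unfolding FL1_def by (subst nn_integral_add) (auto simp: nn_integral_cmult)
  finally show ?thesis .
qed

text \<open>Each part combines \<open>u\<close> and its conjugate with coefficients of modulus
  \<open>1 / 2\<close>, and conjugation preserves \<open>FL1\<close>; hence no constant is
  lost.\<close>

lemma FL1_Re_Im_part:
  fixes u :: "real^'n::finite \<Rightarrow> complex"
  assumes u: "integrable lborel u"
  shows "integrable lborel (Re_part u)" "integrable lborel (Im_part u)" "FL1 (Re_part u) \<le> FL1 u" "FL1 (Im_part u) \<le> FL1 u"
proof -
  have [measurable]: "u \<in> borel_measurable borel" using u by (auto dest: borel_measurable_integrable)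
  have c: "integrable lborel (\<lambda>t. cnj (u t))" using u by simp
  show "integrable lborel (Re_part u)" "integrable lborel (Im_part u)"
    unfolding Re_Im_part_eq by (intro Bochner_Integration.integrable_add integrable_mult_right u c)+
  have *: "ennreal (1 / 2) * x + ennreal (1 / 2) * x = x" for x
  proof -
    have "ennreal (1 / 2) * x + ennreal (1 / 2) * x = (ennreal (1 / 2) + ennreal (1 / 2)) * x"
      by (rule distrib_right[symmetric])
    also have "ennreal (1 / 2) + ennreal (1 / 2) = ennreal (1 / 2 + 1 / 2)"
      by (rule ennreal_plus[symmetric]) auto
    finally show ?thesis by simp
  qed
  show "FL1 (Re_part u) \<le> FL1 u"
    unfolding Re_Im_part_eq using FL1_add_cmult[OF u c, of "1 / 2" "1 / 2"] *[of "FL1 u"] by (simp add: FL1_cnj)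
  show "FL1 (Im_part u) \<le> FL1 u"
    unfolding Re_Im_part_eq using FL1_add_cmult[OF u c, of "- \<i> / 2" "\<i> / 2"] *[of "FL1 u"]
    by (simp add: FL1_cnj norm_divide)
qed

text \<open>The factor \<open>H\<close> makes the exponent 0 possible, since the constant 1 is not
  integrable.\<close>

lemma FL1_power_mult_le:
  fixes u H :: "real^'n::finite \<Rightarrow> complex"
  assumes u: "continuous_on UNIV u" "integrable lborel u" "FL1 u < top" "\<And>t. norm (u t) \<le> B"
    and H: "integrable lborel H"
  shows "integrable lborel (\<lambda>t. u t ^ j * H t)" "FL1 (\<lambda>t. u t ^ j * H t) \<le> FL1 u ^ j * FL1 H"
proof -
  have [measurable]: "u \<in> borel_measurable borel" "H \<in> borel_measurable borel"
    using u H by (auto dest: borel_measurable_integrable)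
  show int: "integrable lborel (\<lambda>t. u t ^ j * H t)" for j
  proof (rule Bochner_Integration.integrable_bound)
    show "integrable lborel (\<lambda>t. of_real (B ^ j) * H t)" by (intro integrable_mult_right H)
    have "0 \<le> B" using order_trans[OF norm_ge_zero u(4)] .
    then show "AE t in lborel. norm (u t ^ j * H t) \<le> norm (of_real (B ^ j) * H t)"
      using u(4) by (intro AE_I2) (auto simp: norm_mult norm_power intro!: mult_right_mono power_mono)
  qed measurable
  show "FL1 (\<lambda>t. u t ^ j * H t) \<le> FL1 u ^ j * FL1 H"
  proof (induction j)
    case (Suc j)
    have "FL1 (\<lambda>t. (u t ^ j * H t) * u t) \<le> FL1 (\<lambda>t. u t ^ j * H t) * FL1 u"
      by (rule FL1_mult_le[OF int u(1-3)])
    also have "\<dots> \<le> FL1 u ^ j * FL1 H * FL1 u" by (intro mult_right_mono Suc) auto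
    finally show ?case by (simp add: ac_simps)
  qed simp
qed

text \<open>The series is estimated term by term under the transform; the localising factor
  \<open>K\<close> is counted once and not in every power.\<close>

lemma FL1_pseries_le:
  fixes u v K :: "real^'n::finite \<Rightarrow> complex"
  assumes sm: "(\<lambda>i. norm (a (fst i) (snd i)) * B ^ fst i * B ^ snd i) summable_on UNIV"
    and u: "continuous_on UNIV u" "integrable lborel u" "FL1 u < top" "\<And>t. norm (u t) \<le> B"
    and v: "continuous_on UNIV v" "integrable lborel v" "FL1 v < top" "\<And>t. norm (v t) \<le> B"
    and K: "integrable lborel K"
  shows "FL1 (\<lambda>t. pseries a (u t) (v t) * K t)
    \<le> (\<integral>\<^sup>+i. ennreal (norm (a (fst i) (snd i))) * (FL1 u ^ fst i * FL1 v ^ snd i) \<partial>count_space UNIV) * FL1 K"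
proof -
  interpret C: sigma_finite_measure "count_space UNIV :: (nat \<times> nat) measure" by (rule sigma_finite_measure_count_space)
  interpret P: pair_sigma_finite "lborel :: (real^'n) measure" "count_space UNIV :: (nat \<times> nat) measure" ..
  have [measurable]: "u \<in> borel_measurable borel" "v \<in> borel_measurable borel" "K \<in> borel_measurable borel"
    using u v K by (auto dest: borel_measurable_integrable)
  define c where "c i = ennreal (norm (a (fst i) (snd i)))" for i
  define W where "W i = (\<lambda>t. u t ^ fst i * v t ^ snd i * K t)" for i
  have [measurable]: "W i \<in> borel_measurable borel" for i unfolding W_def by measurable
  have "(\<lambda>w. c i * ennreal (norm (fourier (W i) w))) \<in> borel_measurable lborel" for i by measurable
  note m[measurable] = measurable_pair_count_space[OF this]
  have "FL1 (\<lambda>t. pseries a (u t) (v t) * K t) \<le> (\<integral>\<^sup>+w. \<integral>\<^sup>+i. c i * ennreal (norm (fourier (W i) w)) \<partial>count_space UNIV \<partial>lborel)"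
    unfolding FL1_def c_def W_def
    by (intro nn_integral_mono fourier_pseries_le[OF sm] u(4) v(4) K) measurable
  also have "\<dots> = (\<integral>\<^sup>+i. \<integral>\<^sup>+w. c i * ennreal (norm (fourier (W i) w)) \<partial>lborel \<partial>count_space UNIV)"
    by (rule P.Fubini'[symmetric, OF m])
  also have "\<dots> = (\<integral>\<^sup>+i. c i * FL1 (W i) \<partial>count_space UNIV)"
    unfolding FL1_def by (intro nn_integral_cong nn_integral_cmult) measurable
  also have "\<dots> \<le> (\<integral>\<^sup>+i. c i * (FL1 u ^ fst i * FL1 v ^ snd i) * FL1 K \<partial>count_space UNIV)"
  proof (rule nn_integral_mono)
    fix i :: "nat \<times> nat"
    have "FL1 (W i) \<le> FL1 u ^ fst i * FL1 (\<lambda>t. v t ^ snd i * K t)"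
      unfolding W_def mult.assoc by (intro FL1_power_mult_le[OF u] FL1_power_mult_le(1)[OF v] K)
    also have "\<dots> \<le> FL1 u ^ fst i * (FL1 v ^ snd i * FL1 K)"
      by (intro mult_left_mono FL1_power_mult_le(2)[OF v] K) simp
    finally show "c i * FL1 (W i) \<le> c i * (FL1 u ^ fst i * FL1 v ^ snd i) * FL1 K"
      by (simp add: mult.assoc mult_left_mono)
  qed
  also have "\<dots> = (\<integral>\<^sup>+i. c i * (FL1 u ^ fst i * FL1 v ^ snd i) \<partial>count_space UNIV) * FL1 K"
    by (rule nn_integral_multc) simp
  finally show ?thesis by (simp add: c_def)
qed

lemma fourier_continuous:
  fixes h :: "real^'n::finite \<Rightarrow> complex"
  assumes h: "integrable lborel h" and w: "w \<longlonglongrightarrow> w0"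
  shows "(\<lambda>m. fourier h (w m)) \<longlonglongrightarrow> fourier h w0"
  unfolding fourier_def
proof (rule integral_dominated_convergence)
  have [measurable]: "h \<in> borel_measurable borel" using h by (auto dest: borel_measurable_integrable)
  show "(\<lambda>t. h t * cis (- (2 * pi * (w0 \<bullet> t)))) \<in> borel_measurable lborel"
    "(\<lambda>t. h t * cis (- (2 * pi * (w m \<bullet> t)))) \<in> borel_measurable lborel" for m by measurable
  show "integrable lborel (\<lambda>t. norm (h t))" using h by simp
  show "AE t in lborel. norm (h t * cis (- (2 * pi * (w m \<bullet> t)))) \<le> norm (h t)" for m
    by (simp add: norm_mult)
  show "AE t in lborel. (\<lambda>m. h t * cis (- (2 * pi * (w m \<bullet> t)))) \<longlonglongrightarrow> h t * cis (- (2 * pi * (w0 \<bullet> t)))"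
    by (intro AE_I2 tendsto_intros isCont_tendsto_compose[of _ cis] w)
qed

lemma nn_integral_lborel_scale:
  fixes h :: "'a::euclidean_space \<Rightarrow> ennreal"
  assumes c: "0 < c" and [measurable]: "h \<in> borel_measurable borel"
  shows "ennreal (1 / c ^ DIM('a)) * (\<integral>\<^sup>+x. h (x /\<^sub>R c) \<partial>lborel) = (\<integral>\<^sup>+x. h x \<partial>lborel)"
proof -
  have "(\<integral>\<^sup>+x. h (x /\<^sub>R c) \<partial>lborel) = ennreal (c ^ DIM('a)) * (\<integral>\<^sup>+x. h ((0 + c *\<^sub>R x) /\<^sub>R c) \<partial>lborel)"
    using c by (subst lborel_affine_nz[of c 0]) (auto simp: nn_integral_density nn_integral_distr nn_integral_cmult)
  then show ?thesis using c by (simp add: mult.assoc[symmetric] ennreal_mult[symmetric])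
qed

text \<open>The modulus of continuity of \<open>T\<close> in \<open>L\<^sup>1\<close>.\<close>

definition L1_shift :: "(real^'n::finite \<Rightarrow> complex) \<Rightarrow> real^'n \<Rightarrow> ennreal" where
  "L1_shift T y = (\<integral>\<^sup>+w. ennreal (norm (T (w - y) - T w)) \<partial>lborel)"

lemma L1_shift_tendsto:
  fixes \<tau> :: "real^'n::finite \<Rightarrow> complex"
  assumes \<tau>: "\<tau> \<in> schwartz"
  shows "(\<lambda>m. L1_shift (fourier \<tau>) (\<eta> /\<^sub>R real (Suc m))) \<longlonglongrightarrow> 0"
proof -
  define k where "k = CARD('n)"
  obtain C where C: "0 \<le> C" "\<And>w. norm (fourier \<tau> w) \<le> C * jb (- real k) w"
    by (rule schwartz_fourier[OF \<tau>, where m = k]) (rule that)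
  note [measurable] = schwartz_measurable[OF \<tau>]
  \<comment> \<open>For translations no longer than \<open>\<eta>\<close>, Peetre's inequality
    preserves the decay of the translate up to a constant; this gives one dominating function for
    all \<open>m\<close>.\<close>
  define D where "D = C * (2 powr real k * jb (real k) \<eta>) + C"
  have D: "0 \<le> D" using C by (simp add: D_def)
  have bd: "norm (fourier \<tau> (w - \<eta> /\<^sub>R real (Suc m)) - fourier \<tau> w) \<le> D * jb (- real k) w" for w m
  proof -
    let ?y = "\<eta> /\<^sub>R real (Suc m)"
    have "norm ?y \<le> norm \<eta>"
      using mult_right_mono[of "inverse (real (Suc m))" 1 "norm \<eta>"] by (simp add: inverse_le_1_iff)
    then have y: "jb (real k) ?y \<le> jb (real k) \<eta>"
      unfolding jb_def by (intro powr_mono2) (auto simp: power_mono)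
    have "jb (- real k) (w - ?y) = (jb (- real k) (w - ?y) * jb (- real k) ?y) * jb (real k) ?y"
      by (simp only: mult.assoc jb_add) simp
    also have "\<dots> \<le> (2 powr real k * jb (- real k) (w - ?y + ?y)) * jb (real k) \<eta>"
      by (intro mult_mono jb_negative_submult y) auto
    finally have "C * jb (- real k) (w - ?y) \<le> C * (2 powr real k * jb (real k) \<eta> * jb (- real k) w)"
      using C by (intro mult_left_mono) (auto simp: ac_simps)
    then have "norm (fourier \<tau> (w - ?y)) \<le> C * (2 powr real k * jb (real k) \<eta> * jb (- real k) w)"
      using C(2)[of "w - ?y"] by simp
    then have "norm (fourier \<tau> (w - ?y) - fourier \<tau> w) \<le> C * (2 powr real k * jb (real k) \<eta> * jb (- real k) w) + C * jb (- real k) w"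
      using C(2)[of w] by (intro norm_triangle_le_diff) (rule add_mono)
    then show ?thesis by (simp add: D_def algebra_simps)
  qed
  have "(\<lambda>m. \<integral>\<^sup>+w. ennreal (norm (fourier \<tau> (w - \<eta> /\<^sub>R real (Suc m)) - fourier \<tau> w)) \<partial>lborel) \<longlonglongrightarrow> (\<integral>\<^sup>+w. (0 :: ennreal) \<partial>(lborel :: (real^'n) measure))"
  proof (rule nn_integral_dominated_convergence)
    show "(\<integral>\<^sup>+w. ennreal (D * jb (- real k) (w::real^'n)) \<partial>lborel) < \<infinity>"
      using nn_integral_jb_finite[of "- real k", where 'a = "real^'n"] D
      by (simp add: ennreal_mult nn_integral_cmult ennreal_mult_less_top k_def)
    show "AE w in lborel. ennreal (norm (fourier \<tau> (w - \<eta> /\<^sub>R real (Suc m)) - fourier \<tau> w)) \<le> ennreal (D * jb (- real k) w)" for m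
      using bd by (intro AE_I2 ennreal_leI)
    show "AE w in lborel. (\<lambda>m. ennreal (norm (fourier \<tau> (w - \<eta> /\<^sub>R real (Suc m)) - fourier \<tau> w))) \<longlonglongrightarrow> 0"
    proof (intro AE_I2)
      fix w :: "real^'n"
      have "(\<lambda>m. w - \<eta> /\<^sub>R real (Suc m)) \<longlonglongrightarrow> w - 0 *\<^sub>R \<eta>"
        by (intro tendsto_intros LIMSEQ_inverse_real_of_nat)
      then have "(\<lambda>m. fourier \<tau> (w - \<eta> /\<^sub>R real (Suc m))) \<longlonglongrightarrow> fourier \<tau> w"
        by (intro fourier_continuous schwartz_integrable \<tau>) simp
      then have "(\<lambda>m. norm (fourier \<tau> (w - \<eta> /\<^sub>R real (Suc m)) - fourier \<tau> w)) \<longlonglongrightarrow> norm (fourier \<tau> w - fourier \<tau> w)"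
        by (intro tendsto_intros)
      then have "(\<lambda>m. ennreal (norm (fourier \<tau> (w - \<eta> /\<^sub>R real (Suc m)) - fourier \<tau> w))) \<longlonglongrightarrow> ennreal (norm (fourier \<tau> w - fourier \<tau> w))"
        by (rule tendsto_ennrealI)
      then show "(\<lambda>m. ennreal (norm (fourier \<tau> (w - \<eta> /\<^sub>R real (Suc m)) - fourier \<tau> w))) \<longlonglongrightarrow> 0" by simp
    qed
  qed measurable
  then show ?thesis by (simp add: L1_shift_def)
qed

text \<open>Near \<open>x0\<close> the function \<open>h - h x0\<close> is small in the Fourier algebra: by inversion it is a
  superposition of the functions \<open>e\<^sup>2\<^sup>\<pi>\<^sup>i\<^sup>\<eta>\<^sup>t - e\<^sup>2\<^sup>\<pi>\<^sup>i\<^sup>\<eta>\<^sup>x\<^sup>0\<close>, and cutting such a function off at scale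
  \<open>1/c\<close> costs only the \<open>L\<^sup>1\<close> distance of the transform of the cutoff to its translate by \<open>\<eta>/c\<close>.\<close>

lemma FL1_local_le:
  fixes h \<tau> :: "real^'n::finite \<Rightarrow> complex"
  assumes h: "continuous_on UNIV h" "integrable lborel h" "FL1 h < top" and \<tau>: "\<tau> \<in> schwartz" and c: "1 \<le> c"
  shows "FL1 (\<lambda>t. (h t - h x0) * \<tau> (c *\<^sub>R (t - x0)))
    \<le> (\<integral>\<^sup>+\<eta>. ennreal (norm (fourier h \<eta>)) * L1_shift (fourier \<tau>) (\<eta> /\<^sub>R c) \<partial>lborel)"
proof -
  define \<tau>c where "\<tau>c t = \<tau> (c *\<^sub>R (t - x0))" for t
  note [measurable] = schwartz_measurable[OF \<tau>]
  have [measurable]: "h \<in> borel_measurable borel" using h by (auto dest: borel_measurable_integrable)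
  have "\<tau>c \<in> schwartz"
    unfolding \<tau>c_def by (rule schwartz_translate[where f = "\<lambda>t. \<tau> (c *\<^sub>R t)"]) (rule schwartz_dilate[OF \<tau> c])
  then have \<tau>ci: "integrable lborel \<tau>c" and [measurable]: "\<tau>c \<in> borel_measurable borel"
    by (auto intro: schwartz_integrable schwartz_measurable)
  have hi: "integrable lborel (fourier h)" using h by (intro integrable_fourier) auto
  have F\<tau>: "fourier \<tau>c w = cis (- (2 * pi * (w \<bullet> x0))) * of_real (1 / c ^ CARD('n)) * fourier \<tau> (w /\<^sub>R c)" for w
  proof -
    have "fourier \<tau>c w = \<bar>1 / c\<bar> ^ DIM(real^'n) *\<^sub>R (LINT t|lborel. \<tau>c (x0 + (1 / c) *\<^sub>R t) * cis (- (2 * pi * (w \<bullet> (x0 + (1 / c) *\<^sub>R t)))))"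
      unfolding fourier_def using c by (intro integral_lborel_affine) auto
    also have "(LINT t|lborel. \<tau>c (x0 + (1 / c) *\<^sub>R t) * cis (- (2 * pi * (w \<bullet> (x0 + (1 / c) *\<^sub>R t)))))
      = (LINT t|lborel. cis (- (2 * pi * (w \<bullet> x0))) * (\<tau> t * cis (- (2 * pi * ((w /\<^sub>R c) \<bullet> t)))))"
    proof (rule Bochner_Integration.integral_cong)
      fix t :: "real^'n"
      have "cis (- (2 * pi * (w \<bullet> (x0 + (1 / c) *\<^sub>R t)))) = cis (- (2 * pi * (w \<bullet> x0))) * cis (- (2 * pi * ((w /\<^sub>R c) \<bullet> t)))"
        by (simp add: cis_mult inner_add_right divide_inverse algebra_simps)
      then show "\<tau>c (x0 + (1 / c) *\<^sub>R t) * cis (- (2 * pi * (w \<bullet> (x0 + (1 / c) *\<^sub>R t))))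
        = cis (- (2 * pi * (w \<bullet> x0))) * (\<tau> t * cis (- (2 * pi * ((w /\<^sub>R c) \<bullet> t))))"
        using c by (simp add: \<tau>c_def)
    qed simp
    also have "\<dots> = cis (- (2 * pi * (w \<bullet> x0))) * fourier \<tau> (w /\<^sub>R c)"
      unfolding fourier_def by (rule integral_mult_right_zero)
    finally show ?thesis using c by (simp add: scaleR_conv_of_real power_one_over)
  qed
  define \<Delta> where "\<Delta> \<eta> w = fourier \<tau> ((w - \<eta>) /\<^sub>R c) - fourier \<tau> (w /\<^sub>R c)" for \<eta> w
  have le: "ennreal (norm (fourier (\<lambda>t. (h t - h x0) * \<tau>c t) w))
    \<le> (\<integral>\<^sup>+\<eta>. ennreal (norm (fourier h \<eta>)) * (ennreal (1 / c ^ CARD('n)) * ennreal (norm (\<Delta> \<eta> w))) \<partial>lborel)" for w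
  proof -
    define E where "E \<eta> t = (cis (2 * pi * (\<eta> \<bullet> t)) - cis (2 * pi * (\<eta> \<bullet> x0))) * cis (- (2 * pi * (w \<bullet> t)))" for \<eta> t
    \<comment> \<open>\<open>E\<close> contains a difference of two phases and is halved to meet the
      bound 1 of \<open>integrable_pair_mult\<close>.\<close>
    have i1: "integrable (lborel \<Otimes>\<^sub>M lborel) (\<lambda>(t, \<eta>). \<tau>c t * fourier h \<eta> * (E \<eta> t / 2))"
    proof (rule integrable_pair_mult[OF \<tau>ci hi])
      show "(\<lambda>(t, \<eta>). E \<eta> t / 2) \<in> borel_measurable (lborel \<Otimes>\<^sub>M lborel)" unfolding E_def by measurable
      show "norm (E \<eta> t / 2) \<le> 1" for t \<eta>
        unfolding E_def norm_mult norm_divide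
        using norm_triangle_ineq4[of "cis (2 * pi * (\<eta> \<bullet> t))" "cis (2 * pi * (\<eta> \<bullet> x0))"] by simp
    qed
    have i2: "integrable (lborel \<Otimes>\<^sub>M lborel) (\<lambda>(t, \<eta>). \<tau>c t * fourier h \<eta> * E \<eta> t)"
      using integrable_mult_right[OF i1, of 2] by (simp add: case_prod_unfold)
    have "fourier (\<lambda>t. (h t - h x0) * \<tau>c t) w = (LINT t|lborel. LINT \<eta>|lborel. \<tau>c t * fourier h \<eta> * E \<eta> t)"
      unfolding fourier_def[of "\<lambda>t. (h t - h x0) * \<tau>c t"]
    proof (rule Bochner_Integration.integral_cong)
      fix t
      have ih: "integrable lborel (\<lambda>\<eta>. fourier h \<eta> * cis (2 * pi * (\<eta> \<bullet> t)))" for t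
        by (rule Bochner_Integration.integrable_bound[OF hi]) (auto simp: norm_mult)
      have "h t - h x0 = (LINT \<eta>|lborel. fourier h \<eta> * cis (2 * pi * (\<eta> \<bullet> t)) - fourier h \<eta> * cis (2 * pi * (\<eta> \<bullet> x0)))"
        by (subst Bochner_Integration.integral_diff[OF ih ih])
          (simp only: Fourier_inversion_FL1[OF h, symmetric])
      then have "(h t - h x0) * \<tau>c t * cis (- (2 * pi * (w \<bullet> t)))
        = (LINT \<eta>|lborel. fourier h \<eta> * cis (2 * pi * (\<eta> \<bullet> t)) - fourier h \<eta> * cis (2 * pi * (\<eta> \<bullet> x0))) * (\<tau>c t * cis (- (2 * pi * (w \<bullet> t))))"
        by simp
      also have "\<dots> = (LINT \<eta>|lborel. (fourier h \<eta> * cis (2 * pi * (\<eta> \<bullet> t)) - fourier h \<eta> * cis (2 * pi * (\<eta> \<bullet> x0))) * (\<tau>c t * cis (- (2 * pi * (w \<bullet> t)))))"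
        by (rule integral_mult_left_zero[symmetric])
      finally show "(h t - h x0) * \<tau>c t * cis (- (2 * pi * (w \<bullet> t))) = (LINT \<eta>|lborel. \<tau>c t * fourier h \<eta> * E \<eta> t)"
        by (simp add: E_def algebra_simps)
    qed simp
    also have "\<dots> = (LINT \<eta>|lborel. LINT t|lborel. \<tau>c t * fourier h \<eta> * E \<eta> t)"
      by (rule lborel_pair.Fubini_integral[OF i2, symmetric])
    also have "\<dots> = (LINT \<eta>|lborel. fourier h \<eta> * (fourier \<tau>c (w - \<eta>) - cis (2 * pi * (\<eta> \<bullet> x0)) * fourier \<tau>c w))"
    proof (rule Bochner_Integration.integral_cong)
      fix \<eta>
      have ic: "integrable lborel (\<lambda>t. \<tau>c t * cis (- (2 * pi * (w \<bullet> t))))" for w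
        by (rule Bochner_Integration.integrable_bound[OF \<tau>ci]) (auto simp: norm_mult)
      have cc: "cis (2 * pi * (\<eta> \<bullet> t)) * cis (- (2 * pi * (w \<bullet> t))) = cis (- (2 * pi * ((w - \<eta>) \<bullet> t)))" for t
        by (simp add: cis_mult inner_diff_left algebra_simps)
      have "(LINT t|lborel. \<tau>c t * fourier h \<eta> * E \<eta> t)
        = (LINT t|lborel. fourier h \<eta> * (\<tau>c t * cis (- (2 * pi * ((w - \<eta>) \<bullet> t))) - cis (2 * pi * (\<eta> \<bullet> x0)) * (\<tau>c t * cis (- (2 * pi * (w \<bullet> t))))))"
      proof (rule Bochner_Integration.integral_cong)
        fix t
        have "\<tau>c t * fourier h \<eta> * E \<eta> t = fourier h \<eta> * (\<tau>c t * (cis (2 * pi * (\<eta> \<bullet> t)) * cis (- (2 * pi * (w \<bullet> t))))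
          - cis (2 * pi * (\<eta> \<bullet> x0)) * (\<tau>c t * cis (- (2 * pi * (w \<bullet> t)))))"
          by (simp add: E_def algebra_simps)
        then show "\<tau>c t * fourier h \<eta> * E \<eta> t = fourier h \<eta> * (\<tau>c t * cis (- (2 * pi * ((w - \<eta>) \<bullet> t)))
          - cis (2 * pi * (\<eta> \<bullet> x0)) * (\<tau>c t * cis (- (2 * pi * (w \<bullet> t)))))"
          unfolding cc .
      qed simp
      also have "\<dots> = fourier h \<eta> * (LINT t|lborel. \<tau>c t * cis (- (2 * pi * ((w - \<eta>) \<bullet> t))) - cis (2 * pi * (\<eta> \<bullet> x0)) * (\<tau>c t * cis (- (2 * pi * (w \<bullet> t)))))"
        by (rule integral_mult_right_zero)
      also have "(LINT t|lborel. \<tau>c t * cis (- (2 * pi * ((w - \<eta>) \<bullet> t))) - cis (2 * pi * (\<eta> \<bullet> x0)) * (\<tau>c t * cis (- (2 * pi * (w \<bullet> t)))))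
        = fourier \<tau>c (w - \<eta>) - cis (2 * pi * (\<eta> \<bullet> x0)) * fourier \<tau>c w"
        unfolding fourier_def
        by (subst Bochner_Integration.integral_diff[OF ic integrable_mult_right[OF ic]]) simp
      finally show "(LINT t|lborel. \<tau>c t * fourier h \<eta> * E \<eta> t) = fourier h \<eta> * (fourier \<tau>c (w - \<eta>) - cis (2 * pi * (\<eta> \<bullet> x0)) * fourier \<tau>c w)" .
    qed simp
    finally have nb: "ennreal (norm (fourier (\<lambda>t. (h t - h x0) * \<tau>c t) w))
      \<le> (\<integral>\<^sup>+\<eta>. ennreal (norm (fourier h \<eta> * (fourier \<tau>c (w - \<eta>) - cis (2 * pi * (\<eta> \<bullet> x0)) * fourier \<tau>c w))) \<partial>lborel)"
      by (simp add: norm_integral_le_nn_integral)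
    \<comment> \<open>The transform of the cutoff about \<open>x0\<close> carries the phase at
      \<open>x0\<close>. Subtracting the value of the character at \<open>x0\<close> matches the
      phases of both terms, so only \<open>\<Delta>\<close> is left in absolute value.\<close>
    have neq: "norm (fourier h \<eta> * (fourier \<tau>c (w - \<eta>) - cis (2 * pi * (\<eta> \<bullet> x0)) * fourier \<tau>c w))
      = norm (fourier h \<eta>) * ((1 / c ^ CARD('n)) * norm (\<Delta> \<eta> w))" for \<eta>
    proof -
      have "cis (- (2 * pi * ((w - \<eta>) \<bullet> x0))) = cis (2 * pi * (\<eta> \<bullet> x0)) * cis (- (2 * pi * (w \<bullet> x0)))"
        by (simp add: cis_mult inner_diff_left algebra_simps)
      then have "fourier \<tau>c (w - \<eta>) - cis (2 * pi * (\<eta> \<bullet> x0)) * fourier \<tau>c w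
        = cis (2 * pi * (\<eta> \<bullet> x0)) * cis (- (2 * pi * (w \<bullet> x0))) * (of_real (1 / c ^ CARD('n)) * \<Delta> \<eta> w)"
        unfolding F\<tau> \<Delta>_def by (simp add: algebra_simps)
      then show ?thesis using c by (simp add: norm_mult norm_divide norm_power)
    qed
    have c0: "0 \<le> 1 / c ^ CARD('n)" using c by simp
    show ?thesis using nb unfolding neq ennreal_mult'[OF norm_ge_zero] ennreal_mult'[OF c0] .
  qed
  have [measurable]: "(\<lambda>(w, \<eta>). \<Delta> \<eta> w) \<in> borel_measurable (lborel \<Otimes>\<^sub>M lborel)"
    unfolding \<Delta>_def by measurable
  have "FL1 (\<lambda>t. (h t - h x0) * \<tau>c t)
    \<le> (\<integral>\<^sup>+w. \<integral>\<^sup>+\<eta>. ennreal (norm (fourier h \<eta>)) * (ennreal (1 / c ^ CARD('n)) * ennreal (norm (\<Delta> \<eta> w))) \<partial>lborel \<partial>lborel)"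
    unfolding FL1_def by (intro nn_integral_mono le)
  also have "\<dots> = (\<integral>\<^sup>+\<eta>. \<integral>\<^sup>+w. ennreal (norm (fourier h \<eta>)) * (ennreal (1 / c ^ CARD('n)) * ennreal (norm (\<Delta> \<eta> w))) \<partial>lborel \<partial>lborel)"
    by (rule lborel_pair.Fubini'[symmetric]) measurable
  also have "\<dots> = (\<integral>\<^sup>+\<eta>. ennreal (norm (fourier h \<eta>)) * L1_shift (fourier \<tau>) (\<eta> /\<^sub>R c) \<partial>lborel)"
  proof (rule nn_integral_cong)
    fix \<eta> :: "real^'n"
    have "(\<integral>\<^sup>+w. ennreal (norm (fourier h \<eta>)) * (ennreal (1 / c ^ CARD('n)) * ennreal (norm (\<Delta> \<eta> w))) \<partial>lborel)
      = ennreal (norm (fourier h \<eta>)) * (ennreal (1 / c ^ CARD('n)) * (\<integral>\<^sup>+w. ennreal (norm (\<Delta> \<eta> w)) \<partial>lborel))"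
      by (subst nn_integral_cmult, measurable, subst nn_integral_cmult, measurable)
    also have "(\<integral>\<^sup>+w. ennreal (norm (\<Delta> \<eta> w)) \<partial>lborel)
      = (\<integral>\<^sup>+w. ennreal (norm (fourier \<tau> (w /\<^sub>R c - \<eta> /\<^sub>R c) - fourier \<tau> (w /\<^sub>R c))) \<partial>lborel)"
      by (simp add: \<Delta>_def scaleR_diff_right)
    \<comment> \<open>Rescaling the frequency absorbs the normalisation of the dilated cutoff, so
      the bound depends on \<open>c\<close> only through the shift
      \<open>\<eta> /\<^sub>R c\<close>.\<close>
    also have "ennreal (1 / c ^ CARD('n)) * \<dots> = L1_shift (fourier \<tau>) (\<eta> /\<^sub>R c)"
      unfolding L1_shift_def
      using nn_integral_lborel_scale[of c "\<lambda>w. ennreal (norm (fourier \<tau> (w - \<eta> /\<^sub>R c) - fourier \<tau> w))"] c by simp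
    finally show "(\<integral>\<^sup>+w. ennreal (norm (fourier h \<eta>)) * (ennreal (1 / c ^ CARD('n)) * ennreal (norm (\<Delta> \<eta> w))) \<partial>lborel)
      = ennreal (norm (fourier h \<eta>)) * L1_shift (fourier \<tau>) (\<eta> /\<^sub>R c)" .
  qed
  finally show ?thesis by (simp add: \<tau>c_def)
qed

text \<open>Dominated convergence in \<open>\<eta>\<close>: the shift terms are bounded by
  \<open>2 * FL1 \<tau>\<close> and tend to 0 for each fixed \<open>\<eta>\<close> as the cutoff
  shrinks.\<close>

lemma FL1_local_tendsto:
  fixes h \<tau> :: "real^'n::finite \<Rightarrow> complex"
  assumes h: "continuous_on UNIV h" "integrable lborel h" "FL1 h < top" and \<tau>: "\<tau> \<in> schwartz"
  shows "(\<lambda>m. FL1 (\<lambda>t. (h t - h x0) * \<tau> (real (Suc m) *\<^sub>R (t - x0)))) \<longlonglongrightarrow> 0"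
proof -
  note [measurable] = schwartz_measurable[OF \<tau>]
  have [measurable]: "h \<in> borel_measurable borel" using h by (auto dest: borel_measurable_integrable)
  have [measurable]: "L1_shift (fourier \<tau>) \<in> borel_measurable borel"
  proof -
    have "(\<lambda>(y, w). ennreal (norm (fourier \<tau> (w - y) - fourier \<tau> w))) \<in> borel_measurable (borel \<Otimes>\<^sub>M lborel)" by measurable
    then show ?thesis unfolding L1_shift_def[abs_def] using lborel.borel_measurable_nn_integral by fastforce
  qed
  have bd: "L1_shift (fourier \<tau>) y \<le> 2 * FL1 \<tau>" for y
  proof -
    have "L1_shift (fourier \<tau>) y \<le> (\<integral>\<^sup>+w. ennreal (norm (fourier \<tau> (w - y))) + ennreal (norm (fourier \<tau> w)) \<partial>lborel)"
      unfolding L1_shift_def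
      by (intro nn_integral_mono) (simp add: ennreal_plus[symmetric] ennreal_leI norm_triangle_ineq4 del: ennreal_plus)
    also have "\<dots> = FL1 \<tau> + FL1 \<tau>"
      unfolding FL1_def by (subst nn_integral_add)
        (auto simp: nn_integral_lborel_translate[where h = "\<lambda>w. ennreal (norm (fourier \<tau> w))"])
    finally show ?thesis by (simp add: mult_2)
  qed
  have "(\<lambda>m. \<integral>\<^sup>+\<eta>. ennreal (norm (fourier h \<eta>)) * L1_shift (fourier \<tau>) (\<eta> /\<^sub>R real (Suc m)) \<partial>lborel)
    \<longlonglongrightarrow> (\<integral>\<^sup>+\<eta>. (0::ennreal) \<partial>(lborel :: (real^'n) measure))"
  proof (rule nn_integral_dominated_convergence)
    show "(\<integral>\<^sup>+\<eta>. ennreal (norm (fourier h \<eta>)) * (2 * FL1 \<tau>) \<partial>lborel) < \<infinity>"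
      using h(3) schwartz_FL1[OF \<tau>]
      by (subst nn_integral_multc) (auto simp: FL1_def[symmetric] ennreal_mult_less_top)
    show "AE \<eta> in lborel. ennreal (norm (fourier h \<eta>)) * L1_shift (fourier \<tau>) (\<eta> /\<^sub>R real (Suc m)) \<le> ennreal (norm (fourier h \<eta>)) * (2 * FL1 \<tau>)" for m
      by (intro AE_I2 mult_left_mono bd) simp
    show "AE \<eta> in lborel. (\<lambda>m. ennreal (norm (fourier h \<eta>)) * L1_shift (fourier \<tau>) (\<eta> /\<^sub>R real (Suc m))) \<longlonglongrightarrow> 0"
    proof (intro AE_I2)
      fix \<eta> :: "real^'n"
      have "(\<lambda>m. ennreal (norm (fourier h \<eta>)) * L1_shift (fourier \<tau>) (\<eta> /\<^sub>R real (Suc m))) \<longlonglongrightarrow> ennreal (norm (fourier h \<eta>)) * 0"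
        by (intro ennreal_tendsto_cmult L1_shift_tendsto[OF \<tau>]) simp
      then show "(\<lambda>m. ennreal (norm (fourier h \<eta>)) * L1_shift (fourier \<tau>) (\<eta> /\<^sub>R real (Suc m))) \<longlonglongrightarrow> 0" by simp
    qed
  qed measurable
  then have lim: "(\<lambda>m. \<integral>\<^sup>+\<eta>. ennreal (norm (fourier h \<eta>)) * L1_shift (fourier \<tau>) (\<eta> /\<^sub>R real (Suc m)) \<partial>lborel) \<longlonglongrightarrow> 0" by simp
  show ?thesis
    by (rule tendsto_sandwich[OF _ _ tendsto_const lim])
      (auto intro!: always_eventually FL1_local_le[OF h \<tau>])
qed

section \<open>Real analytic functions\<close>

text \<open>Summability at the corner \<open>(\<sigma> + \<rho>, \<upsilon> + \<rho>)\<close> of a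
  closed square dominates the series on the whole square.\<close>

lemma real_analytic2_local:
  assumes "real_analytic2 F"
  obtains \<rho> a where "0 < \<rho>" "(\<lambda>i. norm (a (fst i) (snd i)) * \<rho> ^ fst i * \<rho> ^ snd i) summable_on UNIV"
    "\<And>s t. \<bar>s - \<sigma>\<bar> \<le> \<rho> \<Longrightarrow> \<bar>t - \<upsilon>\<bar> \<le> \<rho> \<Longrightarrow> F s t = pseries a (of_real (s - \<sigma>)) (of_real (t - \<upsilon>))"
proof -
  from assms have "\<exists>U a. open U \<and> (\<sigma>, \<upsilon>) \<in> U \<and>
      (\<forall>(s, t)\<in>U. (\<lambda>(j, k). norm (a j k * of_real (s - \<sigma>) ^ j * of_real (t - \<upsilon>) ^ k))
             summable_on (UNIV :: (nat \<times> nat) set) \<and>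
           F s t = (\<Sum>\<^sub>\<infinity>(j, k). a j k * of_real (s - \<sigma>) ^ j * of_real (t - \<upsilon>) ^ k))"
    unfolding real_analytic2_def by blast
  then obtain U a where U: "open U" "(\<sigma>, \<upsilon>) \<in> U"
    and all: "\<forall>(s, t)\<in>U. (\<lambda>(j, k). norm (a j k * of_real (s - \<sigma>) ^ j * of_real (t - \<upsilon>) ^ k))
             summable_on (UNIV :: (nat \<times> nat) set) \<and>
           F s t = (\<Sum>\<^sub>\<infinity>(j, k). a j k * of_real (s - \<sigma>) ^ j * of_real (t - \<upsilon>) ^ k)"
    by (elim exE conjE)
  have sm: "(\<lambda>(j, k). norm (a j k * of_real (s - \<sigma>) ^ j * of_real (t - \<upsilon>) ^ k)) summable_on UNIV"
    and eq: "F s t = (\<Sum>\<^sub>\<infinity>(j, k). a j k * of_real (s - \<sigma>) ^ j * of_real (t - \<upsilon>) ^ k)"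
    if "(s, t) \<in> U" for s t
    using bspec[OF all that] by simp_all
  obtain e where e: "0 < e" "ball (\<sigma>, \<upsilon>) e \<subseteq> U" using U openE by blast
  \<comment> \<open>\<open>2 * \<rho> < e\<close> places the closed square of half side
    \<open>\<rho>\<close> inside the ball.\<close>
  define \<rho> where "\<rho> = e / 3"
  have \<rho>: "0 < \<rho>" using e by (simp add: \<rho>_def)
  have inU: "(s, t) \<in> U" if "\<bar>s - \<sigma>\<bar> \<le> \<rho>" "\<bar>t - \<upsilon>\<bar> \<le> \<rho>" for s t
  proof -
    have "dist (\<sigma>, \<upsilon>) (s, t) \<le> \<bar>s - \<sigma>\<bar> + \<bar>t - \<upsilon>\<bar>"
      unfolding dist_Pair_Pair using sqrt_sum_squares_le_sum_abs[of "dist \<sigma> s" "dist \<upsilon> t"]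
      by (simp add: dist_real_def abs_minus_commute)
    also have "\<dots> < e" using that e by (simp add: \<rho>_def)
    finally show ?thesis using e(2) by auto
  qed
  show thesis
  proof (rule that[OF \<rho>])
    have "(\<lambda>i. norm (a (fst i) (snd i) * of_real ((\<sigma> + \<rho>) - \<sigma>) ^ fst i * of_real ((\<upsilon> + \<rho>) - \<upsilon>) ^ snd i)) summable_on UNIV"
      using sm[OF inU[of "\<sigma> + \<rho>" "\<upsilon> + \<rho>"]] \<rho> by (simp add: case_prod_unfold)
    then show "(\<lambda>i. norm (a (fst i) (snd i)) * \<rho> ^ fst i * \<rho> ^ snd i) summable_on UNIV"
      using \<rho> by (simp add: norm_mult norm_power)
    show "F s t = pseries a (of_real (s - \<sigma>)) (of_real (t - \<upsilon>))" if "\<bar>s - \<sigma>\<bar> \<le> \<rho>" "\<bar>t - \<upsilon>\<bar> \<le> \<rho>" for s t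
      using eq[OF inU[OF that]] by (simp add: pseries_def case_prod_unfold)
  qed
qed

lemma real_analytic2_continuous:
  assumes F: "real_analytic2 F"
  shows "continuous_on UNIV (\<lambda>z. F (fst z) (snd z))"
proof -
  have "isCont (\<lambda>z. F (fst z) (snd z)) z0" for z0 :: "real \<times> real"
  proof -
    obtain \<rho> a where \<rho>: "0 < \<rho>" and sm: "(\<lambda>i. norm (a (fst i) (snd i)) * \<rho> ^ fst i * \<rho> ^ snd i) summable_on UNIV"
      and eq: "\<And>s t. \<bar>s - fst z0\<bar> \<le> \<rho> \<Longrightarrow> \<bar>t - snd z0\<bar> \<le> \<rho> \<Longrightarrow>
        F s t = pseries a (of_real (s - fst z0)) (of_real (t - snd z0))"
      by (rule real_analytic2_local[OF F, where \<sigma> = "fst z0" and \<upsilon> = "snd z0"]) (rule that)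
    define S where "S = {z :: real \<times> real. \<bar>fst z - fst z0\<bar> < \<rho>} \<inter> {z. \<bar>snd z - snd z0\<bar> < \<rho>}"
    have "open S" unfolding S_def by (intro open_Int open_Collect_less continuous_intros)
    have "continuous_on S (\<lambda>z. pseries a (of_real (fst z - fst z0)) (of_real (snd z - snd z0)))"
      by (rule pseries_continuous[OF sm]) (auto simp: S_def simp flip: of_real_diff intro!: continuous_intros)
    then have "continuous_on S (\<lambda>z. F (fst z) (snd z))"
      by (rule continuous_on_eq) (auto simp: S_def eq)
    then show ?thesis
      using \<open>open S\<close> \<rho> by (auto simp: continuous_on_eq_continuous_at S_def)
  qed
  then show ?thesis by (simp add: continuous_on_eq_continuous_at)
qed

lemma operate_continuous_bounded:
  fixes f :: "real^'n::finite \<Rightarrow> complex"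
  assumes F: "real_analytic2 F" and f: "continuous_on UNIV f" "\<And>t. norm (f t) \<le> B"
  obtains B' where "continuous_on UNIV (operate F f)" "\<And>t. norm (operate F f t) \<le> B'"
proof -
  note cF = real_analytic2_continuous[OF F]
  have "continuous_on UNIV (\<lambda>t. (\<lambda>z. F (fst z) (snd z)) (Re (f t), Im (f t)))"
    by (rule continuous_on_compose2[OF cF]) (auto intro!: continuous_intros f)
  then have c: "continuous_on UNIV (operate F f)" by (simp add: operate_def[abs_def])
  have "compact ({- B..B} \<times> {- B..B})" by (intro compact_Times compact_Icc)
  then have "bounded ((\<lambda>z. F (fst z) (snd z)) ` ({- B..B} \<times> {- B..B}))"
    by (intro compact_imp_bounded compact_continuous_image continuous_on_subset[OF cF]) auto
  then obtain B' where B': "\<forall>y\<in>(\<lambda>z. F (fst z) (snd z)) ` ({- B..B} \<times> {- B..B}). norm y \<le> B'"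
    unfolding bounded_iff by blast
  have "norm (operate F f t) \<le> B'" for t
  proof -
    have "\<bar>Re (f t)\<bar> \<le> B" "\<bar>Im (f t)\<bar> \<le> B"
      using abs_Re_le_cmod[of "f t"] abs_Im_le_cmod[of "f t"] f(2)[of t] by linarith+
    then have "(Re (f t), Im (f t)) \<in> {- B..B} \<times> {- B..B}" by auto
    then show ?thesis using B' unfolding operate_def by fastforce
  qed
  with c show thesis by (rule that)
qed

text \<open>The transform of a product with a window is computed locally: wherever the window does not
  vanish, \<open>F(f)\<close> is a power series in a small function.\<close>

lemma FL1_operate_local:
  fixes f u K :: "real^'n::finite \<Rightarrow> complex"
  assumes sm: "(\<lambda>i. norm (a (fst i) (snd i)) * \<rho> ^ fst i * \<rho> ^ snd i) summable_on UNIV"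
    and eq: "\<And>s t. \<bar>s - s0\<bar> \<le> \<rho> \<Longrightarrow> \<bar>t - t0\<bar> \<le> \<rho> \<Longrightarrow> F s t = pseries a (of_real (s - s0)) (of_real (t - t0))"
    and u: "continuous_on UNIV u" "integrable lborel u" "FL1 u \<le> ennreal r" and r: "0 \<le> r" "r \<le> \<rho>"
    and K: "integrable lborel K"
    and loc: "\<And>t. K t \<noteq> 0 \<Longrightarrow> u t = f t - Complex s0 t0"
  shows "FL1 (\<lambda>t. operate F f t * K t) \<le> ennreal (\<Sum>\<^sub>\<infinity>i. norm (a (fst i) (snd i)) * r ^ fst i * r ^ snd i) * FL1 K"
proof -
  \<comment> \<open>The Fourier algebra norm bounds the supremum, so \<open>u\<close> stays in the
    domain of the expansion everywhere, also where \<open>K\<close> vanishes.\<close>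
  have bd: "norm (Re_part u t) \<le> \<rho>" "norm (Im_part u t) \<le> \<rho>" for t
  proof -
    have "ennreal (norm (u t)) \<le> ennreal r" using norm_le_FL1[OF u(1,2), of t] u(3) by (rule order_trans)
    then have "norm (u t) \<le> \<rho>" using r by (simp add: ennreal_le_iff)
    then show "norm (Re_part u t) \<le> \<rho>" "norm (Im_part u t) \<le> \<rho>"
      using abs_Re_le_cmod[of "u t"] abs_Im_le_cmod[of "u t"] by (simp_all add: Re_part_def Im_part_def)
  qed
  have c: "continuous_on UNIV (Re_part u)" "continuous_on UNIV (Im_part u)"
    unfolding Re_part_def Im_part_def by (intro continuous_intros u)+
  note i = FL1_Re_Im_part[OF u(2)]
  have le: "FL1 (Re_part u) \<le> ennreal r" "FL1 (Im_part u) \<le> ennreal r"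
    using order_trans[OF i(3) u(3)] order_trans[OF i(4) u(3)] .
  have fin: "FL1 (Re_part u) < top" "FL1 (Im_part u) < top"
    using le_less_trans[OF le(1)] le_less_trans[OF le(2)] by simp_all
  have pw: "operate F f t * K t = pseries a (Re_part u t) (Im_part u t) * K t" for t
  proof (cases "K t = 0")
    case False
    from loc[OF this] have s: "Re (u t) = Re (f t) - s0" "Im (u t) = Im (f t) - t0" by simp_all
    have "operate F f t = pseries a (of_real (Re (f t) - s0)) (of_real (Im (f t) - t0))"
      unfolding operate_def using bd[of t]
      by (intro eq) (simp_all add: Re_part_def Im_part_def flip: s)
    then show ?thesis by (simp add: Re_part_def Im_part_def s)
  qed simp
  have smr: "(\<lambda>i. norm (a (fst i) (snd i)) * r ^ fst i * r ^ snd i) summable_on UNIV"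
    by (rule summable_on_comparison_test[OF sm]) (use r in \<open>auto intro!: mult_mono power_mono\<close>)
  have "FL1 (\<lambda>t. operate F f t * K t)
    \<le> (\<integral>\<^sup>+i. ennreal (norm (a (fst i) (snd i))) * (FL1 (Re_part u) ^ fst i * FL1 (Im_part u) ^ snd i) \<partial>count_space UNIV) * FL1 K"
    unfolding pw by (rule FL1_pseries_le[OF sm c(1) i(1) fin(1) bd(1) c(2) i(2) fin(2) bd(2) K])
  also have "(\<integral>\<^sup>+i. ennreal (norm (a (fst i) (snd i))) * (FL1 (Re_part u) ^ fst i * FL1 (Im_part u) ^ snd i) \<partial>count_space UNIV)
    \<le> (\<integral>\<^sup>+i. ennreal (norm (a (fst i) (snd i)) * r ^ fst i * r ^ snd i) \<partial>count_space UNIV)"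
  proof (rule nn_integral_mono)
    fix i :: "nat \<times> nat"
    have "FL1 (Re_part u) ^ fst i * FL1 (Im_part u) ^ snd i \<le> ennreal r ^ fst i * ennreal r ^ snd i"
      by (intro mult_mono power_mono le) auto
    also have "\<dots> = ennreal (r ^ fst i * r ^ snd i)" using r by (simp add: ennreal_power ennreal_mult)
    finally show "ennreal (norm (a (fst i) (snd i))) * (FL1 (Re_part u) ^ fst i * FL1 (Im_part u) ^ snd i)
      \<le> ennreal (norm (a (fst i) (snd i)) * r ^ fst i * r ^ snd i)"
      using r by (simp add: mult.assoc ennreal_mult mult_left_mono)
  qed
  also have "\<dots> = ennreal (\<Sum>\<^sub>\<infinity>i. norm (a (fst i) (snd i)) * r ^ fst i * r ^ snd i)"
    using r by (intro nn_integral_count_space_infsum smr) auto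
  finally show ?thesis by (simp add: mult_right_mono)
qed

text \<open>Without constant term every monomial contains a factor \<open>r\<close>. With
  \<open>r\<close> the local norm of \<open>f\<close>, this makes the bound for the local norm of
  \<open>F(f)\<close> integrable over the positions.\<close>

lemma infsum_power_linear_bound:
  assumes sm: "(\<lambda>i. norm (a (fst i) (snd i)) * \<rho> ^ fst i * \<rho> ^ snd i) summable_on UNIV" and a0: "a 0 0 = 0"
    and r: "0 \<le> r" "r \<le> \<rho>" "0 < \<rho>"
  shows "(\<Sum>\<^sub>\<infinity>i. norm (a (fst i) (snd i)) * r ^ fst i * r ^ snd i)
    \<le> (\<Sum>\<^sub>\<infinity>i. norm (a (fst i) (snd i)) * \<rho> ^ fst i * \<rho> ^ snd i) * (r / \<rho>)"
proof -
  have smr: "(\<lambda>i. norm (a (fst i) (snd i)) * r ^ fst i * r ^ snd i) summable_on UNIV"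
    by (rule summable_on_comparison_test[OF sm]) (use r in \<open>auto intro!: mult_mono power_mono\<close>)
  have le: "norm (a (fst i) (snd i)) * r ^ fst i * r ^ snd i \<le> norm (a (fst i) (snd i)) * \<rho> ^ fst i * \<rho> ^ snd i * (r / \<rho>)" for i
  proof (cases "fst i + snd i")
    case 0
    then show ?thesis using a0 by simp
  next
    case (Suc n)
    define q where "q = r / \<rho>"
    have q: "0 \<le> q" "q \<le> 1" "r = q * \<rho>" using r by (auto simp: q_def)
    have "r ^ fst i * r ^ snd i = q ^ Suc n * \<rho> ^ Suc n"
      unfolding power_add[symmetric] Suc q(3) by (rule power_mult_distrib)
    also have "\<dots> \<le> q * \<rho> ^ Suc n"
      using q r by (intro mult_right_mono) (auto simp: mult_left_le power_le_one)
    also have "\<dots> = \<rho> ^ fst i * \<rho> ^ snd i * q" unfolding power_add[symmetric] Suc by simp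
    finally show ?thesis unfolding q_def[symmetric] mult.assoc by (rule mult_left_mono) simp
  qed
  have "(\<Sum>\<^sub>\<infinity>i. norm (a (fst i) (snd i)) * r ^ fst i * r ^ snd i)
    \<le> (\<Sum>\<^sub>\<infinity>i. norm (a (fst i) (snd i)) * \<rho> ^ fst i * \<rho> ^ snd i * (r / \<rho>))"
    by (rule infsum_mono[OF smr summable_on_cmult_left[OF sm] le])
  also have "\<dots> = (\<Sum>\<^sub>\<infinity>i. norm (a (fst i) (snd i)) * \<rho> ^ fst i * \<rho> ^ snd i) * (r / \<rho>)"
    by (rule infsum_cmult_left')
  finally show ?thesis .
qed

section \<open>Local Fourier algebra norms as functions of the position\<close>

definition FL1_window :: "(real^'n::finite \<Rightarrow> complex) \<Rightarrow> (real^'n \<Rightarrow> complex) \<Rightarrow> real^'n \<Rightarrow> ennreal" where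
  "FL1_window g f x = FL1 (\<lambda>t. f t * cnj (g (t - x)))"

lemma FL1_window_eq: "FL1_window g f x = (\<integral>\<^sup>+w. STFT_abs g f x w \<partial>lborel)"
  by (simp add: FL1_window_def FL1_def STFT_abs_def STFT_def)

lemma FL1_window_measurable:
  fixes g :: "real^'n::finite \<Rightarrow> complex"
  assumes "admissible f" "g \<in> schwartz"
  shows "FL1_window g f \<in> borel_measurable borel"
proof -
  have "(\<lambda>(x, w). STFT_abs g f x w) \<in> borel_measurable (borel \<Otimes>\<^sub>M lborel)"
    using STFT_abs_measurable'[OF assms, of fst _ snd] by (simp add: case_prod_unfold)
  then show ?thesis unfolding FL1_window_eq[abs_def] by (rule lborel.borel_measurable_nn_integral)
qed

text \<open>With both exponents 1 and no weight the order of integration may be exchanged, so the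
  frequency is integrated first.\<close>

lemma wnorm_eq_FL1_window:
  fixes g :: "real^'n::finite \<Rightarrow> complex"
  assumes f: "admissible f" and g: "g \<in> schwartz"
  shows "wnorm 1 0 (STFT_Lp g 1 f) = (\<integral>\<^sup>+x. FL1_window g f x \<partial>lborel)"
proof -
  note [measurable] = STFT_abs_measurable'[OF f g]
  show ?thesis
    unfolding wnorm_def STFT_Lp_def Lp_norm_1 FL1_window_eq by (simp, rule lborel_pair.Fubini') measurable
qed

text \<open>After a change of window the local norm is dominated by the convolution of the
  integrable \<open>FL1_window g f\<close> with a bounded kernel vanishing at infinity, and such a
  convolution tends to 0.\<close>

lemma FL1_window_decay:
  fixes g \<gamma> :: "real^'n::finite \<Rightarrow> complex"
  assumes g: "g \<in> schwartz" and nz: "g \<noteq> (\<lambda>t. 0)" and \<gamma>: "\<gamma> \<in> schwartz"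
    and f: "admissible f" and fin: "(\<integral>\<^sup>+x. FL1_window g f x \<partial>lborel) < top" and \<epsilon>: "0 < \<epsilon>"
  obtains R where "\<And>x. R \<le> norm x \<Longrightarrow> FL1_window \<gamma> f x < \<epsilon>"
proof -
  define a where "a = real CARD('n)"
  define m where "m = CARD('n)"
  have a: "0 \<le> a" "1 \<le> a" by (simp_all add: a_def Suc_leI)
  obtain C where C: "0 \<le> C"
    "\<And>f y v. admissible f \<Longrightarrow> STFT_abs \<gamma> f y v
       \<le> (\<integral>\<^sup>+\<eta>. ennreal C * ennreal (jb (- real m) \<eta>) * nn_conv (\<lambda>x. STFT_abs g f x (v - \<eta>)) (\<lambda>z. ennreal (jb (- a) z)) y \<partial>lborel)"
    by (rule window_change_pointwise[OF g \<gamma> nz a(1), where m = m]) (rule that)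
  note [measurable] = STFT_abs_measurable'[OF f g] FL1_window_measurable[OF f g]
  define J where "J = (\<lambda>z :: real^'n. ennreal (jb (- a) z))"
  have [measurable]: "J \<in> borel_measurable borel" unfolding J_def by measurable
  define K where "K = (\<integral>\<^sup>+\<eta>. ennreal (jb (- real m) (\<eta> :: real^'n)) \<partial>lborel)"
  have K: "K < top" unfolding K_def by (intro nn_integral_jb_finite) (simp add: m_def)
  have le: "FL1_window \<gamma> f y \<le> ennreal C * K * nn_conv J (FL1_window g f) y" for y
  proof -
    have "FL1_window \<gamma> f y \<le> (\<integral>\<^sup>+v. \<integral>\<^sup>+\<eta>. ennreal C * ennreal (jb (- real m) \<eta>) * nn_conv (\<lambda>x. STFT_abs g f x (v - \<eta>)) J y \<partial>lborel \<partial>lborel)"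
      unfolding FL1_window_eq J_def by (intro nn_integral_mono C(2) f)
    also have "\<dots> = (\<integral>\<^sup>+\<eta>. \<integral>\<^sup>+v. ennreal C * ennreal (jb (- real m) \<eta>) * nn_conv (\<lambda>x. STFT_abs g f x (v - \<eta>)) J y \<partial>lborel \<partial>lborel)"
      unfolding nn_conv_def by (rule lborel_pair.Fubini'[symmetric]) measurable
    also have "\<dots> = (\<integral>\<^sup>+\<eta>. ennreal C * ennreal (jb (- real m) (\<eta> :: real^'n)) * nn_conv (FL1_window g f) J y \<partial>lborel)"
    proof (rule nn_integral_cong)
      fix \<eta> :: "real^'n"
      have "(\<integral>\<^sup>+v. nn_conv (\<lambda>x. STFT_abs g f x (v - \<eta>)) J y \<partial>lborel) = (\<integral>\<^sup>+z. \<integral>\<^sup>+v. STFT_abs g f (y - z) (v - \<eta>) * J z \<partial>lborel \<partial>lborel)"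
        unfolding nn_conv_def by (rule lborel_pair.Fubini'[symmetric]) measurable
      also have "\<dots> = (\<integral>\<^sup>+z. FL1_window g f (y - z) * J z \<partial>lborel)"
        unfolding FL1_window_eq
        by (intro nn_integral_cong)
          (simp add: nn_integral_multc nn_integral_lborel_translate[where h = "\<lambda>v. STFT_abs g f _ v"])
      finally have "(\<integral>\<^sup>+v. nn_conv (\<lambda>x. STFT_abs g f x (v - \<eta>)) J y \<partial>lborel) = nn_conv (FL1_window g f) J y" by (simp add: nn_conv_def)
      moreover have "(\<lambda>v. nn_conv (\<lambda>x. STFT_abs g f x (v - \<eta>)) J y) \<in> borel_measurable lborel" unfolding nn_conv_def by measurable
      ultimately show "(\<integral>\<^sup>+v. ennreal C * ennreal (jb (- real m) \<eta>) * nn_conv (\<lambda>x. STFT_abs g f x (v - \<eta>)) J y \<partial>lborel)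
        = ennreal C * ennreal (jb (- real m) \<eta>) * nn_conv (FL1_window g f) J y"
        by (simp add: nn_integral_cmult)
    qed
    also have "\<dots> = ennreal C * K * nn_conv (FL1_window g f) J y"
      unfolding K_def by (simp add: nn_integral_multc nn_integral_cmult)
    also have "nn_conv (FL1_window g f) J y = nn_conv J (FL1_window g f) y" by (rule nn_conv_commute) measurable
    finally show ?thesis .
  qed
  show thesis
  proof (rule ccontr)
    assume "\<not> thesis"
    then have "\<exists>x. R \<le> norm x \<and> \<not> FL1_window \<gamma> f x < \<epsilon>" for R using that by blast
    \<comment> \<open>A sequence of counterexamples tending to infinity reduces the claim to
      sequential dominated convergence.\<close>
    then have "\<forall>k::nat. \<exists>x. real k \<le> norm x \<and> \<epsilon> \<le> FL1_window \<gamma> f x" by (simp add: not_less)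
    from choice[OF this] obtain y where y: "\<And>k. real k \<le> norm (y k)" "\<And>k. \<epsilon> \<le> FL1_window \<gamma> f (y k)" by blast
    have "(\<lambda>k. \<integral>\<^sup>+x. J (y k - x) * FL1_window g f x \<partial>lborel) \<longlonglongrightarrow> (\<integral>\<^sup>+x. 0 \<partial>(lborel :: (real^'n) measure))"
    proof (rule nn_integral_dominated_convergence)
      show "(\<integral>\<^sup>+x. FL1_window g f x \<partial>lborel) < \<infinity>" using fin by simp
      have "J z \<le> 1" for z using ennreal_leI[OF jb_le_1[of "- a" z]] a by (simp add: J_def)
      then have "J (y k - x) * FL1_window g f x \<le> 1 * FL1_window g f x" for k x by (intro mult_right_mono) auto
      then show "AE x in lborel. J (y k - x) * FL1_window g f x \<le> FL1_window g f x" for k by simp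
      have "(\<integral>\<^sup>+x. FL1_window g f x \<partial>lborel) \<noteq> \<infinity>" using fin by simp
      then have "AE x in lborel. FL1_window g f x \<noteq> \<infinity>" by (intro nn_integral_PInf_AE) measurable
      then show "AE x in lborel. (\<lambda>k. J (y k - x) * FL1_window g f x) \<longlonglongrightarrow> 0"
      proof eventually_elim
        case (elim x)
        have "filterlim (\<lambda>k. - norm x + real k) at_top sequentially"
          by (intro filterlim_tendsto_add_at_top[OF tendsto_const] filterlim_real_sequentially)
        then have "filterlim (\<lambda>k. norm (y k - x)) at_top sequentially"
        proof (rule filterlim_at_top_mono)
          have "- norm x + real k \<le> norm (y k - x)" for k
            using y(1)[of k] norm_triangle_ineq2[of "y k" x] by linarith
          then show "\<forall>\<^sub>F k in sequentially. - norm x + real k \<le> norm (y k - x)" by simp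
        qed
        then have inv: "(\<lambda>k. inverse (norm (y k - x))) \<longlonglongrightarrow> 0" by (rule tendsto_inverse_0_at_top)
        have "(\<lambda>k. jb (- a) (y k - x)) \<longlonglongrightarrow> 0"
        proof (rule tendsto_sandwich[OF _ _ tendsto_const inv])
          show "\<forall>\<^sub>F k in sequentially. jb (- a) (y k - x) \<le> inverse (norm (y k - x))"
            using filterlim_at_top_dense[THEN iffD1, OF \<open>filterlim (\<lambda>k. norm (y k - x)) at_top sequentially\<close>, rule_format, of 1]
          proof eventually_elim
            case (elim k)
            have "jb (- a) (y k - x) \<le> jb (- 1) (y k - x)" using a by (intro jb_mono) simp
            also have "\<dots> = inverse (1 + (norm (y k - x))\<^sup>2)"
              unfolding jb_def by (simp add: powr_minus powr_one add_nonneg_nonneg)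
            also have "\<dots> \<le> inverse (norm (y k - x))"
            proof (rule le_imp_inverse_le)
              have "norm (y k - x) * 1 \<le> norm (y k - x) * norm (y k - x)" using elim by (intro mult_left_mono) auto
              then show "norm (y k - x) \<le> 1 + (norm (y k - x))\<^sup>2" by (simp add: power2_eq_square)
            qed (use elim in linarith)
            finally show ?case .
          qed
        qed simp
        then have "(\<lambda>k. J (y k - x)) \<longlonglongrightarrow> ennreal 0" unfolding J_def by (rule tendsto_ennrealI)
        then have "(\<lambda>k. FL1_window g f x * J (y k - x)) \<longlonglongrightarrow> FL1_window g f x * ennreal 0"
          using elim by (intro ennreal_tendsto_cmult) (auto simp: less_top)
        then show ?case by (simp add: mult.commute)
      qed
    qed measurable
    then have "(\<lambda>k. nn_conv J (FL1_window g f) (y k)) \<longlonglongrightarrow> 0" by (simp add: nn_conv_def)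
    then have "(\<lambda>k. ennreal C * K * nn_conv J (FL1_window g f) (y k)) \<longlonglongrightarrow> ennreal C * K * 0"
      using K by (intro ennreal_tendsto_cmult) (auto simp: ennreal_mult_less_top)
    then have "\<forall>\<^sub>F k in sequentially. ennreal C * K * nn_conv J (FL1_window g f) (y k) < \<epsilon>"
      using \<epsilon> by (intro order_tendstoD(2)) auto
    then obtain k where "ennreal C * K * nn_conv J (FL1_window g f) (y k) < \<epsilon>"
      by (auto simp: eventually_sequentially)
    then show False using le[of "y k"] y(2)[of k] by (simp add: not_less[symmetric])
  qed
qed

theorem real_analytic_on_Feichtinger_algebra:
  fixes g :: "real^'n::finite \<Rightarrow> complex"
  assumes g: "g \<in> schwartz" and nz: "g \<noteq> (\<lambda>t. 0)"
    and F: "real_analytic2 F" "F 0 0 = 0" and f: "f \<in> modulation_functions g 1 1 0"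
  shows "operate F f \<in> modulation_functions g 1 1 0"
proof -
  have fa: "admissible f" and fw: "wnorm 1 0 (STFT_Lp g 1 f) < top" using f by (auto simp: modulation_functions_iff)
  have fc: "continuous_on UNIV f" using fa by (simp add: admissible_def)
  have one: "1 \<le> (1::ennreal)" by simp
  have emb: "(\<integral>\<^sup>+w. b w \<partial>lborel) \<le> 1 * wnorm 1 0 b" for b :: "real^'n \<Rightarrow> ennreal"
    by (simp add: wnorm_def Lp_norm_1)
  have t1: "(1::ennreal) < top" by simp
  obtain Cb where Cb: "Cb < top" "\<And>f t. admissible f \<Longrightarrow> ennreal (norm (f t)) \<le> Cb * wnorm 1 0 (STFT_Lp g 1 f)"
    by (rule norm_le_wnorm[OF g nz one t1 emb]) (rule that)
  define B where "B = enn2real (Cb * wnorm 1 0 (STFT_Lp g 1 f))"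
  have fb: "norm (f t) \<le> B" for t
  proof -
    have "Cb * wnorm 1 0 (STFT_Lp g 1 f) < top" using Cb(1) fw by (simp add: ennreal_mult_less_top)
    then have "ennreal (norm (f t)) \<le> ennreal B" using Cb(2)[OF fa, of t] by (simp add: B_def)
    then show ?thesis by (subst (asm) ennreal_le_iff) (auto simp: B_def)
  qed
  obtain B' where op: "continuous_on UNIV (operate F f)" "\<And>t. norm (operate F f t) \<le> B'"
    by (rule operate_continuous_bounded[OF F(1) fc fb]) (rule that)
  have opa: "admissible (operate F f)" by (rule admissible_bounded[OF op])
  obtain \<tau> :: "real^'n \<Rightarrow> complex" and R0 where \<tau>: "\<tau> \<in> schwartz" "\<And>t. cnj (\<tau> t) = \<tau> t"
    "\<And>t. norm t \<le> 1 \<Longrightarrow> \<tau> t = 1" "0 < R0" "\<And>t. R0 \<le> norm t \<Longrightarrow> \<tau> t = 0"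
    by (rule schwartz_plateau) (rule that)
  have Nfin: "(\<integral>\<^sup>+x. FL1_window g f x \<partial>lborel) < top" using fw wnorm_eq_FL1_window[OF fa g] by simp
  have Nint: "(\<integral>\<^sup>+x. FL1_window \<tau> f x \<partial>lborel) < top"
  proof -
    obtain C where C: "C < top" "\<And>f. admissible f \<Longrightarrow> wnorm 1 0 (STFT_Lp \<tau> 1 f) \<le> C * wnorm 1 0 (STFT_Lp g 1 f)"
      by (rule wnorm_window_change[OF g \<tau>(1) nz one one order_refl]) (rule that)
    have "C * wnorm 1 0 (STFT_Lp g 1 f) < top" using C(1) fw by (simp add: ennreal_mult_less_top)
    then show ?thesis using C(2)[OF fa] wnorm_eq_FL1_window[OF fa \<tau>(1)] by simp
  qed
  have Npt: "FL1_window \<tau> f x < top" for x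
  proof -
    obtain C where C: "C < top"
      "\<And>f x. admissible f \<Longrightarrow> FL1 (\<lambda>t. f t * cnj (\<tau> (t - x))) \<le> C * wnorm 1 0 (STFT_Lp g 1 f)"
      by (rule FL1_window_le[OF g \<tau>(1) nz one t1 emb]) (rule that)
    have "C * wnorm 1 0 (STFT_Lp g 1 f) < top" using C(1) fw by (simp add: ennreal_mult_less_top)
    then show ?thesis using le_less_trans[OF C(2)[OF fa, of x]] by (simp add: FL1_window_def)
  qed
  \<comment> \<open>Agrees with \<open>f\<close> on the unit ball about \<open>x\<close> and has
    Fourier algebra norm \<open>FL1_window \<tau> f x\<close>, which is small for large
    \<open>x\<close>.\<close>
  define loc where "loc x = (\<lambda>t. f t * cnj (\<tau> (t - x)))" for x
  have loc: "continuous_on UNIV (loc x)" "integrable lborel (loc x)" "FL1 (loc x) = FL1_window \<tau> f x" for x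
    unfolding loc_def using admissible_window[OF fa \<tau>(1), of x] by (auto simp: FL1_window_def)
  have loc_eq: "loc x t = f t" if "norm (t - x) \<le> 1" for x t
    using that \<tau>(2,3) by (simp add: loc_def)
  define K where "K \<gamma> x = (\<lambda>t. cnj (\<gamma> (t - x)))" for \<gamma> :: "real^'n \<Rightarrow> complex" and x
  have K: "integrable lborel (K \<gamma> x)" "FL1 (K \<gamma> x) = FL1 \<gamma>" if "\<gamma> \<in> schwartz" for \<gamma> x
  proof -
    note [measurable] = schwartz_measurable[OF that]
    show "integrable lborel (K \<gamma> x)"
      unfolding K_def by (intro schwartz_integrable schwartz_cnj schwartz_translate that)
    show "FL1 (K \<gamma> x) = FL1 \<gamma>"
      unfolding K_def using FL1_translate[of "\<lambda>t. cnj (\<gamma> t)" x] FL1_cnj[of \<gamma>] by simp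
  qed

  obtain \<rho> a where \<rho>: "0 < \<rho>" and sm: "(\<lambda>i. norm (a (fst i) (snd i)) * \<rho> ^ fst i * \<rho> ^ snd i) summable_on UNIV"
    and eq: "\<And>s t. \<bar>s - 0\<bar> \<le> \<rho> \<Longrightarrow> \<bar>t - 0\<bar> \<le> \<rho> \<Longrightarrow> F s t = pseries a (of_real (s - 0)) (of_real (t - 0))"
    by (rule real_analytic2_local[OF F(1), where \<sigma> = 0 and \<upsilon> = 0]) (rule that)
  have a0: "a 0 0 = 0" using eq[of 0 0] F(2) \<rho> by (simp add: pseries_0)
  obtain R where R: "\<And>x. R \<le> norm x \<Longrightarrow> FL1_window \<tau> f x < ennreal \<rho>"
    by (rule FL1_window_decay[OF g nz \<tau>(1) fa Nfin]) (use \<rho> that in auto)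
  define M0 where "M0 = (\<Sum>\<^sub>\<infinity>i. norm (a (fst i) (snd i)) * \<rho> ^ fst i * \<rho> ^ snd i)"
  have M0: "0 \<le> M0" unfolding M0_def using \<rho> by (intro infsum_nonneg) auto
  \<comment> \<open>For large \<open>x\<close> the function \<open>loc x\<close> is small enough for
    the expansion at 0. The factor \<open>FL1_window \<tau> f x\<close>, due to the missing constant
    term, is what can be integrated over \<open>x\<close>.\<close>
  have far: "FL1 (\<lambda>t. operate F f t * K \<gamma> x t) \<le> ennreal (M0 / \<rho>) * FL1 \<gamma> * FL1_window \<tau> f x"
    if \<gamma>: "\<gamma> \<in> schwartz" and supp: "\<And>t. 1 \<le> norm t \<Longrightarrow> \<gamma> t = 0" and x: "R \<le> norm x" for \<gamma> x
  proof -
    define r where "r = enn2real (FL1_window \<tau> f x)"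
    have r: "0 \<le> r" "FL1_window \<tau> f x = ennreal r" using Npt[of x] by (auto simp: r_def)
    then have r\<rho>: "r \<le> \<rho>" using R[OF x] \<rho> by (simp add: ennreal_less_iff)
    have "FL1 (\<lambda>t. operate F f t * K \<gamma> x t)
      \<le> ennreal (\<Sum>\<^sub>\<infinity>i. norm (a (fst i) (snd i)) * r ^ fst i * r ^ snd i) * FL1 (K \<gamma> x)"
    proof (rule FL1_operate_local[OF sm eq loc(1,2) _ r(1) r\<rho> K(1)[OF \<gamma>]])
      show "FL1 (loc x) \<le> ennreal r" using loc(3) r by simp
      show "loc x t = f t - Complex 0 0" if "K \<gamma> x t \<noteq> 0" for t
      proof -
        have "norm (t - x) < 1" using that supp[of "t - x"] by (auto simp: K_def not_le[symmetric])
        then show ?thesis using loc_eq[of t x] by (simp add: Complex_eq_0)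
      qed
    qed
    also have "\<dots> \<le> ennreal (M0 * (r / \<rho>)) * FL1 (K \<gamma> x)"
      unfolding M0_def by (intro mult_right_mono ennreal_leI infsum_power_linear_bound[OF sm a0 r(1) r\<rho> \<rho>]) simp
    also have "\<dots> = ennreal (M0 / \<rho>) * FL1 \<gamma> * FL1_window \<tau> f x"
    proof -
      have "ennreal (M0 * (r / \<rho>)) = ennreal (M0 / \<rho>) * ennreal r"
        using M0 \<rho> r(1) by (simp add: ennreal_mult[symmetric])
      then show ?thesis unfolding K(2)[OF \<gamma>] r(2) by (simp only: mult.assoc mult.commute[of "ennreal r"])
    qed
    finally show ?thesis .
  qed

  \<comment> \<open>On a bounded region a bound independent of \<open>x\<close> suffices. Radius and
    constant must not depend on the window, which is chosen only after the covering
    argument.\<close>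
  have near: "\<exists>\<delta>>0. \<exists>M\<ge>0. \<forall>\<gamma> x. \<gamma> \<in> schwartz \<longrightarrow> (\<forall>t. \<delta> \<le> norm t \<longrightarrow> \<gamma> t = 0) \<longrightarrow> norm (x - x0) < \<delta> \<longrightarrow>
      FL1 (\<lambda>t. operate F f t * K \<gamma> x t) \<le> ennreal M * FL1 \<gamma>" for x0
  proof -
    obtain \<rho> a where \<rho>: "0 < \<rho>" and sm: "(\<lambda>i. norm (a (fst i) (snd i)) * \<rho> ^ fst i * \<rho> ^ snd i) summable_on UNIV"
      and eq: "\<And>s t. \<bar>s - Re (f x0)\<bar> \<le> \<rho> \<Longrightarrow> \<bar>t - Im (f x0)\<bar> \<le> \<rho> \<Longrightarrow>
        F s t = pseries a (of_real (s - Re (f x0))) (of_real (t - Im (f x0)))"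
      by (rule real_analytic2_local[OF F(1), where \<sigma> = "Re (f x0)" and \<upsilon> = "Im (f x0)"]) (rule that)
    have "(\<lambda>m. FL1 (\<lambda>t. (loc x0 t - loc x0 x0) * \<tau> (real (Suc m) *\<^sub>R (t - x0)))) \<longlonglongrightarrow> 0"
      by (intro FL1_local_tendsto loc \<tau>) (simp add: loc Npt)
    from order_tendstoD(2)[OF this, of "ennreal \<rho>"] \<rho>
    obtain m where m: "FL1 (\<lambda>t. (loc x0 t - loc x0 x0) * \<tau> (real (Suc m) *\<^sub>R (t - x0))) < ennreal \<rho>"
      by (auto simp: eventually_sequentially)
    define c where "c = real (Suc m)"
    have c: "1 \<le> c" by (simp add: c_def)
    define u where "u = (\<lambda>t. (loc x0 t - loc x0 x0) * \<tau> (c *\<^sub>R (t - x0)))"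
    have \<tau>c: "(\<lambda>t. \<tau> (c *\<^sub>R (t - x0))) \<in> schwartz"
      by (rule schwartz_translate[where f = "\<lambda>t. \<tau> (c *\<^sub>R t)"]) (rule schwartz_dilate[OF \<tau>(1) c])
    have uc: "continuous_on UNIV u"
      unfolding u_def by (intro continuous_intros loc schwartz_continuous[OF \<tau>c])
    have ui: "integrable lborel u"
    proof -
      have "integrable lborel (\<lambda>t. f t * (cnj (\<tau> (t - x0)) * \<tau> (c *\<^sub>R (t - x0))))"
        using fa schwartz_mult[OF schwartz_cnj[OF schwartz_translate[OF \<tau>(1)]] \<tau>c, of x0] by (auto simp: admissible_def)
      moreover have "integrable lborel (\<lambda>t. loc x0 x0 * \<tau> (c *\<^sub>R (t - x0)))"
        by (intro integrable_mult_right schwartz_integrable \<tau>c)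
      ultimately have "integrable lborel (\<lambda>t. f t * (cnj (\<tau> (t - x0)) * \<tau> (c *\<^sub>R (t - x0))) - loc x0 x0 * \<tau> (c *\<^sub>R (t - x0)))"
        by (rule Bochner_Integration.integrable_diff)
      then show ?thesis unfolding u_def loc_def by (simp add: left_diff_distrib mult.assoc)
    qed
    have ufl: "FL1 u \<le> ennreal \<rho>" using m by (simp add: u_def c_def)
    \<comment> \<open>If \<open>K \<gamma> x t\<close> does not vanish, \<open>t\<close> is within
      \<open>2 * \<delta> = 1 / c\<close> of \<open>x0\<close>, and there both cutoffs in
      \<open>u\<close> equal 1.\<close>
    define \<delta> where "\<delta> = 1 / (2 * c)"
    define M where "M = (\<Sum>\<^sub>\<infinity>i. norm (a (fst i) (snd i)) * \<rho> ^ fst i * \<rho> ^ snd i)"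
    have "FL1 (\<lambda>t. operate F f t * K \<gamma> x t) \<le> ennreal M * FL1 \<gamma>"
      if \<gamma>: "\<gamma> \<in> schwartz" and supp: "\<forall>t. \<delta> \<le> norm t \<longrightarrow> \<gamma> t = 0" and x: "norm (x - x0) < \<delta>" for \<gamma> x
    proof -
      have "FL1 (\<lambda>t. operate F f t * K \<gamma> x t) \<le> ennreal M * FL1 (K \<gamma> x)"
        unfolding M_def
      proof (rule FL1_operate_local[OF sm eq uc ui ufl _ order_refl K(1)[OF \<gamma>]])
        show "0 \<le> \<rho>" using \<rho> by simp
        show "u t = f t - Complex (Re (f x0)) (Im (f x0))" if "K \<gamma> x t \<noteq> 0" for t
        proof -
          have "norm (t - x) < \<delta>" using that supp by (auto simp: K_def not_le[symmetric])
          then have "norm (t - x0) < 2 * \<delta>" using x norm_triangle_ineq[of "t - x" "x - x0"] by simp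
          then have "norm (t - x0) * c \<le> 1" using c by (simp add: \<delta>_def field_simps)
          then have 1: "norm (c *\<^sub>R (t - x0)) \<le> 1" using c by (simp add: mult.commute)
          have "norm (t - x0) * 1 \<le> norm (t - x0) * c" using c by (intro mult_left_mono) auto
          then have 2: "norm (t - x0) \<le> 1" using \<open>norm (t - x0) * c \<le> 1\<close> by simp
          show ?thesis using loc_eq[OF 2] loc_eq[of x0 x0] \<tau>(3)[OF 1] by (simp add: u_def)
        qed
      qed
      then show ?thesis by (simp add: K(2)[OF \<gamma>])
    qed
    moreover have "0 < \<delta>" "0 \<le> M" using c \<rho> by (auto simp: \<delta>_def M_def intro!: infsum_nonneg)
    ultimately show ?thesis by blast
  qed
  from choice[OF allI, OF near] obtain \<delta> where
    \<delta>': "\<forall>x0. \<delta> x0 > 0 \<and> (\<exists>M\<ge>0. \<forall>\<gamma> x. \<gamma> \<in> schwartz \<longrightarrow> (\<forall>t. \<delta> x0 \<le> norm t \<longrightarrow> \<gamma> t = 0) \<longrightarrow>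
      norm (x - x0) < \<delta> x0 \<longrightarrow> FL1 (\<lambda>t. operate F f t * K \<gamma> x t) \<le> ennreal M * FL1 \<gamma>)" by (rule exE)
  then have "\<forall>x0. \<exists>M\<ge>0. \<forall>\<gamma> x. \<gamma> \<in> schwartz \<longrightarrow> (\<forall>t. \<delta> x0 \<le> norm t \<longrightarrow> \<gamma> t = 0) \<longrightarrow>
      norm (x - x0) < \<delta> x0 \<longrightarrow> FL1 (\<lambda>t. operate F f t * K \<gamma> x t) \<le> ennreal M * FL1 \<gamma>" by simp
  from choice[OF this] obtain M where
    M': "\<forall>x0. M x0 \<ge> 0 \<and> (\<forall>\<gamma> x. \<gamma> \<in> schwartz \<longrightarrow> (\<forall>t. \<delta> x0 \<le> norm t \<longrightarrow> \<gamma> t = 0) \<longrightarrow>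
      norm (x - x0) < \<delta> x0 \<longrightarrow> FL1 (\<lambda>t. operate F f t * K \<gamma> x t) \<le> ennreal (M x0) * FL1 \<gamma>)" by (rule exE)
  have \<delta>: "0 < \<delta> x0" "0 \<le> M x0" for x0 using \<delta>' M' by simp_all
  have nearM: "FL1 (\<lambda>t. operate F f t * K \<gamma> x t) \<le> ennreal (M x0) * FL1 \<gamma>"
    if "\<gamma> \<in> schwartz" "\<forall>t. \<delta> x0 \<le> norm t \<longrightarrow> \<gamma> t = 0" "norm (x - x0) < \<delta> x0" for x0 \<gamma> x
    using M'[rule_format, of x0] that by simp
  have "cball (0 :: real^'n) R \<subseteq> (\<Union>x0\<in>cball 0 R. ball x0 (\<delta> x0))" using \<delta>(1) by auto
  then obtain X where X: "finite X" "cball 0 R \<subseteq> (\<Union>x0\<in>X. ball x0 (\<delta> x0))"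
    by (rule compactE_image[OF compact_cball open_ball])
  \<comment> \<open>The 1 is included because the far estimate needs a window supported in the unit
    ball; finiteness of \<open>X\<close> keeps the minimum positive.\<close>
  define d where "d = Min (insert 1 (\<delta> ` X))"
  have d: "0 < d" "d \<le> 1" "\<And>x0. x0 \<in> X \<Longrightarrow> d \<le> \<delta> x0"
    using X(1) \<delta> by (auto simp: d_def)
  define MM where "MM = (\<Sum>x0\<in>X. M x0)"
  have MM: "M x0 \<le> MM" if "x0 \<in> X" for x0
    unfolding MM_def using that X(1) \<delta> by (intro member_le_sum) auto
  have MM0: "0 \<le> MM" unfolding MM_def using \<delta> by (intro sum_nonneg) auto
  \<comment> \<open>Dilation by \<open>c\<close> shrinks the support radius of \<open>\<tau>\<close>
    from \<open>R0\<close> to at most \<open>d\<close>; \<open>schwartz_dilate\<close> asks for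
    \<open>1 \<le> c\<close>.\<close>
  define c where "c = max 1 (R0 / d)"
  have c: "1 \<le> c" "R0 / d \<le> c" by (auto simp: c_def)
  define \<gamma> where "\<gamma> = (\<lambda>t. \<tau> (c *\<^sub>R t))"
  have \<gamma>: "\<gamma> \<in> schwartz" unfolding \<gamma>_def by (rule schwartz_dilate[OF \<tau>(1) c(1)])
  have supp: "\<gamma> t = 0" if "d \<le> norm t" for t
  proof -
    have "R0 \<le> c * d" using c(2) d(1) by (simp add: field_simps)
    also have "\<dots> \<le> c * norm t" using that c by (intro mult_left_mono) auto
    also have "\<dots> = norm (c *\<^sub>R t)" using c by simp
    finally show ?thesis unfolding \<gamma>_def by (rule \<tau>(5))
  qed
  have \<gamma>nz: "\<gamma> \<noteq> (\<lambda>t. 0)" using \<tau>(3)[of 0] by (auto simp: \<gamma>_def fun_eq_iff intro!: exI[of _ 0])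
  have \<gamma>FL1: "FL1 \<gamma> < top" by (rule schwartz_FL1[OF \<gamma>])
  define E where "E = ennreal (M0 / \<rho>) * FL1 \<gamma>"
  \<comment> \<open>The constant is integrable over the ball and the second term over the whole
    space. The resulting finite norm refers to the window \<open>\<gamma>\<close> and is transferred
    to \<open>g\<close> at the end.\<close>
  have bound: "FL1_window \<gamma> (operate F f) x \<le> ennreal MM * FL1 \<gamma> * indicator (cball 0 R) x + E * FL1_window \<tau> f x" for x
  proof (cases "R \<le> norm x")
    case True
    have "FL1_window \<gamma> (operate F f) x \<le> E * FL1_window \<tau> f x"
      using far[OF \<gamma> _ True] supp d(2) by (simp add: FL1_window_def K_def E_def)
    then show ?thesis by (simp add: add_increasing)
  next
    case False
    then have xR: "x \<in> cball 0 R" by simp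
    then obtain x0 where x0: "x0 \<in> X" "norm (x - x0) < \<delta> x0"
      using X(2) by (auto simp: dist_norm norm_minus_commute)
    have "FL1_window \<gamma> (operate F f) x \<le> ennreal (M x0) * FL1 \<gamma>"
      using nearM[OF \<gamma> _ x0(2)] supp d(3)[OF x0(1)] by (auto simp: FL1_window_def K_def)
    also have "\<dots> \<le> ennreal MM * FL1 \<gamma>" by (intro mult_right_mono ennreal_leI MM x0) simp
    finally show ?thesis using xR by (simp add: add_increasing2)
  qed
  have "(\<integral>\<^sup>+x. FL1_window \<gamma> (operate F f) x \<partial>lborel) \<le> (\<integral>\<^sup>+x. ennreal MM * FL1 \<gamma> * indicator (cball 0 R) x + E * FL1_window \<tau> f x \<partial>lborel)"
    by (intro nn_integral_mono bound)
  also have "\<dots> = ennreal MM * FL1 \<gamma> * emeasure lborel (cball (0 :: real^'n) R) + E * (\<integral>\<^sup>+x. FL1_window \<tau> f x \<partial>lborel)"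
  proof -
    have [measurable]: "cball (0 :: real^'n) R \<in> sets borel" by simp
    note [measurable] = FL1_window_measurable[OF fa \<tau>(1)]
    show ?thesis by (subst nn_integral_add) (simp_all add: nn_integral_cmult nn_integral_cmult_indicator)
  qed
  also have "\<dots> < top"
    using \<gamma>FL1 Nint emeasure_lborel_cball_finite[of "0 :: real^'n" R]
    by (simp add: E_def ennreal_mult_less_top)
  finally have w\<gamma>: "wnorm 1 0 (STFT_Lp \<gamma> 1 (operate F f)) < top" using wnorm_eq_FL1_window[OF opa \<gamma>] by simp
  obtain C where C: "C < top" "\<And>f. admissible f \<Longrightarrow> wnorm 1 0 (STFT_Lp g 1 f) \<le> C * wnorm 1 0 (STFT_Lp \<gamma> 1 f)"
    by (rule wnorm_window_change[OF \<gamma> g \<gamma>nz one one order_refl]) (rule that)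
  have "C * wnorm 1 0 (STFT_Lp \<gamma> 1 (operate F f)) < top" using C(1) w\<gamma> by (simp add: ennreal_mult_less_top)
  then have "wnorm 1 0 (STFT_Lp g 1 (operate F f)) < top" by (rule le_less_trans[OF C(2)[OF opa]])
  then show ?thesis by (rule modulation_functionsI[OF op])
qed

theorem theorem3p9:
  fixes g :: "real^'n::finite \<Rightarrow> complex"
  assumes "g \<in> schwartz" and "g \<noteq> (\<lambda>t. 0)"
  shows
    "(\<forall>F. real_analytic2 F \<and> F 0 0 = 0 \<longrightarrow>
        (\<forall>f \<in> modulation_functions g 1 1 0. operate F f \<in> modulation_functions g 1 1 0))
     \<and>
     (\<forall>p q s. 1 \<le> p \<and> 1 \<le> q \<and>
        (q = 1 \<and> 0 \<le> s \<or>
         (\<exists>q'. 1 / q + 1 / q' = 1 \<and> ennreal s > of_nat CARD('n) / q')) \<longrightarrow>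
        (\<exists>r\<^sub>0>0. \<forall>r\<ge>r\<^sub>0. \<forall>F a. real_entire2 F a \<and> F 0 0 = 0 \<longrightarrow>
           (\<exists>C. \<forall>f \<in> modulation_functions (scaled_window r g) p q s.
              operate F f \<in> modulation_functions (scaled_window r g) p q s \<and>
              modulation_norm (scaled_window r g) p q s (operate F f)
                \<le> C * majorant a
                    (modulation_norm (scaled_window r g) p q s (Re_part f))
                    (modulation_norm (scaled_window r g) p q s (Im_part f)))))"
proof (intro conjI allI impI ballI)
  show "operate F f \<in> modulation_functions g 1 1 0"
    if "real_analytic2 F \<and> F 0 0 = 0" "f \<in> modulation_functions g 1 1 0" for F f
    using real_analytic_on_Feichtinger_algebra[OF assms] that by blast
next
  fix p q :: ennreal and s :: real
  assume h: "1 \<le> p \<and> 1 \<le> q \<and> (q = 1 \<and> 0 \<le> s \<or>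
         (\<exists>q'. 1 / q + 1 / q' = 1 \<and> ennreal s > of_nat CARD('n) / q'))"
  obtain r\<^sub>0 where r0: "0 < r\<^sub>0" "\<And>r F a f. r\<^sub>0 \<le> r \<Longrightarrow> real_entire2 F a \<Longrightarrow> F 0 0 = 0 \<Longrightarrow>
     f \<in> modulation_functions (scaled_window r g) p q s \<Longrightarrow>
     operate F f \<in> modulation_functions (scaled_window r g) p q s \<and>
     modulation_norm (scaled_window r g) p q s (operate F f)
       \<le> majorant a (modulation_norm (scaled_window r g) p q s (Re_part f))
            (modulation_norm (scaled_window r g) p q s (Im_part f))"
    by (rule entire_on_modulation_spaces[OF assms, of p q s]) (use h that in auto)
  show "\<exists>r\<^sub>0>0. \<forall>r\<ge>r\<^sub>0. \<forall>F a. real_entire2 F a \<and> F 0 0 = 0 \<longrightarrow>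
           (\<exists>C. \<forall>f \<in> modulation_functions (scaled_window r g) p q s.
              operate F f \<in> modulation_functions (scaled_window r g) p q s \<and>
              modulation_norm (scaled_window r g) p q s (operate F f)
                \<le> C * majorant a
                    (modulation_norm (scaled_window r g) p q s (Re_part f))
                    (modulation_norm (scaled_window r g) p q s (Im_part f)))"
  proof (rule exI[of _ r\<^sub>0], intro conjI allI impI)
    fix r F a
    assume r: "r\<^sub>0 \<le> r" and F: "real_entire2 F a \<and> F 0 0 = 0"
    \<comment> \<open>The constant is 1: for \<open>r \<ge> r\<^sub>0\<close> the norm is
      submultiplicative, so summing the series costs nothing further.\<close>
    show "\<exists>C. \<forall>f \<in> modulation_functions (scaled_window r g) p q s.
              operate F f \<in> modulation_functions (scaled_window r g) p q s \<and>
              modulation_norm (scaled_window r g) p q s (operate F f)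
                \<le> C * majorant a
                    (modulation_norm (scaled_window r g) p q s (Re_part f))
                    (modulation_norm (scaled_window r g) p q s (Im_part f))"
      using r0(2)[OF r conjunct1[OF F] conjunct2[OF F]] by (intro exI[of _ 1] ballI) simp
  qed (rule r0(1))
qed

end
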